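(* There exist a real constant $A$ and a bounded continuous function $f\colon\mathbf{R}\to\mathbf{R}$ with $f(t)=O(t^{-1})$ as $t\to+\infty$, such that for all real $t$ $$\pi\kappa'(t)=A+f(t)+\sum_{\rho'=\beta'+i\gamma'}\frac{\beta'-\frac12}{(\frac12-\beta')^2+(t-\gamma')^2},$$ where the sum runs over all non-real zeros $\rho'=\beta'+i\gamma'$ of $\zeta'(s)$ (in both half-planes, counted with multiplicity), and terms with $\beta'=\frac12$ are taken to be $0$.
   Context: $\zeta$ is Riemann's zeta function; $\vartheta\colon\mathbf{R}\to\mathbf{R}$ is the Riemann–Siegel theta function, i.e. the real analytic function with $\vartheta(0)=0$ and $\Gamma(\frac14+\frac{it}{2})=|\Gamma(\frac14+\frac{it}{2})|\,e^{i(\vartheta(t)+\frac t2\log\pi)}$. The function $\kappa\colon\mathbf{R}\to\mathbf{R}$ is the unique real analytic function with $\kappa(0)=-\frac12$ and $e^{2\pi i\kappa(t)}=1+2\vartheta'(t)\frac{\zeta(1/2+it)}{\zeta'(1/2+it)}$ for all real $t$ (the quotient is extended analytically, with value $0$, at points where $\zeta'(\frac12+it)=0$; such points are zeros of $\zeta(\frac12+it)$). *)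

theory Defs
  imports "HOL-Complex_Analysis.Complex_Analysis" "HOL-Library.Landau_Symbols"
begin

text \<open>The value at the pole is set to 0 only to make the continuation unique as a total function.\<close>

definition zeta :: "complex \<Rightarrow> complex" where
  "zeta = (THE F. F holomorphic_on (- {1}) \<and>
                  (\<forall>s. Re s > 1 \<longrightarrow> (\<lambda>n. 1 / of_nat (Suc n) powr s) sums F s) \<and>
                  F 1 = 0)"

definition real_analytic :: "(real \<Rightarrow> real) \<Rightarrow> bool" where
  "real_analytic f \<longleftrightarrow>
     (\<forall>x0. \<exists>r>0. \<exists>a. \<forall>x. \<bar>x - x0\<bar> < r \<longrightarrow> (\<lambda>n. a n * (x - x0) ^ n) sums f x)"

definition RS_theta :: "real \<Rightarrow> real" where
  "RS_theta = (THE \<theta>. real_analytic \<theta> \<and> \<theta> 0 = 0 \<and>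
     (\<forall>t. Gamma (1/4 + \<i> * of_real t / 2) =
          of_real (cmod (Gamma (1/4 + \<i> * of_real t / 2))) *
          exp (\<i> * of_real (\<theta> t + t / 2 * ln pi))))"

text \<open>
  Where the derivative of zeta vanishes on the critical line, zeta vanishes there too, to an order
  one higher, so the analytic extension of the quotient has the value 0.  This is also
  the value given by the convention \<^term>\<open>x / 0 = 0\<close>.
\<close>

definition kappa :: "real \<Rightarrow> real" where
  "kappa = (THE k. real_analytic k \<and> k 0 = - (1/2) \<and>
     (\<forall>t. exp (2 * of_real pi * \<i> * of_real (k t)) =
          1 + 2 * of_real (deriv RS_theta t) *
            (zeta (1/2 + \<i> * of_real t) / deriv zeta (1/2 + \<i> * of_real t))))"

definition nonreal_zeta_deriv_zeros :: "complex set" where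
  "nonreal_zeta_deriv_zeros = {\<rho>. deriv zeta \<rho> = 0 \<and> Im \<rho> \<noteq> 0}"

text \<open>
  The contribution of a zero \<open>\<rho>\<close>, repeated according to its multiplicity.
  For \<^term>\<open>Re \<rho> = 1/2\<close> it is 0, also when \<^term>\<open>t = Im \<rho>\<close>.
\<close>

definition zero_term :: "real \<Rightarrow> complex \<Rightarrow> real" where
  "zero_term t \<rho> = of_int (zorder (deriv zeta) \<rho>) *
     ((Re \<rho> - 1/2) / ((1/2 - Re \<rho>)\<^sup>2 + (t - Im \<rho>)\<^sup>2))"

end

theory Submission imports Defs begin

text \<open>
  Put \<open>G(t) = \<pi>\<^sup>-\<^sup>s\<^sup>/\<^sup>2 \<Gamma>(s/2) \<zeta>'(s)\<close> with \<open>s = 1/2 + it\<close>. By the functional equation the defining phase of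
  \<open>\<kappa>\<close> equals \<open>- cnj G / G\<close>, so \<open>\<pi> \<kappa>'(t) = - \<theta>'(t) - Re (\<zeta>''/\<zeta>')(s)\<close> wherever \<open>\<zeta>'(s) \<noteq> 0\<close>. The entire
  function \<open>(s - 1)\<^sup>2 \<zeta>'(s)\<close> has order at most \<open>3/2\<close>, hence its logarithmic derivative is, up to a constant, the
  sum of \<open>1/(s - \<rho>')\<close> over its zeros, with the difference against the value at \<open>1/2\<close> making the series converge.
  The non-real zeros lie in a vertical strip and give the asserted sum. To the left, \<open>\<zeta>'\<close> has exactly one zero,
  a simple real one, in each interval \<open>(- 2n - 2, - 2n)\<close>; these zeros interlace with the poles of \<open>\<Gamma>(s/2)\<close>, so
  their contribution cancels that of \<open>\<theta>'\<close> up to a constant and a term of size \<open>O(1/t)\<close>.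
\<close>

section \<open>Zeros of entire functions of order at most 3/2\<close>

text \<open>The obstacle is the critical line itself. The quotient in the definition of \<kappa> is
  given the value 0 where \<zeta>' = 0, and this is its analytic extension only if \<zeta> vanishes
  there as well. The functional equation yields \<theta>' \<zeta> = 0 at such a point, so zeros of
  \<zeta>' must be excluded wherever \<theta>' = 0. That is a numerical question, and it explains
  the explicit constants and the Euler--Maclaurin formula with two Bernoulli corrections. The same
  formula supplies the continuation of \<zeta> and its polynomial growth on the right.

  The exponent 3/2 is a crude majorant of R log R. It lies below 2, so the second derivative of the
  logarithm of the zero-free part dies out as more and more zeros are divided out.

  \<open>zeta\<close>, \<open>RS_theta\<close> and \<open>kappa\<close> are definite descriptions,
  hence each has to be identified with an explicit object before anything can be said about it. The
  formula for \<kappa>' is derived where \<zeta>' is nonzero; at the remaining isolated points it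
  follows from continuity of both sides.\<close>

lemma entire_divide_zero:
  fixes H :: "complex \<Rightarrow> complex"
  assumes H: "H holomorphic_on UNIV" and nz: "H w \<noteq> 0"
  obtains G n where "G holomorphic_on UNIV" "\<And>z. H z = G z * (z - \<rho>) ^ n" "G \<rho> \<noteq> 0"
proof -
  define n where "n = nat (zorder H \<rho>)"
  define g where "g = zor_poly H \<rho>"
  obtain r where r: "r > 0" "g holomorphic_on cball \<rho> r"
    and g: "\<And>z. z \<in> cball \<rho> r \<Longrightarrow> H z = g z * (z - \<rho>) ^ n \<and> g z \<noteq> 0"
    using zorder_exist_zero[OF H open_UNIV connected_UNIV UNIV_I, of \<rho>] nz
    unfolding n_def g_def by blast
  define G where "G = (\<lambda>z. if z = \<rho> then g \<rho> else H z / (z - \<rho>) ^ n)"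
  have Geq: "G z = g z" if "z \<in> ball \<rho> r" for z
    using g[of z] that by (auto simp: G_def field_simps)
  have 1: "G holomorphic_on ball \<rho> r"
    using holomorphic_transform[OF holomorphic_on_subset[OF r(2)], of "ball \<rho> r" G] Geq by auto
  have 2: "G holomorphic_on (UNIV - {\<rho>})"
  proof (rule holomorphic_transform)
    show "(\<lambda>z. H z / (z - \<rho>) ^ n) holomorphic_on (UNIV - {\<rho>})"
      by (intro holomorphic_intros holomorphic_on_subset[OF H]) auto
  qed (auto simp: G_def)
  have "G holomorphic_on (ball \<rho> r \<union> (UNIV - {\<rho>}))"
    by (intro holomorphic_on_Un 1 2) auto
  also have "ball \<rho> r \<union> (UNIV - {\<rho>}) = UNIV" using r(1) by auto
  finally have "G holomorphic_on UNIV" .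
  moreover have "H z = G z * (z - \<rho>) ^ n" for z
    using g[of z] r(1) by (cases "z = \<rho>") (auto simp: G_def)
  moreover have "G \<rho> \<noteq> 0" using g[of \<rho>] r(1) by (auto simp: G_def)
  ultimately show ?thesis using that by blast
qed

text \<open>Points are divided out one at a time. The order of F at a new point is the order of the
  current quotient there, because the factors already split off do not vanish at it.\<close>

lemma entire_divide_zeros:
  fixes F :: "complex \<Rightarrow> complex"
  assumes F: "F holomorphic_on UNIV" and nz: "F w \<noteq> 0" and "finite S"
  shows "\<exists>H. H holomorphic_on UNIV \<and> (\<forall>\<rho>\<in>S. H \<rho> \<noteq> 0) \<and>
           (\<forall>z. F z = H z * (\<Prod>\<rho>\<in>S. (z - \<rho>) ^ nat (zorder F \<rho>)))"
  using \<open>finite S\<close>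
proof induction
  case empty
  then show ?case using F by (intro exI[of _ F]) auto
next
  case (insert \<rho> S)
  then obtain H where H: "H holomorphic_on UNIV" "\<forall>\<rho>\<in>S. H \<rho> \<noteq> 0"
    "\<And>z. F z = H z * (\<Prod>\<rho>\<in>S. (z - \<rho>) ^ nat (zorder F \<rho>))" by auto
  have "H w \<noteq> 0" using H(3)[of w] nz by auto
  then obtain G n where G: "G holomorphic_on UNIV" "\<And>z. H z = G z * (z - \<rho>) ^ n" "G \<rho> \<noteq> 0"
    using entire_divide_zero[OF H(1)] by metis
  have "zorder F \<rho> = int n"
  proof (rule zorder_eqI[where S = UNIV and g = "\<lambda>z. G z * (\<Prod>\<rho>\<in>S. (z - \<rho>) ^ nat (zorder F \<rho>))"])
    show "(\<lambda>z. G z * (\<Prod>\<rho>\<in>S. (z - \<rho>) ^ nat (zorder F \<rho>))) holomorphic_on UNIV"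
      by (intro holomorphic_intros G)
    show "G \<rho> * (\<Prod>\<rho>'\<in>S. (\<rho> - \<rho>') ^ nat (zorder F \<rho>')) \<noteq> 0"
      using G(3) insert.hyps by auto
  qed (auto simp: H(3) G(2))
  moreover have "\<forall>\<rho>'\<in>S. G \<rho>' \<noteq> 0" using H(2) G(2) by auto
  moreover have "F z = G z * (\<Prod>\<rho>\<in>insert \<rho> S. (z - \<rho>) ^ nat (zorder F \<rho>))" for z
  proof -
    have "F z = G z * (z - \<rho>) ^ n * (\<Prod>\<rho>\<in>S. (z - \<rho>) ^ nat (zorder F \<rho>))"
      using H(3)[of z] G(2)[of z] by simp
    with \<open>zorder F \<rho> = int n\<close> insert.hyps show ?thesis by simp
  qed
  ultimately show ?case using G(1,3) by blast
qed

text \<open>The Moebius map v / (2A - v) sends the half-plane Re v \<le> A into the closed unit disc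
  and fixes 0, so the Schwarz lemma applies to its composition with the rescaled f.\<close>

lemma Borel_Caratheodory:
  fixes f :: "complex \<Rightarrow> complex"
  assumes f: "f holomorphic_on ball 0 R" and f0: "f 0 = 0" and R: "R > 0" and A: "A > 0"
    and Re: "\<And>z. norm z < R \<Longrightarrow> Re (f z) \<le> A" and z: "norm z < R"
  shows "norm (f z) \<le> 2 * A * norm z / (R - norm z)"
proof -
  define \<phi> where "\<phi> = (\<lambda>u. f (of_real R * u) / (2 * of_real A - f (of_real R * u)))"
  have *: "norm (of_real R * u) < R" if "norm u < 1" for u :: complex
    using that R by (simp add: norm_mult)
  have ne: "2 * of_real A - f (of_real R * u) \<noteq> 0" if "norm u < 1" for u
  proof
    assume "2 * of_real A - f (of_real R * u) = 0"
    hence "Re (f (of_real R * u)) = 2 * A" by (metis Re_complex_of_real eq_iff_diff_eq_0 of_real_mult of_real_numeral)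
    with Re[OF *[OF that]] A show False by simp
  qed
  have hol: "\<phi> holomorphic_on ball 0 1"
    unfolding \<phi>_def
    using * ne by (intro holomorphic_intros holomorphic_on_compose_gen[OF _ f, unfolded o_def]) auto
  have le1: "norm (\<phi> u) \<le> 1" if "norm u < 1" for u
  proof -
    let ?v = "f (of_real R * u)"
    have "Re ?v \<le> A" using Re *[OF that] by blast
    hence "(Re ?v)\<^sup>2 + (Im ?v)\<^sup>2 < (2*A - Re ?v)\<^sup>2 + (Im ?v)\<^sup>2 \<or> Re ?v = A"
      using A by (auto simp: power2_eq_square algebra_simps)
    hence "norm ?v \<le> norm (2 * of_real A - ?v)"
      unfolding cmod_def by (auto simp: power2_eq_square algebra_simps)
    thus ?thesis using ne[OF that] by (auto simp: \<phi>_def norm_divide divide_le_eq_1)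
  qed
  \<comment> \<open>The Schwarz lemma wants a strict bound. Equality at an interior point would make
    \<phi> constant, contradicting its value 0 at 0.\<close>
  have lt: "norm (\<phi> u) < 1" if "norm u < 1" for u
  proof (rule ccontr)
    assume "\<not> norm (\<phi> u) < 1"
    hence eq: "norm (\<phi> u) = 1" using le1[OF that] by simp
    hence "\<phi> constant_on ball 0 1"
      using le1 that by (intro maximum_modulus_principle[OF hol, of "ball 0 1" u]) auto
    hence "\<phi> u = \<phi> 0" using that by (auto simp: constant_on_def)
    also have "\<phi> 0 = 0" by (simp add: \<phi>_def f0)
    finally show False using eq by simp
  qed
  define u where "u = z / of_real R"
  have u: "norm u < 1" "of_real R * u = z" using z R by (auto simp: u_def norm_divide)
  have "norm (\<phi> u) \<le> norm u"
    using Schwarz_Lemma(1)[OF hol _ lt u(1)] by (simp add: \<phi>_def f0)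
  hence "norm (f z) \<le> norm u * norm (2 * of_real A - f z)"
    using ne[OF u(1)] u(2) by (simp add: \<phi>_def norm_divide divide_le_eq)
  also have "\<dots> \<le> norm u * (2 * A + norm (f z))"
    using norm_triangle_ineq4[of "2 * of_real A" "f z"] A by (intro mult_left_mono) auto
  also have "norm u = norm z / R" using R by (simp add: u_def norm_divide)
  finally have "norm (f z) * R \<le> norm z * (2 * A + norm (f z))"
    using R by (simp add: field_simps)
  thus ?thesis using z by (simp add: field_simps)
qed

lemma has_field_derivative_prod_linear_powers:
  fixes m :: "complex \<Rightarrow> nat"
  assumes "finite S" "z \<notin> S"
  shows "((\<lambda>z. \<Prod>\<rho>\<in>S. (z - \<rho>) ^ m \<rho>) has_field_derivative
           (\<Prod>\<rho>\<in>S. (z - \<rho>) ^ m \<rho>) * (\<Sum>\<rho>\<in>S. of_nat (m \<rho>) / (z - \<rho>))) (at z)"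
  using assms
proof induction
  case (insert \<rho> S)
  have "((\<lambda>z. (z - \<rho>) ^ m \<rho>) has_field_derivative (z - \<rho>) ^ m \<rho> * (of_nat (m \<rho>) / (z - \<rho>))) (at z)"
  proof (cases "m \<rho>")
    case (Suc k)
    show ?thesis unfolding Suc
      by (rule derivative_eq_intros refl)+ (use insert.prems in \<open>simp add: field_simps\<close>)
  qed simp
  from DERIV_mult[OF this insert.IH] insert.prems insert.hyps
  show ?case by (simp add: algebra_simps)
qed simp

text \<open>A zero \<rho> in the disc of radius R satisfies |z - \<rho>| \<ge> 3R \<ge> 3|w -
  \<rho>| on the circle of radius 4R. Each divided factor therefore gains 3 there, and one
  inequality bounds both the number of zeros and the size of the quotient.\<close>

lemma entire_reduced_quotient:
  fixes F :: "complex \<Rightarrow> complex"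
  assumes F: "F holomorphic_on UNIV" and nz: "F w \<noteq> 0" and R: "R > 0"
    and bound: "\<And>z. norm (z - w) = 4 * R \<Longrightarrow> norm (F z) \<le> B"
  defines "Z \<equiv> {\<rho>\<in>cball w R. F \<rho> = 0}"
  obtains H where "H holomorphic_on UNIV" "\<And>z. z \<in> cball w R \<Longrightarrow> H z \<noteq> 0" "H w = F w"
    "\<And>z. norm (z - w) \<le> 4 * R \<Longrightarrow> norm (H z) * 3 ^ (\<Sum>\<rho>\<in>Z. nat (zorder F \<rho>)) \<le> B"
    "\<And>z. F z \<noteq> 0 \<Longrightarrow> deriv F z / F z = deriv H z / H z + (\<Sum>\<rho>\<in>Z. of_nat (nat (zorder F \<rho>)) / (z - \<rho>))"
    "finite Z"
proof -
  let ?m = "\<lambda>\<rho>. nat (zorder F \<rho>)"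
  have ncF: "\<not> F constant_on UNIV" if "F z = 0" for z
    using nz that unfolding constant_on_def by (metis UNIV_I)
  have fin: "finite Z"
  proof (cases "Z = {}")
    case False
    then obtain z where "F z = 0" by (auto simp: Z_def)
    hence "\<not> F constant_on UNIV" by (rule ncF)
    thus ?thesis unfolding Z_def
      using holomorphic_compact_finite_zeros[OF F open_UNIV connected_UNIV compact_cball subset_UNIV] by simp
  qed simp
  obtain G where G: "G holomorphic_on UNIV" "\<And>\<rho>. \<rho> \<in> Z \<Longrightarrow> G \<rho> \<noteq> 0"
      "\<And>z. F z = G z * (\<Prod>\<rho>\<in>Z. (z - \<rho>) ^ ?m \<rho>)"
    using entire_divide_zeros[OF F nz fin] by blast
  \<comment> \<open>Normalising by the value of the divided product at w gives
    \<open>H w = F w\<close>, so the quotient can be compared with F at the centre without knowing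
    the zeros.\<close>
  define c where "c = (\<Prod>\<rho>\<in>Z. (w - \<rho>) ^ ?m \<rho>)"
  have c: "c \<noteq> 0" using nz fin by (auto simp: c_def Z_def)
  define H where "H = (\<lambda>z. c * G z)"
  have H: "H holomorphic_on UNIV" unfolding H_def by (intro holomorphic_intros G)
  have H0: "H z \<noteq> 0" if "z \<in> cball w R" for z
  proof (cases "z \<in> Z")
    case True thus ?thesis using G(2) c by (simp add: H_def)
  next
    case False
    hence "F z \<noteq> 0" using that by (auto simp: Z_def)
    thus ?thesis using G(3)[of z] c by (auto simp: H_def)
  qed
  have Hw: "H w = F w" by (simp add: H_def G(3) c_def)
  have sphere: "norm (H z) * 3 ^ (\<Sum>\<rho>\<in>Z. ?m \<rho>) \<le> B" if z: "norm (z - w) = 4 * R" for z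
  proof -
    have "norm c * 3 ^ (\<Sum>\<rho>\<in>Z. ?m \<rho>) = (\<Prod>\<rho>\<in>Z. (3 * norm (w - \<rho>)) ^ ?m \<rho>)"
      by (simp add: c_def power_mult_distrib prod.distrib power_sum norm_power prod_norm [symmetric])
    also have "\<dots> \<le> (\<Prod>\<rho>\<in>Z. norm (z - \<rho>) ^ ?m \<rho>)"
    proof (intro prod_mono conjI power_mono)
      fix \<rho> assume "\<rho> \<in> Z"
      hence "norm (w - \<rho>) \<le> R" by (auto simp: Z_def dist_norm)
      moreover have "norm (z - w) \<le> norm (z - \<rho>) + norm (w - \<rho>)"
        by (metis norm_minus_commute norm_triangle_ineq diff_add_cancel add_diff_eq)
      ultimately show "3 * norm (w - \<rho>) \<le> norm (z - \<rho>)" using z by simp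
    qed auto
    finally have "norm (G z) * (norm c * 3 ^ (\<Sum>\<rho>\<in>Z. ?m \<rho>)) \<le> norm (G z) * (\<Prod>\<rho>\<in>Z. norm (z - \<rho>) ^ ?m \<rho>)"
      by (intro mult_left_mono) auto
    also have "\<dots> = norm (F z)" by (simp add: G(3) norm_mult norm_power prod_norm [symmetric])
    also have "\<dots> \<le> B" by (rule bound) fact
    finally show ?thesis by (simp add: H_def norm_mult mult_ac)
  qed
  have le: "norm (H z) * 3 ^ (\<Sum>\<rho>\<in>Z. ?m \<rho>) \<le> B" if z: "norm (z - w) \<le> 4 * R" for z
  proof -
    have "norm (H z) \<le> B / 3 ^ (\<Sum>\<rho>\<in>Z. ?m \<rho>)"
    proof (rule maximum_modulus_frontier[where f = H and \<xi> = z and S = "cball w (4 * R)"])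
      show "H holomorphic_on interior (cball w (4 * R))" using H by (rule holomorphic_on_subset) auto
      show "continuous_on (closure (cball w (4 * R))) H"
        using holomorphic_on_imp_continuous_on[OF H] by (rule continuous_on_subset) auto
      show "norm (H z) \<le> B / 3 ^ (\<Sum>\<rho>\<in>Z. ?m \<rho>)" if "z \<in> frontier (cball w (4 * R))" for z
        using sphere[of z] that R by (simp add: frontier_cball sphere_def dist_norm norm_minus_commute field_simps)
    qed (use z in \<open>auto simp: dist_norm norm_minus_commute\<close>)
    thus ?thesis by (simp add: field_simps)
  qed
  have logderiv: "deriv F z / F z = deriv H z / H z + (\<Sum>\<rho>\<in>Z. of_nat (?m \<rho>) / (z - \<rho>))"
    if z: "F z \<noteq> 0" for z
  proof -
    define P where "P = (\<lambda>z. \<Prod>\<rho>\<in>Z. (z - \<rho>) ^ ?m \<rho>)"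
    define S where "S = (\<Sum>\<rho>\<in>Z. of_nat (?m \<rho>) / (z - \<rho>))"
    have nz: "z \<notin> Z" "H z \<noteq> 0" "P z \<noteq> 0"
      using z G(3)[of z] c by (auto simp: Z_def H_def P_def)
    have F_eq: "F x = (1 / c) * (H x * P x)" for x using c by (auto simp: G(3) H_def P_def)
    have "(H has_field_derivative deriv H z) (at z)" using H holomorphic_derivI by blast
    moreover have "(P has_field_derivative P z * S) (at z)"
      unfolding P_def S_def by (intro has_field_derivative_prod_linear_powers fin nz)
    ultimately have "((\<lambda>x. (1/c) * (H x * P x)) has_field_derivative (1/c) * (deriv H z * P z + P z * S * H z)) (at z)"
      by (intro DERIV_cmult DERIV_mult)
    hence "(F has_field_derivative (1/c) * (deriv H z * P z + P z * S * H z)) (at z)"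
      by (rule has_field_derivative_transform_within_open[of _ _ _ UNIV]) (use F_eq in auto)
    hence "deriv F z = (1/c) * (deriv H z * P z + P z * S * H z)" by (rule DERIV_imp_deriv)
    hence "deriv F z / F z = (deriv H z * P z + P z * S * H z) / (H z * P z)"
      using c by (simp add: F_eq[of z])
    also have "\<dots> = deriv H z / H z + S" using nz by (simp add: field_simps)
    finally show ?thesis by (simp add: S_def)
  qed
  show ?thesis by (rule that[of H]) (use H H0 Hw le logderiv fin in auto)
qed

section \<open>Zero counting and the expansion of the logarithmic derivative\<close>

locale entire_order_three_halves =
  fixes F :: "complex \<Rightarrow> complex" and w :: complex and C :: real
  assumes F: "F holomorphic_on UNIV" and nz: "F w \<noteq> 0"
    and bound: "norm (F z) \<le> exp (C * (1 + norm (z - w)) powr (3/2))"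
begin

abbreviation mult :: "complex \<Rightarrow> nat" where "mult \<rho> \<equiv> nat (zorder F \<rho>)"
definition zeros_upto :: "real \<Rightarrow> complex set" where "zeros_upto R = {\<rho>\<in>cball w R. F \<rho> = 0}"
definition D :: real where "D = \<bar>C\<bar> * 5 powr (3/2) + \<bar>ln (norm (F w))\<bar> + 1"

lemma D_ge_1: "D \<ge> 1" by (simp add: D_def)

lemma bound_le:
  assumes "R \<ge> 1"
  shows "C * (1 + 4 * R) powr (3/2) + \<bar>ln (norm (F w))\<bar> + 1 \<le> D * R powr (3/2)"
proof -
  have "(1 + 4 * R) powr (3/2) \<le> (5 * R) powr (3/2)"
    using assms by (intro powr_mono2) auto
  also have "\<dots> = 5 powr (3/2) * R powr (3/2)" using assms by (subst powr_mult) auto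
  finally have "\<bar>C\<bar> * (1 + 4 * R) powr (3/2) \<le> \<bar>C\<bar> * (5 powr (3/2) * R powr (3/2))"
    by (intro mult_left_mono) auto
  moreover have "C * (1 + 4 * R) powr (3/2) \<le> \<bar>C\<bar> * (1 + 4 * R) powr (3/2)"
    by (intro mult_right_mono) auto
  moreover have "1 \<le> R powr (3/2)" using assms by (simp add: ge_one_powr_ge_zero)
  hence "(\<bar>ln (norm (F w))\<bar> + 1) * 1 \<le> (\<bar>ln (norm (F w))\<bar> + 1) * R powr (3/2)"
    by (intro mult_left_mono) auto
  ultimately show ?thesis by (simp add: D_def algebra_simps)
qed

lemma reduced_quotient:
  assumes R: "R \<ge> 1"
  obtains H where "H holomorphic_on UNIV" "\<And>z. z \<in> cball w R \<Longrightarrow> H z \<noteq> 0" "H w = F w"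
    "\<And>z. norm (z - w) \<le> 4 * R \<Longrightarrow> norm (H z) * 3 ^ (\<Sum>\<rho>\<in>zeros_upto R. mult \<rho>) \<le> exp (C * (1 + 4 * R) powr (3/2))"
    "\<And>z. F z \<noteq> 0 \<Longrightarrow> deriv F z / F z = deriv H z / H z + (\<Sum>\<rho>\<in>zeros_upto R. of_nat (mult \<rho>) / (z - \<rho>))"
    "finite (zeros_upto R)"
proof -
  have "norm (F z) \<le> exp (C * (1 + 4 * R) powr (3/2))" if "norm (z - w) = 4 * R" for z
    using bound[of z] that by simp
  from entire_reduced_quotient[OF F nz _ this, of R] R that show ?thesis
    unfolding zeros_upto_def by auto
qed

lemma finite_zeros_upto: "finite (zeros_upto R)"
proof -
  have "finite (zeros_upto (max 1 R))"
    using reduced_quotient[of "max 1 R"] by (metis max.cobounded1)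
  thus ?thesis by (rule rev_finite_subset) (auto simp: zeros_upto_def)
qed

text \<open>The bound for the reduced quotient, read at the centre \<open>w\<close>, bounds 3 to the
  number of zeros; ln 3 \<ge> 1 turns this into a bound for the number itself.\<close>

lemma count_zeros_upto:
  assumes R: "R \<ge> 1"
  shows "real (\<Sum>\<rho>\<in>zeros_upto R. mult \<rho>) \<le> D * R powr (3/2)"
proof -
  let ?n = "\<Sum>\<rho>\<in>zeros_upto R. mult \<rho>"
  obtain H where "H w = F w"
    "\<And>z. norm (z - w) \<le> 4 * R \<Longrightarrow> norm (H z) * 3 ^ ?n \<le> exp (C * (1 + 4 * R) powr (3/2))"
    using reduced_quotient[OF R] by metis
  from this(1) this(2)[of w] R have "norm (F w) * 3 ^ ?n \<le> exp (C * (1 + 4 * R) powr (3/2))" by simp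
  hence "ln (norm (F w) * 3 ^ ?n) \<le> ln (exp (C * (1 + 4 * R) powr (3/2)))"
    using nz by (subst ln_le_cancel_iff) auto
  hence "ln (norm (F w)) + real ?n * ln 3 \<le> C * (1 + 4 * R) powr (3/2)"
    using nz by (simp add: ln_mult ln_realpow)
  moreover have "ln (3::real) \<ge> 1"
    using exp_le by (subst ln_ge_iff) auto
  hence "real ?n * 1 \<le> real ?n * ln 3" by (intro mult_left_mono) (auto intro: sum_nonneg)
  ultimately show ?thesis using bound_le[OF R] by linarith
qed

text \<open>Dyadic decomposition: the zeros with |\<rho> - w| \<le> 2^k number at most D 2^(3k/2)
  and are weighted by 4 / 4^k.\<close>

lemma summable_mult: "(\<lambda>\<rho>. real (mult \<rho>) / (1 + (norm (\<rho> - w))\<^sup>2)) summable_on {\<rho>. F \<rho> = 0}"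
proof -
  \<comment> \<open>The ratio 2^(3/2) / 4 of the dyadic geometric series. It is below 1 because the
    order 3/2 is below 2.\<close>
  define q :: real where "q = 1 / sqrt 2"
  have q: "0 < q" "q < 1" by (auto simp: q_def real_less_rsqrt)
  have key: "(\<Sum>\<rho>\<in>X. real (mult \<rho>) / (1 + (norm (\<rho> - w))\<^sup>2)) \<le> 4 * D * (1 / (1 - q))"
    if X: "finite X" "X \<subseteq> {\<rho>. F \<rho> = 0}" for X
  proof -
    obtain K :: nat where K: "\<And>\<rho>. \<rho> \<in> X \<Longrightarrow> norm (\<rho> - w) \<le> 2 ^ K"
    proof -
      obtain B where B: "\<And>\<rho>. \<rho> \<in> X \<Longrightarrow> norm (\<rho> - w) \<le> B"
        using finite_imp_bounded[of "(\<lambda>\<rho>. \<rho> - w) ` X"] X by (auto simp: bounded_iff)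
      obtain K :: nat where "B < 2 ^ K" using real_arch_pow[of 2 B] by auto
      with B that show ?thesis by (meson less_eq_real_def order_trans)
    qed
    have term_le: "1 / (1 + (norm (\<rho> - w))\<^sup>2) \<le> (\<Sum>k\<le>K. if norm (\<rho> - w) \<le> 2 ^ k then 4 / 4 ^ k else 0)"
      if "\<rho> \<in> X" for \<rho>
    proof -
      \<comment> \<open>The least dyadic shell containing \<rho>. Minimality gives |\<rho> - w| >
        2^(k-1) for k > 0, which is where the factor 4 comes from.\<close>
      define k where "k = (LEAST k. norm (\<rho> - w) \<le> 2 ^ k)"
      have k: "norm (\<rho> - w) \<le> 2 ^ k" unfolding k_def by (rule LeastI[of _ K]) (use K that in auto)
      have kK: "k \<le> K" unfolding k_def by (rule Least_le) (use K that in auto)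
      have "1 / (1 + (norm (\<rho> - w))\<^sup>2) \<le> 4 / 4 ^ k"
      proof (cases k)
        case 0
        have "1 / (1 + (norm (\<rho> - w))\<^sup>2) \<le> 1"
          by (subst divide_le_eq_1_pos) (auto simp: add_pos_nonneg)
        thus ?thesis using 0 by simp
      next
        case (Suc j)
        have "\<not> norm (\<rho> - w) \<le> 2 ^ j"
          using not_less_Least[of j "\<lambda>k. norm (\<rho> - w) \<le> 2 ^ k"] Suc by (simp add: k_def)
        hence "(2 ^ j)\<^sup>2 \<le> (norm (\<rho> - w))\<^sup>2" by (intro power_mono) auto
        hence "4 ^ j \<le> 1 + (norm (\<rho> - w))\<^sup>2" by (simp add: power2_eq_square power_mult_distrib [symmetric])
        thus ?thesis using Suc by (simp add: field_simps add_pos_nonneg)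
      qed
      also have "\<dots> = (if norm (\<rho> - w) \<le> 2 ^ k then 4 / 4 ^ k else 0)" using k by simp
      also have "\<dots> \<le> (\<Sum>k\<le>K. if norm (\<rho> - w) \<le> 2 ^ k then 4 / 4 ^ k else 0)"
        by (rule member_le_sum) (use kK in auto)
      finally show ?thesis .
    qed
    have "(\<Sum>\<rho>\<in>X. real (mult \<rho>) / (1 + (norm (\<rho> - w))\<^sup>2)) =
          (\<Sum>\<rho>\<in>X. real (mult \<rho>) * (1 / (1 + (norm (\<rho> - w))\<^sup>2)))" by simp
    also have "\<dots> \<le> (\<Sum>\<rho>\<in>X. real (mult \<rho>) * (\<Sum>k\<le>K. if norm (\<rho> - w) \<le> 2 ^ k then 4 / 4 ^ k else 0))"
      by (intro sum_mono mult_left_mono term_le) auto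
    also have "\<dots> = (\<Sum>k\<le>K. 4 / 4 ^ k * (\<Sum>\<rho>\<in>X. if norm (\<rho> - w) \<le> 2 ^ k then real (mult \<rho>) else 0))"
      by (simp add: sum_distrib_left sum_distrib_right if_distrib mult_ac cong: if_cong) (rule sum.swap)
    also have "\<dots> \<le> (\<Sum>k\<le>K. 4 * D * q ^ k)"
    proof (rule sum_mono)
      fix k
      have "(\<Sum>\<rho>\<in>X. if norm (\<rho> - w) \<le> 2 ^ k then real (mult \<rho>) else 0) =
            (\<Sum>\<rho>\<in>{\<rho>\<in>X. norm (\<rho> - w) \<le> 2 ^ k}. real (mult \<rho>))"
        using X by (simp add: sum.inter_filter)
      also have "\<dots> \<le> (\<Sum>\<rho>\<in>zeros_upto (2 ^ k). real (mult \<rho>))"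
        using X by (intro sum_mono2 finite_zeros_upto) (auto simp: zeros_upto_def dist_norm norm_minus_commute)
      also have "\<dots> \<le> D * (2 ^ k) powr (3/2)" using count_zeros_upto[of "2 ^ k"] by simp
      finally have "4 / 4 ^ k * (\<Sum>\<rho>\<in>X. if norm (\<rho> - w) \<le> 2 ^ k then real (mult \<rho>) else 0)
                     \<le> 4 / 4 ^ k * (D * (2 ^ k) powr (3/2))" by (intro mult_left_mono) auto
      also have "(2 ^ k) powr (3/2) = (2 powr (3/2) :: real) ^ k" for k :: nat
        by (simp add: powr_powr powr_realpow [symmetric] mult.commute)
      hence "4 / 4 ^ k * (D * (2 ^ k) powr (3/2)) = 4 * D * (2 powr (3/2) / 4) ^ k"
        by (simp add: power_divide)
      also have "2 powr (3/2) = (2::real) * sqrt 2"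
        using powr_add[of 2 1 "1/2::real"] by (simp add: powr_half_sqrt)
      hence "2 powr (3/2) / 4 = q"
        by (simp add: q_def field_simps)
      finally show "4 / 4 ^ k * (\<Sum>\<rho>\<in>X. if norm (\<rho> - w) \<le> 2 ^ k then real (mult \<rho>) else 0) \<le> 4 * D * q ^ k" .
    qed
    also have "\<dots> = 4 * D * (\<Sum>k\<le>K. q ^ k)" by (simp add: sum_distrib_left)
    also have "\<dots> \<le> 4 * D * (1 / (1 - q))"
    proof (intro mult_left_mono)
      have "(\<Sum>k\<le>K. q ^ k) \<le> (\<Sum>k. q ^ k)"
        using q by (intro sum_le_suminf summable_geometric) auto
      thus "(\<Sum>k\<le>K. q ^ k) \<le> 1 / (1 - q)" using q by (simp add: suminf_geometric)
    qed (use D_ge_1 in auto)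
    finally show ?thesis .
  qed
  show ?thesis
    by (rule nonneg_bounded_partial_sums_imp_summable_on[where C = "4 * D * (1 / (1 - q))"])
       (use key in \<open>auto intro!: eventually_finite_subsets_at_top_weakI simp del: times_divide_eq_right\<close>)
qed

text \<open>Each difference of reciprocals is (z' - z) / ((z - \<rho>)(z' - \<rho>)). The zero set
  is closed, so either distance is at least a fixed multiple of the square root of 1 + |\<rho> -
  w|^2, and the previous sum is a majorant.\<close>

lemma summable_logderiv_diff:
  assumes "F z \<noteq> 0" "F z' \<noteq> 0"
  shows "(\<lambda>\<rho>. norm (of_nat (mult \<rho>) * (1 / (z - \<rho>) - 1 / (z' - \<rho>)))) summable_on {\<rho>. F \<rho> = 0}"
proof -
  have ex: "\<exists>c>0. \<forall>\<rho>. F \<rho> = 0 \<longrightarrow> c * sqrt (1 + (norm (\<rho> - w))\<^sup>2) \<le> norm (z - \<rho>)" if z: "F z \<noteq> 0" for z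
  proof -
    have "closed {\<rho>. F \<rho> = 0}"
      using continuous_closed_vimage[of "{0}" F] holomorphic_on_imp_continuous_on[OF F]
      by (simp add: vimage_def continuous_on_eq_continuous_at)
    then obtain d where d: "d > 0" "\<And>\<rho>. F \<rho> = 0 \<Longrightarrow> d \<le> norm (z - \<rho>)"
      using separate_point_closed[of "{\<rho>. F \<rho> = 0}" z] z by (auto simp: dist_norm)
    \<comment> \<open>With d the lower bound for the distance to the zeros, (1 + |z - w|) / d
      absorbs the constant term and the final 1 the distance itself, so 1 + |\<rho> - w| \<le> M |z
      - \<rho>|.\<close>
    define M where "M = (1 + norm (z - w)) / d + 1"
    have M: "M \<ge> 1" using d by (simp add: M_def add_nonneg_pos)
    show ?thesis
    proof (intro exI[of _ "1 / M"] conjI allI impI)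
      fix \<rho> assume "F \<rho> = 0"
      with d have d': "d \<le> norm (z - \<rho>)" by auto
      have "sqrt (1 + (norm (\<rho> - w))\<^sup>2) \<le> 1 + norm (\<rho> - w)"
        by (rule real_le_lsqrt) (auto simp: power2_eq_square algebra_simps)
      also have "norm (\<rho> - w) \<le> norm (z - w) + norm (z - \<rho>)"
        using norm_triangle_ineq4[of "z - w" "z - \<rho>"] by simp
      also have "1 + (norm (z - w) + norm (z - \<rho>)) \<le> M * norm (z - \<rho>)"
      proof -
        have "(1 + norm (z - w)) / d * d \<le> (1 + norm (z - w)) / d * norm (z - \<rho>)"
          using d d' by (intro mult_left_mono) auto
        moreover have "(1 + norm (z - w)) / d * d = 1 + norm (z - w)" using d by simp
        ultimately show ?thesis unfolding M_def ring_distribs by simp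
      qed
      finally show "1 / M * sqrt (1 + (norm (\<rho> - w))\<^sup>2) \<le> norm (z - \<rho>)"
        using M by (simp add: field_simps)
    qed (use M in auto)
  qed
  obtain c where c: "c > 0" "\<And>\<rho>. F \<rho> = 0 \<Longrightarrow> c * sqrt (1 + (norm (\<rho> - w))\<^sup>2) \<le> norm (z - \<rho>)"
    using ex[OF assms(1)] by auto
  obtain c' where c': "c' > 0" "\<And>\<rho>. F \<rho> = 0 \<Longrightarrow> c' * sqrt (1 + (norm (\<rho> - w))\<^sup>2) \<le> norm (z' - \<rho>)"
    using ex[OF assms(2)] by auto
  have "(\<lambda>\<rho>. norm (z' - z) / (c * c') * (real (mult \<rho>) / (1 + (norm (\<rho> - w))\<^sup>2))) summable_on {\<rho>. F \<rho> = 0}"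
    by (intro summable_on_cmult_right summable_mult)
  thus ?thesis
  proof (rule summable_on_comparison_test)
    fix \<rho> assume "\<rho> \<in> {\<rho>. F \<rho> = 0}"
    hence 0: "F \<rho> = 0" by simp
    hence ne: "z \<noteq> \<rho>" "z' \<noteq> \<rho>" using assms by auto
    let ?s = "sqrt (1 + (norm (\<rho> - w))\<^sup>2)"
    have s: "?s > 0" "?s * ?s = 1 + (norm (\<rho> - w))\<^sup>2" by (auto simp: add_pos_nonneg)
    have "(c * ?s) * (c' * ?s) \<le> norm (z - \<rho>) * norm (z' - \<rho>)"
      using c c' 0 s by (intro mult_mono) auto
    hence le: "c * c' * (1 + (norm (\<rho> - w))\<^sup>2) \<le> norm (z - \<rho>) * norm (z' - \<rho>)"
      using s(2) by (metis (no_types, lifting) mult.assoc mult.left_commute)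
    have "1 / (z - \<rho>) - 1 / (z' - \<rho>) = (z' - z) / ((z - \<rho>) * (z' - \<rho>))"
      using ne by (simp add: field_simps)
    hence "norm (1 / (z - \<rho>) - 1 / (z' - \<rho>)) = norm (z' - z) / (norm (z - \<rho>) * norm (z' - \<rho>))"
      by (simp add: norm_divide norm_mult)
    also have "\<dots> \<le> norm (z' - z) / (c * c' * (1 + (norm (\<rho> - w))\<^sup>2))"
      using le c c' by (intro divide_left_mono mult_pos_pos add_pos_nonneg) (use ne in auto)
    finally have "real (mult \<rho>) * norm (1 / (z - \<rho>) - 1 / (z' - \<rho>)) \<le>
                  real (mult \<rho>) * (norm (z' - z) / (c * c' * (1 + (norm (\<rho> - w))\<^sup>2)))"
      by (intro mult_left_mono) auto
    thus "norm (of_nat (mult \<rho>) * (1 / (z - \<rho>) - 1 / (z' - \<rho>)))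
          \<le> norm (z' - z) / (c * c') * (real (mult \<rho>) / (1 + (norm (\<rho> - w))\<^sup>2))"
      unfolding norm_mult norm_of_nat by (simp add: divide_simps mult_ac)
  qed auto
qed

text \<open>The left side is the difference of logarithmic derivatives of the reduced quotient,
  which has a holomorphic logarithm on the disc. Borel--Caratheodory bounds that logarithm by a
  multiple of R^(3/2), and Cauchy's inequality bounds its second derivative by a multiple of R^(3/2
  - 2).\<close>

lemma zero_free_part_bound:
  assumes R: "R \<ge> 1" and z: "norm (z - w) \<le> R / 4" "norm (z' - w) \<le> R / 4"
    and nz: "F z \<noteq> 0" "F z' \<noteq> 0"
  shows "norm ((deriv F z / F z - deriv F z' / F z') -
           (\<Sum>\<rho>\<in>zeros_upto R. of_nat (mult \<rho>) * (1 / (z - \<rho>) - 1 / (z' - \<rho>))))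
         \<le> 64 * D * R powr (-1/2) * norm (z - z')"
proof -
  obtain H where H: "H holomorphic_on UNIV" "\<And>z. z \<in> cball w R \<Longrightarrow> H z \<noteq> 0" "H w = F w"
    "\<And>z. norm (z - w) \<le> 4 * R \<Longrightarrow> norm (H z) * 3 ^ (\<Sum>\<rho>\<in>zeros_upto R. mult \<rho>) \<le> exp (C * (1 + 4 * R) powr (3/2))"
    "\<And>z. F z \<noteq> 0 \<Longrightarrow> deriv F z / F z = deriv H z / H z + (\<Sum>\<rho>\<in>zeros_upto R. of_nat (mult \<rho>) / (z - \<rho>))"
    "finite (zeros_upto R)"
    by (rule reduced_quotient[OF R], rule that)
  obtain h where h: "h holomorphic_on ball w R" "\<And>z. z \<in> ball w R \<Longrightarrow> exp (h z) = H z"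
  proof (rule holomorphic_logarithm_exists[of "ball w R" H w])
    show "H holomorphic_on ball w R" using H(1) by (rule holomorphic_on_subset) auto
    show "H x \<noteq> 0" if "x \<in> ball w R" for x using H(2)[of x] that by auto
  qed (use R in auto)
  define g where "g = (\<lambda>u. h (w + u) - h w)"
  define A where "A = D * R powr (3/2)"
  have A: "A > 0" using D_ge_1 R by (simp add: A_def)
  have g: "g holomorphic_on ball 0 R"
    unfolding g_def
    by (intro holomorphic_intros holomorphic_on_compose_gen[OF _ h(1), unfolded o_def]) (auto simp: dist_norm)
  have Reg: "Re (g u) \<le> A" if u: "norm u < R" for u
  proof -
    have in_ball: "w + u \<in> ball w R" "w \<in> ball w R" using u R by (auto simp: dist_norm)
    have "norm (H (w + u)) * 1 \<le> norm (H (w + u)) * 3 ^ (\<Sum>\<rho>\<in>zeros_upto R. mult \<rho>)"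
      by (intro mult_left_mono) auto
    also have "\<dots> \<le> exp (C * (1 + 4 * R) powr (3/2))" using u R by (intro H(4)) auto
    finally have "exp (Re (h (w + u))) \<le> exp (C * (1 + 4 * R) powr (3/2))"
      using h(2)[OF in_ball(1)] by (metis mult.right_neutral norm_exp_eq_Re)
    moreover have "exp (Re (h w)) = norm (F w)"
      using h(2)[OF in_ball(2)] H(3) by (metis norm_exp_eq_Re)
    hence "Re (h w) = ln (norm (F w))" by (metis ln_exp)
    ultimately show ?thesis using bound_le[OF R] by (simp add: g_def A_def)
  qed
  have g_bound: "norm (g u) \<le> 2 * A" if u: "norm u \<le> R / 2" for u
  proof -
    have "norm (g u) \<le> 2 * A * norm u / (R - norm u)"
      using u R A by (intro Borel_Caratheodory[OF g _ _ _ Reg]) (auto simp: g_def)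
    also have "\<dots> = 2 * A * (norm u / (R - norm u))" by simp
    also have "\<dots> \<le> 2 * A * 1"
      using u R A by (intro mult_left_mono) (auto simp: divide_le_eq_1)
    finally show ?thesis by simp
  qed
  have sub: "cball u (R / 4) \<subseteq> ball 0 R" "cball u (R / 4) \<subseteq> cball 0 (R / 2)" if "u \<in> cball 0 (R / 4)" for u :: complex
  proof -
    have "norm v \<le> R / 2" if "v \<in> cball u (R / 4)" for v
      using norm_triangle_ineq2[of v u] that \<open>u \<in> cball 0 (R / 4)\<close> by (auto simp: dist_norm norm_minus_commute)
    thus "cball u (R / 4) \<subseteq> ball 0 R" "cball u (R / 4) \<subseteq> cball 0 (R / 2)" using R by force+
  qed
  have g'': "norm (deriv (deriv g) u) \<le> 64 * D * R powr (-1/2)" if u: "u \<in> cball 0 (R / 4)" for u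
  proof -
    \<comment> \<open>Discs of radius R/4 about points of the disc of radius R/4 stay inside R/2,
      where g is at most 2A. The constant 64 is 2! times 2 times 4^2.\<close>
    have "norm ((deriv ^^ 2) g u) \<le> fact 2 * (2 * A) / (R / 4) ^ 2"
    proof (rule Cauchy_inequality)
      show "g holomorphic_on ball u (R / 4)"
        using holomorphic_on_subset[OF g] sub(1)[OF u] ball_subset_cball by blast
      show "continuous_on (cball u (R / 4)) g"
        using holomorphic_on_imp_continuous_on[OF holomorphic_on_subset[OF g sub(1)[OF u]]] .
      show "norm (g x) \<le> 2 * A" if "norm (u - x) = R / 4" for x
        using sub(2)[OF u] that by (intro g_bound) (auto simp: subset_iff dist_norm)
    qed (use R in auto)
    also have "\<dots> = 64 * D * (R powr (3/2) / R ^ 2)" using R by (simp add: A_def power2_eq_square)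
    also have "R powr (3/2) / R ^ 2 = R powr (-1/2)"
    proof -
      have "R powr (3/2) / R ^ 2 = R powr (3/2) / R powr 2" using R by simp
      also have "\<dots> = R powr (3/2 - 2)" by (rule powr_diff [symmetric])
      finally show ?thesis by simp
    qed
    finally show ?thesis by (simp add: numeral_2_eq_2)
  qed
  have logderiv_H: "deriv H x / H x = deriv g (x - w)" if x: "norm (x - w) \<le> R / 4" for x
  proof -
    have xb: "x \<in> ball w R" using x R by (auto simp: dist_norm norm_minus_commute)
    have hx: "(h has_field_derivative deriv h x) (at x)"
      using holomorphic_derivI[OF h(1) open_ball xb] .
    have "((\<lambda>u. exp (h u)) has_field_derivative exp (h x) * deriv h x) (at x)"
      by (rule DERIV_fun_exp[OF hx])
    hence "(H has_field_derivative exp (h x) * deriv h x) (at x)"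
      by (rule has_field_derivative_transform_within_open[of _ _ _ "ball w R"]) (use h(2) xb in auto)
    hence "deriv H x = exp (h x) * deriv h x" by (rule DERIV_imp_deriv)
    hence 1: "deriv H x = H x * deriv h x" by (simp add: h(2)[OF xb])
    have "((\<lambda>u. h (u + w)) has_field_derivative deriv h x) (at (x - w))"
      using hx DERIV_shift[of h "deriv h x" "x - w" w] by simp
    moreover have "(\<lambda>u. h (w + u)) = (\<lambda>u. h (u + w))" by (simp add: add.commute)
    ultimately have "(g has_field_derivative deriv h x - 0) (at (x - w))"
      unfolding g_def by (intro DERIV_diff DERIV_const) simp
    hence "deriv g (x - w) = deriv h x - 0" by (rule DERIV_imp_deriv)
    moreover have "H x \<noteq> 0" using xb by (intro H(2)) auto
    ultimately show ?thesis using 1 by (simp add: field_simps)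
  qed
  have "norm (deriv g (z - w) - deriv g (z' - w)) \<le> 64 * D * R powr (-1/2) * norm ((z - w) - (z' - w))"
  proof (rule field_differentiable_bound)
    show "convex (cball (0::complex) (R / 4))" by simp
    fix u :: complex assume u: "u \<in> cball 0 (R / 4)"
    hence ub: "u \<in> ball 0 R" using R by auto
    have "deriv g holomorphic_on ball 0 R" using g by (intro holomorphic_deriv) auto
    thus "(deriv g has_field_derivative deriv (deriv g) u) (at u within cball 0 (R / 4))"
      using holomorphic_derivI[OF _ open_ball ub] by blast
    show "norm (deriv (deriv g) u) \<le> 64 * D * R powr (-1/2)" by (rule g''[OF u])
  qed (use z in auto)
  moreover have "(deriv F z / F z - deriv F z' / F z') -
           (\<Sum>\<rho>\<in>zeros_upto R. of_nat (mult \<rho>) * (1 / (z - \<rho>) - 1 / (z' - \<rho>))) =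
           deriv g (z - w) - deriv g (z' - w)"
    unfolding H(5)[OF nz(1)] H(5)[OF nz(2)] logderiv_H[OF z(1)] logderiv_H[OF z(2)]
    by (simp add: right_diff_distrib sum_subtractf)
  ultimately show ?thesis by simp
qed

text \<open>Absolute convergence makes the order of summation immaterial, so the value may be read
  off from the discs of growing integer radius, along which the zero-free part tends to 0.\<close>

theorem has_sum_logderiv_diff:
  assumes nz: "F z \<noteq> 0" "F z' \<noteq> 0"
  shows "((\<lambda>\<rho>. of_nat (mult \<rho>) * (1 / (z - \<rho>) - 1 / (z' - \<rho>))) has_sum
           (deriv F z / F z - deriv F z' / F z')) {\<rho>. F \<rho> = 0}"
proof -
  let ?t = "\<lambda>\<rho>. of_nat (mult \<rho>) * (1 / (z - \<rho>) - 1 / (z' - \<rho>))" and ?Z = "{\<rho>. F \<rho> = 0}"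
  let ?d = "deriv F z / F z - deriv F z' / F z'"
  have sum: "?t summable_on ?Z" by (rule abs_summable_summable[OF summable_logderiv_diff[OF nz]])
  have fl: "filterlim (\<lambda>n. zeros_upto (real n)) (finite_subsets_at_top ?Z) sequentially"
    unfolding filterlim_finite_subsets_at_top
  proof (intro allI impI)
    fix X assume X: "finite X \<and> X \<subseteq> ?Z"
    then obtain B where B: "\<And>\<rho>. \<rho> \<in> X \<Longrightarrow> norm (\<rho> - w) \<le> B"
      using finite_imp_bounded[of "(\<lambda>\<rho>. \<rho> - w) ` X"] by (auto simp: bounded_iff)
    show "\<forall>\<^sub>F n in sequentially. finite (zeros_upto (real n)) \<and> X \<subseteq> zeros_upto (real n) \<and> zeros_upto (real n) \<subseteq> ?Z"
      using eventually_ge_at_top[of "nat \<lceil>B\<rceil>"]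
    proof eventually_elim
      case (elim n)
      hence "B \<le> real n" by linarith
      thus ?case using B X finite_zeros_upto[of "real n"]
        by (force simp: zeros_upto_def dist_norm norm_minus_commute)
    qed
  qed
  have lim1: "(\<lambda>n. sum ?t (zeros_upto (real n))) \<longlonglongrightarrow> infsum ?t ?Z"
    using filterlim_compose[OF infsum_tendsto[OF sum] fl] .
  have lim2: "(\<lambda>n. sum ?t (zeros_upto (real n))) \<longlonglongrightarrow> ?d"
  proof (rule Lim_transform2)
    show "(\<lambda>n. ?d) \<longlonglongrightarrow> ?d" by simp
    have "(\<lambda>n. 64 * D * real n powr (-1/2) * norm (z - z')) \<longlonglongrightarrow> 64 * D * 0 * norm (z - z')"
      by (intro tendsto_intros tendsto_neg_powr filterlim_real_sequentially) auto
    hence "(\<lambda>n. 64 * D * real n powr (-1/2) * norm (z - z')) \<longlonglongrightarrow> 0" by simp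
    moreover have "\<forall>\<^sub>F n in sequentially. norm (?d - sum ?t (zeros_upto (real n))) \<le> 64 * D * real n powr (-1/2) * norm (z - z')"
      using eventually_ge_at_top[of "nat \<lceil>1 + 4 * norm (z - w) + 4 * norm (z' - w)\<rceil>"]
    proof eventually_elim
      case (elim n)
      hence "1 + 4 * norm (z - w) + 4 * norm (z' - w) \<le> real n" by linarith
      thus ?case
        using norm_ge_zero[of "z - w"] norm_ge_zero[of "z' - w"]
        by (intro zero_free_part_bound nz) linarith+
    qed
    ultimately show "(\<lambda>n. ?d - sum ?t (zeros_upto (real n))) \<longlonglongrightarrow> 0"
      by (rule Lim_null_comparison[rotated])
  qed
  have "infsum ?t ?Z = ?d" using LIMSEQ_unique[OF lim1 lim2] .
  thus ?thesis using has_sum_infsum[OF sum] by simp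
qed

end

section \<open>The Euler--Maclaurin continuation of zeta\<close>

text \<open>
  Integrating by parts against the kernel \<open>K\<close> below (for which \<open>K''''''  = 1\<close>) gives the
  Euler--Maclaurin formula with the corrections for the Bernoulli numbers \<open>1/6\<close> and \<open>-1/30\<close>.
\<close>
lemma Euler_Maclaurin_step:
  fixes F :: "nat \<Rightarrow> real \<Rightarrow> complex"
  assumes F: "\<And>k x. k \<le> 6 \<Longrightarrow> x \<in> {a..a+1} \<Longrightarrow> (F k has_vector_derivative F (Suc k) x) (at x)"
    and M: "\<And>x. x \<in> {a<..<a+1} \<Longrightarrow> norm (F 7 x) \<le> M"
  shows "norm (F 0 (a+1) - F 0 a - (F 1 a + F 1 (a+1)) / 2 + (F 2 (a+1) - F 2 a) / 12
           - (F 4 (a+1) - F 4 a) / 720) \<le> M / 30240"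
proof -
  \<comment> \<open>\<open>K 0\<close> is (B_6(y) - B_6) / 6! with the Bernoulli polynomial B_6, and
    \<open>K j\<close> is its j-th derivative. \<open>K 0\<close>, \<open>K 1\<close> and
    \<open>K 3\<close> vanish at 0 and 1; \<open>K 2\<close> and \<open>K 4\<close> have the values
    -1/720 and 1/12 at both ends.\<close>
  define K where "K j y = (if j = 0 then y^6 - 3*y^5 + 5/2*y^4 - 1/2*y^2 else if j = 1 then 6*y^5 - 15*y^4 + 10*y^3 - y
    else if j = 2 then 30*y^4 - 60*y^3 + 30*y^2 - 1 else if j = 3 then 120*y^3 - 180*y^2 + 60*y
    else if j = 4 then 360*y^2 - 360*y + 60 else if j = 5 then 720*y - 360 else 720) / 720" for j :: nat and y :: real
  have K': "(K j has_field_derivative K (Suc j) y) (at y)" if "j \<le> 5" for j y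
  proof -
    have "j = 0 \<or> j = 1 \<or> j = 2 \<or> j = 3 \<or> j = 4 \<or> j = 5" using that by auto
    thus ?thesis
      unfolding K_def by (elim disjE; simp) (auto intro!: derivative_eq_intros simp: field_simps)
  qed
  define \<Phi> where "\<Phi> x = K 0 (x - a) *\<^sub>R F 6 x - K 1 (x - a) *\<^sub>R F 5 x + K 2 (x - a) *\<^sub>R F 4 x - K 3 (x - a) *\<^sub>R F 3 x
      + K 4 (x - a) *\<^sub>R F 2 x - K 5 (x - a) *\<^sub>R F 1 x + F 0 x" for x
  have P: "((\<lambda>x. K j (x - a) *\<^sub>R F (6 - j) x) has_vector_derivative
              (K j (x - a) *\<^sub>R F (7 - j) x + K (Suc j) (x - a) *\<^sub>R F (6 - j) x)) (at x)"
    if "x \<in> {a..a+1}" "j \<le> 5" for x j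
  proof -
    have "((\<lambda>x. K j (x - a)) has_field_derivative K (Suc j) (x - a)) (at x)"
      using K'[OF that(2), of "x - a"] DERIV_shift[of "K j" "K (Suc j) (x - a)" x "- a"] by simp
    moreover have "(F (6 - j) has_vector_derivative F (7 - j) x) (at x)"
    proof -
      have "Suc (6 - j) = 7 - j" using that by simp
      thus ?thesis using F[of "6 - j" x] that(1) by simp
    qed
    ultimately show ?thesis by (rule has_vector_derivative_scaleR)
  qed
  have \<Phi>': "(\<Phi> has_vector_derivative K 0 (x - a) *\<^sub>R F 7 x) (at x)" if x: "x \<in> {a..a+1}" for x
  proof -
    have "(\<Phi> has_vector_derivative
       (K 0 (x - a) *\<^sub>R F 7 x + K 1 (x - a) *\<^sub>R F 6 x) - (K 1 (x - a) *\<^sub>R F 6 x + K 2 (x - a) *\<^sub>R F 5 x)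
       + (K 2 (x - a) *\<^sub>R F 5 x + K 3 (x - a) *\<^sub>R F 4 x) - (K 3 (x - a) *\<^sub>R F 4 x + K 4 (x - a) *\<^sub>R F 3 x)
       + (K 4 (x - a) *\<^sub>R F 3 x + K 5 (x - a) *\<^sub>R F 2 x) - (K 5 (x - a) *\<^sub>R F 2 x + K 6 (x - a) *\<^sub>R F 1 x)
       + F 1 x) (at x)"
      unfolding \<Phi>_def
      using P[OF x, of 0] P[OF x, of 1] P[OF x, of 2] P[OF x, of 3] P[OF x, of 4] P[OF x, of 5] F[of 0 x] x
      by (intro has_vector_derivative_add has_vector_derivative_diff) (simp_all add: numeral_eq_Suc)
    thus ?thesis by (simp add: K_def)
  qed
  \<comment> \<open>An antiderivative of - M times \<open>K 0\<close>. Since \<open>K 0\<close> does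
    not change sign on [0, 1], it majorises the remainder, and its total increase is M B_6 / 6! = M
    / 30240.\<close>
  define \<phi> where "\<phi> x = - M * ((x-a)^7/7 - (x-a)^6/2 + (x-a)^5/2 - (x-a)^3/6) / 720" for x
  have \<phi>': "(\<phi> has_vector_derivative - M * K 0 (x - a)) (at x)" for x
  proof (rule has_real_derivative_iff_has_vector_derivative[THEN iffD1])
    show "(\<phi> has_real_derivative - M * K 0 (x - a)) (at x)"
      unfolding \<phi>_def K_def by (auto intro!: derivative_eq_intros simp: field_simps)
  qed
  have K_neg: "K 0 y \<le> 0" if "y \<in> {0..1}" for y
  proof -
    have "K 0 y = - (y^2 * (1-y)^2 * (1/2 + y * (1 - y))) / 720" unfolding K_def by (simp add: field_simps power_numeral_reduce)
    thus ?thesis using that by (auto intro!: mult_nonneg_nonneg add_nonneg_nonneg)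
  qed
  have "norm (\<Phi> (a+1) - \<Phi> a) \<le> \<phi> (a+1) - \<phi> a"
  proof (rule differentiable_bound_general)
    show "continuous_on {a..a+1} \<Phi>"
      by (intro continuous_at_imp_continuous_on ballI has_vector_derivative_continuous[OF \<Phi>'])
    show "continuous_on {a..a+1} \<phi>"
      by (intro continuous_at_imp_continuous_on ballI has_vector_derivative_continuous[OF \<phi>'])
    show "norm (K 0 (x - a) *\<^sub>R F 7 x) \<le> - M * K 0 (x - a)" if "a < x" "x < a + 1" for x
    proof -
      have "norm (K 0 (x - a) *\<^sub>R F 7 x) = - K 0 (x - a) * norm (F 7 x)"
        using K_neg[of "x - a"] that by simp
      also have "\<dots> \<le> - K 0 (x - a) * M"
        using K_neg[of "x - a"] M[of x] that by (intro mult_left_mono) auto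
      finally show ?thesis by (simp add: mult_ac)
    qed
  qed (use \<Phi>' \<phi>' in auto)
  also have "\<phi> (a+1) - \<phi> a = M / 30240" by (simp add: \<phi>_def)
  also have "\<Phi> (a+1) - \<Phi> a = F 0 (a+1) - F 0 a - (F 1 a + F 1 (a+1)) / 2 + (F 2 (a+1) - F 2 a) / 12
           - (F 4 (a+1) - F 4 a) / 720"
    by (simp add: \<Phi>_def K_def scaleR_conv_of_real field_simps)
  finally show ?thesis .
qed

definition em_coeff :: "nat \<Rightarrow> complex \<Rightarrow> complex" where
  "em_coeff k s = (\<Prod>j<k. 1 - s - of_nat j)"

text \<open>This is the k-th derivative of x^(1-s) in x. Starting from x^(1-s) in place of x^(-s)
  keeps a factor 1 - s throughout, so no division by s - 1 occurs and the pole at 1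
  disappears.\<close>

definition em_fun :: "nat \<Rightarrow> complex \<Rightarrow> real \<Rightarrow> complex" where
  "em_fun k s x = em_coeff k s * of_real x powr (1 - s - of_nat k)"

text \<open>The Euler--Maclaurin defect of x^(1-s) on [n, n+1]. Only the seventh derivative
  contributes to it, hence its rapid decay in n.\<close>

definition em_term :: "nat \<Rightarrow> complex \<Rightarrow> complex" where
  "em_term n s = em_fun 0 s (n+1) - em_fun 0 s n - (em_fun 1 s n + em_fun 1 s (n+1)) / 2
     + (em_fun 2 s (n+1) - em_fun 2 s n) / 12 - (em_fun 4 s (n+1) - em_fun 4 s n) / 720"

lemma em_fun_has_vector_derivative:
  assumes "x > 0"
  shows "(em_fun k s has_vector_derivative em_fun (Suc k) s x) (at x)"
proof -
  have "((\<lambda>z. em_coeff k s * z powr (1 - s - of_nat k)) has_field_derivative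
      em_coeff k s * ((1 - s - of_nat k) * of_real x powr (1 - s - of_nat k - 1))) (at (of_real x))"
    using assms by (intro DERIV_cmult has_field_derivative_powr) auto
  hence "((\<lambda>x. em_coeff k s * of_real x powr (1 - s - of_nat k)) has_vector_derivative
      em_coeff k s * ((1 - s - of_nat k) * of_real x powr (1 - s - of_nat k - 1))) (at x)"
    by (rule has_vector_derivative_real_field)
  moreover have "em_coeff k s * ((1 - s - of_nat k) * of_real x powr (1 - s - of_nat k - 1)) =
      em_coeff (Suc k) s * of_real x powr (1 - s - of_nat (Suc k))"
    by (simp add: em_coeff_def diff_diff_eq add.commute)
  ultimately show ?thesis unfolding em_fun_def[abs_def] by (simp only:)
qed

lemma norm_em_fun: "x > 0 \<Longrightarrow> norm (em_fun k s x) = norm (em_coeff k s) * x powr (1 - Re s - k)"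
  by (simp add: em_fun_def norm_mult norm_powr_real_powr)

lemma norm_em_term_le:
  assumes "n \<ge> 1" "Re s \<ge> -6"
  shows "norm (em_term n s) \<le> norm (em_coeff 7 s) * real n powr (- Re s - 6) / 30240"
  unfolding em_term_def of_nat_add of_nat_1
proof (rule Euler_Maclaurin_step[of "real n" "\<lambda>k. em_fun k s"])
  fix k :: nat and x assume "k \<le> 6" "x \<in> {real n..real n + 1}"
  thus "(em_fun k s has_vector_derivative em_fun (Suc k) s x) (at x)"
    using assms by (intro em_fun_has_vector_derivative) auto
next
  fix x assume "x \<in> {real n<..<real n + 1}"
  hence x: "real n < x" "x < real n + 1" by auto
  hence "norm (em_fun 7 s x) = norm (em_coeff 7 s) * x powr (- Re s - 6)"
    using assms by (subst norm_em_fun) (auto simp: algebra_simps)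
  also have "x powr (- Re s - 6) \<le> real n powr (- Re s - 6)"
    using x assms by (intro powr_mono2') auto
  finally show "norm (em_fun 7 s x) \<le> norm (em_coeff 7 s) * real n powr (- Re s - 6)"
    by (simp add: mult_left_mono)
qed

lemma holomorphic_em_term [holomorphic_intros]: "n \<ge> 1 \<Longrightarrow> em_term n holomorphic_on A"
  unfolding em_term_def em_fun_def em_coeff_def by (intro holomorphic_intros) auto

text \<open>This is (s - 1) \<zeta>(s) to the right of Re s = -1. The polynomial collects the
  boundary contributions at x = 1 that remain when the defects are telescoped.\<close>

definition xi0 :: "complex \<Rightarrow> complex" where
  "xi0 s = 1 + (s - 1) * (1/2 + s/12 - s * (s+1) * (s+2) / 720) + (\<Sum>n. em_term (Suc n) s)"

lemma norm_em_coeff_le: "norm (em_coeff k s) \<le> (norm s + real k) ^ k"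
proof -
  have "norm (em_coeff k s) \<le> (\<Prod>j<k. norm s + real k)"
    unfolding em_coeff_def prod_norm [symmetric]
  proof (intro prod_mono conjI)
    fix j assume "j \<in> {..<k}"
    have "norm (1 - s - of_nat j) \<le> norm s + norm (1 - complex_of_nat j)"
      using norm_triangle_ineq4[of "1 - of_nat j" s] by (simp add: algebra_simps)
    also have "norm (1 - complex_of_nat j) = \<bar>1 - real j\<bar>"
      by (metis norm_of_real of_real_1 of_real_diff of_real_of_nat_eq)
    also have "\<dots> \<le> real k" using \<open>j \<in> _\<close> by auto
    finally show "norm (1 - s - of_nat j) \<le> norm s + real k" by simp
  qed auto
  thus ?thesis by simp
qed

lemma norm_em_term_le':
  assumes "Re s \<ge> -1"
  shows "norm (em_term (Suc n) s) \<le> (norm s + 7) ^ 7 * (real (Suc n) powr - 5)"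
proof -
  have "norm (em_term (Suc n) s) \<le> norm (em_coeff 7 s) * real (Suc n) powr (- Re s - 6) / 30240"
    using assms by (intro norm_em_term_le) auto
  also have "\<dots> \<le> norm (em_coeff 7 s) * real (Suc n) powr (- Re s - 6)"
    by (simp add: field_simps mult_left_le)
  also have "\<dots> \<le> (norm s + 7) ^ 7 * (real (Suc n) powr - 5)"
    using norm_em_coeff_le[of 7 s] assms by (intro mult_mono powr_mono) auto
  finally show ?thesis .
qed

lemma summable_em_bound: "summable (\<lambda>n. C * real (Suc n) powr - 5)"
proof -
  have "summable (\<lambda>n. real n powr - 5)" by (subst summable_real_powr_iff) auto
  hence "summable (\<lambda>n. real (Suc n) powr - 5)" by (subst summable_Suc_iff)
  thus ?thesis by (rule summable_mult)
qed

lemma summable_em_term: "Re s \<ge> -1 \<Longrightarrow> summable (\<lambda>n. em_term (Suc n) s)"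
  by (rule summable_comparison_test'[OF summable_em_bound norm_em_term_le'])

lemma holomorphic_xi0: "xi0 holomorphic_on {s. Re s > -1}"
proof -
  have "(\<lambda>s. \<Sum>n. em_term (Suc n) s) holomorphic_on {s. Re s > -1}"
  proof (rule holomorphic_uniform_sequence[where f = "\<lambda>N s. \<Sum>n<N. em_term (Suc n) s"])
    show op: "open {s. Re s > -1}" by (rule open_halfspace_Re_gt)
    fix s assume s: "s \<in> {s. Re s > -1}"
    then obtain d where d: "d > 0" "cball s d \<subseteq> {s. Re s > -1}"
      using op open_contains_cball by blast
    have "uniform_limit (cball s d) (\<lambda>N s. \<Sum>n<N. em_term (Suc n) s) (\<lambda>s. \<Sum>n. em_term (Suc n) s) sequentially"
    proof (rule Weierstrass_m_test[OF _ summable_em_bound])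
      fix n z assume z: "z \<in> cball s d"
      have "norm z \<le> norm s + d" using z norm_triangle_ineq2[of z s] by (auto simp: dist_norm norm_minus_commute)
      have "norm (em_term (Suc n) z) \<le> (norm z + 7) ^ 7 * (real (Suc n) powr - 5)"
        using z d(2) by (intro norm_em_term_le') auto
      also have "\<dots> \<le> (norm s + d + 7) ^ 7 * (real (Suc n) powr - 5)"
        using \<open>norm z \<le> norm s + d\<close> by (intro mult_right_mono power_mono) auto
      finally show "norm (em_term (Suc n) z) \<le> (norm s + d + 7) ^ 7 * (real (Suc n) powr - 5)" .
    qed
    with d show "\<exists>d. 0 < d \<and> cball s d \<subseteq> {s. Re s > -1} \<and>
       uniform_limit (cball s d) (\<lambda>N s. \<Sum>n<N. em_term (Suc n) s) (\<lambda>s. \<Sum>n. em_term (Suc n) s) sequentially" by blast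
  qed (intro holomorphic_intros, auto)
  thus ?thesis unfolding xi0_def by (intro holomorphic_intros) auto
qed

lemma norm_xi0_le:
  "\<exists>C>0. \<forall>s. Re s \<ge> -1 \<longrightarrow> norm (xi0 s) \<le> C * (norm s + 7) ^ 7"
proof -
  define S where "S = (\<Sum>n. real (Suc n) powr - 5)"
  have sumS: "summable (\<lambda>n. real (Suc n) powr - 5)" using summable_em_bound[of 1] by simp
  have S: "S \<ge> 0" unfolding S_def by (intro suminf_nonneg sumS) auto
  have "norm (xi0 s) \<le> (1 + 2 + S) * (norm s + 7) ^ 7" if "Re s \<ge> -1" for s
  proof -
    define y where "y = norm s + 7"
    have y: "y \<ge> 7" by (simp add: y_def)
    have "norm (\<Sum>n. em_term (Suc n) s) \<le> (\<Sum>n. y ^ 7 * real (Suc n) powr - 5)"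
      using norm_em_term_le'[OF that] unfolding y_def by (intro norm_suminf_le summable_em_bound) auto
    also have "\<dots> = y ^ 7 * S" unfolding S_def by (rule suminf_mult[OF sumS])
    finally have 1: "norm (\<Sum>n. em_term (Suc n) s) \<le> y ^ 7 * S" .
    have n: "norm (s + of_real c) \<le> y" if "\<bar>c\<bar> \<le> 7" for c
      using norm_triangle_ineq[of s "of_real c"] that by (simp add: y_def)
    have a: "norm (s - 1) \<le> y" "norm s \<le> y" "norm (s + 1) \<le> y" "norm (s + 2) \<le> y"
      using n[of "-1"] n[of 0] n[of 1] n[of 2] by simp_all
    have "norm (1/2 + s/12 - s * (s+1) * (s+2) / 720) \<le> norm (1/2 + s/12) + norm (s * (s+1) * (s+2) / 720)"
      by (rule norm_triangle_ineq4)
    also have "norm (1/2 + s/12) \<le> 1/2 + norm s / 12"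
      by (rule norm_triangle_le) (simp add: norm_divide)
    also have "norm (s * (s+1) * (s+2) / 720) \<le> y * y * y / 720"
      unfolding norm_divide norm_mult using a y by (intro divide_mono mult_mono) auto
    also have "1/2 + norm s / 12 + y * y * y / 720 \<le> 2 * (y * y * y)"
    proof -
      have "7 * 7 * y \<le> y * y * y" using y by (intro mult_mono) auto
      thus ?thesis using a(2) y by linarith
    qed
    finally have "norm ((s - 1) * (1/2 + s/12 - s * (s+1) * (s+2) / 720)) \<le> y * (2 * (y * y * y))"
      unfolding norm_mult using a y by (intro mult_mono) auto
    also have "\<dots> = 2 * y ^ 4" by (simp add: power_numeral_reduce)
    also have "\<dots> \<le> 2 * y ^ 7" using y by (intro mult_left_mono power_increasing) auto
    finally have 2: "norm ((s - 1) * (1/2 + s/12 - s * (s+1) * (s+2) / 720)) \<le> 2 * y ^ 7" .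
    have "norm (xi0 s) \<le> 1 + norm ((s - 1) * (1/2 + s/12 - s * (s+1) * (s+2) / 720)) + norm (\<Sum>n. em_term (Suc n) s)"
      unfolding xi0_def by (intro norm_triangle_le add_mono order_refl norm_triangle_le) auto
    also have "\<dots> \<le> y ^ 7 + 2 * y ^ 7 + y ^ 7 * S"
      using 1 2 y by (intro add_mono) auto
    finally show ?thesis unfolding y_def by (simp add: algebra_simps)
  qed
  thus ?thesis using S by (intro exI[of _ "1 + 2 + S"]) auto
qed

lemma sum_em_term:
  assumes "a \<ge> 1" "a \<le> N"
  shows "(\<Sum>n=a..<N. em_term n s) = em_fun 0 s N - em_fun 0 s a - (\<Sum>n=a..N. em_fun 1 s (real n))
     + (em_fun 1 s a + em_fun 1 s N) / 2 + (em_fun 2 s N - em_fun 2 s a) / 12 - (em_fun 4 s N - em_fun 4 s a) / 720"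
  using assms(2)
proof (induction N rule: dec_induct)
  case (step n)
  have 1: "(\<Sum>n=a..<Suc n. em_term n s) = (\<Sum>n=a..<n. em_term n s) + em_term n s"
    using step by simp
  have 2: "(\<Sum>n=a..Suc n. em_fun 1 s (real n)) = (\<Sum>n=a..n. em_fun 1 s (real n)) + em_fun 1 s (real (Suc n))"
    using step by simp
  show ?case unfolding 1 2 step.IH unfolding em_term_def
    by (simp add: algebra_simps add_divide_distrib diff_divide_distrib)
qed (simp add: field_simps)

text \<open>A limit of trapezoid sums valid on both sides of the pole: for Re s > 1 it recovers the
  Dirichlet series, and for s in (-1, 0) it is the form in which the functional equation is
  proved.\<close>

lemma xi0_LIMSEQ:
  assumes s: "Re s > -1"
  shows "(\<lambda>N. (s - 1) * ((\<Sum>n=1..N. of_nat n powr -s) - of_nat N powr -s / 2) + of_nat N powr (1 - s))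
           \<longlonglongrightarrow> xi0 s"
proof -
  \<comment> \<open>The norm is of order N^(1 - Re s - k), so Re s > -1 makes the upper boundary
    terms of orders 2 and 4 vanish in the limit. Those of orders 0 and 1 remain as the trapezoid
    correction.\<close>
  have em0: "(\<lambda>N. em_fun k s (real N)) \<longlonglongrightarrow> 0" if "k \<ge> 2" for k
  proof (rule tendsto_norm_zero_cancel, rule Lim_transform_eventually)
    have "(\<lambda>N. norm (em_coeff k s) * real N powr (1 - Re s - k)) \<longlonglongrightarrow> norm (em_coeff k s) * 0"
      using that s by (intro tendsto_mult tendsto_const tendsto_neg_powr filterlim_real_sequentially) auto
    thus "(\<lambda>N. norm (em_coeff k s) * real N powr (1 - Re s - k)) \<longlonglongrightarrow> 0" by simp
    show "\<forall>\<^sub>F N in sequentially. norm (em_coeff k s) * real N powr (1 - Re s - k) = norm (em_fun k s (real N))"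
      using eventually_gt_at_top[of 0] by eventually_elim (simp add: norm_em_fun)
  qed
  have "(\<lambda>N. 1 + (s - 1) * (1/2 + s/12 - s * (s+1) * (s+2) / 720) + (\<Sum>n<N. em_term (Suc n) s)) \<longlonglongrightarrow> xi0 s"
    unfolding xi0_def using s by (intro tendsto_add tendsto_const summable_LIMSEQ summable_em_term) auto
  hence "(\<lambda>N. 1 + (s - 1) * (1/2 + s/12 - s * (s+1) * (s+2) / 720) + (\<Sum>n<N. em_term (Suc n) s)
         - em_fun 2 s (real (Suc N)) / 12 + em_fun 4 s (real (Suc N)) / 720) \<longlonglongrightarrow> xi0 s - 0 / 12 + 0 / 720"
    by (intro tendsto_add tendsto_diff tendsto_divide tendsto_const LIMSEQ_Suc[OF em0]) auto
  hence "(\<lambda>N. (s - 1) * ((\<Sum>n=1..Suc N. of_nat n powr -s) - of_nat (Suc N) powr -s / 2) + of_nat (Suc N) powr (1 - s))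
           \<longlonglongrightarrow> xi0 s - 0 / 12 + 0 / 720"
  proof (rule Lim_transform_eventually, intro always_eventually allI)
    fix N
    have c: "em_coeff 0 s = 1" "em_coeff 1 s = 1 - s" "em_coeff 2 s = (1 - s) * (- s)"
       "em_coeff 4 s = (1 - s) * (- s) * (- s - 1) * (- s - 2)"
      by (simp_all add: em_coeff_def numeral_eq_Suc algebra_simps)
    have "(\<Sum>n<N. em_term (Suc n) s) = (\<Sum>n=1..<Suc N. em_term n s)"
      using sum.shift_bounds_nat_ivl[of "\<lambda>n. em_term n s" 0 1 N] by (simp add: atLeast0LessThan)
    also have "\<dots> = em_fun 0 s (Suc N) - em_fun 0 s 1 - (\<Sum>n=1..Suc N. em_fun 1 s (real n))
     + (em_fun 1 s 1 + em_fun 1 s (Suc N)) / 2 + (em_fun 2 s (Suc N) - em_fun 2 s 1) / 12 - (em_fun 4 s (Suc N) - em_fun 4 s 1) / 720"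
      using sum_em_term[of 1 "Suc N" s] by simp
    also have "(\<Sum>n=1..Suc N. em_fun 1 s (real n)) = (1 - s) * (\<Sum>n=1..Suc N. of_nat n powr -s)"
      unfolding sum_distrib_left by (intro sum.cong) (auto simp: em_fun_def c simp del: One_nat_def)
    finally have *: "(\<Sum>n<N. em_term (Suc n) s) = em_fun 0 s (Suc N) - em_fun 0 s 1 - (1 - s) * (\<Sum>n=1..Suc N. of_nat n powr -s)
     + (em_fun 1 s 1 + em_fun 1 s (Suc N)) / 2 + (em_fun 2 s (Suc N) - em_fun 2 s 1) / 12 - (em_fun 4 s (Suc N) - em_fun 4 s 1) / 720" .
    have **: "em_fun 0 s 1 = 1" "em_fun 1 s 1 = 1 - s" "em_fun 2 s 1 = (1 - s) * (- s)"
       "em_fun 4 s 1 = (1 - s) * (- s) * (- s - 1) * (- s - 2)"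
       "em_fun 0 s (Suc N) = of_nat (Suc N) powr (1 - s)" "em_fun 1 s (Suc N) = (1 - s) * of_nat (Suc N) powr -s"
      by (simp_all add: em_fun_def c del: One_nat_def)
    show "1 + (s - 1) * (1/2 + s/12 - s * (s+1) * (s+2) / 720) + (\<Sum>n<N. em_term (Suc n) s)
         - em_fun 2 s (real (Suc N)) / 12 + em_fun 4 s (real (Suc N)) / 720 =
       (s - 1) * ((\<Sum>n=1..Suc N. of_nat n powr -s) - of_nat (Suc N) powr -s / 2) + of_nat (Suc N) powr (1 - s)"
      unfolding * ** by (simp add: field_simps)
  qed
  hence "(\<lambda>N. (s - 1) * ((\<Sum>n=1..Suc N. of_nat n powr -s) - of_nat (Suc N) powr -s / 2) + of_nat (Suc N) powr (1 - s))
           \<longlonglongrightarrow> xi0 s" by simp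
  thus ?thesis by (rule LIMSEQ_imp_Suc)
qed

lemma xi0_sums:
  assumes s: "Re s > 1"
  shows "(\<lambda>n. 1 / of_nat (Suc n) powr s) sums (xi0 s / (s - 1))"
proof -
  have "summable (\<lambda>n. real n powr - Re s)" using s by (subst summable_real_powr_iff) auto
  hence "summable (\<lambda>n. real (Suc n) powr - Re s)" by (subst summable_Suc_iff)
  hence "summable (\<lambda>n. of_nat (Suc n) powr -s)"
    by (rule summable_comparison_test') (simp add: norm_powr_real_powr)
  hence "(\<lambda>n. of_nat (Suc n) powr -s) sums (\<Sum>n. of_nat (Suc n) powr -s)" (is "_ sums ?Z")
    by (rule summable_sums)
  hence lim: "(\<lambda>N. \<Sum>n=1..N. of_nat n powr -s) \<longlonglongrightarrow> ?Z"
    unfolding sums_def by (simp add: sum.atLeast1_atMost_eq)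
  have pw: "(\<lambda>N. of_nat N powr w) \<longlonglongrightarrow> 0" if "Re w < 0" for w :: complex
  proof (rule tendsto_norm_zero_cancel, rule Lim_transform_eventually)
    show "(\<lambda>N. real N powr Re w) \<longlonglongrightarrow> 0"
      using that by (intro tendsto_neg_powr filterlim_real_sequentially)
    show "\<forall>\<^sub>F N in sequentially. real N powr Re w = norm (of_nat N powr w)"
      using eventually_gt_at_top[of 0]
      by eventually_elim (simp add: norm_powr_real_powr)
  qed
  have "(\<lambda>N. (s - 1) * ((\<Sum>n=1..N. of_nat n powr -s) - of_nat N powr -s / 2) + of_nat N powr (1 - s))
     \<longlonglongrightarrow> (s - 1) * (?Z - 0 / 2) + 0"
    using s by (intro tendsto_intros lim pw) auto
  hence "xi0 s = (s - 1) * ?Z" using xi0_LIMSEQ[of s] s LIMSEQ_unique by fastforce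
  moreover have "s \<noteq> 1" using s by auto
  ultimately have "?Z = xi0 s / (s - 1)" by simp
  moreover have "(\<lambda>n. 1 / of_nat (Suc n) powr s) = (\<lambda>n. of_nat (Suc n) powr -s)"
    by (simp add: powr_minus field_simps)
  ultimately show ?thesis using \<open>_ sums ?Z\<close> by simp
qed

section \<open>The functional equation\<close>

lemma Digamma_reflection_complex:
  fixes z :: complex
  assumes "z \<notin> \<int>"
  shows "Digamma (1 - z) - Digamma z = of_real pi * cot (of_real pi * z)"
proof -
  have z: "z \<notin> \<int>\<^sub>\<le>\<^sub>0" "1 - z \<notin> \<int>\<^sub>\<le>\<^sub>0"
    using assms nonpos_Ints_Int Ints_diff[of 1 "1 - z"] by auto
  have sn: "sin (of_real pi * z) \<noteq> 0"
    using assms by (subst sin_eq_0) (auto simp: mult.commute[of pi])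
  have G: "Gamma z \<noteq> 0" "Gamma (1 - z) \<noteq> 0" using z by (auto simp: Gamma_eq_zero_iff)
  have 1: "((\<lambda>z. Gamma z * Gamma (1 - z)) has_field_derivative
          Gamma z * Gamma (1 - z) * (Digamma z - Digamma (1 - z))) (at z)"
    using z by (auto intro!: derivative_eq_intros simp: algebra_simps)
  have 2: "((\<lambda>z. of_real pi / sin (of_real pi * z)) has_field_derivative
          - of_real pi * (of_real pi * cos (of_real pi * z)) / (sin (of_real pi * z))\<^sup>2) (at z)"
    using sn by (auto intro!: derivative_eq_intros simp: power2_eq_square)
  have "Gamma z * Gamma (1 - z) * (Digamma z - Digamma (1 - z)) =
        - of_real pi * (of_real pi * cos (of_real pi * z)) / (sin (of_real pi * z))\<^sup>2"
    by (rule DERIV_unique[OF 1]) (use 2 in \<open>simp add: Gamma_reflection_complex\<close>)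
  hence "of_real pi / sin (of_real pi * z) * (Digamma z - Digamma (1 - z)) =
         of_real pi / sin (of_real pi * z) * (- of_real pi * cot (of_real pi * z))"
    using sn by (simp add: Gamma_reflection_complex cot_def power2_eq_square)
  hence "Digamma z - Digamma (1 - z) = - of_real pi * cot (of_real pi * z)"
    using sn by (subst (asm) mult_left_cancel) auto
  thus ?thesis by (simp add: algebra_simps)
qed

text \<open>At the imaginary point z = i u / (2 pi), the Digamma reflection formula turns the series
  of Digamma (1 - z) - Digamma (1 + z) into the expansion of pi cot (pi z) - 1 / z, that is, of the
  hyperbolic cotangent at u / 2.\<close>

lemma coth_partial_fraction:
  fixes u :: real
  assumes u: "u > 0"
  shows "(\<lambda>m. 2 * u / (u\<^sup>2 + 4 * pi\<^sup>2 * (real (Suc m))\<^sup>2)) sums (1 / (exp u - 1) + 1/2 - 1/u)"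
proof -
  define y where "y = u / (2 * pi)"
  have y: "y > 0" using u by (simp add: y_def)
  define z where "z = \<i> * of_real y"
  have zI: "z \<notin> \<int>" using y by (auto simp: z_def complex_eq_iff Ints_def)
  have np: "1 - z \<notin> \<int>\<^sub>\<le>\<^sub>0" "1 + z \<notin> \<int>\<^sub>\<le>\<^sub>0" "z \<noteq> 0"
    using y by (auto simp: z_def complex_eq_iff nonpos_Ints_def)
  have D: "(\<lambda>k. inverse (of_nat (Suc k)) - inverse (w + of_nat k)) sums (Digamma w + euler_mascheroni)"
    if "w \<noteq> 0" for w :: complex
    using summable_Digamma[OF that] by (simp add: Digamma_def summable_sums)
  have "(\<lambda>k. (inverse (of_nat (Suc k)) - inverse ((1 - z) + of_nat k)) - (inverse (of_nat (Suc k)) - inverse ((1 + z) + of_nat k)))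
          sums ((Digamma (1 - z) + euler_mascheroni) - (Digamma (1 + z) + euler_mascheroni))"
    by (intro sums_diff D) (use y in \<open>auto simp: z_def complex_eq_iff\<close>)
  also have "(Digamma (1 - z) + euler_mascheroni) - (Digamma (1 + z) + euler_mascheroni) = of_real pi * cot (of_real pi * z) - 1 / z"
    using Digamma_reflection_complex[OF zI] Digamma_plus1[OF np(3)] by (simp add: algebra_simps)
  also have "(\<lambda>k. (inverse (of_nat (Suc k)) - inverse ((1 - z) + of_nat k)) - (inverse (of_nat (Suc k)) - inverse ((1 + z) + of_nat k)))
     = (\<lambda>k. - \<i> * of_real (2 * y / ((real (Suc k))\<^sup>2 + y\<^sup>2)))"
  proof
    fix k
    have ne: "of_nat (Suc k) - z \<noteq> 0" "of_nat (Suc k) + z \<noteq> 0" using y by (auto simp: z_def complex_eq_iff)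
    have pos: "(real (Suc k))\<^sup>2 + y\<^sup>2 > 0" using y by (intro add_nonneg_pos) auto
    have "(of_nat (Suc k) - z) * (of_nat (Suc k) + z) = of_real ((real (Suc k))\<^sup>2 + y\<^sup>2)"
      by (simp add: z_def algebra_simps power2_eq_square)
    moreover have "(inverse (of_nat (Suc k)) - inverse ((1 - z) + of_nat k)) - (inverse (of_nat (Suc k)) - inverse ((1 + z) + of_nat k))
       = - 2 * z / ((of_nat (Suc k) - z) * (of_nat (Suc k) + z))"
      using ne by (simp add: field_simps)
    ultimately show "(inverse (of_nat (Suc k)) - inverse ((1 - z) + of_nat k)) - (inverse (of_nat (Suc k)) - inverse ((1 + z) + of_nat k))
       = - \<i> * of_real (2 * y / ((real (Suc k))\<^sup>2 + y\<^sup>2))"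
      by (simp add: z_def)
  qed
  also have "of_real pi * cot (of_real pi * z) - 1 / z = - \<i> * of_real (pi * (1 + 2 / (exp u - 1)) - 1 / y)"
  proof -
    have "exp u - 1 \<noteq> 0" using u by simp
    have piz: "of_real pi * z = \<i> * of_real (u / 2)" by (simp add: z_def y_def)
    have e: "exp (u / 2) * exp (- u / 2) = 1" by (simp flip: exp_add)
    have e2: "exp (u/2) * exp (u/2) = exp u" by (simp flip: exp_add)
    have "cosh (u/2) * (exp u - 1) = sinh (u/2) * (exp u + 1)"
      unfolding cosh_def sinh_def e2 [symmetric] by (simp add: exp_minus field_simps)
    moreover have "sinh (u/2) \<noteq> 0" using u by simp
    ultimately have c: "cosh (u/2) / sinh (u/2) = 1 + 2 / (exp u - 1)"
      using \<open>exp u - 1 \<noteq> 0\<close> by (simp add: field_simps)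
    have "\<i> * (\<i> * complex_of_real x) = of_real (- x)" for x by simp
    hence cs: "cos (\<i> * of_real x) = of_real (cosh x)" "sin (\<i> * of_real x) = \<i> * of_real (sinh x)" for x :: real
      unfolding cos_exp_eq sin_exp_eq cosh_def sinh_def scaleR_conv_of_real of_real_add of_real_diff of_real_mult exp_of_real
      by (simp_all add: field_simps flip: exp_of_real)
    have "cot (of_real pi * z) = - \<i> * of_real (cosh (u/2) / sinh (u/2))"
      using \<open>sinh (u/2) \<noteq> 0\<close> unfolding piz cot_def cs by (simp add: field_simps del: sinh_real_zero_iff)
    hence cot_eq: "cot (of_real pi * z) = - \<i> * of_real (1 + 2 / (exp u - 1))" by (simp only: c)
    have z_eq: "1 / z = - \<i> * of_real (1 / y)" using y by (simp add: z_def field_simps)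
    show ?thesis unfolding cot_eq z_eq by (simp only: of_real_diff of_real_mult) (simp add: algebra_simps)
  qed
  finally have "(\<lambda>k. - \<i> * of_real (2 * y / ((real (Suc k))\<^sup>2 + y\<^sup>2))) sums
      (- \<i> * complex_of_real (pi * (1 + 2 / (exp u - 1)) - 1 / y))" .
  hence "(\<lambda>k. of_real (2 * y / ((real (Suc k))\<^sup>2 + y\<^sup>2))) sums complex_of_real (pi * (1 + 2 / (exp u - 1)) - 1 / y)"
    by (subst (asm) sums_mult_iff) (simp_all only: neg_equal_0_iff_equal complex_i_not_zero not_False_eq_True)
  hence "(\<lambda>k. 2 * y / ((real (Suc k))\<^sup>2 + y\<^sup>2)) sums (pi * (1 + 2 / (exp u - 1)) - 1 / y)"
    by (subst (asm) sums_of_real_iff)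
  hence "(\<lambda>k. 1 / (2 * pi) * (2 * y / ((real (Suc k))\<^sup>2 + y\<^sup>2))) sums (1 / (2 * pi) * (pi * (1 + 2 / (exp u - 1)) - 1 / y))"
    by (rule sums_mult)
  moreover have "1 / (2 * pi) * (2 * y / ((real (Suc k))\<^sup>2 + y\<^sup>2)) = 2 * u / (u\<^sup>2 + 4 * pi\<^sup>2 * (real (Suc k))\<^sup>2)" for k
  proof -
    have "(real (Suc k))\<^sup>2 + y\<^sup>2 = (u\<^sup>2 + 4 * pi\<^sup>2 * (real (Suc k))\<^sup>2) / (4 * pi\<^sup>2)"
      by (simp add: y_def field_simps power2_eq_square)
    thus ?thesis by (simp add: y_def power2_eq_square)
  qed
  moreover have "1 / (2 * pi) * (pi * (1 + 2 / (exp u - 1)) - 1 / y) = 1 / (exp u - 1) + 1/2 - 1/u"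
    using u by (simp add: y_def field_simps)
  ultimately show ?thesis by simp
qed

section \<open>Mellin integrals of nonnegative functions\<close>

lemma nn_integral_powr_exp:
  fixes b y :: real
  assumes b: "b > 0" and y: "y > 0"
  shows "(\<integral>\<^sup>+ u. ennreal (indicator {0<..} u * (u powr (b - 1) * exp (- (y * u)))) \<partial>lborel) = ennreal (Gamma b / y powr b)"
proof -
  define f where "f = (\<lambda>t::real. ennreal (indicator {0<..} t * (t powr (b - 1) * exp (- t))))"
  have [measurable]: "f \<in> borel_measurable borel" unfolding f_def by measurable
  have "ennreal (Gamma b) = (\<integral>\<^sup>+ t. f t \<partial>lborel)"
    unfolding Gamma_conv_nn_integral_real[OF b] f_def
    by (intro nn_integral_cong arg_cong[where f = ennreal]) (auto simp: indicator_def exp_minus field_simps)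
  also have "\<dots> = ennreal \<bar>y\<bar> * (\<integral>\<^sup>+ u. f (0 + y * u) \<partial>lborel)"
    by (rule nn_integral_real_affine) (use y in auto)
  also have "(\<integral>\<^sup>+ u. f (0 + y * u) \<partial>lborel) =
     (\<integral>\<^sup>+ u. ennreal (y powr (b - 1)) * ennreal (indicator {0<..} u * (u powr (b - 1) * exp (- (y * u)))) \<partial>lborel)"
    unfolding f_def using y
    by (intro nn_integral_cong) (auto simp: indicator_def zero_less_mult_iff powr_mult mult_ac simp flip: ennreal_mult')
  also have "\<dots> = ennreal (y powr (b - 1)) * (\<integral>\<^sup>+ u. ennreal (indicator {0<..} u * (u powr (b - 1) * exp (- (y * u)))) \<partial>lborel)"
    by (rule nn_integral_cmult) measurable
  finally have "ennreal (Gamma b) = ennreal (y * y powr (b - 1)) *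
     (\<integral>\<^sup>+ u. ennreal (indicator {0<..} u * (u powr (b - 1) * exp (- (y * u)))) \<partial>lborel)" (is "_ = _ * ?I")
    using y by (simp add: ennreal_mult' mult.assoc)
  also have "y * y powr (b - 1) = y powr b" using y by (simp add: powr_diff)
  finally have *: "ennreal (Gamma b) = ennreal (y powr b) * ?I" .
  have "ennreal (Gamma b / y powr b) = ennreal (1 / y powr b) * ennreal (Gamma b)"
    by (simp flip: ennreal_mult')
  also have "\<dots> = ennreal (1 / y powr b * y powr b) * ?I"
    unfolding * by (subst ennreal_mult') (auto simp: mult.assoc)
  also have "1 / y powr b * y powr b = 1" using y by simp
  finally show ?thesis by simp
qed

text \<open>The Mellin transform of a Laplace transform is a Gamma factor times a Mellin transform
  of the weight. All integrands are nonnegative, so Tonelli applies and no convergence has to be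
  discussed.\<close>

lemma nn_integral_exp_weight:
  fixes a :: real and w :: "real \<Rightarrow> real"
  assumes a: "a < 1" and w: "\<And>y. w y \<ge> 0" "\<And>y. y \<le> 0 \<Longrightarrow> w y = 0"
    and [measurable]: "w \<in> borel_measurable borel"
  shows "(\<integral>\<^sup>+ u. ennreal (indicator {0<..} u * u powr -a) * (\<integral>\<^sup>+ y. ennreal (w y * exp (- (y * u))) \<partial>lborel) \<partial>lborel)
       = ennreal (Gamma (1 - a)) * (\<integral>\<^sup>+ y. ennreal (w y * y powr (a - 1)) \<partial>lborel)"
proof -
  have "(\<integral>\<^sup>+ u. ennreal (indicator {0<..} u * u powr -a) * (\<integral>\<^sup>+ y. ennreal (w y * exp (- (y * u))) \<partial>lborel) \<partial>lborel)
     = (\<integral>\<^sup>+ u. (\<integral>\<^sup>+ y. ennreal (indicator {0<..} u * u powr -a) * ennreal (w y * exp (- (y * u))) \<partial>lborel) \<partial>lborel)"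
    by (intro nn_integral_cong nn_integral_cmult [symmetric]) measurable
  also have "\<dots> = (\<integral>\<^sup>+ y. (\<integral>\<^sup>+ u. ennreal (indicator {0<..} u * u powr -a) * ennreal (w y * exp (- (y * u))) \<partial>lborel) \<partial>lborel)"
    by (rule lborel_pair.Fubini') measurable
  also have "\<dots> = (\<integral>\<^sup>+ y. ennreal (w y) * (\<integral>\<^sup>+ u. ennreal (indicator {0<..} u * (u powr ((1 - a) - 1) * exp (- (y * u)))) \<partial>lborel) \<partial>lborel)"
    using w by (subst nn_integral_cmult [symmetric])
      (auto intro!: nn_integral_cong simp: mult_ac indicator_def simp flip: ennreal_mult')
  also have "\<dots> = (\<integral>\<^sup>+ y. ennreal (Gamma (1 - a)) * ennreal (w y * y powr (a - 1)) \<partial>lborel)"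
  proof (intro nn_integral_cong)
    fix y :: real
    show "ennreal (w y) * (\<integral>\<^sup>+ u. ennreal (indicator {0<..} u * (u powr ((1 - a) - 1) * exp (- (y * u)))) \<partial>lborel)
        = ennreal (Gamma (1 - a)) * ennreal (w y * y powr (a - 1))"
    proof (cases "y > 0")
      case True
      have "Gamma (1 - a) / y powr (1 - a) = Gamma (1 - a) * y powr (a - 1)"
        using powr_minus_divide[of y "1 - a"] by simp
      thus ?thesis using nn_integral_powr_exp[of "1 - a" y] True a w(1)
        by (simp add: mult_ac Gamma_real_nonneg flip: ennreal_mult')
    qed (use w in auto)
  qed
  also have "\<dots> = ennreal (Gamma (1 - a)) * (\<integral>\<^sup>+ y. ennreal (w y * y powr (a - 1)) \<partial>lborel)"
    by (rule nn_integral_cmult) measurable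
  finally show ?thesis .
qed

text \<open>The indicator of (0, x] has Laplace transform (1 - exp (- x u)) / u, so this is the
  weighted formula with that indicator as weight.\<close>

lemma nn_integral_one_minus_exp:
  fixes a x :: real
  assumes a: "0 < a" "a < 1" and x: "x \<ge> 0"
  shows "(\<integral>\<^sup>+ u. ennreal (indicator {0<..} u * ((1 - exp (- (x * u))) * u powr (-a - 1))) \<partial>lborel)
       = ennreal (Gamma (1 - a) * (x powr a / a))"
proof -
  define w where "w = (\<lambda>y. indicator {0<..x} y :: real)"
  have inner: "(\<integral>\<^sup>+ y. ennreal (w y * exp (- (y * u))) \<partial>lborel) = ennreal ((1 - exp (- (x * u))) / u)" if u: "u > 0" for u
  proof -
    have "((\<lambda>y. exp (- (y * u))) has_integral (- exp (- (x * u)) / u - (- exp (- (0 * u)) / u))) {0..x}"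
      using x u by (intro fundamental_theorem_of_calculus)
        (auto intro!: derivative_eq_intros simp flip: has_real_derivative_iff_has_vector_derivative)
    hence "((\<lambda>y. exp (- (y * u))) has_integral ((1 - exp (- (x * u))) / u)) {0..x}"
      by (simp add: diff_divide_distrib)
    from nn_integral_has_integral_lebesgue[OF _ this]
    have "(\<integral>\<^sup>+ y. ennreal (indicator {0..x} y * exp (- (y * u))) \<partial>lborel) = ennreal ((1 - exp (- (x * u))) / u)" by simp
    moreover have "(\<integral>\<^sup>+ y. ennreal (w y * exp (- (y * u))) \<partial>lborel) = (\<integral>\<^sup>+ y. ennreal (indicator {0..x} y * exp (- (y * u))) \<partial>lborel)"
      using AE_lborel_singleton[of "0::real"] by (intro nn_integral_cong_AE) (auto elim!: eventually_mono simp: w_def indicator_def)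
    ultimately show ?thesis by simp
  qed
  have "(\<integral>\<^sup>+ u. ennreal (indicator {0<..} u * ((1 - exp (- (x * u))) * u powr (-a - 1))) \<partial>lborel) =
        (\<integral>\<^sup>+ u. ennreal (indicator {0<..} u * u powr -a) * (\<integral>\<^sup>+ y. ennreal (w y * exp (- (y * u))) \<partial>lborel) \<partial>lborel)"
  proof (intro nn_integral_cong)
    fix u :: real
    show "ennreal (indicator {0<..} u * ((1 - exp (- (x * u))) * u powr (-a - 1))) =
          ennreal (indicator {0<..} u * u powr -a) * (\<integral>\<^sup>+ y. ennreal (w y * exp (- (y * u))) \<partial>lborel)"
    proof (cases "u > 0")
      case True
      hence "u powr (-a - 1) = u powr -a / u" by (subst powr_diff) auto
      thus ?thesis using True x by (simp add: inner mult_ac flip: ennreal_mult')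
    qed auto
  qed
  also have "\<dots> = ennreal (Gamma (1 - a)) * (\<integral>\<^sup>+ y. ennreal (w y * y powr (a - 1)) \<partial>lborel)"
    by (rule nn_integral_exp_weight) (use a in \<open>auto simp: w_def\<close>)
  also have "(\<integral>\<^sup>+ y. ennreal (w y * y powr (a - 1)) \<partial>lborel) = (\<integral>\<^sup>+ y. ennreal (indicator {0..x} y * y powr (a - 1)) \<partial>lborel)"
    using AE_lborel_singleton[of "0::real"] by (intro nn_integral_cong_AE) (auto elim!: eventually_mono simp: w_def indicator_def)
  also have "\<dots> = ennreal (x powr a / a)"
    using nn_integral_has_integral_lebesgue[OF _ has_integral_powr_from_0[of "a - 1" x]] a x by simp
  finally show ?thesis using a x by (simp add: Gamma_real_nonneg flip: ennreal_mult')
qed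

text \<open>The integral over \<open>x\<close> of the previous lemma, computed with the weight \<open>x - y\<close> instead.\<close>
lemma nn_integral_one_minus_exp_integrated:
  fixes a x :: real
  assumes a: "0 < a" "a < 1" and x: "x \<ge> 0"
  shows "(\<integral>\<^sup>+ u. ennreal (indicator {0<..} u * ((x - (1 - exp (- (x * u))) / u) * u powr (-a - 1))) \<partial>lborel)
       = ennreal (Gamma (1 - a) * (x powr (a + 1) / (a * (a + 1))))"
proof -
  define w where "w = (\<lambda>y. indicator {0<..x} y * (x - y) :: real)"
  have inner: "(\<integral>\<^sup>+ y. ennreal (w y * exp (- (y * u))) \<partial>lborel) = ennreal ((x - (1 - exp (- (x * u))) / u) / u)" if u: "u > 0" for u
  proof -
    define G where "G = (\<lambda>y. (1 / u - (x - y)) * exp (- (y * u)) / u)"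
    have "((\<lambda>y. (x - y) * exp (- (y * u))) has_integral (G x - G 0)) {0..x}"
      unfolding G_def using x u by (intro fundamental_theorem_of_calculus)
        (auto intro!: derivative_eq_intros simp: field_simps simp flip: has_real_derivative_iff_has_vector_derivative)
    also have "G x - G 0 = (x - (1 - exp (- (x * u))) / u) / u"
      using u by (simp add: G_def field_simps)
    finally have hi: "((\<lambda>y. (x - y) * exp (- (y * u))) has_integral (x - (1 - exp (- (x * u))) / u) / u) {0..x}" .
    have "(\<integral>\<^sup>+ y. ennreal (indicator {0..x} y * ((x - y) * exp (- (y * u)))) \<partial>lborel) = ennreal ((x - (1 - exp (- (x * u))) / u) / u)"
      by (rule nn_integral_has_integral_lebesgue[OF _ hi]) auto
    moreover have "(\<integral>\<^sup>+ y. ennreal (w y * exp (- (y * u))) \<partial>lborel) = (\<integral>\<^sup>+ y. ennreal (indicator {0..x} y * ((x - y) * exp (- (y * u)))) \<partial>lborel)"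
      using AE_lborel_singleton[of "0::real"] by (intro nn_integral_cong_AE) (auto elim!: eventually_mono simp: w_def indicator_def)
    ultimately show ?thesis by simp
  qed
  have "(\<integral>\<^sup>+ u. ennreal (indicator {0<..} u * ((x - (1 - exp (- (x * u))) / u) * u powr (-a - 1))) \<partial>lborel) =
        (\<integral>\<^sup>+ u. ennreal (indicator {0<..} u * u powr -a) * (\<integral>\<^sup>+ y. ennreal (w y * exp (- (y * u))) \<partial>lborel) \<partial>lborel)"
  proof (intro nn_integral_cong)
    fix u :: real
    show "ennreal (indicator {0<..} u * ((x - (1 - exp (- (x * u))) / u) * u powr (-a - 1))) =
          ennreal (indicator {0<..} u * u powr -a) * (\<integral>\<^sup>+ y. ennreal (w y * exp (- (y * u))) \<partial>lborel)"
    proof (cases "u > 0")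
      case True
      hence "u powr (-a - 1) = u powr -a / u" by (subst powr_diff) auto
      thus ?thesis using True x by (simp add: inner mult_ac flip: ennreal_mult')
    qed auto
  qed
  also have "\<dots> = ennreal (Gamma (1 - a)) * (\<integral>\<^sup>+ y. ennreal (w y * y powr (a - 1)) \<partial>lborel)"
    by (rule nn_integral_exp_weight) (use a in \<open>auto simp: w_def indicator_def\<close>)
  also have "(\<integral>\<^sup>+ y. ennreal (w y * y powr (a - 1)) \<partial>lborel) = (\<integral>\<^sup>+ y. ennreal (indicator {0..x} y * (x * y powr (a - 1) - y powr a)) \<partial>lborel)"
    using AE_lborel_singleton[of "0::real"]
    by (intro nn_integral_cong_AE) (auto elim!: eventually_mono simp: w_def indicator_def powr_diff field_simps)
  also have "\<dots> = ennreal (x * (x powr a / a) - x powr (a + 1) / (a + 1))"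
  proof (rule nn_integral_has_integral_lebesgue)
    show "((\<lambda>y. x * y powr (a - 1) - y powr a) has_integral (x * (x powr a / a) - x powr (a + 1) / (a + 1))) {0..x}"
      using has_integral_powr_from_0[of "a - 1" x] has_integral_powr_from_0[of a x] a x
      by (intro has_integral_diff has_integral_mult_right) auto
    show "0 \<le> x * y powr (a - 1) - y powr a" if y: "y \<in> {0..x}" for y
    proof (cases "y = 0")
      case False
      hence "y powr a = y * y powr (a - 1)" using y by (simp add: powr_diff)
      also have "\<dots> \<le> x * y powr (a - 1)" using y by (intro mult_right_mono) auto
      finally show ?thesis by simp
    qed auto
  qed
  also have "x * (x powr a / a) - x powr (a + 1) / (a + 1) = x powr (a + 1) / (a * (a + 1))"
  proof (cases "x = 0")
    case False
    thus ?thesis using a x by (simp add: powr_add field_simps)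
  qed (use a in auto)
  finally show ?thesis using a x by (simp add: Gamma_real_nonneg flip: ennreal_mult')
qed

text \<open>The substitution is made on [0, n], with upper limit n^2 on the other side; monotone
  convergence carries it to the half-line.\<close>

lemma nn_integral_square_substitution:
  fixes f :: "real \<Rightarrow> real"
  assumes [measurable]: "f \<in> borel_measurable borel" and nonneg: "\<And>x. f x \<ge> 0"
  shows "(\<integral>\<^sup>+ v. ennreal (f v) * indicator {0..} v \<partial>lborel) = (\<integral>\<^sup>+ u. ennreal (f (u\<^sup>2) * (2 * u)) * indicator {0..} u \<partial>lborel)"
proof (rule LIMSEQ_unique)
  have "(\<lambda>n. \<integral>\<^sup>+ v. ennreal (f v) * indicator {0..(real n)\<^sup>2} v \<partial>lborel) \<longlonglongrightarrow> (\<integral>\<^sup>+ v. ennreal (f v) * indicator {0..} v \<partial>lborel)"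
  proof (rule nn_integral_LIMSEQ)
    show "incseq (\<lambda>n v. ennreal (f v) * indicator {0..(real n)\<^sup>2} v)"
    proof (intro incseq_SucI le_funI mult_left_mono)
      fix n v
      have le: "(real n)\<^sup>2 \<le> (real (Suc n))\<^sup>2" by (intro power_mono) auto
      show "indicator {0..(real n)\<^sup>2} v \<le> (indicator {0..(real (Suc n))\<^sup>2} v :: ennreal)"
        by (auto simp: indicator_def simp del: of_nat_Suc intro: order_trans[OF _ le])
    qed auto
    show "(\<lambda>n. ennreal (f v) * indicator {0..(real n)\<^sup>2} v) \<longlonglongrightarrow> ennreal (f v) * indicator {0..} v" for v
    proof (rule tendsto_eventually)
      show "\<forall>\<^sub>F n in sequentially. ennreal (f v) * indicator {0..(real n)\<^sup>2} v = ennreal (f v) * indicator {0..} v"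
        using eventually_ge_at_top[of "nat \<lceil>max 1 v\<rceil>"]
      proof eventually_elim
        case (elim n)
        hence "max 1 v \<le> real n" by linarith
        hence n: "1 \<le> real n" "v \<le> real n" by auto
        have "real n * 1 \<le> real n * real n" using n by (intro mult_left_mono) auto
        hence "v \<le> real n * real n" using n by linarith
        hence "v \<le> (real n)\<^sup>2" by (simp only: power2_eq_square)
        thus ?case by (auto simp: indicator_def)
      qed
    qed
  qed measurable
  also have "(\<lambda>n. \<integral>\<^sup>+ v. ennreal (f v) * indicator {0..(real n)\<^sup>2} v \<partial>lborel) =
             (\<lambda>n. \<integral>\<^sup>+ u. ennreal (f (u\<^sup>2) * (2 * u)) * indicator {0..real n} u \<partial>lborel)"
  proof
    fix n
    have "(\<integral>\<^sup>+ v. ennreal (f v * indicator {0\<^sup>2..(real n)\<^sup>2} v) \<partial>lborel) =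
          (\<integral>\<^sup>+ u. ennreal (f (u\<^sup>2) * (2 * u) * indicator {0..real n} u) \<partial>lborel)"
    proof (rule nn_integral_substitution[of "\<lambda>x. x\<^sup>2" 0 "real n" f "\<lambda>x. 2 * x"])
      show "((\<lambda>x. x\<^sup>2) has_real_derivative 2 * x) (at x)" for x :: real
        by (auto intro!: derivative_eq_intros)
      show "continuous_on {0..real n} (\<lambda>x. 2 * x)" by (intro continuous_intros)
      show "set_borel_measurable borel {0\<^sup>2..(real n)\<^sup>2} f"
        unfolding set_borel_measurable_def by measurable
    qed auto
    moreover have "(\<integral>\<^sup>+ v. ennreal (f v * indicator {0\<^sup>2..(real n)\<^sup>2} v) \<partial>lborel) =
          (\<integral>\<^sup>+ v. ennreal (f v) * indicator {0..(real n)\<^sup>2} v \<partial>lborel)"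
      by (intro nn_integral_cong) (auto simp: indicator_def)
    moreover have "(\<integral>\<^sup>+ u. ennreal (f (u\<^sup>2) * (2 * u) * indicator {0..real n} u) \<partial>lborel) =
          (\<integral>\<^sup>+ u. ennreal (f (u\<^sup>2) * (2 * u)) * indicator {0..real n} u \<partial>lborel)"
      by (intro nn_integral_cong) (auto simp: indicator_def)
    ultimately show "(\<integral>\<^sup>+ v. ennreal (f v) * indicator {0..(real n)\<^sup>2} v \<partial>lborel) =
          (\<integral>\<^sup>+ u. ennreal (f (u\<^sup>2) * (2 * u)) * indicator {0..real n} u \<partial>lborel)" by simp
  qed
  finally show "(\<lambda>n. \<integral>\<^sup>+ u. ennreal (f (u\<^sup>2) * (2 * u)) * indicator {0..real n} u \<partial>lborel) \<longlonglongrightarrow>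
                (\<integral>\<^sup>+ v. ennreal (f v) * indicator {0..} v \<partial>lborel)" .
  show "(\<lambda>n. \<integral>\<^sup>+ u. ennreal (f (u\<^sup>2) * (2 * u)) * indicator {0..real n} u \<partial>lborel) \<longlonglongrightarrow>
        (\<integral>\<^sup>+ u. ennreal (f (u\<^sup>2) * (2 * u)) * indicator {0..} u \<partial>lborel)"
  proof (rule nn_integral_LIMSEQ)
    show "incseq (\<lambda>n u. ennreal (f (u\<^sup>2) * (2 * u)) * indicator {0..real n} u)"
      by (intro incseq_SucI le_funI mult_left_mono indicator_leI) auto
    show "(\<lambda>n. ennreal (f (u\<^sup>2) * (2 * u)) * indicator {0..real n} u) \<longlonglongrightarrow> ennreal (f (u\<^sup>2) * (2 * u)) * indicator {0..} u" for u
    proof (rule tendsto_eventually)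
      show "\<forall>\<^sub>F n in sequentially. ennreal (f (u\<^sup>2) * (2 * u)) * indicator {0..real n} u = ennreal (f (u\<^sup>2) * (2 * u)) * indicator {0..} u"
        using eventually_ge_at_top[of "nat \<lceil>u\<rceil>"]
      proof eventually_elim
        case (elim n)
        hence "u \<le> real n" by linarith
        thus ?case by (auto simp: indicator_def)
      qed
    qed
  qed measurable
qed

lemma nn_integral_powr_exp_square:
  fixes a y :: real
  assumes a: "a < 1" and y: "y > 0"
  shows "(\<integral>\<^sup>+ u. ennreal (indicator {0<..} u * (2 * u powr -a * exp (- (y * u\<^sup>2)))) \<partial>lborel)
       = ennreal (Gamma ((1 - a) / 2) / y powr ((1 - a) / 2))"
proof -
  define b where "b = (1 - a) / 2"
  have b: "b > 0" using a by (simp add: b_def)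
  define f where "f = (\<lambda>v::real. indicator {0<..} v * (v powr (b - 1) * exp (- (y * v))))"
  have [measurable]: "f \<in> borel_measurable borel" unfolding f_def by measurable
  have "ennreal (Gamma b / y powr b) = (\<integral>\<^sup>+ v. ennreal (f v) * indicator {0..} v \<partial>lborel)"
    unfolding nn_integral_powr_exp[OF b y, symmetric] f_def by (intro nn_integral_cong) (auto simp: indicator_def)
  also have "\<dots> = (\<integral>\<^sup>+ u. ennreal (f (u\<^sup>2) * (2 * u)) * indicator {0..} u \<partial>lborel)"
    by (rule nn_integral_square_substitution) (auto simp: f_def indicator_def)
  also have "\<dots> = (\<integral>\<^sup>+ u. ennreal (indicator {0<..} u * (2 * u powr -a * exp (- (y * u\<^sup>2)))) \<partial>lborel)"
  proof (intro nn_integral_cong)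
    fix u :: real
    show "ennreal (f (u\<^sup>2) * (2 * u)) * indicator {0..} u = ennreal (indicator {0<..} u * (2 * u powr -a * exp (- (y * u\<^sup>2))))"
    proof (cases "u > 0")
      case True
      have "(u\<^sup>2) powr (b - 1) * u = (u powr 2) powr (b - 1) * u powr 1" using True by simp
      also have "\<dots> = u powr (2 * (b - 1) + 1)" by (simp only: powr_powr powr_add)
      also have "2 * (b - 1) + 1 = -a" by (simp add: b_def field_simps)
      finally show ?thesis using True by (simp add: f_def mult_ac)
    qed (auto simp: f_def indicator_def)
  qed
  finally show ?thesis by (simp add: b_def)
qed

text \<open>Writing 1 / (u^2 + q^2) as the integral of exp (- y (u^2 + q^2)) over y > 0 and
  exchanging integrals leaves two Gamma factors with arguments adding up to 1; the reflection
  formula produces the cosine.\<close>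

lemma nn_integral_Mellin_kernel:
  fixes a q :: real
  assumes a: "-1 < a" "a < 1" and q: "q > 0"
  shows "(\<integral>\<^sup>+ u. ennreal (indicator {0<..} u * (2 * u powr -a / (u\<^sup>2 + q\<^sup>2))) \<partial>lborel)
       = ennreal (pi / cos (pi * a / 2) * q powr (-a - 1))"
proof -
  have inner: "(\<integral>\<^sup>+ y. ennreal (indicator {0<..} y * exp (- (y * r))) \<partial>lborel) = ennreal (1 / r)" if "r > 0" for r :: real
  proof -
    have "(\<integral>\<^sup>+ y. ennreal (indicator {0<..} y * exp (- (y * r))) \<partial>lborel) =
          (\<integral>\<^sup>+ y. ennreal (indicator {0<..} y * (y powr (1 - 1) * exp (- (r * y)))) \<partial>lborel)"
      by (intro nn_integral_cong) (auto simp: indicator_def mult.commute)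
    also have "\<dots> = ennreal (1 / r)" using that by (subst nn_integral_powr_exp) auto
    finally show ?thesis .
  qed
  have "(\<integral>\<^sup>+ u. ennreal (indicator {0<..} u * (2 * u powr -a / (u\<^sup>2 + q\<^sup>2))) \<partial>lborel) =
        (\<integral>\<^sup>+ u. (\<integral>\<^sup>+ y. ennreal (indicator {0<..} u * (2 * u powr -a)) * ennreal (indicator {0<..} y * exp (- (y * (u\<^sup>2 + q\<^sup>2)))) \<partial>lborel) \<partial>lborel)"
  proof (intro nn_integral_cong)
    fix u :: real
    have "u\<^sup>2 + q\<^sup>2 > 0" using q by (simp add: add_nonneg_pos)
    thus "ennreal (indicator {0<..} u * (2 * u powr -a / (u\<^sup>2 + q\<^sup>2))) =
      (\<integral>\<^sup>+ y. ennreal (indicator {0<..} u * (2 * u powr -a)) * ennreal (indicator {0<..} y * exp (- (y * (u\<^sup>2 + q\<^sup>2)))) \<partial>lborel)"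
      by (subst nn_integral_cmult, measurable) (simp add: inner flip: ennreal_mult')
  qed
  also have "\<dots> = (\<integral>\<^sup>+ y. (\<integral>\<^sup>+ u. ennreal (indicator {0<..} u * (2 * u powr -a)) * ennreal (indicator {0<..} y * exp (- (y * (u\<^sup>2 + q\<^sup>2)))) \<partial>lborel) \<partial>lborel)"
    by (rule lborel_pair.Fubini') measurable
  also have "\<dots> = (\<integral>\<^sup>+ y. ennreal (Gamma ((1 - a) / 2)) * ennreal (indicator {0<..} y * (y powr ((1 + a) / 2 - 1) * exp (- (q\<^sup>2 * y)))) \<partial>lborel)"
  proof (intro nn_integral_cong)
    fix y :: real
    show "(\<integral>\<^sup>+ u. ennreal (indicator {0<..} u * (2 * u powr -a)) * ennreal (indicator {0<..} y * exp (- (y * (u\<^sup>2 + q\<^sup>2)))) \<partial>lborel)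
      = ennreal (Gamma ((1 - a) / 2)) * ennreal (indicator {0<..} y * (y powr ((1 + a) / 2 - 1) * exp (- (q\<^sup>2 * y))))"
    proof (cases "y > 0")
      case True
      have "(\<integral>\<^sup>+ u. ennreal (indicator {0<..} u * (2 * u powr -a)) * ennreal (indicator {0<..} y * exp (- (y * (u\<^sup>2 + q\<^sup>2)))) \<partial>lborel) =
         (\<integral>\<^sup>+ u. ennreal (exp (- (q\<^sup>2 * y))) * ennreal (indicator {0<..} u * (2 * u powr -a * exp (- (y * u\<^sup>2)))) \<partial>lborel)"
        using True by (intro nn_integral_cong) (auto simp: ring_distribs exp_add mult_ac exp_diff exp_minus field_simps simp flip: ennreal_mult')
      also have "\<dots> = ennreal (exp (- (q\<^sup>2 * y))) * ennreal (Gamma ((1 - a) / 2) / y powr ((1 - a) / 2))"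
        using nn_integral_powr_exp_square[of a y] a True by (subst nn_integral_cmult) auto
      also have "Gamma ((1 - a) / 2) / y powr ((1 - a) / 2) = Gamma ((1 - a) / 2) * y powr ((1 + a) / 2 - 1)"
      proof -
        have "(1 + a) / 2 - 1 = - ((1 - a) / 2)" by (simp add: field_simps)
        thus ?thesis by (simp only: powr_minus_divide) simp
      qed
      finally show ?thesis using True a by (simp add: Gamma_real_nonneg mult_ac flip: ennreal_mult')
    qed auto
  qed
  also have "\<dots> = ennreal (Gamma ((1 - a) / 2)) * ennreal (Gamma ((1 + a) / 2) / (q\<^sup>2) powr ((1 + a) / 2))"
    using nn_integral_powr_exp[of "(1 + a) / 2" "q\<^sup>2"] a q by (subst nn_integral_cmult) auto
  also have "\<dots> = ennreal (Gamma ((1 - a) / 2) * Gamma ((1 + a) / 2) / (q\<^sup>2) powr ((1 + a) / 2))"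
    using a by (simp add: Gamma_real_nonneg flip: ennreal_mult')
  also have "(q\<^sup>2) powr ((1 + a) / 2) = (q powr 2) powr ((1 + a) / 2)" using q by simp
  also have "\<dots> = q powr (1 + a)"
  proof -
    have "2 * ((1 + a) / 2) = 1 + a" by (simp add: field_simps)
    thus ?thesis by (simp only: powr_powr)
  qed
  also have "Gamma ((1 - a) / 2) * Gamma ((1 + a) / 2) = pi / cos (pi * a / 2)"
  proof -
    have "complex_of_real (Gamma ((1 - a) / 2) * Gamma ((1 + a) / 2)) =
          Gamma (complex_of_real ((1 - a) / 2)) * Gamma (1 - complex_of_real ((1 - a) / 2))"
    proof -
      have "1 - complex_of_real ((1 - a) / 2) = complex_of_real ((1 + a) / 2)" by (simp add: field_simps)
      thus ?thesis by (simp only: Gamma_complex_of_real of_real_mult)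
    qed
    also have "\<dots> = of_real pi / sin (of_real pi * complex_of_real ((1 - a) / 2))" by (rule Gamma_reflection_complex)
    also have "\<dots> = complex_of_real (pi / sin (pi * ((1 - a) / 2)))"
      by (simp only: sin_of_real of_real_mult [symmetric] of_real_divide [symmetric])
    also have "sin (pi * ((1 - a) / 2)) = cos (pi * a / 2)"
      by (simp add: sin_cos_eq algebra_simps diff_divide_distrib)
    finally show ?thesis by (simp only: of_real_eq_iff)
  qed
  also have "pi / cos (pi * a / 2) / q powr (1 + a) = pi / cos (pi * a / 2) * q powr (-a - 1)"
  proof -
    have "-a - 1 = - (1 + a)" by simp
    thus ?thesis by (simp only: powr_minus_divide) simp
  qed
  finally show ?thesis .
qed

section \<open>The functional equation on the real interval (-1, 0)\<close>

text \<open>Half the hyperbolic cotangent of u / 2 with its pole at 0 removed.\<close>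

definition coth_kernel :: "real \<Rightarrow> real" where "coth_kernel u = 1 / (exp u - 1) + 1/2 - 1/u"

lemma coth_kernel_sums: "u > 0 \<Longrightarrow> (\<lambda>m. 2 * u / (u\<^sup>2 + (2 * pi * real (Suc m))\<^sup>2)) sums coth_kernel u"
  using coth_partial_fraction[of u] unfolding coth_kernel_def by (simp add: power_mult_distrib)

lemma coth_kernel_nonneg: "u > 0 \<Longrightarrow> coth_kernel u \<ge> 0"
  using coth_kernel_sums sums_unique by (metis (no_types, lifting) suminf_nonneg sums_summable
     divide_nonneg_nonneg add_nonneg_nonneg zero_le_power2 mult_nonneg_nonneg less_imp_le zero_le_numeral)

lemma coth_kernel_le_half:
  assumes "u > 0"
  shows "coth_kernel u \<le> 1 / 2"
proof -
  have "u \<le> exp u - 1" using exp_ge_add_one_self[of u] by linarith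
  hence "1 / (exp u - 1) \<le> 1 / u" using assms by (intro divide_left_mono) auto
  thus ?thesis by (simp add: coth_kernel_def)
qed

text \<open>The partial fractions at 2 pi t, together with the bound 1/2 for the kernel. The size 1
  / t of this sum controls both the Digamma remainder and the decay of the bounded function f in the
  final formula.\<close>

lemma suminf_inverse_sum_squares:
  assumes t: "t > 0"
  shows "summable (\<lambda>n. 1 / ((real (Suc n))\<^sup>2 + t\<^sup>2))" "(\<Sum>n. 1 / ((real (Suc n))\<^sup>2 + t\<^sup>2)) \<le> pi / (2 * t)"
proof -
  have "(\<lambda>m. pi / t * (2 * (2 * pi * t) / ((2 * pi * t)\<^sup>2 + (2 * pi * real (Suc m))\<^sup>2))) sums (pi / t * coth_kernel (2 * pi * t))"
    using t by (intro sums_mult coth_kernel_sums) auto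
  moreover have "pi / t * (2 * (2 * pi * t) / ((2 * pi * t)\<^sup>2 + (2 * pi * real (Suc m))\<^sup>2)) = 1 / ((real (Suc m))\<^sup>2 + t\<^sup>2)" for m
  proof -
    define d where "d = (real (Suc m))\<^sup>2 + t\<^sup>2"
    have "(2 * pi * t)\<^sup>2 + (2 * pi * real (Suc m))\<^sup>2 = 4 * pi\<^sup>2 * d"
      by (simp add: d_def power2_eq_square algebra_simps)
    moreover have "d \<noteq> 0" using t by (simp add: d_def add_pos_pos less_imp_neq[symmetric])
    ultimately show ?thesis unfolding d_def [symmetric] using t by (simp add: power2_eq_square)
  qed
  ultimately have S: "(\<lambda>m. 1 / ((real (Suc m))\<^sup>2 + t\<^sup>2)) sums (pi / t * coth_kernel (2 * pi * t))" by simp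
  from S show "summable (\<lambda>n. 1 / ((real (Suc n))\<^sup>2 + t\<^sup>2))" by (rule sums_summable)
  have "(\<Sum>n. 1 / ((real (Suc n))\<^sup>2 + t\<^sup>2)) = pi / t * coth_kernel (2 * pi * t)" using S by (rule sums_unique [symmetric])
  also have "\<dots> \<le> pi / t * (1 / 2)" using t by (intro mult_left_mono coth_kernel_le_half) auto
  finally show "(\<Sum>n. 1 / ((real (Suc n))\<^sup>2 + t\<^sup>2)) \<le> pi / (2 * t)" by simp
qed

text \<open>The left side is the integral of 1 - exp (- x u) over [0, M + 1], the first bracket its
  trapezoid sum (the value at 0 being 0). Geometric summation makes the error an exact multiple of
  the kernel.\<close>

lemma trapezoid_one_minus_exp:
  fixes u :: real
  assumes u: "u > 0"
  shows "real (Suc M) - (1 - exp (- (real (Suc M) * u))) / u =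
     ((\<Sum>n=1..M. 1 - exp (- (real n * u))) + (1 - exp (- (real (Suc M) * u))) / 2) + (1 - exp (- (real (Suc M) * u))) * coth_kernel u"
proof -
  define r where "r = exp (- u)"
  have r: "r \<noteq> 1" "r > 0" using u by (auto simp: r_def)
  have pw: "exp (- (real n * u)) = r ^ n" for n
    by (simp add: r_def exp_of_nat_mult [symmetric] mult.commute)
  have k: "coth_kernel u = r / (1 - r) + 1/2 - 1/u"
  proof -
    have "exp u = 1 / r" by (simp add: r_def exp_minus field_simps)
    thus ?thesis using r unfolding coth_kernel_def by (simp only:) (simp add: field_simps)
  qed
  have geo: "(\<Sum>n=1..M. r ^ n) = (r - r ^ Suc M) / (1 - r)"
    using r by (simp add: sum_gp)
  have S: "(\<Sum>n=1..M. 1 - exp (- (real n * u))) = real M - (r - r ^ Suc M) / (1 - r)"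
    unfolding pw sum_subtractf geo by simp
  have "- ((r - r ^ Suc M) / (1 - r)) + (1 - r ^ Suc M) * (1 + r / (1 - r)) = 1"
    using r by (simp add: field_simps)
  moreover have "- Y + (1 - p) * (1 + X) = 1 \<Longrightarrow>
      m + 1 - (1 - p) * W = (m - Y + (1 - p) / 2) + (1 - p) * (X + 1/2 - W)" for p X Y W m :: real
    by (simp add: algebra_simps)
  ultimately have "real M + 1 - (1 - r ^ Suc M) * (1 / u) = (real M - (r - r ^ Suc M) / (1 - r) + (1 - r ^ Suc M) / 2)
      + (1 - r ^ Suc M) * (r / (1 - r) + 1/2 - 1/u)" by blast
  thus ?thesis unfolding S unfolding pw k by (simp add: add.commute)
qed

text \<open>Integrating the trapezoid identity against u^(-a-1) turns 1 - exp (- x u) into a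
  multiple of x^a and its integral into a multiple of x^(a+1). The Mellin integral of the kernel is
  thus the trapezoid error for the power x^a.\<close>

lemma coth_kernel_Mellin_trapezoid:
  fixes a :: real
  assumes a: "0 < a" "a < 1"
  shows "(\<integral>\<^sup>+ u. ennreal (indicator {0<..} u * ((1 - exp (- (real (Suc M) * u))) * coth_kernel u * u powr (-a - 1))) \<partial>lborel)
     = ennreal (Gamma (1 - a) / a * (real (Suc M) powr (a + 1) / (a + 1) - ((\<Sum>n=1..M. real n powr a) + real (Suc M) powr a / 2)))"
proof -
  define N where "N = real (Suc M)"
  have N: "N \<ge> 0" by (simp add: N_def)
  define A where "A = (\<integral>\<^sup>+ u. ennreal (indicator {0<..} u * ((1 - exp (- (N * u))) * coth_kernel u * u powr (-a - 1))) \<partial>lborel)"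
  have [measurable]: "coth_kernel \<in> borel_measurable borel" unfolding coth_kernel_def[abs_def] by measurable
  define h where "h x u = indicator {0<..} u * ((1 - exp (- (x * u))) * u powr (-a - 1))" for x u :: real
  have h: "(\<integral>\<^sup>+ u. ennreal (h x u) \<partial>lborel) = ennreal (Gamma (1 - a) * (x powr a / a))" if "x \<ge> 0" for x
    unfolding h_def by (rule nn_integral_one_minus_exp[OF a that])
  have hn: "h x u \<ge> 0" if "x \<ge> 0" for x u using that by (auto simp: h_def indicator_def)
  have [measurable]: "h x \<in> borel_measurable borel" for x unfolding h_def[abs_def] by measurable
  define T where "T = (\<Sum>n=1..M. real n powr a) + N powr a / 2"
  have G: "Gamma (1 - a) \<ge> 0" using a by (intro Gamma_real_nonneg) auto
  have "ennreal (Gamma (1 - a) * (N powr (a + 1) / (a * (a + 1)))) =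
    (\<integral>\<^sup>+ u. ennreal (indicator {0<..} u * ((N - (1 - exp (- (N * u))) / u) * u powr (-a - 1))) \<partial>lborel)"
    by (rule nn_integral_one_minus_exp_integrated [symmetric]) (use a N in auto)
  also have "\<dots> = (\<integral>\<^sup>+ u. ((\<Sum>n=1..M. ennreal (h (real n) u)) + ennreal (1/2) * ennreal (h N u)) +
       ennreal (indicator {0<..} u * ((1 - exp (- (N * u))) * coth_kernel u * u powr (-a - 1))) \<partial>lborel)"
  proof (intro nn_integral_cong)
    fix u :: real
    show "ennreal (indicator {0<..} u * ((N - (1 - exp (- (N * u))) / u) * u powr (-a - 1))) =
      ((\<Sum>n=1..M. ennreal (h (real n) u)) + ennreal (1/2) * ennreal (h N u)) +
       ennreal (indicator {0<..} u * ((1 - exp (- (N * u))) * coth_kernel u * u powr (-a - 1)))"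
    proof (cases "u > 0")
      case True
      let ?p = "u powr (-a - 1)"
      have "(\<Sum>n=1..M. ennreal (h (real n) u)) + ennreal (1/2) * ennreal (h N u) = ennreal ((\<Sum>n=1..M. h (real n) u) + 1/2 * h N u)"
      proof -
        have "(\<Sum>n=1..M. ennreal (h (real n) u)) = ennreal (\<Sum>n=1..M. h (real n) u)"
          by (rule sum_ennreal) (auto intro: hn)
        moreover have "ennreal (1/2) * ennreal (h N u) = ennreal (1/2 * h N u)"
          by (rule ennreal_mult'[symmetric]) auto
        moreover have "ennreal (\<Sum>n=1..M. h (real n) u) + ennreal (1/2 * h N u) = ennreal ((\<Sum>n=1..M. h (real n) u) + 1/2 * h N u)"
          using hn[OF N, of u] N by (intro ennreal_plus[symmetric] sum_nonneg hn mult_nonneg_nonneg) auto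
        ultimately show ?thesis by (simp only:)
      qed
      also have "(\<Sum>n=1..M. h (real n) u) + 1/2 * h N u = ((\<Sum>n=1..M. 1 - exp (- (real n * u))) + (1 - exp (- (N * u))) / 2) * ?p"
      proof -
        have "(\<Sum>n=1..M. h (real n) u) = (\<Sum>n=1..M. 1 - exp (- (real n * u))) * ?p" "h N u = (1 - exp (- (N * u))) * ?p"
          using True by (simp_all add: h_def sum_distrib_right)
        thus ?thesis by (simp only: distrib_right)
      qed
      finally have *: "(\<Sum>n=1..M. ennreal (h (real n) u)) + ennreal (1/2) * ennreal (h N u) = ennreal (((\<Sum>n=1..M. 1 - exp (- (real n * u))) + (1 - exp (- (N * u))) / 2) * ?p)" .
      have eN: "1 - exp (- (x * u)) \<ge> 0" if "x \<ge> 0" for x using True that by simp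
      have "(N - (1 - exp (- (N * u))) / u) * ?p = ((\<Sum>n=1..M. 1 - exp (- (real n * u))) + (1 - exp (- (N * u))) / 2) * ?p
          + (1 - exp (- (N * u))) * coth_kernel u * ?p"
        unfolding N_def trapezoid_one_minus_exp[OF True] by (simp add: algebra_simps)
      also have "ennreal \<dots> = ennreal (((\<Sum>n=1..M. 1 - exp (- (real n * u))) + (1 - exp (- (N * u))) / 2) * ?p)
          + ennreal ((1 - exp (- (N * u))) * coth_kernel u * ?p)"
        using eN N coth_kernel_nonneg[OF True]
        by (intro ennreal_plus mult_nonneg_nonneg add_nonneg_nonneg sum_nonneg divide_nonneg_nonneg) auto
      finally show ?thesis unfolding * using True by simp
    qed (auto simp: h_def)
  qed
  also have "\<dots> = ((\<Sum>n=1..M. (\<integral>\<^sup>+ u. ennreal (h (real n) u) \<partial>lborel)) + ennreal (1/2) * (\<integral>\<^sup>+ u. ennreal (h N u) \<partial>lborel)) + A"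
    unfolding A_def by (simp add: nn_integral_add nn_integral_sum nn_integral_cmult)
  also have "(\<Sum>n=1..M. (\<integral>\<^sup>+ u. ennreal (h (real n) u) \<partial>lborel)) + ennreal (1/2) * (\<integral>\<^sup>+ u. ennreal (h N u) \<partial>lborel)
     = ennreal (Gamma (1 - a) / a * T)"
  proof -
    let ?c = "Gamma (1 - a) / a"
    have c: "?c \<ge> 0" using G a by simp
    have "(\<Sum>n=1..M. (\<integral>\<^sup>+ u. ennreal (h (real n) u) \<partial>lborel)) = (\<Sum>n=1..M. ennreal (?c * real n powr a))"
      by (intro sum.cong refl) (simp add: h)
    also have "\<dots> = ennreal (\<Sum>n=1..M. ?c * real n powr a)"
      using c by (intro sum_ennreal mult_nonneg_nonneg) auto
    finally have 1: "(\<Sum>n=1..M. (\<integral>\<^sup>+ u. ennreal (h (real n) u) \<partial>lborel)) = ennreal (\<Sum>n=1..M. ?c * real n powr a)" .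
    have "ennreal (1/2) * ennreal (Gamma (1 - a) * (N powr a / a)) = ennreal (1/2 * (Gamma (1 - a) * (N powr a / a)))"
      by (rule ennreal_mult'[symmetric]) simp
    moreover have "1/2 * (Gamma (1 - a) * (N powr a / a)) = ?c * (N powr a / 2)" by simp
    ultimately have 2: "ennreal (1/2) * (\<integral>\<^sup>+ u. ennreal (h N u) \<partial>lborel) = ennreal (?c * (N powr a / 2))"
      unfolding h[OF N] by (simp only:)
    have "ennreal (\<Sum>n=1..M. ?c * real n powr a) + ennreal (?c * (N powr a / 2)) =
        ennreal ((\<Sum>n=1..M. ?c * real n powr a) + ?c * (N powr a / 2))"
      using c by (intro ennreal_plus[symmetric] sum_nonneg mult_nonneg_nonneg) auto
    also have "(\<Sum>n=1..M. ?c * real n powr a) + ?c * (N powr a / 2) = ?c * T"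
      by (simp only: T_def sum_distrib_left distrib_left)
    finally show ?thesis unfolding 1 2 .
  qed
  finally have *: "ennreal (Gamma (1 - a) * (N powr (a + 1) / (a * (a + 1)))) = ennreal (Gamma (1 - a) / a * T) + A" .
  have "T \<ge> 0" by (auto simp: T_def intro!: add_nonneg_nonneg sum_nonneg)
  hence T: "Gamma (1 - a) / a * T \<ge> 0" using G a by auto
  \<comment> \<open>Cancellation in the extended nonnegative reals is legitimate because the
    trapezoid part is finite.\<close>
  have "A = (A + ennreal (Gamma (1 - a) / a * T)) - ennreal (Gamma (1 - a) / a * T)" by simp
  also have "A + ennreal (Gamma (1 - a) / a * T) = ennreal (Gamma (1 - a) * (N powr (a + 1) / (a * (a + 1))))"
    using * by (simp add: add.commute)
  also have "\<dots> - ennreal (Gamma (1 - a) / a * T) = ennreal (Gamma (1 - a) * (N powr (a + 1) / (a * (a + 1))) - Gamma (1 - a) / a * T)"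
    using T by (rule ennreal_minus)
  also have "Gamma (1 - a) * (N powr (a + 1) / (a * (a + 1))) - Gamma (1 - a) / a * T = Gamma (1 - a) / a * (N powr (a + 1) / (a + 1) - T)"
    by (simp add: right_diff_distrib)
  finally show ?thesis unfolding A_def T_def N_def .
qed

text \<open>The Mellin integral \<open>A\<close> of the kernel is computed twice. As a monotone
  limit of trapezoid errors it gives \<open>xi0\<close> at -a; with the kernel expanded in partial
  fractions it gives the Dirichlet series at 1 + a.\<close>

lemma xi0_functional_equation_real:
  fixes a :: real
  assumes a: "0 < a" "a < 1"
  shows "xi0 (of_real (-a)) = of_real ((a + 1) / Gamma (1 - a) * (2 * pi) powr (-a - 1) * pi / cos (pi * a / 2)) * xi0 (of_real (1 + a))"
proof -
  define c where "c = Gamma (1 - a) / a"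
  have c: "c > 0" using a by (auto simp: c_def)
  have "0 < pi * a" "pi * a < pi * 1" using a by (auto intro!: mult_strict_left_mono)
  hence cos: "cos (pi * a / 2) > 0" by (intro cos_gt_zero_pi) (use pi_gt_zero in linarith)+
  have [measurable]: "coth_kernel \<in> borel_measurable borel" unfolding coth_kernel_def[abs_def] by measurable
  define A where "A = (\<integral>\<^sup>+ u. ennreal (indicator {0<..} u * (coth_kernel u * u powr (-a - 1))) \<partial>lborel)"
  define S where "S = (\<lambda>N. N powr (a + 1) / (a + 1) :: real)"
  \<comment> \<open>The trapezoid error for x^a on [0, N]. Multiplied by a + 1 it is the sequence
    converging to \<open>xi0\<close> at s = -a.\<close>
  define R where "R N = real N powr (a + 1) / (a + 1) - ((\<Sum>n=1..N. real n powr a) - real N powr a / 2)" for N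
  have pw: "of_nat n powr - complex_of_real (- a) = of_real (real n powr a)"
           "of_nat n powr (1 - complex_of_real (- a)) = of_real (real n powr (a + 1))" for n
    using powr_of_real[of "real n" a] powr_of_real[of "real n" "a + 1"] by (simp_all add: add.commute)
  have "(\<lambda>N. (of_real (-a) - 1) * ((\<Sum>n=1..N. of_nat n powr -of_real (-a)) - of_nat N powr -of_real (-a) / 2) + of_nat N powr (1 - of_real (-a)))
           \<longlonglongrightarrow> xi0 (of_real (-a))"
    using a by (intro xi0_LIMSEQ) auto
  also have "(\<lambda>N. (of_real (-a) - 1) * ((\<Sum>n=1..N. of_nat n powr -of_real (-a)) - of_nat N powr -of_real (-a) / 2) + of_nat N powr (1 - of_real (-a)))
     = (\<lambda>N. complex_of_real ((a + 1) * R N))"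
  proof
    fix N
    have *: "(a + 1) * R N = real N powr (a + 1) - (a + 1) * ((\<Sum>n=1..N. real n powr a) - real N powr a / 2)"
      using a by (simp add: R_def right_diff_distrib)
    show "(of_real (-a) - 1) * ((\<Sum>n=1..N. of_nat n powr -of_real (-a)) - of_nat N powr -of_real (-a) / 2) + of_nat N powr (1 - of_real (-a))
     = complex_of_real ((a + 1) * R N)" unfolding pw * by (simp add: algebra_simps add_divide_distrib diff_divide_distrib)
  qed
  finally have lim: "(\<lambda>N. complex_of_real ((a + 1) * R N)) \<longlonglongrightarrow> xi0 (of_real (-a))" .
  define x where "x = Re (xi0 (of_real (-a)))"
  have "(\<lambda>N. Im (complex_of_real ((a + 1) * R N))) \<longlonglongrightarrow> Im (xi0 (of_real (-a)))"
    using lim by (rule tendsto_Im)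
  hence "(\<lambda>N::nat. 0) \<longlonglongrightarrow> Im (xi0 (of_real (-a)))" by simp
  hence "Im (xi0 (of_real (-a))) = 0" by (simp only: LIMSEQ_const_iff)
  hence xi_eq: "xi0 (of_real (-a)) = of_real x" by (simp only: x_def complex_eq_iff Re_complex_of_real Im_complex_of_real)
  have "(\<lambda>N. Re (complex_of_real ((a + 1) * R N))) \<longlonglongrightarrow> x"
    unfolding x_def using lim by (rule tendsto_Re)
  hence "(\<lambda>N. (a + 1) * R N) \<longlonglongrightarrow> x" by simp
  from tendsto_mult[OF tendsto_const[of "c / (a + 1)"] this]
  have "(\<lambda>N. c / (a + 1) * ((a + 1) * R N)) \<longlonglongrightarrow> c / (a + 1) * x" .
  moreover have "c / (a + 1) * ((a + 1) * R N) = c * R N" for N using a by simp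
  ultimately have "(\<lambda>N. c * R N) \<longlonglongrightarrow> c / (a + 1) * x" by (simp only:)
  from tendsto_ennrealI[OF LIMSEQ_Suc[OF this]]
  have "(\<lambda>N. ennreal (c * R (Suc N))) \<longlonglongrightarrow> ennreal (c / (a + 1) * x)" .
  moreover have "(\<lambda>N. ennreal (c * R (Suc N))) \<longlonglongrightarrow> A"
  proof -
    have "(\<lambda>M. \<integral>\<^sup>+ u. ennreal (indicator {0<..} u * ((1 - exp (- (real (Suc M) * u))) * coth_kernel u * u powr (-a - 1))) \<partial>lborel) \<longlonglongrightarrow> A"
      unfolding A_def
    proof (rule nn_integral_LIMSEQ)
      show "incseq (\<lambda>M u. ennreal (indicator {0<..} u * ((1 - exp (- (real (Suc M) * u))) * coth_kernel u * u powr (-a - 1))))"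
      proof (intro incseq_SucI le_funI ennreal_leI)
        fix M and u :: real
        show "indicator {0<..} u * ((1 - exp (- (real (Suc M) * u))) * coth_kernel u * u powr (-a - 1))
          \<le> indicator {0<..} u * ((1 - exp (- (real (Suc (Suc M)) * u))) * coth_kernel u * u powr (-a - 1))"
        proof (cases "u > 0")
          case True
          hence "real (Suc M) * u \<le> real (Suc (Suc M)) * u" by (intro mult_right_mono) auto
          hence "1 - exp (- (real (Suc M) * u)) \<le> 1 - exp (- (real (Suc (Suc M)) * u))" by simp
          thus ?thesis using coth_kernel_nonneg[OF True] by (intro mult_left_mono mult_right_mono) auto
        qed simp
      qed
      show "(\<lambda>M. ennreal (indicator {0<..} u * ((1 - exp (- (real (Suc M) * u))) * coth_kernel u * u powr (-a - 1)))) \<longlonglongrightarrow>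
          ennreal (indicator {0<..} u * (coth_kernel u * u powr (-a - 1)))" for u
      proof (cases "u > 0")
        case True
        have "(\<lambda>M. exp (- u) ^ Suc M) \<longlonglongrightarrow> 0"
          using True by (intro LIMSEQ_Suc[OF LIMSEQ_realpow_zero]) auto
        hence "(\<lambda>M. exp (- (real (Suc M) * u))) \<longlonglongrightarrow> 0"
          unfolding exp_of_nat_mult [symmetric] by (simp only: mult_minus_right)
        from tendsto_diff[OF tendsto_const[of 1] this]
        have "(\<lambda>M. (1 - exp (- (real (Suc M) * u))) * coth_kernel u * u powr (-a - 1)) \<longlonglongrightarrow> (1 - 0) * coth_kernel u * u powr (-a - 1)"
          by (intro tendsto_mult tendsto_const)
        thus ?thesis using True by (intro tendsto_ennrealI) simp
      qed auto
    qed measurable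
    also have "(\<lambda>M. \<integral>\<^sup>+ u. ennreal (indicator {0<..} u * ((1 - exp (- (real (Suc M) * u))) * coth_kernel u * u powr (-a - 1))) \<partial>lborel) = (\<lambda>M. ennreal (c * R (Suc M)))"
    proof
      fix M
      have "{1..Suc M} = insert (Suc M) {1..M}" by auto
      hence "R (Suc M) = real (Suc M) powr (a + 1) / (a + 1) - ((\<Sum>n=1..M. real n powr a) + real (Suc M) powr a / 2)"
        unfolding R_def by simp
      thus "(\<integral>\<^sup>+ u. ennreal (indicator {0<..} u * ((1 - exp (- (real (Suc M) * u))) * coth_kernel u * u powr (-a - 1))) \<partial>lborel) = ennreal (c * R (Suc M))"
        unfolding coth_kernel_Mellin_trapezoid[OF a] c_def by simp
    qed
    finally show ?thesis .
  qed
  ultimately have A1: "A = ennreal (c / (a + 1) * x)" using LIMSEQ_unique by blast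
  define Z where "Z = (\<Sum>m. real (Suc m) powr (-a - 1))"
  have "summable (\<lambda>m. real m powr (-a - 1))" using a by (subst summable_real_powr_iff) auto
  hence sumZ: "summable (\<lambda>m. real (Suc m) powr (-a - 1))" by (subst summable_Suc_iff)
  have A2: "A = ennreal (pi / cos (pi * a / 2) * (2 * pi) powr (-a - 1) * Z)"
  proof -
    have "A = (\<integral>\<^sup>+ u. (\<Sum>m. ennreal (indicator {0<..} u * (2 * u powr -a / (u\<^sup>2 + (2 * pi * real (Suc m))\<^sup>2)))) \<partial>lborel)"
      unfolding A_def
    proof (intro nn_integral_cong)
      fix u :: real
      show "ennreal (indicator {0<..} u * (coth_kernel u * u powr (-a - 1))) =
            (\<Sum>m. ennreal (indicator {0<..} u * (2 * u powr -a / (u\<^sup>2 + (2 * pi * real (Suc m))\<^sup>2))))"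
      proof (cases "u > 0")
        case True
        have "(\<lambda>m. 2 * u / (u\<^sup>2 + (2 * pi * real (Suc m))\<^sup>2) * u powr (-a - 1)) sums (coth_kernel u * u powr (-a - 1))"
          by (intro sums_mult2 coth_kernel_sums True)
        also have "(\<lambda>m. 2 * u / (u\<^sup>2 + (2 * pi * real (Suc m))\<^sup>2) * u powr (-a - 1)) = (\<lambda>m. 2 * u powr -a / (u\<^sup>2 + (2 * pi * real (Suc m))\<^sup>2))"
          using True by (simp add: powr_diff)
        finally have s: "(\<lambda>m. 2 * u powr -a / (u\<^sup>2 + (2 * pi * real (Suc m))\<^sup>2)) sums (coth_kernel u * u powr (-a - 1))" .
        have "(\<Sum>m. ennreal (2 * u powr -a / (u\<^sup>2 + (2 * pi * real (Suc m))\<^sup>2))) = ennreal (\<Sum>m. 2 * u powr -a / (u\<^sup>2 + (2 * pi * real (Suc m))\<^sup>2))"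
          by (rule suminf_ennreal2[OF _ sums_summable[OF s]]) auto
        also have "\<dots> = ennreal (coth_kernel u * u powr (-a - 1))" by (simp only: sums_unique[OF s])
        finally show ?thesis using True by simp
      qed auto
    qed
    also have "\<dots> = (\<Sum>m. \<integral>\<^sup>+ u. ennreal (indicator {0<..} u * (2 * u powr -a / (u\<^sup>2 + (2 * pi * real (Suc m))\<^sup>2))) \<partial>lborel)"
      by (rule nn_integral_suminf) measurable
    also have "\<dots> = (\<Sum>m. ennreal (pi / cos (pi * a / 2) * (2 * pi) powr (-a - 1) * real (Suc m) powr (-a - 1)))"
    proof (intro suminf_cong)
      fix m
      show "(\<integral>\<^sup>+ u. ennreal (indicator {0<..} u * (2 * u powr -a / (u\<^sup>2 + (2 * pi * real (Suc m))\<^sup>2))) \<partial>lborel)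
          = ennreal (pi / cos (pi * a / 2) * (2 * pi) powr (-a - 1) * real (Suc m) powr (-a - 1))"
      proof -
        have q: "2 * pi * real (Suc m) > 0" and a': "-1 < a" using a by auto
        have "(2 * pi * real (Suc m)) powr (-a - 1) = (2 * pi) powr (-a - 1) * real (Suc m) powr (-a - 1)"
          by (rule powr_mult)
        thus ?thesis unfolding nn_integral_Mellin_kernel[OF a' a(2) q] by (simp only: mult.assoc)
      qed
    qed
    also have "\<dots> = ennreal (\<Sum>m. pi / cos (pi * a / 2) * (2 * pi) powr (-a - 1) * real (Suc m) powr (-a - 1))"
      by (rule suminf_ennreal2[OF _ summable_mult[OF sumZ]]) (use cos in auto)
    also have "(\<Sum>m. pi / cos (pi * a / 2) * (2 * pi) powr (-a - 1) * real (Suc m) powr (-a - 1)) = pi / cos (pi * a / 2) * (2 * pi) powr (-a - 1) * Z"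
      unfolding Z_def by (rule suminf_mult[OF sumZ])
    finally show ?thesis .
  qed
  have "Z > 0" unfolding Z_def by (intro suminf_pos sumZ) auto
  hence pos: "pi / cos (pi * a / 2) * (2 * pi) powr (-a - 1) * Z > 0" using cos by simp
  have "c / (a + 1) * x = pi / cos (pi * a / 2) * (2 * pi) powr (-a - 1) * Z"
  \<comment> \<open>Embedding a negative real gives 0, so equality of embedded values does not yet
    settle the sign; positivity of \<open>A\<close> does.\<close>
  proof (cases "c / (a + 1) * x \<ge> 0")
    case True
    thus ?thesis using A1 A2 pos by (simp add: ennreal_inj)
  next
    case False
    hence "A = 0" using A1 by (simp add: ennreal_neg)
    thus ?thesis using A2 pos by (simp add: ennreal_eq_0_iff)
  qed
  hence x_eq: "x = (a + 1) / Gamma (1 - a) * (2 * pi) powr (-a - 1) * pi / cos (pi * a / 2) * (a * Z)"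
  proof -
    define K where "K = pi / cos (pi * a / 2) * (2 * pi) powr (-a - 1) * Z"
    assume "c / (a + 1) * x = pi / cos (pi * a / 2) * (2 * pi) powr (-a - 1) * Z"
    hence "c / (a + 1) * x = K" by (simp only: K_def)
    hence "x = (a + 1) / c * K" using c a by (simp add: field_simps)
    thus ?thesis by (simp add: K_def c_def)
  qed
  have "xi0 (of_real (1 + a)) = of_real (a * Z)"
  proof -
    have "(\<lambda>n. 1 / of_nat (Suc n) powr complex_of_real (1 + a)) sums (xi0 (of_real (1 + a)) / (of_real (1 + a) - 1))"
      using a by (intro xi0_sums) auto
    also have "(\<lambda>n. 1 / of_nat (Suc n) powr complex_of_real (1 + a)) = (\<lambda>n. complex_of_real (real (Suc n) powr (- a - 1)))"
    proof
      fix n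
      have "of_nat (Suc n) powr complex_of_real (1 + a) = of_real (real (Suc n) powr (1 + a))"
        using powr_of_real[of "real (Suc n)" "1 + a"] by simp
      thus "1 / of_nat (Suc n) powr complex_of_real (1 + a) = complex_of_real (real (Suc n) powr (- a - 1))"
      proof -
        assume *: "of_nat (Suc n) powr complex_of_real (1 + a) = of_real (real (Suc n) powr (1 + a))"
        have "-a - 1 = - (1 + a)" by simp
        hence "real (Suc n) powr (- a - 1) = 1 / real (Suc n) powr (1 + a)" by (simp only: powr_minus_divide)
        thus ?thesis unfolding * by (simp only: of_real_divide of_real_1)
      qed
    qed
    finally have "(\<lambda>n. complex_of_real (real (Suc n) powr (- a - 1))) sums (xi0 (of_real (1 + a)) / (of_real (1 + a) - 1))" .
    moreover have "(\<lambda>n. complex_of_real (real (Suc n) powr (- a - 1))) sums of_real Z"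
      unfolding Z_def by (intro sums_of_real summable_sums sumZ)
    ultimately have "xi0 (of_real (1 + a)) / (of_real (1 + a) - 1) = of_real Z" by (rule sums_unique2)
    thus ?thesis using a by (simp add: field_simps)
  qed
  thus ?thesis unfolding xi_eq x_eq by (simp only: of_real_mult)
qed

section \<open>The functional equation in complex form\<close>

text \<open>The factor of the functional equation without its sine. What is left is holomorphic and
  zero-free for Re s < 1, so the sine alone carries the trivial zeros.\<close>

definition zeta_factor :: "complex \<Rightarrow> complex" where
  "zeta_factor s = 2 * (2 * of_real pi) powr (s - 1) * Gamma (1 - s)"

lemma one_minus_notin_nonpos_Ints: "Re s < 1 \<Longrightarrow> 1 - s \<notin> \<int>\<^sub>\<le>\<^sub>0"
  by (auto elim!: nonpos_Ints_cases simp: complex_eq_iff)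

lemma holomorphic_zeta_factor: "zeta_factor holomorphic_on {s. Re s < 1}"
  unfolding zeta_factor_def using one_minus_notin_nonpos_Ints by (intro holomorphic_intros) auto

lemma zeta_factor_nonzero: "Re s < 1 \<Longrightarrow> zeta_factor s \<noteq> 0"
  using one_minus_notin_nonpos_Ints[of s] by (simp add: zeta_factor_def Gamma_eq_zero_iff)

text \<open>Gamma reflection and the double-angle formula convert the cosine in the denominator into
  the sine that remains holomorphic for complex s.\<close>

lemma xi0_functional_equation_real':
  assumes a: "0 < a" "a < 1" and s: "s = complex_of_real (-a)"
  shows "xi0 s / (s - 1) = zeta_factor s * sin (of_real pi * s / 2) * (xi0 (1 - s) / (- s))"
proof -
  have "0 < pi * a" "pi * a < pi * 1" using a by (auto intro!: mult_strict_left_mono)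
  hence cos: "cos (pi * a / 2) > 0" by (intro cos_gt_zero_pi) (use pi_gt_zero in linarith)+
  have sn: "sin (pi * a) > 0" using \<open>0 < pi * a\<close> \<open>pi * a < pi * 1\<close> by (intro sin_gt_zero) auto
  have G: "Gamma (1 - a) > 0" using a by auto
  have refl: "Gamma a * Gamma (1 - a) = pi / sin (pi * a)"
  proof -
    have "complex_of_real (Gamma a * Gamma (1 - a)) = Gamma (of_real a) * Gamma (1 - of_real a)"
      using Gamma_complex_of_real[of a] Gamma_complex_of_real[of "1 - a"] by simp
    also have "\<dots> = of_real pi / sin (of_real pi * of_real a)" by (rule Gamma_reflection_complex)
    also have "\<dots> = complex_of_real (pi / sin (pi * a))"
      by (simp only: sin_of_real of_real_mult [symmetric] of_real_divide [symmetric])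
    finally show ?thesis by (simp only: of_real_eq_iff)
  qed
  have G1: "Gamma (1 + a) = a * Gamma a" 
  proof -
    have "a \<notin> \<int>\<^sub>\<le>\<^sub>0" using a by (auto elim!: nonpos_Ints_cases)
    thus ?thesis using Gamma_plus1[of a] by (simp add: add.commute)
  qed
  have dbl: "sin (pi * a) = 2 * sin (pi * a / 2) * cos (pi * a / 2)" using sin_double[of "pi * a / 2"] by simp
  have "2 * Gamma (1 + a) * sin (pi * a / 2) / a = pi / (Gamma (1 - a) * cos (pi * a / 2))"
  proof -
    have ne: "Gamma (1 - a) \<noteq> 0" "cos (pi * a / 2) \<noteq> 0" "sin (pi * a / 2) \<noteq> 0" using G cos sn dbl by auto
    have "Gamma a = Gamma a * Gamma (1 - a) / Gamma (1 - a)" using ne(1) by simp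
    also have "\<dots> = pi / sin (pi * a) / Gamma (1 - a)" by (simp only: refl)
    also have "\<dots> = pi / (2 * sin (pi * a / 2) * cos (pi * a / 2) * Gamma (1 - a))" by (simp add: dbl)
    finally have "2 * Gamma (1 + a) * sin (pi * a / 2) / a =
        2 * (pi / (2 * sin (pi * a / 2) * cos (pi * a / 2) * Gamma (1 - a))) * sin (pi * a / 2)"
      unfolding G1 using a by simp
    also have "\<dots> = pi / (Gamma (1 - a) * cos (pi * a / 2))" using ne by simp
    finally show ?thesis .
  qed
  note key = this
  have h: "(a + 1) / (- a - 1) = -1" using a by (simp add: field_simps)
  have eq: "(a + 1) / Gamma (1 - a) * (2 * pi) powr (-a - 1) * pi / cos (pi * a / 2) / (- a - 1)
     = 2 * (2 * pi) powr (-a - 1) * Gamma (1 + a) * sin (- (pi * a / 2)) / a"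
  proof -
    have "(a + 1) / Gamma (1 - a) * (2 * pi) powr (-a - 1) * pi / cos (pi * a / 2) / (- a - 1) =
        (a + 1) / (- a - 1) * ((2 * pi) powr (-a - 1) * (pi / (Gamma (1 - a) * cos (pi * a / 2))))" by (simp add: mult_ac)
    also have "\<dots> = - ((2 * pi) powr (-a - 1) * (2 * Gamma (1 + a) * sin (pi * a / 2) / a))" unfolding h key by simp
    also have "\<dots> = 2 * (2 * pi) powr (-a - 1) * Gamma (1 + a) * sin (- (pi * a / 2)) / a" by simp
    finally show ?thesis .
  qed
  have "(2 * complex_of_real pi) powr (s - 1) = of_real ((2 * pi) powr (-a - 1))"
    using powr_of_real[of "2 * pi" "-a - 1"] by (simp add: s)
  moreover have "Gamma (1 - s) = of_real (Gamma (1 + a))"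
    using Gamma_complex_of_real[of "1 + a"] by (simp add: s)
  moreover have "sin (of_real pi * s / 2) = of_real (sin (- (pi * a / 2)))"
  proof -
    have "of_real pi * s / 2 = complex_of_real (- (pi * a / 2))" by (simp add: s)
    thus ?thesis by (simp only: sin_of_real)
  qed
  moreover have "xi0 s = of_real ((a + 1) / Gamma (1 - a) * (2 * pi) powr (-a - 1) * pi / cos (pi * a / 2)) * xi0 (1 - s)"
    using xi0_functional_equation_real[OF a] by (simp add: s)
  moreover have "s - 1 = of_real (- a - 1)" "- s = of_real a" by (simp_all add: s)
  ultimately have "xi0 s / (s - 1) = of_real ((a + 1) / Gamma (1 - a) * (2 * pi) powr (-a - 1) * pi / cos (pi * a / 2) / (- a - 1)) * xi0 (1 - s)"
    "zeta_factor s * sin (of_real pi * s / 2) * (xi0 (1 - s) / (- s)) = of_real (2 * (2 * pi) powr (-a - 1) * Gamma (1 + a) * sin (- (pi * a / 2)) / a) * xi0 (1 - s)"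
    unfolding zeta_factor_def by (simp_all only: of_real_mult of_real_divide of_real_numeral) (simp_all add: algebra_simps)
  thus ?thesis by (simp only: eq)
qed

text \<open>Identity theorem: the real points of the strip accumulate at -1/2.\<close>

lemma xi0_functional_equation_strip:
  assumes s: "-1 < Re s" "Re s < 0"
  shows "xi0 s / (s - 1) = zeta_factor s * sin (of_real pi * s / 2) * (xi0 (1 - s) / (- s))"
proof -
  define S where "S = {s. -1 < Re s} \<inter> {s. Re s < 0}"
  have S: "open S" "connected S"
    unfolding S_def by (auto intro!: open_Int open_halfspace_Re_gt open_halfspace_Re_lt
        convex_connected convex_Int convex_halfspace_Re_gt convex_halfspace_Re_lt)
  have x: "xi0 holomorphic_on S" using holomorphic_xi0 by (rule holomorphic_on_subset) (auto simp: S_def)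
  have x': "(\<lambda>s. xi0 (1 - s)) holomorphic_on S"
    by (rule holomorphic_on_compose_gen[OF _ holomorphic_xi0, unfolded o_def]) (auto intro!: holomorphic_intros simp: S_def)
  have f: "zeta_factor holomorphic_on S" using holomorphic_zeta_factor by (rule holomorphic_on_subset) (auto simp: S_def)
  have "xi0 s / (s - 1) - zeta_factor s * sin (of_real pi * s / 2) * (xi0 (1 - s) / (- s)) = 0"
  proof (rule analytic_continuation[where S = S and \<xi> = "-1/2" and U = "(\<lambda>a. complex_of_real (-a)) ` {0<..<1}"
      and f = "\<lambda>s. xi0 s / (s - 1) - zeta_factor s * sin (of_real pi * s / 2) * (xi0 (1 - s) / (- s))"])
    show "(\<lambda>s. xi0 s / (s - 1) - zeta_factor s * sin (of_real pi * s / 2) * (xi0 (1 - s) / (- s))) holomorphic_on S"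
      by (intro holomorphic_intros x x' f) (auto simp: S_def)
    show "(-1/2 :: complex) islimpt (\<lambda>a. complex_of_real (-a)) ` {0<..<1}"
      unfolding islimpt_approachable
    proof (intro allI impI)
      fix e :: real assume e: "e > 0"
      define a where "a = 1/2 + min (e/2) (1/4)"
      have "dist (complex_of_real (-a)) (-1/2) = norm (complex_of_real (- a + 1/2))" by (simp add: dist_norm)
      also have "\<dots> = \<bar>- a + 1/2\<bar>" by (rule norm_of_real)
      also have "\<dots> < e" using e by (auto simp: a_def)
      finally have "dist (complex_of_real (-a)) (-1/2) < e" .
      moreover have "complex_of_real (-a) \<noteq> -1/2" using e by (auto simp: complex_eq_iff a_def)
      moreover have "a \<in> {0<..<1}" using e by (auto simp: a_def)
      ultimately show "\<exists>x'\<in>(\<lambda>a. complex_of_real (-a)) ` {0<..<1}. x' \<noteq> -1/2 \<and> dist x' (-1/2) < e" by blast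
    qed
    fix z assume "z \<in> (\<lambda>a. complex_of_real (-a)) ` {0<..<1}"
    then obtain a where "z = of_real (-a)" "0 < a" "a < 1" by auto
    thus "xi0 z / (z - 1) - zeta_factor z * sin (of_real pi * z / 2) * (xi0 (1 - z) / (- z)) = 0"
      using xi0_functional_equation_real'[of a z] by simp
  qed (use s S in \<open>auto simp: S_def\<close>)
  thus ?thesis by (rule iffD1[OF right_minus_eq])
qed

text \<open>The two formulas agree on the strip -1 < Re s < 0, so the boundary Re s = -1 between the
  cases is harmless and holomorphy can be checked on two overlapping open sets.\<close>

definition zeta_cont :: "complex \<Rightarrow> complex" where
  "zeta_cont s = (if s = 1 then 0 else if Re s > -1 then xi0 s / (s - 1)
     else zeta_factor s * sin (of_real pi * s / 2) * (xi0 (1 - s) / (- s)))"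

lemma holomorphic_zeta_cont: "zeta_cont holomorphic_on (- {1})"
proof -
  have 1: "zeta_cont holomorphic_on ({s. Re s > -1} - {1})"
  proof (rule holomorphic_transform)
    show "(\<lambda>s. xi0 s / (s - 1)) holomorphic_on ({s. Re s > -1} - {1})"
      by (intro holomorphic_intros holomorphic_on_subset[OF holomorphic_xi0]) auto
  qed (auto simp: zeta_cont_def)
  have 2: "zeta_cont holomorphic_on {s. Re s < 0}"
  proof (rule holomorphic_transform)
    show "(\<lambda>s. zeta_factor s * sin (of_real pi * s / 2) * (xi0 (1 - s) / (- s))) holomorphic_on {s. Re s < 0}"
      by (intro holomorphic_intros holomorphic_on_subset[OF holomorphic_zeta_factor]
          holomorphic_on_compose_gen[OF _ holomorphic_xi0, unfolded o_def]) auto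
    show "zeta_factor s * sin (of_real pi * s / 2) * (xi0 (1 - s) / (- s)) = zeta_cont s" if "s \<in> {s. Re s < 0}" for s
      using that xi0_functional_equation_strip[of s] by (auto simp: zeta_cont_def)
  qed
  have "zeta_cont holomorphic_on (({s. Re s > -1} - {1}) \<union> {s. Re s < 0})"
    by (intro holomorphic_on_Un 1 2 open_Diff open_halfspace_Re_gt open_halfspace_Re_lt) auto
  also have "({s. Re s > -1} - {1}) \<union> {s. Re s < 0} = - {1::complex}" by auto
  finally show ?thesis .
qed

lemma zeta_unique:
  assumes "F holomorphic_on (- {1})" "G holomorphic_on (- {1})"
    and "\<And>s. Re s > 1 \<Longrightarrow> F s = G s" and "s \<noteq> 1"
  shows "F s = G s"
proof (rule analytic_continuation_open[of "{s. Re s > 1}" "- {1}" F G])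
  show "connected (- {1::complex})"
    using connected_punctured_universe[of "1::complex"] by (simp add: Compl_eq_Diff_UNIV)
  show "{s. Re s > 1} \<noteq> {}" by (auto intro: exI[of _ 2])
qed (use assms in \<open>auto simp: open_halfspace_Re_gt\<close>)

lemma zeta_cont_sums: "Re s > 1 \<Longrightarrow> (\<lambda>n. 1 / of_nat (Suc n) powr s) sums zeta_cont s"
  using xi0_sums[of s] by (auto simp: zeta_cont_def)

lemma zeta_eq_zeta_cont: "zeta = zeta_cont"
  unfolding zeta_def
proof (rule the_equality)
  show "zeta_cont holomorphic_on - {1} \<and> (\<forall>s. Re s > 1 \<longrightarrow> (\<lambda>n. 1 / of_nat (Suc n) powr s) sums zeta_cont s) \<and> zeta_cont 1 = 0"
    using holomorphic_zeta_cont zeta_cont_sums by (auto simp: zeta_cont_def)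
next
  fix F assume F: "F holomorphic_on - {1} \<and> (\<forall>s. Re s > 1 \<longrightarrow> (\<lambda>n. 1 / of_nat (Suc n) powr s) sums F s) \<and> F 1 = 0"
  have "F s = zeta_cont s" for s
  proof (cases "s = 1")
    case False
    show ?thesis
    proof (rule zeta_unique[OF _ holomorphic_zeta_cont _ False])
      show "F s = zeta_cont s" if "Re s > 1" for s
        using F that zeta_cont_sums[OF that] sums_unique2 by blast
    qed (use F in auto)
  qed (use F in \<open>auto simp: zeta_cont_def\<close>)
  thus "F = zeta_cont" by auto
qed

lemma holomorphic_zeta: "zeta holomorphic_on - {1}"
  unfolding zeta_eq_zeta_cont by (rule holomorphic_zeta_cont)

lemma zeta_sums: "Re s > 1 \<Longrightarrow> (\<lambda>n. 1 / of_nat (Suc n) powr s) sums zeta s"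
  unfolding zeta_eq_zeta_cont by (rule zeta_cont_sums)

lemma zeta_eq_xi0: "Re s > -1 \<Longrightarrow> s \<noteq> 1 \<Longrightarrow> zeta s = xi0 s / (s - 1)"
  by (simp add: zeta_eq_zeta_cont zeta_cont_def)

lemma zeta_functional_equation:
  assumes "Re s < 1" "s \<noteq> 0"
  shows "zeta s = zeta_factor s * sin (of_real pi * s / 2) * zeta (1 - s)"
proof -
  have "zeta s - zeta_factor s * sin (of_real pi * s / 2) * zeta (1 - s) = (\<lambda>_. 0) s"
  proof (rule analytic_continuation_open[of "{s. Re s < 0}" "{s. Re s < 1} - {0}"
        "\<lambda>s. zeta s - zeta_factor s * sin (of_real pi * s / 2) * zeta (1 - s)" "\<lambda>_. 0"])
    show "connected ({s. Re s < 1} - {0::complex})"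
      by (intro connected_open_delete open_halfspace_Re_lt convex_connected convex_halfspace_Re_lt) auto
    show "{s. Re s < 0} \<noteq> {}" by (auto intro: exI[of _ "-1"])
    show "(\<lambda>s. zeta s - zeta_factor s * sin (of_real pi * s / 2) * zeta (1 - s)) holomorphic_on {s. Re s < 1} - {0}"
      by (intro holomorphic_intros holomorphic_on_subset[OF holomorphic_zeta] holomorphic_on_subset[OF holomorphic_zeta_factor]
          holomorphic_on_compose_gen[OF _ holomorphic_zeta, unfolded o_def]) auto
    show "zeta z - zeta_factor z * sin (of_real pi * z / 2) * zeta (1 - z) = 0" if "z \<in> {s. Re s < 0}" for z
    proof -
      have "zeta (1 - z) = xi0 (1 - z) / (- z)" using that by (subst zeta_eq_xi0) auto
      thus ?thesis using that xi0_functional_equation_strip[of z]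
        by (auto simp: zeta_eq_zeta_cont zeta_cont_def)
    qed
  qed (use assms in \<open>auto intro: open_halfspace_Re_lt open_Diff\<close>)
  thus ?thesis by simp
qed

text \<open>Conjugating argument and value gives another continuation of the same Dirichlet series,
  so uniqueness applies away from 1; at 1 the conventional value 0 is real.\<close>

lemma cnj_zeta: "cnj (zeta s) = zeta (cnj s)"
proof (cases "s = 1")
  case False
  have "(cnj \<circ> zeta \<circ> cnj) (cnj s) = zeta (cnj s)"
  proof (rule zeta_unique[of "cnj \<circ> zeta \<circ> cnj" zeta "cnj s"])
    have "bij cnj" by (rule involuntory_imp_bij) simp
    hence "cnj ` (- {1}) = - {1}" by (simp add: bij_image_Compl_eq)
    thus "cnj \<circ> zeta \<circ> cnj holomorphic_on - {1}"
      using holomorphic_on_compose_cnj_cnj[of zeta "- {1}"] holomorphic_zeta by (simp add: open_Compl)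
    show "zeta holomorphic_on - {1}" by (rule holomorphic_zeta)
    show "(cnj \<circ> zeta \<circ> cnj) s = zeta s" if s: "Re s > 1" for s
    proof -
      have "(\<lambda>n. 1 / of_nat (Suc n) powr cnj s) sums zeta (cnj s)" using s by (intro zeta_sums) simp
      hence "(\<lambda>n. cnj (1 / of_nat (Suc n) powr cnj s)) sums cnj (zeta (cnj s))" by (rule iffD2[OF sums_cnj])
      moreover have "cnj (1 / of_nat (Suc n) powr cnj s) = 1 / of_nat (Suc n) powr s" for n
        by (simp add: cnj_powr)
      ultimately have "(\<lambda>n. 1 / of_nat (Suc n) powr s) sums cnj (zeta (cnj s))" by (simp only:)
      with zeta_sums[OF s] show ?thesis using sums_unique2 by fastforce
    qed
    show "cnj s \<noteq> 1" using False by (metis complex_cnj_cnj complex_cnj_one)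
  qed
  thus ?thesis by simp
qed (simp add: zeta_eq_zeta_cont zeta_cont_def)

section \<open>Growth of zeta\<close>

lemma norm_Gamma_le:
  assumes "Re z > 0"
  shows "norm (Gamma z) \<le> Gamma (Re z)"
proof -
  let ?f = "\<lambda>t. of_real t powr (z - 1) / of_real (exp t) :: complex" and ?g = "\<lambda>t. t powr (Re z - 1) / exp t"
  have f: "(?f has_integral Gamma z) {0..}" by (rule Gamma_integral_complex[OF assms])
  have g: "(?g has_integral Gamma (Re z)) {0..}" by (rule Gamma_integral_real[OF assms])
  have "norm (integral {0..} ?f) \<le> integral {0..} ?g"
  proof (rule integral_norm_bound_integral)
    show "?f integrable_on {0..}" "?g integrable_on {0..}" using f g by blast+
    show "norm (?f t) \<le> ?g t" if "t \<in> {0..}" for t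
      using that by (cases "t = 0") (auto simp: norm_divide norm_powr_real_powr)
  qed
  thus ?thesis using f g by (simp add: integral_unique)
qed

text \<open>With x \<le> n \<le> x + 1, Gamma x is below n! \<le> n^n, and ln n \<le> 2 sqrt n. This
  estimate is the origin of the exponent 3/2.\<close>

lemma Gamma_real_le_exp:
  fixes x :: real
  assumes x: "x \<ge> 3/2"
  shows "Gamma x \<le> exp (2 * (x + 1) powr (3/2))"
proof -
  define n where "n = nat \<lceil>x\<rceil>"
  have n: "x \<le> real n" "real n \<le> x + 1" using x by (auto simp: n_def)
  have n1: "n \<ge> 1" using n x by linarith
  have "Gamma x < Gamma (1 + real n)" using x n by (intro Gamma_real_strict_mono) auto
  also have "\<dots> = fact n" by (rule Gamma_fact)
  also have "fact n \<le> real n ^ n" using fact_le_power[of n, where 'a = real] by simp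
  also have "real n ^ n = exp (real n * ln (real n))" using n1 by (simp add: exp_of_nat_mult)
  also have "\<dots> \<le> exp (2 * (x + 1) powr (3/2))"
  proof -
    have sq: "sqrt (real n) > 0" using n1 by simp
    have "ln (real n) = 2 * ln (sqrt (real n))" using n1 by (simp add: ln_sqrt)
    also have "ln (sqrt (real n)) \<le> sqrt (real n)" using ln_le_minus_one[OF sq] by simp
    finally have "real n * ln (real n) \<le> real n * (2 * sqrt (real n))" by (intro mult_left_mono) auto
    also have "\<dots> = 2 * real n powr (3/2)"
      using n1 powr_add[of "real n" 1 "1/2"] by (simp add: powr_half_sqrt)
    also have "\<dots> \<le> 2 * (x + 1) powr (3/2)" using n by (intro mult_left_mono powr_mono2) auto
    finally show ?thesis by simp
  qed
  finally show ?thesis by simp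
qed

definition zeta_entire :: "complex \<Rightarrow> complex" where
  "zeta_entire s = (if s = 1 then 1 else (s - 1) * zeta s)"

lemma xi0_1: "xi0 1 = 1"
proof -
  have "em_term (Suc n) 1 = 0" for n
  proof -
    have c: "em_coeff (Suc k) 1 = 0" for k unfolding em_coeff_def by (simp only: prod.lessThan_Suc_shift) simp
    have "em_coeff 1 1 = 0" "em_coeff 2 1 = 0" "em_coeff 4 1 = 0"
      using c[of 0] c[of 1] c[of 3] by (simp_all add: numeral_eq_Suc)
    hence "em_fun 1 1 x = 0" "em_fun 2 1 x = 0" "em_fun 4 1 x = 0" for x by (simp_all only: em_fun_def mult_zero_left)
    moreover have "em_fun 0 1 x = 1" if "x > 0" for x using that by (simp add: em_fun_def em_coeff_def)
    ultimately show ?thesis unfolding em_term_def by (simp del: One_nat_def)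
  qed
  thus ?thesis by (simp add: xi0_def)
qed

lemma zeta_entire_eq_xi0: "Re s > -1 \<Longrightarrow> zeta_entire s = xi0 s"
  by (auto simp: zeta_entire_def xi0_1 zeta_eq_xi0)

lemma holomorphic_zeta_entire [holomorphic_intros]: "zeta_entire holomorphic_on A"
proof -
  have 1: "zeta_entire holomorphic_on {s. Re s > -1}"
    by (rule holomorphic_transform[OF holomorphic_xi0]) (simp add: zeta_entire_eq_xi0)
  have "zeta_entire holomorphic_on - {1}"
    by (rule holomorphic_transform[of "\<lambda>s. (s - 1) * zeta s"])
       (auto intro!: holomorphic_intros holomorphic_zeta simp: zeta_entire_def)
  hence "zeta_entire holomorphic_on ({s. Re s > -1} \<union> - {1})"
    using 1 by (intro holomorphic_on_Un open_halfspace_Re_gt) auto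
  also have "{s. Re s > -1} \<union> - {1} = (UNIV :: complex set)" by auto
  finally show ?thesis by (rule holomorphic_on_subset) auto
qed

lemma zeta_field_derivative: "s \<noteq> 1 \<Longrightarrow> (zeta has_field_derivative deriv zeta s) (at s)"
  using holomorphic_derivI[OF holomorphic_zeta] by (auto simp: open_Compl)

text \<open>This is (s - 1)^2 \<zeta>'(s), written through (s - 1) \<zeta>(s) so that it is visibly
  entire. Its value at 1 is -1, which makes 1 a convenient centre for counting its zeros.\<close>

definition zeta_deriv_entire :: "complex \<Rightarrow> complex" where
  "zeta_deriv_entire s = (s - 1) * deriv zeta_entire s - zeta_entire s"

lemma holomorphic_zeta_deriv_entire: "zeta_deriv_entire holomorphic_on A"
proof -
  have "deriv zeta_entire holomorphic_on UNIV" by (intro holomorphic_deriv holomorphic_zeta_entire) auto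
  hence d: "deriv zeta_entire holomorphic_on A" by (rule holomorphic_on_subset) auto
  show ?thesis unfolding zeta_deriv_entire_def[abs_def]
    by (rule holomorphic_on_diff[OF holomorphic_on_mult[OF _ d]]) (intro holomorphic_intros)+
qed

lemma zeta_deriv_entire_1: "zeta_deriv_entire 1 = -1"
  by (simp add: zeta_deriv_entire_def zeta_entire_def)

lemma zeta_deriv_entire_eq:
  assumes "s \<noteq> 1"
  shows "zeta_deriv_entire s = (s - 1)\<^sup>2 * deriv zeta s"
proof -
  have "((\<lambda>s. (s - 1) * zeta s) has_field_derivative (s - 1) * deriv zeta s + zeta s) (at s)"
    using zeta_field_derivative[OF assms] by (auto intro!: derivative_eq_intros)
  hence "(zeta_entire has_field_derivative (s - 1) * deriv zeta s + zeta s) (at s)"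
    by (rule has_field_derivative_transform_within_open[of _ _ _ "- {1}"]) (use assms in \<open>auto simp: zeta_entire_def open_Compl\<close>)
  hence d: "deriv zeta_entire s = (s - 1) * deriv zeta s + zeta s" by (rule DERIV_imp_deriv)
  show ?thesis unfolding zeta_deriv_entire_def d
    using assms by (simp add: zeta_entire_def power2_eq_square algebra_simps)
qed

lemma norm_sin_le_exp: "norm (sin z) \<le> exp (norm (z :: complex))"
proof -
  have "norm (sin z) = norm (exp (\<i> * z) - exp (- (\<i> * z))) / 2"
    by (simp add: sin_exp_eq norm_divide norm_mult)
  also have "norm (exp (\<i> * z) - exp (- (\<i> * z))) \<le> norm (exp (\<i> * z)) + norm (exp (- (\<i> * z)))"
    by (rule norm_triangle_ineq4)
  also have "\<dots> \<le> exp (norm z) + exp (norm z)"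
    using abs_Im_le_cmod[of z] by (intro add_mono) (auto simp: norm_exp_eq_Re)
  finally show ?thesis by simp
qed

text \<open>Growth is polynomial to the right of Re s = -1. To the left the functional equation
  brings in Gamma (1 - s), whose bound dominates; the other factors are at most exponential or
  covered by the polynomial case.\<close>

lemma norm_zeta_entire_le:
  "\<exists>C\<ge>0. \<forall>s. norm (zeta_entire s) \<le> exp (C * (1 + norm (s - 1)) powr (3/2))"
proof -
  obtain c where c: "c > 0" "\<And>s. Re s \<ge> -1 \<Longrightarrow> norm (xi0 s) \<le> c * (norm s + 7) ^ 7"
    using norm_xi0_le by auto
  define K where "K = c + 70"
  have poly: "norm (xi0 s) \<le> exp (K * R powr (3/2))" if "Re s \<ge> -1" "norm s \<le> R" "R \<ge> 1" for s R
  proof -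
    have RR: "R powr 1 \<le> R powr (3/2)" using that by (intro powr_mono) auto
    have "norm (xi0 s) \<le> c * (norm s + 7) ^ 7" using c that by auto
    also have "\<dots> \<le> exp c * exp (norm s + 7) ^ 7"
    proof -
      have "c \<le> exp c" "norm s + 7 \<le> exp (norm s + 7)"
        using exp_ge_add_one_self[of c] exp_ge_add_one_self[of "norm s + 7"] by linarith+
      thus ?thesis using c(1) by (intro mult_mono power_mono) auto
    qed
    also have "exp (norm s + 7) ^ 7 = exp (7 * (norm s + 7))"
      using exp_of_nat_mult[of 7 "norm s + 7"] by simp
    also have "exp c * exp (7 * (norm s + 7)) = exp (c + 7 * (norm s + 7))" by (rule exp_add [symmetric])
    also have "\<dots> \<le> exp (K * R powr (3/2))"
    proof -
      have "c + 7 * (norm s + 7) \<le> c * R + 7 * (R + 7 * R)" using that c by (intro add_mono) auto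
      also have "\<dots> \<le> K * R powr 1" using that by (simp add: K_def algebra_simps)
      also have "\<dots> \<le> K * R powr (3/2)" using RR c by (intro mult_left_mono) (auto simp: K_def)
      finally show ?thesis by simp
    qed
    finally show ?thesis .
  qed
  define C where "C = K + 20"
  have "norm (zeta_entire s) \<le> exp (C * (1 + norm (s - 1)) powr (3/2))" for s
  proof -
    define R where "R = 1 + norm (s - 1)"
    have R: "R \<ge> 1" "norm s \<le> R" "norm (1 - s) \<le> R"
      using norm_triangle_ineq[of "s - 1" 1] by (auto simp: R_def norm_minus_commute)
    have RR: "R powr 1 \<le> R powr (3/2)" using R by (intro powr_mono) auto
    hence RR': "1 \<le> R powr (3/2)" using R by simp
    show ?thesis
    proof (cases "Re s > -1")
      case True
      have "norm (zeta_entire s) \<le> exp (K * R powr (3/2))"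
        using poly[of s R] True R by (simp add: zeta_entire_eq_xi0)
      also have "\<dots> \<le> exp (C * R powr (3/2))" using RR' by (simp add: C_def distrib_right)
      finally show ?thesis by (simp add: R_def)
    next
      case False
      have s: "s \<noteq> 1" "s \<noteq> 0" using False by auto
      have Res: "- Re s \<le> norm (1 - s) - 1" using complex_Re_le_cmod[of "1 - s"] by simp
      have "zeta (1 - s) = xi0 (1 - s) / (- s)" using False by (subst zeta_eq_xi0) auto
      moreover have "zeta s = zeta_factor s * sin (of_real pi * s / 2) * zeta (1 - s)"
        using False s by (intro zeta_functional_equation) auto
      ultimately have "zeta_entire s = (s - 1) / (- s) * zeta_factor s * sin (of_real pi * s / 2) * xi0 (1 - s)"
        using s by (simp add: zeta_entire_def)
      hence "norm (zeta_entire s) = norm ((s - 1) / (- s)) * norm (zeta_factor s) * norm (sin (of_real pi * s / 2)) * norm (xi0 (1 - s))"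
        by (simp only: norm_mult)
      also have "\<dots> \<le> exp 2 * exp (2 * (2 * R) powr (3/2) + 1) * exp (2 * R) * exp (K * R powr (3/2))"
      proof (intro mult_mono)
        have n1: "norm s \<ge> 1" using False abs_Re_le_cmod[of s] by linarith
        have "norm (s - 1) \<le> norm s + norm s"
          using norm_triangle_ineq4[of s 1] n1 by (simp)
        hence "norm ((s - 1) / (- s)) \<le> 2" using n1 by (simp add: norm_divide divide_le_eq)
        also have "\<dots> \<le> exp 2" using exp_ge_add_one_self[of 2] by simp
        finally show "norm ((s - 1) / (- s)) \<le> exp 2" .
        have "norm (zeta_factor s) = 2 * (2 * pi) powr (Re s - 1) * norm (Gamma (1 - s))"
          by (simp add: zeta_factor_def norm_mult norm_powr_real_powr)
        also have "\<dots> \<le> 2 * 1 * exp (2 * (2 * R) powr (3/2))"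
        proof (intro mult_mono)
          have "(2 * pi) powr (Re s - 1) \<le> (2 * pi) powr 0"
            using False pi_gt3 by (intro powr_mono) auto
          thus "(2 * pi) powr (Re s - 1) \<le> 1" by simp
          have "norm (Gamma (1 - s)) \<le> Gamma (Re (1 - s))" using False by (intro norm_Gamma_le) auto
          also have "\<dots> \<le> exp (2 * (Re (1 - s) + 1) powr (3/2))" using False by (intro Gamma_real_le_exp) auto
          also have "\<dots> \<le> exp (2 * (2 * R) powr (3/2))"
            using False Res R by (simp, intro powr_mono2) auto
          finally show "norm (Gamma (1 - s)) \<le> exp (2 * (2 * R) powr (3/2))" .
        qed auto
        also have "\<dots> \<le> exp 1 * exp (2 * (2 * R) powr (3/2))" using exp_ge_add_one_self[of 1] by (intro mult_right_mono) auto
        finally show "norm (zeta_factor s) \<le> exp (2 * (2 * R) powr (3/2) + 1)" by (simp add: exp_add mult.commute)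
        have "norm (sin (of_real pi * s / 2)) \<le> exp (norm (of_real pi * s / 2))" by (rule norm_sin_le_exp)
        also have "norm (of_real pi * s / 2) \<le> 2 * R"
        proof -
          have "pi * norm s \<le> 4 * R" using pi_less_4 R by (intro mult_mono) auto
          thus ?thesis by (simp add: norm_mult norm_divide)
        qed
        finally show "norm (sin (of_real pi * s / 2)) \<le> exp (2 * R)" by simp
        show "norm (xi0 (1 - s)) \<le> exp (K * R powr (3/2))" using False R by (intro poly) auto
      qed auto
      also have "\<dots> = exp (2 + (2 * (2 * R) powr (3/2) + 1) + 2 * R + K * R powr (3/2))" by (simp only: exp_add)
      also have "\<dots> \<le> exp (C * R powr (3/2))"
      proof -
        have "(2 * R) powr (3/2) = 2 powr (3/2) * R powr (3/2)" by (rule powr_mult)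
        also have "(2::real) powr (3/2) \<le> 2 powr 2" by (intro powr_mono) auto
        finally have "(2 * R) powr (3/2) \<le> 4 * R powr (3/2)" by (simp add: mult_right_mono)
        thus ?thesis using RR RR' R by (simp add: C_def algebra_simps)
      qed
      finally show ?thesis by (simp add: R_def)
    qed
  qed
  moreover have "C \<ge> 0" using c by (simp add: C_def K_def)
  ultimately show ?thesis by blast
qed

text \<open>Cauchy's inequality on a unit circle. Moving by 1 at most doubles 1 + |s - 1|, which
  costs the factor 2^(3/2) \<le> 4 in the exponent.\<close>

lemma norm_zeta_deriv_entire_le:
  "\<exists>C. \<forall>s. norm (zeta_deriv_entire s) \<le> exp (C * (1 + norm (s - 1)) powr (3/2))"
proof -
  obtain C where C: "C \<ge> 0" "\<And>s. norm (zeta_entire s) \<le> exp (C * (1 + norm (s - 1)) powr (3/2))"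
    using norm_zeta_entire_le by auto
  have "norm (zeta_deriv_entire s) \<le> exp ((4 * C + 1) * (1 + norm (s - 1)) powr (3/2))" for s
  proof -
    define R where "R = 1 + norm (s - 1)"
    have R: "R \<ge> 1" by (simp add: R_def)
    have RR: "R powr 1 \<le> R powr (3/2)" using R by (intro powr_mono) auto
    have le: "norm (zeta_entire w) \<le> exp (4 * C * R powr (3/2))" if "norm (s - w) \<le> 1" for w
    proof -
      have "norm (w - 1) \<le> norm (s - 1) + norm (s - w)"
        using norm_triangle_ineq4[of "s - 1" "s - w"] by simp
      hence "norm (w - 1) \<le> norm (s - 1) + 1" using that by linarith
      moreover have "1 + x \<le> 2 * (1 + a)" if "x \<le> a + 1" "0 \<le> a" for x a :: real using that by simp
      ultimately have "1 + norm (w - 1) \<le> 2 * R" unfolding R_def using norm_ge_zero by blast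
      hence "(1 + norm (w - 1)) powr (3/2) \<le> (2 * R) powr (3/2)" by (intro powr_mono2) auto
      also have "(2 * R) powr (3/2) = 2 powr (3/2) * R powr (3/2)" by (rule powr_mult)
      also have "(2::real) powr (3/2) \<le> 2 powr 2" by (intro powr_mono) auto
      finally have "(1 + norm (w - 1)) powr (3/2) \<le> 4 * R powr (3/2)" by (simp add: mult_right_mono)
      hence "C * (1 + norm (w - 1)) powr (3/2) \<le> C * (4 * R powr (3/2))" using C(1) by (intro mult_left_mono)
      thus ?thesis using C(2)[of w] by (simp add: mult_ac order_trans)
    qed
    have "norm ((deriv ^^ 1) zeta_entire s) \<le> fact 1 * exp (4 * C * R powr (3/2)) / 1 ^ 1"
      by (rule Cauchy_inequality)
         (auto intro!: holomorphic_zeta_entire holomorphic_on_imp_continuous_on le)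
    hence d: "norm (deriv zeta_entire s) \<le> exp (4 * C * R powr (3/2))" by simp
    have "norm (zeta_deriv_entire s) \<le> norm (s - 1) * norm (deriv zeta_entire s) + norm (zeta_entire s)"
      unfolding zeta_deriv_entire_def norm_mult [symmetric] by (rule norm_triangle_ineq4)
    also have "\<dots> \<le> norm (s - 1) * exp (4 * C * R powr (3/2)) + exp (4 * C * R powr (3/2))"
      using d le[of s] by (intro add_mono mult_left_mono) auto
    also have "\<dots> = R * exp (4 * C * R powr (3/2))" by (simp add: R_def algebra_simps)
    also have "\<dots> \<le> exp (R powr (3/2)) * exp (4 * C * R powr (3/2))"
    proof -
      have "R powr 1 = R" using R by simp
      hence "R \<le> exp (R powr (3/2))" using exp_ge_add_one_self[of "R powr (3/2)"] RR by linarith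
      thus ?thesis by (intro mult_right_mono) auto
    qed
    also have "\<dots> = exp ((4 * C + 1) * R powr (3/2))" by (simp add: algebra_simps flip: exp_add)
    finally show ?thesis by (simp add: R_def)
  qed
  thus ?thesis by blast
qed

lemma zeta_deriv_entire_order: "\<exists>C. entire_order_three_halves zeta_deriv_entire 1 C"
proof -
  obtain C where "\<And>s. norm (zeta_deriv_entire s) \<le> exp (C * (1 + norm (s - 1)) powr (3/2))"
    using norm_zeta_deriv_entire_le by auto
  thus ?thesis
    by (intro exI[of _ C]) (unfold_locales, auto simp: holomorphic_zeta_deriv_entire zeta_deriv_entire_1)
qed

section \<open>Zeros of the derivative in the outer half-planes\<close>

text \<open>What is left of the Dirichlet series is the sum of (2/n)^s over n \<ge> 3. Two of the Re
  s powers of 2/n are kept for convergence, the others are replaced by powers of 2/3.\<close>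

lemma zeta_minus_main_terms:
  "\<exists>B>0. \<forall>s. Re s \<ge> 2 \<longrightarrow> norm (2 powr s * (zeta s - 1) - 1) \<le> B * (2/3) powr Re s"
proof -
  define g where "g n = (2 / (real n + 3)) ^ 2" for n :: nat
  have sg: "summable g"
  proof -
    have "summable (\<lambda>n. 1 / (real n) ^ 2)" using inverse_power_summable[of 2, where 'a = real] by (simp add: inverse_eq_divide)
    hence "summable (\<lambda>n. 1 / (real (n + 3)) ^ 2)" by (rule summable_ignore_initial_segment)
    hence "summable (\<lambda>n. 4 * (1 / (real (n + 3)) ^ 2))" by (rule summable_mult)
    thus ?thesis by (simp add: g_def[abs_def] power_divide)
  qed
  define B where "B = 9/4 * (\<Sum>n. g n) + 1"
  have "norm (2 powr s * (zeta s - 1) - 1) \<le> B * (2/3) powr Re s" if s: "Re s \<ge> 2" for s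
  proof -
    have "(\<lambda>n. 1 / of_nat (Suc n) powr s) sums zeta s" using s by (intro zeta_sums) auto
    hence "(\<lambda>n. 1 / of_nat (Suc (n + 2)) powr s) sums (zeta s - (\<Sum>n<2. 1 / of_nat (Suc n) powr s))"
      by (rule sums_split_initial_segment)
    hence "(\<lambda>n. 2 powr s * (1 / of_nat (Suc (n + 2)) powr s)) sums (2 powr s * (zeta s - (\<Sum>n<2. 1 / of_nat (Suc n) powr s)))"
      by (rule sums_mult)
    also have "2 powr s * (zeta s - (\<Sum>n<2. 1 / of_nat (Suc n) powr s)) = 2 powr s * (zeta s - 1) - 1"
      by (simp add: numeral_2_eq_2 algebra_simps)
    finally have sm: "(\<lambda>n. 2 powr s * (1 / of_nat (Suc (n + 2)) powr s)) sums (2 powr s * (zeta s - 1) - 1)" .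
    have b: "norm (2 powr s * (1 / of_nat (Suc (n + 2)) powr s)) \<le> 9/4 * (2/3) powr Re s * g n" for n
    proof -
      have "of_nat (Suc (n + 2)) = complex_of_real (real n + 3)" by simp
      hence "norm (2 powr s * (1 / of_nat (Suc (n + 2)) powr s)) = 2 powr Re s / (real n + 3) powr Re s"
        by (simp only: norm_mult norm_divide norm_one) (simp add: norm_powr_real_powr)
      also have "\<dots> = (2 / (real n + 3)) powr Re s" by (simp add: powr_divide)
      also have "\<dots> = (2 / (real n + 3)) powr (Re s - 2 + 2)" by simp
      also have "\<dots> = (2 / (real n + 3)) powr (Re s - 2) * (2 / (real n + 3)) powr 2" by (rule powr_add)
      also have "\<dots> \<le> (2 / 3) powr (Re s - 2) * (2 / (real n + 3)) powr 2"
        using s by (intro mult_right_mono powr_mono2) (auto simp: field_simps)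
      also have "(2 / 3 :: real) powr (Re s - 2) = 9/4 * (2/3) powr Re s" by (simp add: powr_diff power2_eq_square)
      finally show ?thesis by (simp add: g_def)
    qed
    have "norm (\<Sum>n. 2 powr s * (1 / of_nat (Suc (n + 2)) powr s)) \<le> (\<Sum>n. 9/4 * (2/3) powr Re s * g n)"
      by (rule norm_suminf_le[OF b summable_mult[OF sg]])
    also have "\<dots> = 9/4 * (2/3) powr Re s * (\<Sum>n. g n)" by (rule suminf_mult[OF sg])
    also have "\<dots> \<le> B * (2/3) powr Re s" by (simp add: B_def algebra_simps)
    finally show ?thesis using sums_unique[OF sm] by simp
  qed
  moreover have "B > 0" unfolding B_def by (intro add_nonneg_pos mult_nonneg_nonneg suminf_nonneg sg) (auto simp: g_def)
  ultimately show ?thesis by blast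
qed

text \<open>Writing \<zeta>(s) = 1 + 2^(-s) (1 + r(s)) with r and r' at most 1/8, the derivative is
  2^(-s) (r' - ln 2 (1 + r)). It cannot vanish, because ln 2 times 7/8 exceeds 1/8.\<close>

lemma zeta_right_half_plane:
  "\<exists>K\<ge>3. \<forall>s. Re s \<ge> K \<longrightarrow> zeta s \<noteq> 0 \<and> deriv zeta s \<noteq> 0 \<and> norm (deriv zeta s / zeta s) \<le> 8 * 2 powr (- Re s)"
proof -
  obtain B where B: "B > 0" "\<And>s. Re s \<ge> 2 \<Longrightarrow> norm (2 powr s * (zeta s - 1) - 1) \<le> B * (2/3) powr Re s"
    using zeta_minus_main_terms by auto
  define r where "r s = 2 powr s * (zeta s - 1) - 1" for s
  have "((\<lambda>x. B * (2/3) powr x) \<longlongrightarrow> 0) at_top" by real_asymp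
  hence "eventually (\<lambda>x. B * (2/3) powr x < 1/8) at_top" by (rule order_tendstoD) auto
  then obtain K0 where K0: "\<And>x. x \<ge> K0 \<Longrightarrow> B * (2/3) powr x < 1/8" by (auto simp: eventually_at_top_linorder)
  \<comment> \<open>The extra 1 leaves room for the unit disc on which Cauchy's inequality turns the
    bound for r into one for r'.\<close>
  define K where "K = max 3 (K0 + 1)"
  have small: "norm (r s) \<le> 1/8" if "Re s \<ge> K - 1" for s
    using B(2)[of s] K0[of "Re s"] that unfolding r_def K_def by fastforce
  have hr: "r holomorphic_on {s. Re s > 1}"
    unfolding r_def by (intro holomorphic_intros holomorphic_on_subset[OF holomorphic_zeta]) auto
  have ln2: "ln 2 \<ge> (1/2::real)" "ln 2 \<le> (1::real)" using ln2_ge_two_thirds ln_2_less_1 by linarith+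
  have "zeta s \<noteq> 0 \<and> deriv zeta s \<noteq> 0 \<and> norm (deriv zeta s / zeta s) \<le> 8 * 2 powr (- Re s)" if s: "Re s \<ge> K" for s
  proof -
    have s3: "Re s \<ge> 3" using s by (simp add: K_def)
    have "norm ((deriv ^^ 1) r s) \<le> fact 1 * (1/8) / 1 ^ 1"
    proof (rule Cauchy_inequality)
      have sub: "cball s 1 \<subseteq> {s. Re s > 1}"
      proof
        fix w assume "w \<in> cball s 1"
        thus "w \<in> {s. Re s > 1}" using abs_Re_le_cmod[of "s - w"] s3 by (auto simp: dist_norm)
      qed
      thus "continuous_on (cball s 1) r"
        using holomorphic_on_imp_continuous_on[OF hr] continuous_on_subset by blast
      show "r holomorphic_on ball s 1" using hr sub ball_subset_cball holomorphic_on_subset by (metis order_trans)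
      show "norm (r w) \<le> 1/8" if "norm (s - w) = 1" for w
        using abs_Re_le_cmod[of "s - w"] that s by (intro small) auto
    qed auto
    hence r': "norm (deriv r s) \<le> 1/8" by simp
    have r: "norm (r s) \<le> 1/8" using s by (intro small) auto
    have zeq: "zeta w = 1 + 2 powr (-w) * (1 + r w)" for w
      by (simp add: r_def powr_minus field_simps)
    have "(r has_field_derivative deriv r s) (at s)"
      using holomorphic_derivI[OF hr open_halfspace_Re_gt] s3 by auto
    moreover have "((\<lambda>w. 2 powr (-w)) has_field_derivative - Ln 2 * 2 powr (-s)) (at s)"
      by (rule DERIV_cong[OF DERIV_chain2[OF has_field_derivative_powr_right DERIV_minus[OF DERIV_ident]]]) auto
    ultimately have "((\<lambda>w. 1 + 2 powr (-w) * (1 + r w)) has_field_derivative 2 powr (-s) * (deriv r s - Ln 2 * (1 + r s))) (at s)"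
      by (auto intro!: derivative_eq_intros simp: algebra_simps)
    hence "(zeta has_field_derivative 2 powr (-s) * (deriv r s - Ln 2 * (1 + r s))) (at s)"
      by (simp only: zeq[symmetric])
    hence zd: "deriv zeta s = 2 powr (-s) * (deriv r s - Ln 2 * (1 + r s))" by (rule DERIV_imp_deriv)
    have Ln2: "Ln 2 = complex_of_real (ln 2)" by (simp add: Ln_of_real [symmetric] flip: Ln_of_real)
    have n2: "norm (2 powr (-s)) = 2 powr (- Re s)" by (simp add: norm_powr_real_powr)
    have up: "norm (deriv r s - Ln 2 * (1 + r s)) \<le> 2"
    proof -
      have "norm (Ln 2 * (1 + r s)) \<le> 1 * (1 + 1/8)" unfolding norm_mult Ln2
        using ln2 r by (intro mult_mono norm_triangle_le) auto
      thus ?thesis using norm_triangle_ineq4[of "deriv r s" "Ln 2 * (1 + r s)"] r' by simp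
    qed
    have ne: "deriv r s - Ln 2 * (1 + r s) \<noteq> 0"
    proof
      assume "deriv r s - Ln 2 * (1 + r s) = 0"
      hence "norm (deriv r s) = norm (Ln 2 * (1 + r s))" by simp
      moreover have "1/2 * (7/8) \<le> norm (Ln 2 * (1 + r s))" unfolding norm_mult Ln2
        using ln2 r norm_triangle_ineq2[of 1 "- r s"] by (intro mult_mono) auto
      ultimately show False using r' by simp
    qed
    have "2 powr (- Re s) \<le> 2 powr (-3)" using s3 by (intro powr_mono) auto
    hence p8: "2 powr (- Re s) \<le> 1/8" by (simp add: powr_minus)
    have "norm (2 powr (-s) * (1 + r s)) \<le> 1/8 * (1 + 1/8)"
      unfolding norm_mult n2 using p8 r by (intro mult_mono norm_triangle_le) auto
    hence "1/2 \<le> norm (zeta s)" unfolding zeq[of s]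
      using norm_triangle_ineq2[of 1 "- (2 powr (-s) * (1 + r s))"] by simp
    moreover from this have "norm (deriv zeta s) / norm (zeta s) \<le> (2 powr (- Re s) * 2) / (1/2)"
      unfolding zd norm_mult n2 using up by (intro frac_le mult_left_mono) auto
    moreover have "2 powr (- Re s) * 2 / (1/2) \<le> 8 * 2 powr (- Re s)" by simp
    ultimately have "norm (deriv zeta s / zeta s) \<le> 8 * 2 powr (- Re s)" unfolding norm_divide by linarith
    thus ?thesis using ne \<open>1/2 \<le> norm (zeta s)\<close> by (auto simp: zd)
  qed
  moreover have "K \<ge> 3" by (simp add: K_def)
  ultimately show ?thesis by blast
qed

lemma zeta_logderiv_small:
  assumes e: "e > 0"
  shows "\<exists>K\<ge>3. \<forall>s. Re s \<ge> K \<longrightarrow> zeta s \<noteq> 0 \<and> norm (deriv zeta s / zeta s) \<le> e \<and>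
           norm (deriv (\<lambda>s. deriv zeta s / zeta s) s) \<le> e"
proof -
  obtain K where K: "K \<ge> 3" "\<And>s. Re s \<ge> K \<Longrightarrow> zeta s \<noteq> 0"
      "\<And>s. Re s \<ge> K \<Longrightarrow> norm (deriv zeta s / zeta s) \<le> 8 * 2 powr (- Re s)"
    using zeta_right_half_plane by auto
  have "((\<lambda>x. 8 * 2 powr (-x)) \<longlongrightarrow> (0::real)) at_top" by real_asymp
  hence "eventually (\<lambda>x. 8 * 2 powr (-x) < e) at_top" by (rule order_tendstoD) (use e in auto)
  then obtain K1 where K1: "\<And>x. x \<ge> K1 \<Longrightarrow> 8 * 2 powr (-x) < e" by (auto simp: eventually_at_top_linorder)
  let ?Q = "\<lambda>s. deriv zeta s / zeta s"
  have le: "norm (?Q s) \<le> e" if "Re s \<ge> max K K1" for s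
    using K(3)[of s] K1[of "Re s"] that by fastforce
  have hQ: "?Q holomorphic_on {s. Re s > K}"
    using K(1,2) by (intro holomorphic_intros holomorphic_on_subset[OF holomorphic_zeta] holomorphic_on_subset[OF holomorphic_deriv[OF holomorphic_zeta]])
       (auto simp: open_Compl)
  have "norm (deriv ?Q s) \<le> e" if s: "Re s \<ge> max K K1 + 2" for s
  proof -
    have "norm ((deriv ^^ 1) ?Q s) \<le> fact 1 * e / 1 ^ 1"
    proof (rule Cauchy_inequality)
      have sub: "cball s 1 \<subseteq> {s. Re s > K}"
      proof
        fix w assume "w \<in> cball s 1"
        thus "w \<in> {s. Re s > K}" using abs_Re_le_cmod[of "s - w"] s by (auto simp: dist_norm)
      qed
      thus "continuous_on (cball s 1) ?Q"
        using holomorphic_on_imp_continuous_on[OF hQ] continuous_on_subset by blast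
      show "?Q holomorphic_on ball s 1" using hQ sub ball_subset_cball holomorphic_on_subset by (metis order_trans)
      show "norm (?Q w) \<le> e" if "norm (s - w) = 1" for w
        using abs_Re_le_cmod[of "s - w"] that s by (intro le) auto
    qed auto
    thus ?thesis by simp
  qed
  moreover have "zeta s \<noteq> 0" "norm (?Q s) \<le> e" if "Re s \<ge> max K K1 + 2" for s
  proof -
    have "max K K1 \<le> Re s" using that by linarith
    thus "zeta s \<noteq> 0" "norm (?Q s) \<le> e" using K(2)[of s] le[of s] by auto
  qed
  moreover have "max K K1 + 2 \<ge> 3" using K(1) by simp
  ultimately show ?thesis by blast
qed

section \<open>Zeros of the derivative in the left half-plane\<close>

lemma Digamma_sums:
  "z \<noteq> 0 \<Longrightarrow> (\<lambda>k. inverse (of_nat (Suc k)) - inverse (z + of_nat k)) sums (Digamma (z :: complex) + euler_mascheroni)"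
  using summable_Digamma[of z] by (simp add: Digamma_def summable_sums)

text \<open>Termwise comparison of the series: the real part of 1 / (z + k) is at most 1 / (Re z +
  k).\<close>

lemma Re_Digamma_ge:
  assumes "Re z > 0"
  shows "Digamma (Re z) \<le> Re (Digamma z)"
proof -
  have z: "z \<noteq> 0" using assms by auto
  have S1: "(\<lambda>k. Re (inverse (of_nat (Suc k)) - inverse (z + of_nat k))) sums Re (Digamma z + euler_mascheroni)"
    by (rule sums_Re[OF Digamma_sums[OF z]])
  have S2: "(\<lambda>k. inverse (real (Suc k)) - inverse (Re z + real k)) sums (Digamma (Re z) + euler_mascheroni)"
    using summable_Digamma[of "Re z"] assms by (simp add: Digamma_def summable_sums)
  have le: "inverse (real (Suc k)) - inverse (Re z + real k) \<le> Re (inverse (of_nat (Suc k)) - inverse (z + of_nat k))" for k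
  proof -
    have pos: "Re z + real k > 0" using assms by simp
    have "Re (inverse (z + of_nat k)) \<le> norm (inverse (z + of_nat k))" by (rule complex_Re_le_cmod)
    also have "\<dots> = inverse (norm (z + of_nat k))" by (rule norm_inverse)
    also have "\<dots> \<le> inverse (Re z + real k)"
      using pos complex_Re_le_cmod[of "z + of_nat k"] by (intro le_imp_inverse_le) auto
    finally have "Re (inverse (z + of_nat k)) \<le> inverse (Re z + real k)" .
    moreover have "inverse (of_nat (Suc k)) = complex_of_real (inverse (real (Suc k)))" by simp
    ultimately show ?thesis by (simp only: minus_complex.sel Re_complex_of_real)
  qed
  have "Digamma (Re z) + euler_mascheroni \<le> Re (Digamma z + euler_mascheroni)"
    by (rule sums_le[OF le S2 S1])
  moreover have "Re euler_mascheroni = euler_mascheroni"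
    by (metis Re_complex_of_real of_real_euler_mascheroni)
  ultimately show ?thesis by simp
qed

lemma Digamma_real_unbounded: "\<exists>K\<ge>1. \<forall>x\<ge>K. Digamma (x::real) \<ge> B"
proof -
  have "eventually (\<lambda>n. harm n \<ge> B + euler_mascheroni) sequentially"
    using harm_at_top by (auto simp: filterlim_at_top)
  then obtain n where n: "harm n \<ge> B + euler_mascheroni" by (auto simp: eventually_sequentially)
  have "Digamma (real (Suc n)) = harm n - euler_mascheroni" using Digamma_of_nat[of n, where 'a = real] by simp
  hence "Digamma (real (Suc n)) \<ge> B" using n by simp
  thus ?thesis using Digamma_real_mono[of "real (Suc n)"] by (intro exI[of _ "real (Suc n)"]) force
qed

lemma norm_Polygamma_1_le:
  assumes "Re z > 1"
  shows "norm (Polygamma 1 z) \<le> 1 / (Re z - 1)"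
proof -
  define x where "x = Re z"
  have x: "x > 1" using assms by (simp add: x_def)
  have tel: "(\<lambda>k. 1 / (x - 1 + real k) - 1 / (x - 1 + real (Suc k))) sums (1 / (x - 1 + real 0) - 0)"
  proof (rule telescope_sums')
    show "(\<lambda>k. 1 / (x - 1 + real k)) \<longlonglongrightarrow> 0" by real_asymp
  qed
  have le: "norm (inverse ((z + of_nat k) ^ Suc 1)) \<le> 1 / (x - 1 + real k) - 1 / (x - 1 + real (Suc k))" for k
  proof -
    have "x + real k \<le> norm (z + of_nat k)" using complex_Re_le_cmod[of "z + of_nat k"] by (simp add: x_def)
    hence "norm (inverse ((z + of_nat k) ^ Suc 1)) \<le> inverse ((x + real k) ^ Suc 1)"
      unfolding norm_inverse norm_power using x by (intro le_imp_inverse_le power_mono) auto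
    also have "\<dots> \<le> 1 / ((x - 1 + real k) * (x + real k))"
      using x by (simp add: divide_simps mult_right_mono)
    also have "\<dots> = 1 / (x - 1 + real k) - 1 / (x - 1 + real (Suc k))"
      using x by (simp add: divide_simps)
    finally show ?thesis .
  qed
  have "Polygamma 1 z = (\<Sum>k. inverse ((z + of_nat k) ^ Suc 1))" by (simp add: Polygamma_def)
  also have "norm \<dots> \<le> (\<Sum>k. 1 / (x - 1 + real k) - 1 / (x - 1 + real (Suc k)))"
    by (rule norm_suminf_le[OF le sums_summable[OF tel]])
  also have "\<dots> = 1 / (x - 1)" using sums_unique[OF tel] by simp
  finally show ?thesis by (simp add: x_def)
qed

text \<open>On the left the functional equation gives \<open>\<zeta>'(s) = X(s) (\<pi>/2 cos (\<pi>s/2) + L(s) sin (\<pi>s/2))\<close> with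
  the zero-free factor \<open>X(s) = 2 (2\<pi>)\<^bsup>s-1\<^esup> \<Gamma>(1-s) \<zeta>(1-s)\<close> and \<open>L = X'/X\<close>.\<close>
definition left_logderiv :: "complex \<Rightarrow> complex" where
  "left_logderiv s = Ln (2 * of_real pi) - Digamma (1 - s) - deriv zeta (1 - s) / zeta (1 - s)"

definition left_factor :: "complex \<Rightarrow> complex" where
  "left_factor s = of_real pi / 2 * cos (of_real pi * s / 2) + left_logderiv s * sin (of_real pi * s / 2)"

lemma deriv_zeta_left:
  assumes s: "Re s < 0" and nz: "zeta (1 - s) \<noteq> 0"
  shows "deriv zeta s = zeta_factor s * zeta (1 - s) * left_factor s"
proof -
  have np: "1 - s \<notin> \<int>\<^sub>\<le>\<^sub>0" using s by (intro one_minus_notin_nonpos_Ints) auto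
  have s0: "s \<noteq> 0" "1 - s \<noteq> 1" using s by auto
  have dz: "((\<lambda>w. zeta (1 - w)) has_field_derivative deriv zeta (1 - s) * (- 1)) (at s)"
    by (rule DERIV_chain2[where g = "\<lambda>w. 1 - w", OF zeta_field_derivative[OF s0(2)]]) (auto intro!: derivative_eq_intros)
  have dp: "((\<lambda>w. (2 * of_real pi) powr (w - 1)) has_field_derivative Ln (2 * of_real pi) * (2 * of_real pi) powr (s - 1) * 1) (at s)"
    by (rule DERIV_chain2[where g = "\<lambda>w. w - 1", OF has_field_derivative_powr_right]) (auto intro!: derivative_eq_intros)
  have dG: "((\<lambda>w. Gamma (1 - w)) has_field_derivative Gamma (1 - s) * Digamma (1 - s) * (- 1)) (at s)"
    by (rule DERIV_chain2[where g = "\<lambda>w. 1 - w", OF has_field_derivative_Gamma[OF np]]) (auto intro!: derivative_eq_intros)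
  have df: "(zeta_factor has_field_derivative zeta_factor s * (Ln (2 * of_real pi) - Digamma (1 - s))) (at s)"
    unfolding zeta_factor_def[abs_def]
    by (rule DERIV_cong[OF DERIV_mult[OF DERIV_cmult[OF dp] dG]]) (simp add: algebra_simps)
  have ds: "((\<lambda>w. sin (of_real pi * w / 2)) has_field_derivative of_real pi / 2 * cos (of_real pi * s / 2)) (at s)"
    by (auto intro!: derivative_eq_intros)
  have "((\<lambda>w. zeta_factor w * sin (of_real pi * w / 2) * zeta (1 - w)) has_field_derivative
     zeta_factor s * zeta (1 - s) * left_factor s) (at s)"
    by (rule DERIV_cong[OF DERIV_mult[OF DERIV_mult[OF df ds] dz]])
       (use nz in \<open>simp add: left_factor_def left_logderiv_def field_simps\<close>)
  hence "(zeta has_field_derivative zeta_factor s * zeta (1 - s) * left_factor s) (at s)"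
  proof (rule has_field_derivative_transform_within_open[of _ _ _ "{s. Re s < 0}"])
    show "zeta_factor w * sin (of_real pi * w / 2) * zeta (1 - w) = zeta w" if "w \<in> {s. Re s < 0}" for w
      using that by (intro zeta_functional_equation [symmetric]) auto
  qed (use s in \<open>auto intro: open_halfspace_Re_lt\<close>)
  thus ?thesis by (rule DERIV_imp_deriv)
qed

text \<open>Far to the left, 1 - s is far to the right, where Re Digamma is large while the trigamma
  function and the logarithmic derivative of \<zeta> are small. The bound on the real part excludes
  zeros away from the real axis, the bound on the derivative those near it.\<close>

lemma left_half_plane_facts:
  assumes d: "d > 0"
  shows "\<exists>K\<ge>2. \<forall>s. Re s \<le> -K \<longrightarrow> zeta (1 - s) \<noteq> 0 \<and> Re (left_logderiv s) < - B \<and>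
          (\<exists>L'. (left_logderiv has_field_derivative L') (at s) \<and> norm L' \<le> d)"
proof -
  define d' where "d' = min 1 (d / 2)"
  have d': "d' > 0" using d by (simp add: d'_def)
  obtain K1 where K1: "K1 \<ge> 3" "\<And>s. Re s \<ge> K1 \<Longrightarrow> zeta s \<noteq> 0" "\<And>s. Re s \<ge> K1 \<Longrightarrow> norm (deriv zeta s / zeta s) \<le> d'"
      "\<And>s. Re s \<ge> K1 \<Longrightarrow> norm (deriv (\<lambda>s. deriv zeta s / zeta s) s) \<le> d'"
    using zeta_logderiv_small[OF d'] by blast
  obtain K2 where K2: "K2 \<ge> 1" "\<And>x::real. x \<ge> K2 \<Longrightarrow> Digamma x \<ge> B + ln (2 * pi) + 2"
    using Digamma_real_unbounded by blast
  define K where "K = Max {K1, K2, 2 + 2 / d, 2}"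
  have K: "K \<ge> K1" "K \<ge> K2" "K \<ge> 2 + 2 / d" "K \<ge> 2" unfolding K_def by (rule Max_ge; simp)+
  have "zeta (1 - s) \<noteq> 0 \<and> Re (left_logderiv s) < - B \<and>
          (\<exists>L'. (left_logderiv has_field_derivative L') (at s) \<and> norm L' \<le> d)" if s: "Re s \<le> -K" for s
  proof (intro conjI exI)
    let ?Q = "\<lambda>s. deriv zeta s / zeta s"
    have Re1: "Re (1 - s) \<ge> K1" "Re (1 - s) \<ge> K2" "Re (1 - s) \<ge> 3 + 2 / d" using s K by auto
    show nz: "zeta (1 - s) \<noteq> 0" using K1(2) Re1 by blast
    have "Re (?Q (1 - s)) \<ge> - d'" using K1(3)[OF Re1(1)] abs_Re_le_cmod[of "?Q (1 - s)"] by linarith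
    moreover have "Re (Digamma (1 - s)) \<ge> B + ln (2 * pi) + 2"
      using Re_Digamma_ge[of "1 - s"] K2(2)[OF Re1(2)] Re1 K2(1) by fastforce
    moreover have "Ln (2 * of_real pi) = complex_of_real (ln (2 * pi))"
      using Ln_of_real[of "2 * pi"] by simp
    moreover have "d' \<le> 1" by (simp add: d'_def)
    ultimately show "Re (left_logderiv s) < - B" unfolding left_logderiv_def by simp
    have hQ: "?Q holomorphic_on - {1} \<inter> {s. zeta s \<noteq> 0}"
      by (intro holomorphic_intros holomorphic_on_subset[OF holomorphic_zeta] holomorphic_on_subset[OF holomorphic_deriv[OF holomorphic_zeta]])
         (auto simp: open_Compl)
    have op: "open (- {1} \<inter> {s. zeta s \<noteq> 0})"
      using continuous_open_preimage[OF holomorphic_on_imp_continuous_on[OF holomorphic_zeta], of "- {0}"]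
      by (simp add: vimage_def open_Compl Collect_neg_eq [symmetric] Int_def)
    have s1: "1 - s \<noteq> 1" using s K by auto
    have dQ: "(?Q has_field_derivative deriv ?Q (1 - s)) (at (1 - s))"
      by (rule holomorphic_derivI[OF hQ op]) (use nz s1 in auto)
    have np: "1 - s \<notin> \<int>\<^sub>\<le>\<^sub>0" using s K(4) by (intro one_minus_notin_nonpos_Ints) linarith
    have dD: "(Digamma has_field_derivative Polygamma 1 (1 - s)) (at (1 - s))"
      using has_field_derivative_Polygamma[of "1 - s" 0 UNIV] np by simp
    have i: "((\<lambda>w. 1 - w) has_field_derivative - 1) (at s)" by (auto intro!: derivative_eq_intros)
    show "(left_logderiv has_field_derivative 0 - Polygamma 1 (1 - s) * (- 1) - deriv ?Q (1 - s) * (- 1)) (at s)"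
      unfolding left_logderiv_def[abs_def] by (intro DERIV_diff DERIV_const DERIV_chain2[where g = "\<lambda>w. 1 - w", OF dD i] DERIV_chain2[where g = "\<lambda>w. 1 - w", OF dQ i])
    have sneg: "Re s < 0" using s K(4) by linarith
    have "norm (Polygamma 1 (1 - s)) \<le> 1 / (Re (1 - s) - 1)" using sneg by (intro norm_Polygamma_1_le) simp
    also have "\<dots> \<le> 1 / (2 / d)"
    proof (intro divide_left_mono mult_pos_pos)
      show "2 / d \<le> Re (1 - s) - 1" using Re1(3) by linarith
      show "0 < Re (1 - s) - 1" using sneg by simp
    qed (use d in auto)
    also have "\<dots> = d / 2" by simp
    finally have P: "norm (Polygamma 1 (1 - s)) \<le> d / 2" .
    have "norm (deriv ?Q (1 - s)) \<le> d / 2" using K1(4)[OF Re1(1)] by (simp add: d'_def)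
    with P show "norm (0 - Polygamma 1 (1 - s) * (- 1) - deriv ?Q (1 - s) * (- 1)) \<le> d"
      using norm_triangle_ineq[of "Polygamma 1 (1 - s)" "deriv ?Q (1 - s)"] by simp
  qed
  thus ?thesis using K(4) by blast
qed

lemma cnj_deriv_zeta: "s \<noteq> 1 \<Longrightarrow> cnj (deriv zeta s) = deriv zeta (cnj s)"
proof -
  assume s: "s \<noteq> 1"
  have "(zeta has_field_derivative deriv zeta s) (at (cnj (cnj s)))" using zeta_field_derivative[OF s] by simp
  hence "(cnj \<circ> zeta \<circ> cnj has_field_derivative cnj (deriv zeta s)) (at (cnj s))"
    by (rule has_field_derivative_cnj_cnj)
  moreover have "cnj \<circ> zeta \<circ> cnj = zeta" by (auto simp: fun_eq_iff cnj_zeta)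
  ultimately show ?thesis by (metis DERIV_imp_deriv)
qed

lemma Im_left_logderiv_of_real:
  assumes "x < 0"
  shows "Im (left_logderiv (of_real x)) = 0"
proof -
  have "1 - complex_of_real x = of_real (1 - x)" by simp
  hence "Digamma (1 - complex_of_real x) = of_real (Digamma (1 - x))"
    using Polygamma_of_real[of "1 - x" 0, where 'a = complex] assms by simp
  moreover have "Ln (2 * of_real pi) = complex_of_real (ln (2 * pi))" using Ln_of_real[of "2 * pi"] by simp
  moreover have "cnj (deriv zeta (1 - of_real x)) = deriv zeta (1 - of_real x)"
    using assms by (subst cnj_deriv_zeta) auto
  hence "deriv zeta (1 - of_real x) \<in> \<real>" by (simp add: Reals_cnj_iff)
  moreover have "zeta (1 - of_real x) \<in> \<real>" by (simp add: Reals_cnj_iff cnj_zeta)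
  ultimately have "left_logderiv (of_real x) \<in> \<real>" unfolding left_logderiv_def by (metis Reals_diff Reals_divide Reals_of_real)
  thus ?thesis by (simp add: complex_is_Real_iff)
qed

text \<open>With z = pi s / 2, a zero means (pi/2) cos z = - L sin z. Away from the real axis |cos
  z| is comparable to |sin z|, which forces |L| \<le> pi. Near the axis the imaginary parts are
  compared: L is real on the axis and varies too slowly to match the cotangent.\<close>

lemma no_nonreal_zeros_left: "\<exists>K\<ge>2. \<forall>s. Re s \<le> -K \<and> deriv zeta s = 0 \<longrightarrow> Im s = 0"
proof -
  \<comment> \<open>For |Im s| < 1 the imaginary part v of z has |v| \<le> 2, so d cosh v \<le> 1;
    this is the slack used at the end.\<close>
  define d :: real where "d = 1 / cosh 2"
  have d: "d > 0" by (simp add: d_def)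
  obtain K where K: "K \<ge> 2" "\<And>s. Re s \<le> -K \<Longrightarrow> zeta (1 - s) \<noteq> 0" "\<And>s. Re s \<le> -K \<Longrightarrow> Re (left_logderiv s) < - pi"
     "\<And>s. Re s \<le> -K \<Longrightarrow> \<exists>L'. (left_logderiv has_field_derivative L') (at s) \<and> norm L' \<le> d"
    using left_half_plane_facts[OF d, of pi] by metis
  have False if s: "Re s \<le> -K" "deriv zeta s = 0" and y: "Im s \<noteq> 0" for s
  proof -
    define L where "L = left_logderiv s"
    define z where "z = of_real pi * s / 2"
    define x where "x = Re z" define v where "v = Im z"
    have v: "v = pi * Im s / 2" by (simp add: v_def z_def)
    have "zeta_factor s * zeta (1 - s) \<noteq> 0" using K(1,2) s zeta_factor_nonzero[of s] by auto
    moreover have "deriv zeta s = zeta_factor s * zeta (1 - s) * left_factor s"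
      using s K(1,2) by (intro deriv_zeta_left) auto
    ultimately have "left_factor s = 0" using s by simp
    hence eq: "of_real (pi / 2) * cos z = - L * sin z" by (simp add: left_factor_def L_def z_def eq_neg_iff_add_eq_0)
    define ch where "ch = cosh v" define sh where "sh = sinh v"
    have hyp: "ch\<^sup>2 = 1 + sh\<^sup>2" unfolding ch_def sh_def using cosh_square_eq[of v] by simp
    have ch: "ch > 0" by (simp add: ch_def)
    have c: "Re (cos z) = cos x * ch" "Im (cos z) = - sin x * sh" "Re (sin z) = sin x * ch" "Im (sin z) = cos x * sh"
      by (simp_all add: Re_cos Im_cos Re_sin Im_sin x_def v_def ch_def sh_def cosh_def sinh_def field_simps)
    have shv: "\<bar>v\<bar> \<le> \<bar>sh\<bar>" using real_le_abs_sinh[of v] by (simp add: sh_def sinh_def exp_minus)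
    have nS: "(norm (sin z))\<^sup>2 = ch\<^sup>2 - (cos x)\<^sup>2" "(norm (sin z))\<^sup>2 = (sin x)\<^sup>2 + sh\<^sup>2"
      unfolding cmod_power2 c power_mult_distrib hyp using sin_cos_squared_add[of x]
      by (simp_all add: algebra_simps) (simp_all add: sin_squared_eq algebra_simps)
    have nC: "(norm (cos z))\<^sup>2 = (cos x)\<^sup>2 + sh\<^sup>2"
      unfolding cmod_power2 c power_mult_distrib hyp by (simp add: sin_squared_eq algebra_simps)
    show False
    proof (cases "\<bar>Im s\<bar> \<ge> 1")
      case True
      have "1 \<le> \<bar>v\<bar>" using True pi_gt3 mult_mono[of 2 pi 1 "\<bar>Im s\<bar>"] by (simp add: v abs_mult)
      hence "1 \<le> \<bar>sh\<bar>" using shv by linarith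
      hence sh1: "1 \<le> sh\<^sup>2" by (metis abs_le_square_iff abs_one one_power2)
      have "(cos x)\<^sup>2 \<le> 1" by (simp add: abs_square_le_1)
      \<comment> \<open>|cos z|^2 \<le> 1 + sh^2 \<le> 2 sh^2 \<le> 2 |sin z|^2, as |sh| \<ge> 1
        here.\<close>
      hence le: "(norm (cos z))\<^sup>2 \<le> 2 * (norm (sin z))\<^sup>2" unfolding nC nS(2) distrib_left using sh1 zero_le_power2[of "sin x"] by linarith
      have S0: "(norm (sin z))\<^sup>2 > 0" unfolding nS(2) using sh1 zero_le_power2[of "sin x"] by linarith
      have "(norm L)\<^sup>2 * (norm (sin z))\<^sup>2 = (pi / 2)\<^sup>2 * (norm (cos z))\<^sup>2"
        using arg_cong[OF eq, of "\<lambda>w. (norm w)\<^sup>2"] by (simp add: norm_mult power_mult_distrib power_divide)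
      also have "\<dots> \<le> (pi / 2)\<^sup>2 * (2 * (norm (sin z))\<^sup>2)" using le by (intro mult_left_mono) auto
      finally have "(norm L)\<^sup>2 * (norm (sin z))\<^sup>2 \<le> (pi\<^sup>2 / 2) * (norm (sin z))\<^sup>2" by (simp add: power_divide)
      hence "(norm L)\<^sup>2 \<le> pi\<^sup>2 / 2" using S0 by (rule mult_right_le_imp_le)
      hence "(norm L)\<^sup>2 \<le> pi\<^sup>2" by (smt (verit) zero_le_power2 field_sum_of_halves)
      hence "norm L \<le> pi" by (rule power2_le_imp_le) auto
      moreover have "Re L < - pi" using K(3)[OF s(1)] by (simp add: L_def)
      ultimately show False using abs_Re_le_cmod[of L] by linarith
    next
      case False
      have ImL: "\<bar>Im L\<bar> \<le> d * \<bar>Im s\<bar>"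
      proof -
        have "norm (left_logderiv s - left_logderiv (of_real (Re s))) \<le> d * norm (s - of_real (Re s))"
        proof (rule field_differentiable_bound)
          show "convex {s. Re s \<le> -K}" by (rule convex_halfspace_Re_le)
          fix w assume w: "w \<in> {s. Re s \<le> -K}"
          then obtain L' where L': "(left_logderiv has_field_derivative L') (at w)" "norm L' \<le> d" using K(4) by auto
          moreover have "deriv left_logderiv w = L'" using L'(1) by (rule DERIV_imp_deriv)
          ultimately show "(left_logderiv has_field_derivative deriv left_logderiv w) (at w within {s. Re s \<le> -K})"
            "norm (deriv left_logderiv w) \<le> d" using has_field_derivative_at_within by auto
        qed (use s in auto)
        also have "s - of_real (Re s) = \<i> * of_real (Im s)" by (simp add: complex_eq_iff)
        also have "norm \<dots> = \<bar>Im s\<bar>" by (simp add: norm_mult)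
        finally have "norm (left_logderiv s - left_logderiv (of_real (Re s))) \<le> d * \<bar>Im s\<bar>" .
        moreover have "Im (left_logderiv s - left_logderiv (of_real (Re s))) = Im L"
          using Im_left_logderiv_of_real[of "Re s"] s K(1) by (simp add: L_def)
        ultimately show ?thesis using abs_Im_le_cmod[of "left_logderiv s - left_logderiv (of_real (Re s))"] by linarith
      qed
      \<comment> \<open>Multiplying by the conjugate of sin z isolates Im L: the imaginary part of
        cos z cnj (sin z) is - sinh v cosh v, whatever the real part of z.\<close>
      have "of_real (pi / 2) * cos z * cnj (sin z) = - L * of_real ((norm (sin z))\<^sup>2)"
        unfolding eq by (simp only: mult.assoc complex_norm_square)
      from arg_cong[OF this, of Im] have "(pi / 2) * (- (sin x * sh) * (sin x * ch) - cos x * ch * (cos x * sh)) = - Im L * (norm (sin z))\<^sup>2"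
        by (simp add: c algebra_simps)
      moreover have "- (sin x * sh) * (sin x * ch) - cos x * ch * (cos x * sh) = - (sh * ch)"
      proof -
        have "- (S * sh) * (S * ch) - C * ch * (C * sh) = - ((S\<^sup>2 + C\<^sup>2) * (sh * ch))" for S C :: real
          by (simp add: algebra_simps power2_eq_square)
        from this[of "sin x" "cos x"] show ?thesis by simp
      qed
      ultimately have "pi / 2 * (sh * ch) = Im L * (norm (sin z))\<^sup>2" by simp
      hence "\<bar>pi / 2 * (sh * ch)\<bar> = \<bar>Im L * (norm (sin z))\<^sup>2\<bar>" by (simp only:)
      moreover have "\<bar>pi / 2 * (sh * ch)\<bar> = pi / 2 * \<bar>sh\<bar> * ch" using ch by (simp add: abs_mult)
      moreover have "\<bar>Im L * (norm (sin z))\<^sup>2\<bar> = \<bar>Im L\<bar> * (norm (sin z))\<^sup>2" by (simp add: abs_mult)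
      ultimately have "pi / 2 * \<bar>sh\<bar> * ch = \<bar>Im L\<bar> * (norm (sin z))\<^sup>2" by (simp only:)
      also have "\<dots> \<le> \<bar>Im L\<bar> * ch\<^sup>2" unfolding nS(1) by (intro mult_left_mono) auto
      also have "\<dots> = \<bar>Im L\<bar> * ch * ch" by (simp add: power2_eq_square)
      finally have "pi / 2 * \<bar>sh\<bar> \<le> \<bar>Im L\<bar> * ch" using ch by (rule mult_right_le_imp_le)
      also have "\<dots> \<le> d * \<bar>Im s\<bar> * cosh 2"
      proof (intro mult_mono ImL)
        have "\<bar>v\<bar> \<le> 2" using False pi_less_4 mult_mono[of pi 4 "\<bar>Im s\<bar>" 1] by (simp add: v abs_mult)
        thus "ch \<le> cosh 2" unfolding ch_def using cosh_real_nonneg_le_iff[of "\<bar>v\<bar>" 2] by simp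
      qed (use ch d in auto)
      also have "\<dots> = \<bar>Im s\<bar>" by (simp add: d_def)
      finally have "pi / 2 * \<bar>sh\<bar> \<le> \<bar>Im s\<bar>" .
      moreover have "pi / 2 * \<bar>v\<bar> \<le> pi / 2 * \<bar>sh\<bar>" using shv by (intro mult_left_mono) auto
      moreover have "pi / 2 * \<bar>v\<bar> = pi\<^sup>2 / 4 * \<bar>Im s\<bar>" by (simp add: v abs_mult power2_eq_square)
      moreover have "3 * 3 \<le> pi * pi" using pi_gt3 by (intro mult_mono) auto
      hence "1 * \<bar>Im s\<bar> < pi\<^sup>2 / 4 * \<bar>Im s\<bar>" using y by (intro mult_strict_right_mono) (auto simp: power2_eq_square)
      ultimately show False by linarith
    qed
  qed
  thus ?thesis using K(1) by blast
qed

text \<open>On the axis \<open>left_factor\<close> is a real function T with T(-2m) = (-1)^m pi/2,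
  so sign changes give zeros. Between even integers T divided by the sine is (pi/2) cot + L. Its
  derivative, multiplied by the square of the sine, is at most - pi^2/4 + 1 < 0, so the zero is
  unique.\<close>

lemma real_zeros_left:
  "\<exists>N\<ge>1. \<forall>n\<ge>N. deriv zeta (of_real (- 2 * real n)) \<noteq> 0 \<and>
     (\<exists>a. - 2 * real n - 2 < a \<and> a < - 2 * real n \<and> deriv zeta (of_real a) = 0 \<and> deriv (deriv zeta) (of_real a) \<noteq> 0 \<and>
        (\<forall>b. - 2 * real n - 2 < b \<and> b < - 2 * real n \<and> deriv zeta (of_real b) = 0 \<longrightarrow> b = a))"
proof -
  obtain K where K: "K \<ge> 2" "\<And>s. Re s \<le> -K \<Longrightarrow> zeta (1 - s) \<noteq> 0"
     "\<And>s. Re s \<le> -K \<Longrightarrow> \<exists>L'. (left_logderiv has_field_derivative L') (at s) \<and> norm L' \<le> 1"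
    using left_half_plane_facts[OF zero_less_one, of pi] by metis
  define N where "N = nat \<lceil>K\<rceil> + 1"
  have N: "real N \<ge> K + 1" unfolding N_def by linarith
  define D where "D = deriv left_logderiv"
  have D: "(left_logderiv has_field_derivative D s) (at s)" "norm (D s) \<le> 1" if "Re s \<le> -K" for s
  proof -
    obtain L' where L': "(left_logderiv has_field_derivative L') (at s)" "norm L' \<le> 1" using K(3) \<open>Re s \<le> -K\<close> by auto
    have "D s = L'" unfolding D_def using L'(1) by (rule DERIV_imp_deriv)
    thus "(left_logderiv has_field_derivative D s) (at s)" "norm (D s) \<le> 1" using L' by auto
  qed
  have pi2: "pi\<^sup>2 / 4 > 1" using mult_mono[of 3 pi 3 pi] pi_gt3 by (simp add: power2_eq_square)
  have iff: "deriv zeta s = 0 \<longleftrightarrow> left_factor s = 0" if "Re s \<le> -K" for s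
    using that K(1,2) zeta_factor_nonzero[of s] deriv_zeta_left[of s] by auto
  define Lr where "Lr x = Re (left_logderiv (of_real x))" for x
  define T where "T x = pi / 2 * cos (pi * x / 2) + Lr x * sin (pi * x / 2)" for x
  define T' where "T' x = - (pi / 2)\<^sup>2 * sin (pi * x / 2) + Re (D (of_real x)) * sin (pi * x / 2) + Lr x * (pi / 2 * cos (pi * x / 2))" for x
  have T_eq: "left_factor (of_real x) = of_real (T x)" if "x \<le> -K" for x
  proof -
    have "left_logderiv (of_real x) = of_real (Lr x)"
      using Im_left_logderiv_of_real[of x] that K(1) by (simp add: Lr_def complex_eq_iff)
    moreover have "of_real pi * complex_of_real x / 2 = of_real (pi * x / 2)" by simp
    ultimately show ?thesis unfolding left_factor_def T_def
      by (simp only: cos_of_real sin_of_real) simp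
  qed
  have Lr': "(Lr has_field_derivative Re (D (of_real x))) (at x)" if "x \<le> -K" for x
  proof -
    have "((\<lambda>x. left_logderiv (of_real x)) has_vector_derivative D (of_real x)) (at x)"
      using D(1)[of "of_real x"] that by (intro has_vector_derivative_real_field) simp
    hence "((\<lambda>x. Re (left_logderiv (of_real x))) has_vector_derivative Re (D (of_real x))) (at x)"
      by (rule bounded_linear.has_vector_derivative[OF bounded_linear_Re])
    thus ?thesis by (simp add: Lr_def[abs_def] has_real_derivative_iff_has_vector_derivative)
  qed
  have T': "(T has_field_derivative T' x) (at x)" if "x \<le> -K" for x
    unfolding T_def[abs_def] T'_def
    by (rule derivative_eq_intros refl Lr'[OF that] | simp)+ (simp add: power2_eq_square algebra_simps)
  have key: "T' x * sin (pi * x / 2) - T x * (pi / 2 * cos (pi * x / 2)) < 0" if "x \<le> -K" for x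
  proof -
    have "(- p\<^sup>2 * S + d * S + L * (p * C)) * S - (p * C + L * S) * (p * C) = - p\<^sup>2 * (S\<^sup>2 + C\<^sup>2) + d * S\<^sup>2"
      for p S C d L :: real by (simp add: power2_eq_square algebra_simps)
    hence "T' x * sin (pi * x / 2) - T x * (pi / 2 * cos (pi * x / 2)) =
       - (pi / 2)\<^sup>2 * ((sin (pi * x / 2))\<^sup>2 + (cos (pi * x / 2))\<^sup>2) + Re (D (of_real x)) * (sin (pi * x / 2))\<^sup>2"
      unfolding T_def T'_def by blast
    also have "\<dots> = - (pi\<^sup>2 / 4) + Re (D (of_real x)) * (sin (pi * x / 2))\<^sup>2" by (simp add: power_divide)
    also have "Re (D (of_real x)) * (sin (pi * x / 2))\<^sup>2 \<le> 1 * 1"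
    proof (intro mult_mono)
      show "Re (D (of_real x)) \<le> 1" using D(2)[of "of_real x"] that complex_Re_le_cmod[of "D (of_real x)"] by simp
      show "(sin (pi * x / 2))\<^sup>2 \<le> 1" by (simp add: abs_square_le_1)
    qed auto
    finally show ?thesis using pi2 by simp
  qed
  have "deriv zeta (of_real (- 2 * real n)) \<noteq> 0 \<and>
     (\<exists>a. - 2 * real n - 2 < a \<and> a < - 2 * real n \<and> deriv zeta (of_real a) = 0 \<and> deriv (deriv zeta) (of_real a) \<noteq> 0 \<and>
        (\<forall>b. - 2 * real n - 2 < b \<and> b < - 2 * real n \<and> deriv zeta (of_real b) = 0 \<longrightarrow> b = a))" if n: "n \<ge> N" for n
  proof -
    have nK: "x \<le> -K" if "x \<le> - 2 * real n" for x using n N that by linarith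
    have zT: "deriv zeta (of_real x) = 0 \<longleftrightarrow> T x = 0" if "x \<le> - 2 * real n" for x
      using iff[of "of_real x"] T_eq[of x] nK[OF that] by simp
    have Tn: "T (- 2 * real m) = pi / 2 * (-1) ^ m" for m
    proof -
      have "pi * (- 2 * real m) / 2 = - (real m * pi)" by simp
      thus ?thesis unfolding T_def by (simp only: cos_minus sin_minus cos_npi sin_npi mult_zero_right minus_zero add_0_right)
    qed
    have sn: "sin (pi * x / 2) \<noteq> 0" if "- 2 * real n - 2 < x" "x < - 2 * real n" for x
    proof
      assume "sin (pi * x / 2) = 0"
      then obtain i :: int where "pi * x / 2 = of_int i * pi" by (auto simp: sin_zero_iff_int2)
      hence "x = 2 * of_int i" by (simp add: field_simps)
      hence "- real n - 1 < of_int i" "of_int i < - real n" using that by linarith+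
      hence "of_int (- int n - 1) < (of_int i :: real)" "of_int i < (of_int (- int n) :: real)" by simp_all
      hence "- int n - 1 < i" "i < - int n" unfolding of_int_less_iff .
      thus False by linarith
    qed
    have "continuous_on {- 2 * real n - 2 .. - 2 * real n} T"
    proof (rule DERIV_continuous_on)
      fix x assume "x \<in> {- 2 * real n - 2 .. - 2 * real n}"
      hence "x \<le> -K" by (intro nK) simp
      thus "(T has_field_derivative T' x) (at x within {- 2 * real n - 2 .. - 2 * real n})"
        by (rule has_field_derivative_at_within[OF T'])
    qed
    hence cont: "continuous_on {- 2 * real n - 2 .. - 2 * real n} (\<lambda>x. (-1) ^ n * T x)"
      by (rule continuous_on_mult_left)
    have "\<exists>x\<ge>- 2 * real n - 2. x \<le> - 2 * real n \<and> (-1) ^ n * T x = 0"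
    proof (rule IVT'[of "\<lambda>x. (-1) ^ n * T x" "- 2 * real n - 2" 0 "- 2 * real n", OF _ _ _ cont])
      have "- 2 * real n - 2 = - 2 * real (Suc n)" by simp
      hence "T (- 2 * real n - 2) = pi / 2 * (-1) ^ Suc n" by (simp only: Tn)
      hence "(-1) ^ n * T (- 2 * real n - 2) = - (pi / 2) * ((-1) ^ n * (-1) ^ n)" by simp
      also have "\<dots> = - (pi / 2)" by (simp flip: power_add)
      finally have "(-1) ^ n * T (- 2 * real n - 2) = - (pi / 2)" .
      thus "(-1) ^ n * T (- 2 * real n - 2) \<le> 0" using pi_ge_zero by linarith
      have "(-1) ^ n * T (- 2 * real n) = (pi / 2) * ((-1) ^ n * (-1) ^ n)" by (simp only: Tn) simp
      also have "\<dots> = pi / 2" by (simp flip: power_add)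
      finally have "(-1) ^ n * T (- 2 * real n) = pi / 2" .
      thus "0 \<le> (-1) ^ n * T (- 2 * real n)" using pi_ge_zero by linarith
    qed auto
    then obtain a where a: "- 2 * real n - 2 \<le> a" "a \<le> - 2 * real n" "T a = 0" by auto
    have ne: "T (- 2 * real n) \<noteq> 0" "T (- 2 * real n - 2) \<noteq> 0"
    proof -
      have Tnz: "T (- 2 * real m) \<noteq> 0" for m unfolding Tn by simp
      have e: "- 2 * real n - 2 = - 2 * real (Suc n)" by simp
      show "T (- 2 * real n) \<noteq> 0" "T (- 2 * real n - 2) \<noteq> 0" unfolding e by (rule Tnz)+
    qed
    have a': "- 2 * real n - 2 < a" "a < - 2 * real n" using a ne by (auto simp: less_le)
    have uniq: "False" if bc: "- 2 * real n - 2 < b" "b < c" "c < - 2 * real n" "T b = 0" "T c = 0" for b c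
    proof -
      have "T b / sin (pi * b / 2) > T c / sin (pi * c / 2)"
      proof (rule DERIV_neg_imp_decreasing[OF bc(2)])
        fix x assume x: "b \<le> x" "x \<le> c"
        have s0: "sin (pi * x / 2) \<noteq> 0" using x bc by (intro sn) auto
        have xK: "x \<le> -K" using x bc by (intro nK) auto
        have "((\<lambda>x. T x / sin (pi * x / 2)) has_field_derivative
          (T' x * sin (pi * x / 2) - T x * (cos (pi * x / 2) * (pi / 2))) / (sin (pi * x / 2) * sin (pi * x / 2))) (at x)"
          by (rule DERIV_divide[where g = "\<lambda>x. sin (pi * x / 2)", OF T'[OF xK] _ s0]) (auto intro!: derivative_eq_intros)
        moreover have "(T' x * sin (pi * x / 2) - T x * (cos (pi * x / 2) * (pi / 2))) / (sin (pi * x / 2) * sin (pi * x / 2)) < 0"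
          using key[OF xK] s0 by (intro divide_neg_pos) (auto simp: mult_ac zero_less_mult_iff linorder_neq_iff)
        ultimately show "\<exists>y. ((\<lambda>x. T x / sin (pi * x / 2)) has_field_derivative y) (at x) \<and> y < 0" by blast
      qed
      thus False using bc by simp
    qed
    have "b = a" if "- 2 * real n - 2 < b" "b < - 2 * real n" "deriv zeta (of_real b) = 0" for b
      using uniq[of a b] uniq[of b a] that a a' zT[of b] by (cases b a rule: linorder_cases) auto
    moreover have "deriv (deriv zeta) (of_real a) \<noteq> 0"
    proof -
      let ?a = "complex_of_real a" and ?X = "\<lambda>s. zeta_factor s * zeta (1 - s)"
      have aK: "Re ?a \<le> -K" using nK[OF a(2)] by simp
      have aK': "Re ?a < -K + 1" using aK by simp
      define U where "U = {s. Re s < -K} "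
      have aU: "?a \<in> U" using a' n N by (simp add: U_def)
      have U: "open U" unfolding U_def by (rule open_halfspace_Re_lt)
      have Xh: "?X holomorphic_on U"
        using K(1) by (intro holomorphic_intros holomorphic_on_subset[OF holomorphic_zeta_factor]
            holomorphic_on_compose_gen[OF _ holomorphic_zeta, unfolded o_def]) (auto simp: U_def)
      have dX: "(?X has_field_derivative deriv ?X ?a) (at ?a)" by (rule holomorphic_derivI[OF Xh U aU])
      define z where "z = of_real pi * ?a / 2"
      define E where "E = - (of_real pi / 2)\<^sup>2 * sin z + (D ?a * sin z + left_logderiv ?a * (of_real pi / 2 * cos z))"
      have dF: "(left_factor has_field_derivative E) (at ?a)"
        unfolding left_factor_def[abs_def] E_def z_def
        by (rule derivative_eq_intros refl D(1)[OF aK] | simp)+ (simp add: power2_eq_square algebra_simps)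
      have F0: "left_factor ?a = 0" using T_eq[of a] a nK[OF a(2)] by simp
      have "((\<lambda>s. ?X s * left_factor s) has_field_derivative deriv ?X ?a * left_factor ?a + E * ?X ?a) (at ?a)"
        by (rule DERIV_mult[OF dX dF])
      hence "(deriv zeta has_field_derivative deriv ?X ?a * left_factor ?a + E * ?X ?a) (at ?a)"
        by (rule has_field_derivative_transform_within_open[OF _ U aU])
           (use K in \<open>auto simp: U_def intro!: deriv_zeta_left [symmetric]\<close>)
      hence "deriv (deriv zeta) ?a = E * ?X ?a" using F0 by (simp add: DERIV_imp_deriv)
      moreover have "?X ?a \<noteq> 0" using K(1) K(2)[of ?a] zeta_factor_nonzero[of ?a] aK by auto
      \<comment> \<open>Simplicity follows from the identity behind monotonicity, now over the
        complex numbers: at a zero, E sin z = - pi^2/4 + D sin^2 z, which is nonzero since |D| \<le>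
        1.\<close>
      moreover have "E \<noteq> 0"
      proof
        assume "E = 0"
        have zr: "z = of_real (pi * a / 2)" by (simp add: z_def)
        have "(- p\<^sup>2 * S + (d * S + L * (p * C))) * S - (p * C + L * S) * (p * C) = - p\<^sup>2 * (S\<^sup>2 + C\<^sup>2) + d * S\<^sup>2"
          for p S C d L :: complex by (simp add: power2_eq_square algebra_simps)
        hence "E * sin z - left_factor ?a * (of_real pi / 2 * cos z) =
          - (of_real pi / 2)\<^sup>2 * ((sin z)\<^sup>2 + (cos z)\<^sup>2) + D ?a * (sin z)\<^sup>2"
          unfolding E_def left_factor_def z_def by blast
        hence "of_real (pi\<^sup>2 / 4) = D ?a * (sin z)\<^sup>2" using \<open>E = 0\<close> F0 by (simp add: power_divide)
        hence "norm (complex_of_real (pi\<^sup>2 / 4)) = norm (D ?a) * (norm (sin z))\<^sup>2" by (simp only: norm_mult norm_power)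
        also have "\<dots> \<le> 1 * 1"
        proof (intro mult_mono D(2)[OF aK])
          have "norm (sin z) = \<bar>sin (pi * a / 2)\<bar>" unfolding zr sin_of_real by simp
          thus "(norm (sin z))\<^sup>2 \<le> 1" by (simp add: abs_square_le_1)
        qed auto
        finally show False using pi2 by (simp only: norm_of_real)
      qed
      ultimately show ?thesis by simp
    qed
    moreover have "deriv zeta (of_real a) = 0" using zT[of a] a by simp
    moreover have "deriv zeta (of_real (- 2 * real n)) \<noteq> 0" using zT[of "- 2 * real n"] ne by simp
    ultimately show ?thesis using a' by blast
  qed
  moreover have "N \<ge> 1" by (simp add: N_def)
  ultimately show ?thesis by blast
qed

section \<open>Real analytic lifts of phases\<close>

text \<open>\<open>c\<close> is the embedding of the values of \<open>f\<close> into the complex numbers, that is \<open>of_real\<close> or \<open>id\<close>.\<close>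
definition locally_holomorphic_ext :: "(real \<Rightarrow> 'a::{real_normed_vector}) \<Rightarrow> ('a \<Rightarrow> complex) \<Rightarrow> bool" where
  "locally_holomorphic_ext f c \<longleftrightarrow> (\<forall>x0. \<exists>r>0. \<exists>F. F holomorphic_on ball (of_real x0) r \<and>
      (\<forall>x. \<bar>x - x0\<bar> < r \<longrightarrow> c (f x) = F (of_real x)))"

lemma real_analyticI:
  assumes "locally_holomorphic_ext f complex_of_real"
  shows "real_analytic f"
  unfolding real_analytic_def
proof
  fix x0
  obtain r F where F: "r > 0" "F holomorphic_on ball (of_real x0) r" "\<And>x. \<bar>x - x0\<bar> < r \<Longrightarrow> complex_of_real (f x) = F (of_real x)"
    using assms unfolding locally_holomorphic_ext_def by metis
  define a where "a n = Re ((deriv ^^ n) F (of_real x0) / fact n)" for n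
  have "(\<lambda>n. a n * (x - x0) ^ n) sums f x" if x: "\<bar>x - x0\<bar> < r" for x
  proof -
    have "norm (complex_of_real x0 - of_real x) = \<bar>x - x0\<bar>" by (metis norm_minus_commute norm_of_real of_real_diff)
    hence "complex_of_real x \<in> ball (of_real x0) r" using x by (simp add: dist_norm)
    from holomorphic_power_series[OF F(2) this]
    have "(\<lambda>n. Re ((deriv ^^ n) F (of_real x0) / fact n * (of_real x - of_real x0) ^ n)) sums Re (F (of_real x))"
      by (rule sums_Re)
    moreover have "Re (c * (complex_of_real x - of_real x0) ^ n) = Re c * (x - x0) ^ n" for c n
      by (simp flip: of_real_diff of_real_power)
    moreover have "Re (F (of_real x)) = f x" using F(3)[OF x] by (metis Re_complex_of_real)
    ultimately show ?thesis unfolding a_def by (simp only:)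
  qed
  thus "\<exists>r>0. \<exists>a. \<forall>x. \<bar>x - x0\<bar> < r \<longrightarrow> (\<lambda>n. a n * (x - x0) ^ n) sums f x" using F(1) by blast
qed

lemma locally_holomorphic_ext_deriv:
  assumes "locally_holomorphic_ext f complex_of_real"
  shows "(f has_field_derivative deriv f x) (at x)" "isCont (deriv f) x"
proof -
  obtain r F where F: "r > 0" "F holomorphic_on ball (of_real x) r" "\<And>y. \<bar>y - x\<bar> < r \<Longrightarrow> complex_of_real (f y) = F (of_real y)"
    using assms unfolding locally_holomorphic_ext_def by metis
  have inb: "complex_of_real y \<in> ball (of_real x) r" if "\<bar>y - x\<bar> < r" for y
    using that by (metis dist_commute dist_norm mem_ball norm_of_real of_real_diff)
  have d: "(f has_field_derivative Re (deriv F (of_real y))) (at y)" if y: "\<bar>y - x\<bar> < r" for y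
  proof -
    have "(F has_field_derivative deriv F (of_real y)) (at (of_real y))" by (rule holomorphic_derivI[OF F(2) open_ball inb[OF y]])
    hence "((\<lambda>y. F (of_real y)) has_vector_derivative deriv F (of_real y)) (at y)" by (rule has_vector_derivative_real_field)
    hence "((\<lambda>y. Re (F (of_real y))) has_vector_derivative Re (deriv F (of_real y))) (at y)"
      by (rule bounded_linear.has_vector_derivative[OF bounded_linear_Re])
    hence "((\<lambda>y. Re (F (of_real y))) has_field_derivative Re (deriv F (of_real y))) (at y)"
      by (simp add: has_real_derivative_iff_has_vector_derivative)
    thus ?thesis
    proof (rule has_field_derivative_transform_within_open[of _ _ _ "ball x r"])
      show "Re (F (of_real z)) = f z" if "z \<in> ball x r" for z
        using F(3)[of z] that by (metis Re_complex_of_real abs_minus_commute dist_real_def mem_ball)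
    qed (use y in \<open>auto simp: dist_real_def abs_minus_commute\<close>)
  qed
  show "(f has_field_derivative deriv f x) (at x)" using d[of x] F(1) DERIV_imp_deriv by fastforce
  have "deriv F holomorphic_on ball (of_real x) r" using F(2) by (intro holomorphic_deriv) auto
  hence "isCont (deriv F) (complex_of_real x)"
    using holomorphic_on_imp_continuous_on F(1) by (metis centre_in_ball continuous_on_eq_continuous_at open_ball)
  hence "isCont (\<lambda>y. deriv F (of_real y)) x"
    by (intro isCont_o2[where f = complex_of_real and g = "deriv F"]) auto
  hence c1: "isCont (\<lambda>y. Re (deriv F (of_real y))) x" by (rule bounded_linear.isCont[OF bounded_linear_Re])
  have ev: "\<forall>\<^sub>F y in nhds x. deriv f y = Re (deriv F (of_real y))"
  proof -
    have "\<forall>\<^sub>F y in nhds x. y \<in> ball x r" using F(1) by (intro eventually_nhds_in_open) auto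
    thus ?thesis by eventually_elim (rule DERIV_imp_deriv[OF d], simp add: dist_real_def abs_minus_commute)
  qed
  show "isCont (deriv f) x" using iffD2[OF isCont_cong[OF ev] c1] .
qed

lemma real_analytic_imp_continuous:
  assumes "real_analytic f"
  shows "continuous_on UNIV f"
proof (intro continuous_at_imp_continuous_on ballI)
  fix x0 :: real
  obtain r a where r: "r > 0" and a: "\<And>x. \<bar>x - x0\<bar> < r \<Longrightarrow> (\<lambda>n. a n * (x - x0) ^ n) sums f x"
    using assms unfolding real_analytic_def by metis
  have "summable (\<lambda>n. a n * (r / 2) ^ n)" using a[of "x0 + r / 2"] r by (auto simp: sums_iff)
  hence c0: "isCont (\<lambda>y. \<Sum>n. a n * y ^ n) 0" by (rule isCont_powser) (use r in auto)
  have c1: "isCont (\<lambda>x. \<Sum>n. a n * (x - x0) ^ n) x0"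
    by (rule isCont_o2[where f = "\<lambda>x. x - x0" and g = "\<lambda>y. \<Sum>n. a n * y ^ n"]) (use c0 in auto)
  have ev: "\<forall>\<^sub>F x in nhds x0. (\<Sum>n. a n * (x - x0) ^ n) = f x"
  proof -
    have "\<forall>\<^sub>F y in nhds x0. y \<in> ball x0 r" using r by (intro eventually_nhds_in_open) auto
    thus ?thesis by eventually_elim (use a in \<open>auto simp: sums_iff dist_real_def abs_minus_commute\<close>)
  qed
  show "isCont f x0" using iffD1[OF isCont_cong[OF ev] c1] .
qed

text \<open>Distinct logarithms of 1 are at least 2 pi apart, so a continuous choice on a connected
  set cannot move.\<close>

lemma continuous_phase_constant:
  fixes g :: "real \<Rightarrow> complex"
  assumes "connected S" "continuous_on S g" "\<And>x. x \<in> S \<Longrightarrow> exp (g x) = 1" "x \<in> S" "y \<in> S"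
  shows "g x = g y"
proof -
  have "g constant_on S"
  proof (rule continuous_discrete_range_constant[OF assms(1,2)])
    fix x assume x: "x \<in> S"
    show "\<exists>e>0. \<forall>y. y \<in> S \<and> g y \<noteq> g x \<longrightarrow> e \<le> norm (g y - g x)"
    proof (intro exI[of _ "2 * pi"] conjI allI impI)
      fix y assume y: "y \<in> S \<and> g y \<noteq> g x"
      have "exp (g y - g x) = 1" using assms(3) x y by (simp add: exp_diff)
      then obtain n :: int where n: "Re (g y - g x) = 0" "Im (g y - g x) = of_int (2 * n) * pi"
        by (auto simp: exp_eq_1)
      have "n \<noteq> 0" using y n by (auto simp: complex_eq_iff)
      hence "1 \<le> \<bar>n\<bar>" by linarith
      hence "1 \<le> \<bar>of_int n :: real\<bar>" by (metis of_int_1_le_iff of_int_abs)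
      hence "2 * pi * 1 \<le> 2 * pi * \<bar>of_int n\<bar>" by (intro mult_left_mono) auto
      also have "\<dots> = \<bar>Im (g y - g x)\<bar>" unfolding n by (simp add: abs_mult)
      also have "\<dots> \<le> norm (g y - g x)" by (rule abs_Im_le_cmod)
      finally show "2 * pi \<le> norm (g y - g x)" by simp
    qed auto
  qed
  thus ?thesis using assms(4,5) by (auto simp: constant_on_def)
qed

text \<open>The uniqueness half of both definite descriptions: c = 1 for \<theta> and c = 2 pi for
  \<kappa>.\<close>

lemma real_phase_unique:
  fixes k k' :: "real \<Rightarrow> real"
  assumes "continuous_on UNIV k" "continuous_on UNIV k'" "k 0 = k' 0" "c \<noteq> 0"
    and "\<And>t. exp (\<i> * of_real (c * k t)) = exp (\<i> * of_real (c * k' t))"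
  shows "k = k'"
proof
  fix t
  have "(\<lambda>t. \<i> * of_real (c * (k t - k' t))) t = (\<lambda>t. \<i> * of_real (c * (k t - k' t))) 0"
  proof (rule continuous_phase_constant[of UNIV "\<lambda>t. \<i> * of_real (c * (k t - k' t))" t 0])
    show "continuous_on UNIV (\<lambda>t. \<i> * complex_of_real (c * (k t - k' t)))"
      by (intro continuous_intros assms)
    show "exp (\<i> * complex_of_real (c * (k x - k' x))) = 1" for x
      using assms(5)[of x] by (simp add: algebra_simps exp_diff)
  qed auto
  thus "k t = k' t" using assms(3,4) by simp
qed

text \<open>A continuous logarithm exists globally since the line is contractible. Locally it
  differs by a constant from a logarithm of the holomorphic extension, so it inherits
  analyticity.\<close>

lemma unimodular_lift:
  fixes u :: "real \<Rightarrow> complex"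
  assumes u: "locally_holomorphic_ext u id" and norm: "\<And>t. norm (u t) = 1" and u0: "u 0 = -1"
  obtains k where "locally_holomorphic_ext k complex_of_real" "k 0 = - (1/2)"
    "\<And>t. exp (2 * of_real pi * \<i> * of_real (k t)) = u t"
proof -
  have contu: "continuous_on UNIV u"
  proof (intro continuous_at_imp_continuous_on ballI)
    fix x :: real
    obtain r F where F: "r > 0" "F holomorphic_on ball (of_real x) r" "\<And>y. \<bar>y - x\<bar> < r \<Longrightarrow> u y = F (of_real y)"
      using u unfolding locally_holomorphic_ext_def id_def by metis
    have "isCont F (complex_of_real x)"
      using holomorphic_on_imp_continuous_on[OF F(2)] F(1) by (metis centre_in_ball continuous_on_eq_continuous_at open_ball)
    hence c1: "isCont (\<lambda>y. F (of_real y)) x" by (intro isCont_o2[where f = complex_of_real and g = F]) auto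
    have ev: "\<forall>\<^sub>F y in nhds x. F (of_real y) = u y"
    proof -
      have "\<forall>\<^sub>F y in nhds x. y \<in> ball x r" using F(1) by (intro eventually_nhds_in_open) auto
      thus ?thesis by eventually_elim (use F in \<open>auto simp: dist_real_def abs_minus_commute\<close>)
    qed
    show "isCont u x" using iffD1[OF isCont_cong[OF ev] c1] .
  qed
  have nz: "u t \<noteq> 0" for t using norm[of t] by auto
  obtain g where g: "continuous_on UNIV g" "\<And>t. u t = exp (g t)"
    using continuous_logarithm_on_contractible[OF contu convex_imp_contractible[OF convex_UNIV]] nz by (metis UNIV_I)
  have Reg: "Re (g t) = 0" for t using norm[of t] by (simp add: g(2) norm_exp_eq_Re)
  \<comment> \<open>The shift by -1/2 corresponds to u(0) = -1 = exp (- i pi) and fixes the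
    branch.\<close>
  define k where "k t = Im (g t - g 0) / (2 * pi) - 1/2" for t
  have contk: "continuous_on UNIV k" unfolding k_def by (intro continuous_intros g) auto
  have expk: "exp (2 * of_real pi * \<i> * of_real (k t)) = u t" for t
  proof -
    have "2 * of_real pi * \<i> * of_real (k t) = g t - g 0 - \<i> * of_real pi"
      using Reg by (simp add: complex_eq_iff k_def field_simps)
    also have "exp \<dots> = u t / u 0 / exp (\<i> * of_real pi)" by (simp only: exp_diff g(2))
    also have "\<dots> = u t" by (simp add: u0)
    finally show ?thesis .
  qed
  have "locally_holomorphic_ext k complex_of_real"
    unfolding locally_holomorphic_ext_def
  proof
    fix x :: real
    obtain r F where F: "r > 0" "F holomorphic_on ball (of_real x) r" "\<And>y. \<bar>y - x\<bar> < r \<Longrightarrow> u y = F (of_real y)"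
      using u unfolding locally_holomorphic_ext_def id_def by metis
    have "F (of_real x) \<noteq> 0" using F(1) F(3)[of x] nz[of x] by simp
    moreover have "isCont F (complex_of_real x)"
      using holomorphic_on_imp_continuous_on[OF F(2)] F(1) by (metis centre_in_ball continuous_on_eq_continuous_at open_ball)
    ultimately obtain e where e: "e > 0" "\<And>z. dist (complex_of_real x) z < e \<Longrightarrow> F z \<noteq> 0"
      using continuous_at_avoid by blast
    define q where "q = min r e"
    have q: "q > 0" "q \<le> r" "q \<le> e" using F(1) e(1) by (auto simp: q_def)
    obtain h where h: "h holomorphic_on ball (of_real x) q" "\<And>z. z \<in> ball (of_real x) q \<Longrightarrow> exp (h z) = F z"
    proof (rule holomorphic_logarithm_exists[of "ball (of_real x) q" F "of_real x"])
      show "F holomorphic_on ball (complex_of_real x) q" using F(2) by (rule holomorphic_on_subset) (use q in auto)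
    qed (use e q in auto)
    have inb: "complex_of_real y \<in> ball (of_real x) q \<longleftrightarrow> y \<in> ball x q" for y
      by (metis dist_norm dist_real_def mem_ball norm_of_real of_real_diff)
    \<comment> \<open>The difference of two logarithms of u on the interval, hence constant.\<close>
    define d where "d y = h (of_real y) - 2 * of_real pi * \<i> * of_real (k y)" for y
    have dc: "d y = d x" if "y \<in> ball x q" for y
    proof (rule continuous_phase_constant)
      show "continuous_on (ball x q) d"
        unfolding d_def using inb
        by (intro continuous_intros continuous_on_compose2[OF holomorphic_on_imp_continuous_on[OF h(1)]] continuous_on_subset[OF contk]) auto
      show "exp (d y) = 1" if y: "y \<in> ball x q" for y
      proof -
        have "exp (h (of_real y)) = u y" using h(2) inb[of y] y F(3)[of y] q by (auto simp: dist_real_def abs_minus_commute)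
        thus ?thesis using nz by (simp add: d_def exp_diff expk)
      qed
    qed (use that q in auto)
    have "complex_of_real (k y) = (h (of_real y) - d x) / (2 * of_real pi * \<i>)" if "\<bar>y - x\<bar> < q" for y
      using dc[of y] that by (simp add: d_def[of y] dist_real_def abs_minus_commute field_simps)
    moreover have "(\<lambda>z. (h z - d x) / (2 * of_real pi * \<i>)) holomorphic_on ball (of_real x) q"
      by (intro holomorphic_intros h) auto
    ultimately show "\<exists>r>0. \<exists>F. F holomorphic_on ball (of_real x) r \<and> (\<forall>y. \<bar>y - x\<bar> < r \<longrightarrow> complex_of_real (k y) = F (of_real y))"
      using q(1) by (intro exI[of _ q] conjI exI[of _ "\<lambda>z. (h z - d x) / (2 * of_real pi * \<i>)"]) auto
  qed
  moreover have "k 0 = - (1/2)" by (simp add: k_def)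
  ultimately show ?thesis using that expk by blast
qed

section \<open>The Riemann--Siegel theta function\<close>

definition theta_lift :: "real \<Rightarrow> real" where
  "theta_lift t = Im (ln_Gamma (1/4 + \<i> * of_real t / 2)) - t / 2 * ln pi"

lemma cnj_Digamma: "cnj (Digamma z) = Digamma (cnj z)" if "z \<noteq> 0" for z :: complex
proof -
  have "(\<lambda>k. cnj (inverse (of_nat (Suc k)) - inverse (z + of_nat k))) sums cnj (Digamma z + euler_mascheroni)"
    using summable_Digamma[OF that] by (intro iffD2[OF sums_cnj]) (simp add: Digamma_def summable_sums)
  moreover have "(\<lambda>k. inverse (of_nat (Suc k)) - inverse (cnj z + of_nat k)) sums (Digamma (cnj z) + euler_mascheroni)"
    using summable_Digamma[of "cnj z"] that by (simp add: Digamma_def summable_sums)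
  moreover have "cnj (inverse (of_nat (Suc k)) - inverse (z + of_nat k)) = inverse (of_nat (Suc k)) - inverse (cnj z + of_nat k)" for k
    by simp
  ultimately have "cnj (Digamma z + euler_mascheroni) = Digamma (cnj z) + euler_mascheroni"
    using sums_unique2 by (metis (no_types, lifting) sums_cong)
  moreover have "cnj (euler_mascheroni :: complex) = euler_mascheroni"
    by (metis complex_cnj_complex_of_real of_real_euler_mascheroni)
  ultimately show ?thesis by simp
qed

text \<open>An imaginary part is not holomorphic. Analyticity comes from writing it as half the
  difference of ln_Gamma at 1/4 + i z / 2 and 1/4 - i z / 2, divided by i; the two are conjugate for
  real z, and both arguments stay in the right half-plane near the real axis.\<close>

lemma theta_lift_props:
  "real_analytic theta_lift" "theta_lift 0 = 0"
  "Gamma (1/4 + \<i> * of_real t / 2) = of_real (cmod (Gamma (1/4 + \<i> * of_real t / 2))) * exp (\<i> * of_real (theta_lift t + t / 2 * ln pi))"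
  "(theta_lift has_field_derivative Re (Digamma (1/4 + \<i> * of_real t / 2)) / 2 - ln pi / 2) (at t)"
proof -
  define g where "g z = ln_Gamma (1/4 + \<i> * z / 2)" for z :: complex
  have np: "1/4 + \<i> * z / 2 \<notin> \<real>\<^sub>\<le>\<^sub>0" if "\<bar>Im z\<bar> < 1/2" for z
    using that by (auto simp: complex_nonpos_Reals_iff)
  have Imb: "\<bar>Im z\<bar> < 1/4" if "z \<in> ball (of_real x) (1/4)" for z x
    using that abs_Im_le_cmod[of "z - of_real x"] by (auto simp: dist_norm norm_minus_commute)
  \<comment> \<open>Conjugation symmetry of ln_Gamma is verified on its approximating series, whose
    logarithms all have arguments off the negative axis, and then passed to the limit.\<close>
  have cg: "cnj (g z) = ln_Gamma (1/4 - \<i> * cnj z / 2)" if "\<bar>Im z\<bar> < 1/2" for z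
  proof -
    let ?w = "1/4 + \<i> * z / 2"
    have np': "?w \<notin> \<int>\<^sub>\<le>\<^sub>0" "cnj ?w \<notin> \<int>\<^sub>\<le>\<^sub>0" using that by (auto elim!: nonpos_Ints_cases simp: complex_eq_iff)
    have "ln_Gamma_series ?w \<longlonglongrightarrow> g z" unfolding g_def by (rule ln_Gamma_complex_LIMSEQ[OF np'(1)])
    hence lim: "(\<lambda>n. cnj (ln_Gamma_series ?w n)) \<longlonglongrightarrow> cnj (g z)" by (rule tendsto_cnj)
    have sym: "cnj (ln_Gamma_series ?w n) = ln_Gamma_series (cnj ?w) n" if "n \<ge> 1" for n
    proof -
      have 1: "?w / of_nat k + 1 \<notin> \<real>\<^sub>\<le>\<^sub>0" if "k \<ge> 1" for k
        using that \<open>\<bar>Im z\<bar> < 1/2\<close> by (auto simp: complex_nonpos_Reals_iff Re_divide_of_nat add_pos_nonneg not_le add_nonneg_pos divide_nonneg_pos)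
      have c1: "cnj (Ln ?w) = Ln (cnj ?w)" using np[OF \<open>\<bar>Im z\<bar> < 1/2\<close>] by (intro cnj_Ln)
      have c2: "cnj (Ln (?w / of_nat k + 1)) = Ln (cnj ?w / of_nat k + 1)" if "k \<in> {1..n}" for k
        using 1[of k] that by (subst cnj_Ln) auto
      have c3: "cnj (Ln (of_nat n)) = Ln (of_nat n)"
        using that by (subst cnj_Ln) (auto simp: complex_nonpos_Reals_iff)
      have S: "(\<Sum>k=1..n. cnj (Ln (?w / of_nat k + 1))) = (\<Sum>k=1..n. Ln (cnj ?w / of_nat k + 1))"
        by (intro sum.cong refl c2)
      show ?thesis
        by (simp only: ln_Gamma_series_def complex_cnj_diff complex_cnj_mult cnj_sum c1 c3 S complex_cnj_of_nat)
    qed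
    have "\<forall>\<^sub>F n in sequentially. cnj (ln_Gamma_series ?w n) = ln_Gamma_series (cnj ?w) n"
      using eventually_ge_at_top[of "1::nat"] by eventually_elim (rule sym)
    with lim have "ln_Gamma_series (cnj ?w) \<longlonglongrightarrow> cnj (g z)" by (rule Lim_transform_eventually)
    moreover have "ln_Gamma_series (cnj ?w) \<longlonglongrightarrow> ln_Gamma (cnj ?w)" by (rule ln_Gamma_complex_LIMSEQ[OF np'(2)])
    ultimately have "cnj (g z) = ln_Gamma (cnj ?w)" by (rule LIMSEQ_unique)
    thus ?thesis by simp
  qed
  show "theta_lift 0 = 0"
    using ln_Gamma_complex_of_real[of "1/4"] by (simp add: theta_lift_def)
  show "Gamma (1/4 + \<i> * of_real t / 2) = of_real (cmod (Gamma (1/4 + \<i> * of_real t / 2))) * exp (\<i> * of_real (theta_lift t + t / 2 * ln pi))"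
  proof -
    let ?w = "1/4 + \<i> * of_real t / 2"
    have "?w \<notin> \<int>\<^sub>\<le>\<^sub>0" by (auto elim!: nonpos_Ints_cases simp: complex_eq_iff)
    hence G: "Gamma ?w = exp (ln_Gamma ?w)" by (simp add: Gamma_complex_altdef)
    have "ln_Gamma ?w = of_real (Re (ln_Gamma ?w)) + \<i> * of_real (theta_lift t + t / 2 * ln pi)"
      by (simp add: theta_lift_def complex_eq_iff)
    hence "exp (ln_Gamma ?w) = exp (of_real (Re (ln_Gamma ?w))) * exp (\<i> * of_real (theta_lift t + t / 2 * ln pi))"
      by (metis exp_add)
    thus ?thesis unfolding G norm_exp_eq_Re by (simp only: exp_of_real)
  qed
  show "(theta_lift has_field_derivative Re (Digamma (1/4 + \<i> * of_real t / 2)) / 2 - ln pi / 2) (at t)"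
  proof -
    let ?w = "1/4 + \<i> * of_real t / 2"
    have i: "((\<lambda>z. 1/4 + \<i> * z / 2) has_field_derivative \<i> / 2) (at (of_real t))" by (auto intro!: derivative_eq_intros)
    have "(g has_field_derivative Digamma ?w * (\<i> / 2)) (at (of_real t))"
      unfolding g_def[abs_def] by (rule DERIV_chain2[where g = "\<lambda>z. 1/4 + \<i> * z / 2", OF has_field_derivative_ln_Gamma_complex i]) (auto simp: complex_nonpos_Reals_iff)
    hence "((\<lambda>x. g (of_real x)) has_vector_derivative Digamma ?w * (\<i> / 2)) (at t)" by (rule has_vector_derivative_real_field)
    hence "((\<lambda>x. Im (g (of_real x))) has_vector_derivative Im (Digamma ?w * (\<i> / 2))) (at t)"
      by (rule bounded_linear.has_vector_derivative[OF bounded_linear_Im])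
    hence "((\<lambda>x. Im (g (of_real x))) has_field_derivative Re (Digamma ?w) / 2) (at t)"
      by (simp add: has_real_derivative_iff_has_vector_derivative)
    moreover have "((\<lambda>t. t / 2 * ln pi) has_field_derivative ln pi / 2) (at t)"
      by (auto intro!: derivative_eq_intros)
    ultimately show ?thesis unfolding theta_lift_def[abs_def] g_def by (rule DERIV_diff)
  qed
  show "real_analytic theta_lift"
  proof (rule real_analyticI, unfold locally_holomorphic_ext_def, intro allI exI conjI impI)
    fix x :: real
    let ?F = "\<lambda>z. (ln_Gamma (1/4 + \<i> * z / 2) - ln_Gamma (1/4 - \<i> * z / 2)) / (2 * \<i>) - z / 2 * of_real (ln pi)"
    show "?F holomorphic_on ball (of_real x) (1/4)"
      using np Imb[of _ x] by (intro holomorphic_intros holomorphic_on_compose_gen[OF _ holomorphic_ln_Gamma[of "- \<real>\<^sub>\<le>\<^sub>0"], unfolded o_def])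
        (fastforce simp: complex_nonpos_Reals_iff)+
    fix y :: real assume "\<bar>y - x\<bar> < 1/4"
    have "g (of_real y) - cnj (g (of_real y)) = 2 * \<i> * of_real (Im (g (of_real y)))"
      by (simp add: complex_eq_iff)
    thus "complex_of_real (theta_lift y) = ?F (of_real y)"
      using cg[of "of_real y"] by (simp add: theta_lift_def g_def)
  qed auto
qed

lemma RS_theta_eq: "RS_theta = theta_lift"
  unfolding RS_theta_def
proof (rule the_equality)
  fix \<theta> assume \<theta>: "real_analytic \<theta> \<and> \<theta> 0 = 0 \<and> (\<forall>t. Gamma (1/4 + \<i> * of_real t / 2) =
          of_real (cmod (Gamma (1/4 + \<i> * of_real t / 2))) * exp (\<i> * of_real (\<theta> t + t / 2 * ln pi)))"
  show "\<theta> = theta_lift"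
  proof (rule real_phase_unique[of _ _ 1])
    fix t
    have "1/4 + \<i> * of_real t / 2 \<notin> \<int>\<^sub>\<le>\<^sub>0" by (auto elim!: nonpos_Ints_cases simp: complex_eq_iff)
    hence "complex_of_real (cmod (Gamma (1/4 + \<i> * of_real t / 2))) \<noteq> 0" by (simp add: Gamma_eq_zero_iff)
    moreover have "of_real (cmod (Gamma (1/4 + \<i> * of_real t / 2))) * exp (\<i> * of_real (\<theta> t + t / 2 * ln pi)) =
      of_real (cmod (Gamma (1/4 + \<i> * of_real t / 2))) * exp (\<i> * of_real (theta_lift t + t / 2 * ln pi))"
      using \<theta> theta_lift_props(3)[of t] by metis
    ultimately have "exp (\<i> * of_real (\<theta> t + t / 2 * ln pi)) = exp (\<i> * of_real (theta_lift t + t / 2 * ln pi))"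
      by (simp only: mult_left_cancel not_False_eq_True)
    hence "exp (\<i> * of_real (\<theta> t)) * exp (\<i> * of_real (t / 2 * ln pi)) = exp (\<i> * of_real (theta_lift t)) * exp (\<i> * of_real (t / 2 * ln pi))"
      by (simp only: of_real_add distrib_left exp_add)
    hence "exp (\<i> * of_real (\<theta> t)) = exp (\<i> * of_real (theta_lift t))" by (simp only: mult_right_cancel exp_not_eq_zero not_False_eq_True)
    thus "exp (\<i> * of_real (1 * \<theta> t)) = exp (\<i> * of_real (1 * theta_lift t))" by (simp only: mult_1)
  qed (use \<theta> theta_lift_props in \<open>auto intro: real_analytic_imp_continuous\<close>)
qed (use theta_lift_props in auto)

lemma deriv_RS_theta: "deriv RS_theta t = Re (Digamma (1/4 + \<i> * of_real t / 2)) / 2 - ln pi / 2"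
  unfolding RS_theta_eq by (rule DERIV_imp_deriv[OF theta_lift_props(4)])

section \<open>The phase of kappa on the critical line\<close>

text \<open>The archimedean factor pi^(-s/2) Gamma (s/2).\<close>

definition gam :: "complex \<Rightarrow> complex" where
  "gam s = exp (- (s / 2) * of_real (ln pi)) * Gamma (s / 2)"

definition gam_logderiv :: "complex \<Rightarrow> complex" where
  "gam_logderiv s = Digamma (s / 2) / 2 - of_real (ln pi) / 2"

lemma half_notin_nonpos_Ints: "Re s > 0 \<Longrightarrow> s / 2 \<notin> \<int>\<^sub>\<le>\<^sub>0"
  by (auto elim!: nonpos_Ints_cases simp: complex_eq_iff)

lemma gam_nonzero: "Re s > 0 \<Longrightarrow> gam s \<noteq> 0"
  using half_notin_nonpos_Ints[of s] by (simp add: gam_def Gamma_eq_zero_iff)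

lemma cnj_gam: "cnj (gam s) = gam (cnj s)"
  by (simp add: gam_def cnj_Gamma exp_cnj)

lemma cnj_gam_logderiv: "Re s > 0 \<Longrightarrow> cnj (gam_logderiv s) = gam_logderiv (cnj s)"
  using cnj_Digamma[of "s / 2"] by (cases "s = 0") (simp_all add: gam_logderiv_def)

lemma gam_field_derivative:
  assumes "Re s > 0"
  shows "(gam has_field_derivative gam s * gam_logderiv s) (at s)"
proof -
  have A: "((\<lambda>w. Gamma (w / 2)) has_field_derivative Gamma (s / 2) * Digamma (s / 2) * (1 / 2)) (at s)"
    by (rule DERIV_chain2[where g = "\<lambda>w. w / 2", OF has_field_derivative_Gamma[OF half_notin_nonpos_Ints[OF assms]]])
       (auto intro!: derivative_eq_intros)
  have B: "((\<lambda>w. exp (- (w / 2) * of_real (ln pi))) has_field_derivative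
      exp (- (s / 2) * of_real (ln pi)) * (- of_real (ln pi) / 2)) (at s)"
    by (auto intro!: derivative_eq_intros)
  from DERIV_mult[OF B A] show ?thesis unfolding gam_def[abs_def]
    by (rule DERIV_cong) (simp add: gam_logderiv_def algebra_simps)
qed

text \<open>Gamma reflection at s/2 removes the sine, Legendre duplication at (1 - s)/2 splits Gamma
  (1 - s), and the powers of 2 and pi cancel. This makes the functional equation symmetric.\<close>

lemma gam_reflection:
  assumes s: "0 < Re s" "Re s < 1"
  shows "gam s * zeta_factor s * sin (of_real pi * s / 2) = gam (1 - s)"
proof -
  define l2 lp where "l2 = complex_of_real (ln 2)" and "lp = complex_of_real (ln pi)"
  have np: "s / 2 \<notin> \<int>\<^sub>\<le>\<^sub>0" "1 - s / 2 \<notin> \<int>\<^sub>\<le>\<^sub>0" "(1 - s) / 2 \<notin> \<int>\<^sub>\<le>\<^sub>0" "(1 - s) / 2 + 1 / 2 \<notin> \<int>\<^sub>\<le>\<^sub>0"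
  proof -
    have *: "z \<notin> \<int>\<^sub>\<le>\<^sub>0" if "Re z > 0" for z :: complex using that by (auto elim!: nonpos_Ints_cases)
    show "s / 2 \<notin> \<int>\<^sub>\<le>\<^sub>0" "1 - s / 2 \<notin> \<int>\<^sub>\<le>\<^sub>0" "(1 - s) / 2 \<notin> \<int>\<^sub>\<le>\<^sub>0" "(1 - s) / 2 + 1 / 2 \<notin> \<int>\<^sub>\<le>\<^sub>0"
      by (rule *; use s in \<open>simp add: field_simps\<close>)+
  qed
  have sn: "sin (of_real pi * (s / 2)) \<noteq> 0"
  proof
    assume "sin (of_real pi * (s / 2)) = 0"
    then obtain n :: int where n: "of_real pi * (s / 2) = of_real (of_int n * pi)" by (auto simp: sin_eq_0)
    hence "s = of_int (2 * n)" by (simp add: field_simps)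
    hence "Re s = of_int (2 * n)" by simp
    hence "0 < (of_int (2 * n) :: real)" "(of_int (2 * n) :: real) < of_int 1" using s by auto
    hence "0 < 2 * n" "2 * n < 1" by (simp_all only: of_int_0_less_iff of_int_less_iff)
    thus False by linarith
  qed
  have refl: "Gamma (s / 2) * Gamma (1 - s / 2) = of_real pi / sin (of_real pi * (s / 2))" by (rule Gamma_reflection_complex)
  have dup: "Gamma ((1 - s) / 2) * Gamma ((1 - s) / 2 + 1 / 2) =
      exp ((1 - 2 * ((1 - s) / 2)) * of_real (ln 2)) * of_real (sqrt pi) * Gamma (2 * ((1 - s) / 2))"
    using np by (intro Gamma_legendre_duplication)
  have e1: "(1 - s) / 2 + 1 / 2 = 1 - s / 2" "2 * ((1 - s) / 2) = 1 - s" "1 - 2 * ((1 - s) / 2) = s" by (simp_all add: field_simps)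
  have sqp: "complex_of_real (sqrt pi) = exp (lp / 2)"
  proof -
    have "sqrt pi = exp (ln pi / 2)" by (simp add: ln_sqrt [symmetric] flip: ln_sqrt)
    thus ?thesis by (simp add: lp_def exp_of_real [symmetric] flip: exp_of_real)
  qed
  have pie: "complex_of_real pi = exp lp" by (simp add: lp_def exp_of_real)
  have pw: "(2 * complex_of_real pi) powr (s - 1) = exp ((s - 1) * (l2 + lp))"
  proof -
    have "Ln (2 * complex_of_real pi) = of_real (ln (2 * pi))" using Ln_of_real[of "2 * pi"] by simp
    also have "ln (2 * pi) = ln 2 + ln pi" by (simp add: ln_mult)
    finally show ?thesis by (simp add: powr_def l2_def lp_def)
  qed
  have two: "(2::complex) = exp l2" by (simp add: l2_def exp_of_real)
  define P Q where "P = Gamma (1 - s / 2)" and "Q = Gamma ((1 - s) / 2)"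
  have P0: "P \<noteq> 0" using np by (simp add: P_def Gamma_eq_zero_iff)
  have "Gamma (s / 2) * sin (of_real pi * s / 2) = exp lp / P"
  proof -
    have "Gamma (s / 2) = of_real pi / sin (of_real pi * (s / 2)) / P" using P0 by (simp only: refl [symmetric] P_def [symmetric]) simp
    thus ?thesis using sn by (simp add: pie)
  qed
  moreover have "Gamma (1 - s) = Q * P / (exp (s * l2) * exp (lp / 2))"
    using dup unfolding e1 sqp [symmetric] by (simp add: P_def Q_def l2_def field_simps)
  moreover have "gam s * zeta_factor s * sin (of_real pi * s / 2) =
     exp (- (s / 2) * lp) * (Gamma (s / 2) * sin (of_real pi * s / 2)) * (exp l2 * exp ((s - 1) * (l2 + lp))) * Gamma (1 - s)"
    unfolding gam_def zeta_factor_def pw lp_def [symmetric] by (simp add: two [symmetric])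
  ultimately have "gam s * zeta_factor s * sin (of_real pi * s / 2) =
     exp (- (s / 2) * lp) * (exp lp / P) * (exp l2 * exp ((s - 1) * (l2 + lp))) * (Q * P / (exp (s * l2) * exp (lp / 2)))"
    by simp
  also have "\<dots> = Q * (exp (- (s / 2) * lp) * exp lp * exp l2 * exp ((s - 1) * (l2 + lp)) * exp (- (s * l2)) * exp (- (lp / 2)))"
    using P0 by (simp add: exp_minus field_simps)
  also have "exp (- (s / 2) * lp) * exp lp * exp l2 * exp ((s - 1) * (l2 + lp)) * exp (- (s * l2)) * exp (- (lp / 2)) =
     exp (- (s / 2) * lp + lp + l2 + (s - 1) * (l2 + lp) + - (s * l2) + - (lp / 2))"
    by (simp only: exp_add)
  also have "- (s / 2) * lp + lp + l2 + (s - 1) * (l2 + lp) + - (s * l2) + - (lp / 2) = - ((1 - s) / 2) * lp"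
    by (simp add: field_simps)
  finally show ?thesis by (simp add: gam_def Q_def lp_def mult.commute)
qed

text \<open>On the critical line this symmetry makes \<open>\<Lambda> = gam * \<zeta>\<close> real and \<open>\<Lambda>'\<close> imaginary.\<close>
lemma completed_zeta_symmetric:
  assumes s: "0 < Re s" "Re s < 1"
  shows "gam s * zeta s = gam (1 - s) * zeta (1 - s)"
proof -
  have "zeta s = zeta_factor s * sin (of_real pi * s / 2) * zeta (1 - s)"
    using s by (intro zeta_functional_equation) auto
  hence "gam s * zeta s = (gam s * zeta_factor s * sin (of_real pi * s / 2)) * zeta (1 - s)" by (simp only: mult.assoc)
  thus ?thesis unfolding gam_reflection[OF s] .
qed

lemma completed_zeta_deriv_symmetric:
  assumes s: "0 < Re s" "Re s < 1"
  shows "gam s * (gam_logderiv s * zeta s + deriv zeta s) =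
         - (gam (1 - s) * (gam_logderiv (1 - s) * zeta (1 - s) + deriv zeta (1 - s)))"
proof -
  have d: "((\<lambda>s. gam s * zeta s) has_field_derivative gam s * (gam_logderiv s * zeta s + deriv zeta s)) (at s)"
    if "0 < Re s" "Re s < 1" for s
  proof -
    have "(zeta has_field_derivative deriv zeta s) (at s)" by (rule zeta_field_derivative) (use that in auto)
    from DERIV_mult[OF gam_field_derivative[OF that(1)] this] show ?thesis by (rule DERIV_cong) (simp add: algebra_simps)
  qed
  have "((\<lambda>s. gam (1 - s) * zeta (1 - s)) has_field_derivative
      gam (1 - s) * (gam_logderiv (1 - s) * zeta (1 - s) + deriv zeta (1 - s)) * (- 1)) (at s)"
    by (rule DERIV_chain2[where g = "\<lambda>s. 1 - s" and f = "\<lambda>s. gam s * zeta s", OF d]) (use s in \<open>auto intro!: derivative_eq_intros\<close>)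
  moreover have "((\<lambda>s. gam (1 - s) * zeta (1 - s)) has_field_derivative gam s * (gam_logderiv s * zeta s + deriv zeta s)) (at s)"
  proof (rule has_field_derivative_transform_within_open[OF d[OF s]])
    show "open ({s. 0 < Re s} \<inter> {s. Re s < 1})" by (intro open_Int open_halfspace_Re_gt open_halfspace_Re_lt)
    show "gam z * zeta z = gam (1 - z) * zeta (1 - z)" if "z \<in> {s. 0 < Re s} \<inter> {s. Re s < 1}" for z
      using that by (intro completed_zeta_symmetric) auto
  qed (use s in auto)
  ultimately show ?thesis using DERIV_unique by fastforce
qed

abbreviation crit :: "real \<Rightarrow> complex" where "crit t \<equiv> 1/2 + \<i> * of_real t"

lemma Re_gam_logderiv: "Re (gam_logderiv (crit t)) = deriv RS_theta t"
proof -
  have "crit t / 2 = 1/4 + \<i> * of_real t / 2" by (simp add: field_simps)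
  hence "gam_logderiv (crit t) = Digamma (1/4 + \<i> * of_real t / 2) / 2 - of_real (ln pi) / 2"
    by (simp only: gam_logderiv_def)
  thus ?thesis by (simp add: deriv_RS_theta)
qed

text \<open>With \<omega> the logarithmic derivative of \<open>gam\<close>, gam \<zeta>' =
  \<Lambda>' - \<omega> \<Lambda>. As \<Lambda> is real and \<Lambda>' imaginary, minus its
  conjugate is \<Lambda>' + cnj \<omega> \<Lambda>, and 2 Re \<omega> = 2 \<theta>'. The
  division-free form also speaks about zeros of \<zeta>'.\<close>

lemma critical_line_reflection:
  "gam (crit t) * (deriv zeta (crit t) + 2 * of_real (deriv RS_theta t) * zeta (crit t)) = - cnj (gam (crit t) * deriv zeta (crit t))"
proof -
  define s where "s = crit t"
  have s: "0 < Re s" "Re s < 1" "s \<noteq> 1" and c: "1 - s = cnj s" by (auto simp: s_def complex_eq_iff)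
  have L: "cnj (gam s * zeta s) = gam s * zeta s"
    using completed_zeta_symmetric[OF s(1,2)] unfolding c by (simp add: cnj_gam cnj_zeta)
  have L': "cnj (gam s * (gam_logderiv s * zeta s + deriv zeta s)) = - (gam s * (gam_logderiv s * zeta s + deriv zeta s))"
    using completed_zeta_deriv_symmetric[OF s(1,2)] s unfolding c
    by (simp add: cnj_gam cnj_zeta cnj_deriv_zeta cnj_gam_logderiv)
  define \<omega> Lm Ld where "\<omega> = gam_logderiv s" and "Lm = gam s * zeta s" and "Ld = gam s * (gam_logderiv s * zeta s + deriv zeta s)"
  have "gam s * deriv zeta s = Ld - \<omega> * Lm" by (simp add: Ld_def \<omega>_def Lm_def algebra_simps)
  moreover from this have "- cnj (gam s * deriv zeta s) = Ld + cnj \<omega> * Lm" using L L' by (simp add: Ld_def Lm_def)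
  moreover have "2 * complex_of_real (deriv RS_theta t) = \<omega> + cnj \<omega>"
    using Re_gam_logderiv[of t] by (simp add: \<omega>_def s_def complex_eq_iff)
  hence "gam s * (deriv zeta s + 2 * of_real (deriv RS_theta t) * zeta s) = gam s * deriv zeta s + (\<omega> + cnj \<omega>) * Lm"
    by (simp only: Lm_def) (simp add: algebra_simps)
  ultimately show ?thesis unfolding s_def [symmetric] by (simp add: algebra_simps)
qed

definition kappa_phase :: "real \<Rightarrow> complex" where
  "kappa_phase t = 1 + 2 * of_real (deriv RS_theta t) * (zeta (crit t) / deriv zeta (crit t))"

lemma kappa_phase_eq:
  assumes "deriv zeta (crit t) \<noteq> 0"
  shows "kappa_phase t = - cnj (gam (crit t) * deriv zeta (crit t)) / (gam (crit t) * deriv zeta (crit t))"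
proof -
  have "gam (crit t) \<noteq> 0" by (rule gam_nonzero) simp
  hence "kappa_phase t = gam (crit t) * (deriv zeta (crit t) + 2 * of_real (deriv RS_theta t) * zeta (crit t)) / (gam (crit t) * deriv zeta (crit t))"
    using assms by (simp add: kappa_phase_def field_simps)
  thus ?thesis by (simp only: critical_line_reflection)
qed

text \<open>Up to sign the phase is a quotient of conjugates; at a zero of \<zeta>' the convention
  for division by 0 makes it 1.\<close>

lemma norm_kappa_phase: "norm (kappa_phase t) = 1"
proof (cases "deriv zeta (crit t) = 0")
  case False
  moreover have "gam (crit t) \<noteq> 0" by (rule gam_nonzero) simp
  ultimately show ?thesis by (subst kappa_phase_eq) (auto simp: norm_divide norm_mult)
qed (simp add: kappa_phase_def)

section \<open>No zero of the derivative where the derivative of theta vanishes\<close>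

lemma pi_ge_3: "pi \<ge> 3"
  using sin_x_le_x[of "pi / 6"] by (simp add: sin_30)

text \<open>If pi were at least 16/5, then sin (8/15) \<le> sin (pi/6) = 1/2, contradicting the
  cubic Taylor polynomial.\<close>

lemma pi_less_16_div_5: "pi < 16 / 5"
proof (rule ccontr)
  assume "\<not> pi < 16 / 5"
  hence "sin (8 / 15) \<le> sin (pi / 6)" by (intro sin_monotone_2pi_le) auto
  moreover have "\<bar>sin (8 / 15) - (\<Sum>m<5. sin_coeff m * (8 / 15) ^ m)\<bar> \<le> inverse (fact 5) * \<bar>8 / 15 :: real\<bar> ^ 5"
    by (rule Maclaurin_sin_bound)
  moreover have "(\<Sum>m<5. sin_coeff m * (8 / 15 :: real) ^ m) = 8 / 15 - (8 / 15) ^ 3 / 6"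
  proof -
    have "{..<5::nat} = {0, 1, 2, 3, 4}" by auto
    thus ?thesis by (simp add: sin_coeff_def fact_numeral)
  qed
  moreover have "inverse (fact 5) * \<bar>8 / 15 :: real\<bar> ^ 5 \<le> 1 / 1000"
    by (simp add: fact_numeral power_numeral_reduce)
  moreover have "(8 / 15 :: real) - (8 / 15) ^ 3 / 6 > 101 / 200" by (simp add: power_numeral_reduce)
  ultimately show False by (simp add: sin_30)
qed

text \<open>The derivative of the left-hand function is 2 w^2 / (1 - w^2); for |w| \<le> 1/5 its
  denominator is at least 24/25, whence 25/12.\<close>

lemma norm_artanh_remainder_le:
  fixes w :: complex
  assumes "norm w \<le> 1 / 5"
  shows "norm (Ln (1 + w) - Ln (1 - w) - 2 * w) \<le> 25 / 12 * norm w ^ 3"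
proof -
  define f where "f w = Ln (1 + w) - Ln (1 - w) - 2 * w" for w :: complex
  define r where "r = norm w"
  have r: "r \<le> 1 / 5" "r \<ge> 0" using assms by (auto simp: r_def)
  have re: "1 + z \<notin> \<real>\<^sub>\<le>\<^sub>0" "1 - z \<notin> \<real>\<^sub>\<le>\<^sub>0" if "norm z \<le> r" for z :: complex
    using that r abs_Re_le_cmod[of z] by (auto simp: complex_nonpos_Reals_iff)
  have n1: "norm (1 - z\<^sup>2) \<ge> 24 / 25" if "norm z \<le> r" for z :: complex
  proof -
    have "norm z ^ 2 \<le> (1 / 5) ^ 2" using that r by (intro power_mono) auto
    thus ?thesis using norm_triangle_ineq2[of 1 "z\<^sup>2"] by (simp add: norm_power power_divide)
  qed
  have "norm (f w - f 0) \<le> (25 / 12 * r ^ 2) * norm (w - 0)"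
  proof (rule field_differentiable_bound[where S = "cball 0 r" and f' = "\<lambda>z. 2 * z\<^sup>2 / (1 - z\<^sup>2)"])
    fix z :: complex assume "z \<in> cball 0 r"
    hence z: "norm z \<le> r" by simp
    have nz: "1 + z \<noteq> 0" "1 - z \<noteq> 0" "1 - z\<^sup>2 \<noteq> 0" using re[OF z] n1[OF z] by auto
    have "(f has_field_derivative (inverse (1 + z) + inverse (1 - z) - 2)) (at z within cball 0 r)"
      unfolding f_def using re[OF z] by (auto intro!: derivative_eq_intros)
    moreover have "inverse (1 + z) + inverse (1 - z) - 2 = 2 * z\<^sup>2 / (1 - z\<^sup>2)"
      using nz by (simp add: field_simps power2_eq_square)
    ultimately show "(f has_field_derivative 2 * z\<^sup>2 / (1 - z\<^sup>2)) (at z within cball 0 r)" by simp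
    have "norm (2 * z\<^sup>2 / (1 - z\<^sup>2)) \<le> 2 * r ^ 2 / (24 / 25)"
      unfolding norm_divide norm_mult norm_power using n1[OF z] z by (intro frac_le mult_mono power_mono) auto
    thus "norm (2 * z\<^sup>2 / (1 - z\<^sup>2)) \<le> 25 / 12 * r ^ 2" by simp
  qed (use r in \<open>auto simp: r_def\<close>)
  thus ?thesis by (simp add: f_def r_def power_numeral_reduce)
qed

text \<open>Midpoint rule: 1 / (z + n) is compared with the increment of the logarithm from z + n -
  1/2 to z + n + 1/2. The increments telescope to ln |z - 1/2|, and the errors are summed with the
  bound for the sum of 1 / (n^2 + y^2).\<close>

lemma Re_Digamma_quarter_approx:
  assumes y: "y \<ge> 5 / 2"
  shows "\<bar>Re (Digamma (1/4 + \<i> * of_real y)) - ln (norm (-1/4 + \<i> * of_real y))\<bar> \<le> 25 / 96 * (1 / y ^ 3 + pi / (2 * y\<^sup>2))"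
proof -
  define z where "z = 1/4 + \<i> * of_real y"
  define zz where "zz n = z + of_nat n" for n
  define e where "e n = ln (norm (zz n + 1/2)) - ln (norm (zz n - 1/2)) - Re (inverse (zz n))" for n
  have z0: "z \<noteq> 0" using y by (auto simp: z_def complex_eq_iff)
  have zz: "zz n \<noteq> 0" "zz n - 1/2 \<noteq> 0" "zz n + 1/2 \<noteq> 0" for n using y by (auto simp: zz_def z_def complex_eq_iff)
  have nz: "norm (zz n) ^ 2 = (real n + 1/4)\<^sup>2 + y\<^sup>2" for n by (simp add: cmod_power2 zz_def z_def)
  have ny: "norm (zz n) \<ge> y" for n
    using abs_Im_le_cmod[of "zz n"] by (simp add: zz_def z_def)
  have e: "\<bar>e n\<bar> \<le> 25 / 96 * (1 / norm (zz n) ^ 3)" for n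
  proof -
    define w where "w = 1 / (2 * zz n)"
    have w: "norm w = 1 / (2 * norm (zz n))" by (simp add: w_def norm_divide norm_mult)
    \<comment> \<open>The hypothesis y \<ge> 5/2 is exactly what brings |w| down to 1/5.\<close>
    have "norm w \<le> 1 / (2 * (5/2))" unfolding w using ny[of n] y by (intro divide_left_mono mult_left_mono mult_pos_pos) auto
    hence w5: "norm w \<le> 1 / 5" by simp
    have nz: "1 + w \<noteq> 0" "1 - w \<noteq> 0" 
    proof -
      show "1 + w \<noteq> 0"
      proof
        assume "1 + w = 0"
        hence "w = - 1" by (simp add: add_eq_0_iff)
        thus False using w5 by simp
      qed
      show "1 - w \<noteq> 0" using w5 by auto
    qed
    have "zz n + 1/2 = zz n * (1 + w)" "zz n - 1/2 = zz n * (1 - w)" using zz(1)[of n] by (simp_all add: w_def field_simps)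
    hence "ln (norm (zz n + 1/2)) - ln (norm (zz n - 1/2)) = ln (norm (1 + w)) - ln (norm (1 - w))"
      using zz(1)[of n] nz by (simp add: norm_mult ln_mult)
    moreover have "Re (inverse (zz n)) = Re (2 * w)" using zz(1)[of n] by (simp add: w_def field_simps)
    ultimately have "e n = Re (Ln (1 + w) - Ln (1 - w) - 2 * w)"
      using nz by (simp add: e_def)
    hence "\<bar>e n\<bar> \<le> 25 / 12 * norm w ^ 3"
      using abs_Re_le_cmod[of "Ln (1 + w) - Ln (1 - w) - 2 * w"] norm_artanh_remainder_le[OF w5] by linarith
    thus ?thesis unfolding w by (simp add: power_divide power_mult_distrib)
  qed
  have e_sum: "\<bar>\<Sum>n<m. e n\<bar> \<le> 25 / 96 * (1 / y ^ 3 + pi / (2 * y\<^sup>2))" for m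
  proof -
    note S = suminf_inverse_sum_squares[of y]
    have "\<bar>\<Sum>n<m. e n\<bar> \<le> (\<Sum>n<m. \<bar>e n\<bar>)" by (rule sum_abs)
    also have "\<dots> \<le> (\<Sum>n<Suc m. 25 / 96 * (1 / norm (zz n) ^ 3))"
      using e by (intro order_trans[OF sum_mono sum_mono2]) auto
    also have "\<dots> = 25 / 96 * (1 / norm (zz 0) ^ 3 + (\<Sum>n<m. 1 / norm (zz (Suc n)) ^ 3))"
      unfolding sum_distrib_left [symmetric] by (subst sum.lessThan_Suc_shift) simp
    also have "\<dots> \<le> 25 / 96 * (1 / y ^ 3 + (\<Sum>n<m. 1 / y * (1 / ((real (Suc n))\<^sup>2 + y\<^sup>2))))"
    proof (intro mult_left_mono add_mono sum_mono)
      show "1 / norm (zz 0) ^ 3 \<le> 1 / y ^ 3" using ny[of 0] y by (intro divide_left_mono power_mono mult_pos_pos zero_less_power) auto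
      fix n
      have "(real (Suc n))\<^sup>2 \<le> (real (Suc n) + 1/4)\<^sup>2" by (intro power_mono) auto
      hence "(real (Suc n))\<^sup>2 + y\<^sup>2 \<le> norm (zz (Suc n)) ^ 2" unfolding nz by simp
      hence "y * ((real (Suc n))\<^sup>2 + y\<^sup>2) \<le> norm (zz (Suc n)) * norm (zz (Suc n)) ^ 2"
        using ny[of "Suc n"] y by (intro mult_mono) auto
      hence "1 / norm (zz (Suc n)) ^ 3 \<le> 1 / (y * ((real (Suc n))\<^sup>2 + y\<^sup>2))"
        using y zz(1)[of "Suc n"] by (intro divide_left_mono mult_pos_pos add_pos_pos) (auto simp: power_numeral_reduce)
      thus "1 / norm (zz (Suc n)) ^ 3 \<le> 1 / y * (1 / ((real (Suc n))\<^sup>2 + y\<^sup>2))" by simp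
    qed auto
    also have "(\<Sum>n<m. 1 / y * (1 / ((real (Suc n))\<^sup>2 + y\<^sup>2))) \<le> 1 / y * (pi / (2 * y))"
    proof -
      have "(\<Sum>n<m. 1 / ((real (Suc n))\<^sup>2 + y\<^sup>2)) \<le> pi / (2 * y)"
        using S y by (intro order_trans[OF sum_le_suminf]) auto
      thus ?thesis unfolding sum_distrib_left [symmetric] using y by (intro mult_left_mono) auto
    qed
    finally show ?thesis using y by (simp add: power2_eq_square mult_left_mono)
  qed
  have tel: "(\<Sum>n<m. e n) = ln (norm (zz m - 1/2)) - ln (norm (zz 0 - 1/2)) - Re (\<Sum>n<m. inverse (zz n))" for m
  proof (induction m)
    case (Suc m)
    have "zz (Suc m) - 1/2 = zz m + 1/2" by (simp add: zz_def)
    hence "ln (norm (zz (Suc m) - 1/2)) = ln (norm (zz m + 1/2))" by (simp only:)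
    thus ?case using Suc by (simp add: e_def del: inverse_complex.sel)
  qed simp
  have "(\<lambda>m. (ln (norm (zz m - 1/2)) - ln (real m)) + Re (of_real (ln (real m)) - (\<Sum>n<m. inverse (z + of_nat n)))
           - ln (norm (zz 0 - 1/2))) \<longlonglongrightarrow> 0 + Re (Digamma z) - ln (norm (zz 0 - 1/2))"
  proof (intro tendsto_add tendsto_diff tendsto_const tendsto_Re Digamma_LIMSEQ z0)
    have "(\<lambda>m. ln (sqrt ((real m - 1/4)\<^sup>2 + y\<^sup>2)) - ln (real m)) \<longlonglongrightarrow> 0" using y by real_asymp
    thus "(\<lambda>m. ln (norm (zz m - 1/2)) - ln (real m)) \<longlonglongrightarrow> 0"
      by (simp add: zz_def z_def cmod_def algebra_simps)
  qed
  hence "(\<lambda>m. \<Sum>n<m. e n) \<longlonglongrightarrow> Re (Digamma z) - ln (norm (zz 0 - 1/2))"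
    unfolding tel by (simp add: zz_def algebra_simps)
  hence "(\<lambda>m. \<bar>\<Sum>n<m. e n\<bar>) \<longlonglongrightarrow> \<bar>Re (Digamma z) - ln (norm (zz 0 - 1/2))\<bar>" by (rule tendsto_rabs)
  hence "\<bar>Re (Digamma z) - ln (norm (zz 0 - 1/2))\<bar> \<le> 25 / 96 * (1 / y ^ 3 + pi / (2 * y\<^sup>2))"
    using e_sum by (intro LIMSEQ_le_const2) auto
  moreover have "zz 0 - 1/2 = -1/4 + \<i> * of_real y" by (simp add: zz_def z_def)
  ultimately show ?thesis by (simp add: z_def)
qed

lemma Re_Digamma_quarter_mono:
  assumes "\<bar>x\<bar> \<le> \<bar>y\<bar>"
  shows "Re (Digamma (1/4 + \<i> * of_real x)) \<le> Re (Digamma (1/4 + \<i> * of_real y))"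
proof (rule LIMSEQ_le)
  have nz: "1/4 + \<i> * of_real x \<noteq> 0" for x by (auto simp: complex_eq_iff)
  show "(\<lambda>m. Re (of_real (ln (real m)) - (\<Sum>n<m. inverse ((1/4 + \<i> * of_real x) + of_nat n)))) \<longlonglongrightarrow> Re (Digamma (1/4 + \<i> * of_real x))" for x
    by (intro tendsto_Re Digamma_LIMSEQ nz)
  show "(\<lambda>m. Re (of_real (ln (real m)) - (\<Sum>n<m. inverse ((1/4 + \<i> * of_real y) + of_nat n)))) \<longlonglongrightarrow> Re (Digamma (1/4 + \<i> * of_real y))"
    by (intro tendsto_Re Digamma_LIMSEQ nz)
  have "Re (inverse ((1/4 + \<i> * of_real y) + of_nat n)) \<le> Re (inverse ((1/4 + \<i> * of_real x) + of_nat n))" for n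
  proof -
    have "x\<^sup>2 \<le> y\<^sup>2" using assms abs_le_square_iff by blast
    hence "(1/4 + real n) / ((1/4 + real n)\<^sup>2 + y\<^sup>2) \<le> (1/4 + real n) / ((1/4 + real n)\<^sup>2 + x\<^sup>2)"
      by (intro divide_left_mono mult_pos_pos add_pos_nonneg) auto
    thus ?thesis by simp
  qed
  thus "\<exists>N. \<forall>m\<ge>N. Re (of_real (ln (real m)) - (\<Sum>n<m. inverse ((1/4 + \<i> * of_real x) + of_nat n)))
      \<le> Re (of_real (ln (real m)) - (\<Sum>n<m. inverse ((1/4 + \<i> * of_real y) + of_nat n)))"
    by (intro exI[of _ 0] allI impI) (simp add: sum_mono del: inverse_complex.sel)
qed

text \<open>\<theta>' increases with |t|, so t = 5 decides. There the logarithm is at most ln 2.6,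
  the error at most 1/10, and ln 3 - ln 2.6 exceeds 1/10.\<close>

lemma deriv_RS_theta_neg:
  assumes "\<bar>t\<bar> \<le> 5"
  shows "deriv RS_theta t < 0"
proof -
  have "Re (Digamma (1/4 + \<i> * of_real (t / 2))) \<le> Re (Digamma (1/4 + \<i> * of_real (5 / 2)))"
    using assms by (intro Re_Digamma_quarter_mono) auto
  also have "\<dots> \<le> ln (norm (-1/4 + \<i> * of_real (5 / 2))) + 25 / 96 * (1 / (5 / 2) ^ 3 + pi / (2 * (5 / 2)\<^sup>2))"
    using Re_Digamma_quarter_approx[of "5 / 2"] by linarith
  also have "25 / 96 * (1 / (5 / 2) ^ 3 + pi / (2 * (5 / 2)\<^sup>2)) \<le> (1 / 10 :: real)"
    using pi_less_16_div_5 by (simp add: power_numeral_reduce)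
  also have "ln (norm (-1/4 + \<i> * of_real (5 / 2))) \<le> ln (2.6 :: real)"
  proof (rule ln_mono)
    show "norm (-1/4 + \<i> * of_real (5 / 2)) \<le> 2.6" by (simp add: cmod_def power2_eq_square) (rule power2_le_imp_le; simp add: power_mult_distrib)
  qed (auto simp: complex_eq_iff)
  also have "ln (2.6 :: real) + 1 / 10 < ln 3"
  proof -
    have "ln (2.6 / 3) \<le> (2.6 / 3 :: real) - 1" by (rule ln_le_minus_one) simp
    moreover have "ln (2.6 / 3) = ln (2.6 :: real) - ln 3" by (rule ln_divide_pos) auto
    ultimately show ?thesis by linarith
  qed
  also have "ln 3 \<le> ln pi" using pi_ge_3 by simp
  finally show ?thesis by (simp add: deriv_RS_theta)
qed

text \<open>At y = t/2 \<ge> 17/5 the gap ln (17/5) - ln (16/5) exceeds 1/20, which covers the error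
  term with pi replaced by 16/5.\<close>

lemma deriv_RS_theta_pos:
  assumes "t \<ge> 34 / 5"
  shows "deriv RS_theta t > 0"
proof -
  define y where "y = t / 2"
  have y: "y \<ge> 17 / 5" using assms by (simp add: y_def)
  have "ln pi < ln (16 / 5)" using pi_less_16_div_5 by simp
  also have "ln (16 / 5) + 1 / 20 \<le> ln (17 / 5 :: real)"
  proof -
    have "ln (16 / 17) \<le> (16 / 17 :: real) - 1" by (rule ln_le_minus_one) simp
    thus ?thesis by (simp add: ln_div)
  qed
  hence "ln (16 / 5) \<le> ln (17 / 5 :: real) - 1 / 20" by simp
  also have "ln (17 / 5 :: real) \<le> ln (norm (-1/4 + \<i> * of_real y))"
  proof (rule ln_mono)
    show "17 / 5 \<le> norm (-1/4 + \<i> * of_real y)"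
      using abs_Im_le_cmod[of "-1/4 + \<i> * of_real y"] y by simp
  qed auto
  also have "\<dots> \<le> Re (Digamma (1/4 + \<i> * of_real y)) + 25 / 96 * (1 / y ^ 3 + pi / (2 * y\<^sup>2))"
    using Re_Digamma_quarter_approx[of y] y by linarith
  also have "25 / 96 * (1 / y ^ 3 + pi / (2 * y\<^sup>2)) \<le> 25 / 96 * (1 / (17 / 5) ^ 3 + pi / (2 * (17 / 5)\<^sup>2))"
    using y by (intro mult_left_mono add_mono divide_left_mono power_mono mult_pos_pos zero_less_power) auto
  also have "\<dots> \<le> (1 / 20 :: real)"
    using pi_less_16_div_5 by (simp add: power_numeral_reduce)
  finally show ?thesis by (simp add: deriv_RS_theta y_def)
qed

section \<open>Explicit Lipschitz bounds for the Euler--Maclaurin remainder\<close>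

text \<open>For x \<ge> 4, 1 / x^5 is at most the reciprocal of (x-2)(x-1)x(x+1)(x+2), which
  telescopes. The constant 3/80 is just above 1/32 + 1/243 plus the resulting tail 1/480.\<close>

lemma suminf_inverse_fifth_powers:
  "summable (\<lambda>n. 1 / (real n + 2) ^ 5)" "(\<Sum>n. 1 / (real n + 2) ^ 5) \<le> 3 / 80"
proof -
  have "(\<Sum>n<m+2. 1 / (real n + 2) ^ 5) \<le> 3 / 80 - 1 / (4 * (real m + 2) * (real m + 3) * (real m + 4) * (real m + 5))" for m
  proof (induction m)
    case (Suc m)
    define x where "x = real m + 4"
    have x: "x \<ge> 4" by (simp add: x_def)
    have "1 / x ^ 5 \<le> 1 / ((x - 2) * (x - 1) * x * (x + 1) * (x + 2))"
    proof (rule divide_left_mono)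
      have "x ^ 5 - (x - 2) * (x - 1) * x * (x + 1) * (x + 2) = x * (5 * x\<^sup>2 - 4)"
        by (simp add: algebra_simps power_numeral_reduce)
      moreover have "4\<^sup>2 \<le> x\<^sup>2" using x by (intro power_mono) auto
      hence "x * (5 * x\<^sup>2 - 4) \<ge> 0" using x by (intro mult_nonneg_nonneg) auto
      ultimately show "(x - 2) * (x - 1) * x * (x + 1) * (x + 2) \<le> x ^ 5" by linarith
    qed (use x in auto)
    also have "\<dots> = 1 / (4 * (x - 2) * (x - 1) * x * (x + 1)) - 1 / (4 * (x - 1) * x * (x + 1) * (x + 2))"
    proof -
      have "x \<noteq> 0" "x - 1 \<noteq> 0" "x - 2 \<noteq> 0" "x + 1 \<noteq> 0" "x + 2 \<noteq> 0" using x by auto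
      thus ?thesis by (simp add: divide_simps) (simp add: algebra_simps)
    qed
    finally show ?case using Suc by (simp add: x_def add.commute add.left_commute)
  qed (simp add: numeral_eq_Suc)
  hence b: "(\<Sum>n<m. 1 / (real n + 2) ^ 5) \<le> 3 / 80" for m
  proof -
    assume *: "\<And>m. (\<Sum>n<m+2. 1 / (real n + 2) ^ 5) \<le> 3 / 80 - 1 / (4 * (real m + 2) * (real m + 3) * (real m + 4) * (real m + 5))"
    have "(\<Sum>n<m. 1 / (real n + 2) ^ 5) \<le> (\<Sum>n<m+2. 1 / (real n + 2) ^ 5)" by (rule sum_mono2) auto
    moreover have "0 \<le> 1 / (4 * (real m + 2) * (real m + 3) * (real m + 4) * (real m + 5))" by simp
    ultimately show ?thesis using *[of m] by linarith
  qed
  show s: "summable (\<lambda>n. 1 / (real n + 2) ^ 5)" using b by (intro summableI_nonneg_bounded[of _ "3 / 80"]) auto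
  show "(\<Sum>n. 1 / (real n + 2) ^ 5) \<le> 3 / 80" using b s by (intro suminf_le_const) auto
qed

text \<open>Tangent line of the logarithm at 2 sqrt 2, chosen because its logarithm is (3/2) ln
  2.\<close>

lemma ln_le_three_eighths:
  assumes "x \<ge> 2"
  shows "ln x \<le> 3 / 8 * (x :: real)"
proof -
  define a :: real where "a = 2 * sqrt 2"
  have a: "a > 0" "a \<ge> 2.828"
  proof -
    have "sqrt (1.414\<^sup>2) \<le> sqrt (2 :: real)" by (rule real_sqrt_le_mono) (simp add: power2_eq_square)
    thus "a \<ge> 2.828" by (simp add: a_def)
  qed (simp add: a_def)
  have "ln x = ln (x / a) + ln a" using assms a by (simp add: ln_div)
  also have "ln (x / a) \<le> x / a - 1" using assms a by (intro ln_le_minus_one) auto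
  also have "x / a \<le> x / 2.828" using assms a by (intro divide_left_mono) auto
  also have "ln a = 3 / 2 * ln 2" by (simp add: a_def ln_mult ln_sqrt)
  also have "\<dots> \<le> 3 / 2 * (25 / 36)" using ln2_le_25_over_36 by simp
  finally show ?thesis using assms by (simp add: field_simps)
qed

text \<open>Each constant is a rounded-up value of |1/2 + j + 6.8 i| for j = 0, ..., 5.\<close>

lemma crit_strip_norms:
  fixes s :: complex
  assumes "Re s = 1/2" "0 \<le> Im s" "Im s \<le> 34 / 5"
  shows "norm s \<le> 6.82" "norm (s + 1) \<le> 6.97" "norm (s + 2) \<le> 7.25" "norm (s + 3) \<le> 7.65"
    "norm (s + 4) \<le> 8.16" "norm (s + 5) \<le> 8.75"
proof -
  have I: "(Im s)\<^sup>2 \<le> (34 / 5)\<^sup>2" using assms by (intro power_mono) auto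
  have "norm (s + of_real a) \<le> c" if "(1/2 + a)\<^sup>2 + (34 / 5)\<^sup>2 \<le> c\<^sup>2" "c \<ge> 0" for a c
  proof -
    have "(Re (s + of_real a))\<^sup>2 + (Im (s + of_real a))\<^sup>2 \<le> c\<^sup>2" using that(1) I by (simp only: plus_complex.sel Re_complex_of_real Im_complex_of_real assms(1) add_0_right)
    thus ?thesis using that(2) unfolding cmod_def by (intro real_le_lsqrt) auto
  qed
  from this[of 0 "6.82"] this[of 1 "6.97"] this[of 2 "7.25"] this[of 3 "7.65"] this[of 4 "8.16"] this[of 5 "8.75"]
  show "norm s \<le> 6.82" "norm (s + 1) \<le> 6.97" "norm (s + 2) \<le> 7.25" "norm (s + 3) \<le> 7.65"
    "norm (s + 4) \<le> 8.16" "norm (s + 5) \<le> 8.75"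
    by (simp_all add: power2_eq_square)
qed

text \<open>The sixth derivative of x^(-s), that is, the seventh derivative of x^(1-s) divided by 1
  - s.\<close>

definition em_kernel :: "real \<Rightarrow> complex \<Rightarrow> complex" where
  "em_kernel x s = s * (s + 1) * (s + 2) * (s + 3) * (s + 4) * (s + 5) * of_real x powr (- s - 6)"

lemma em_fun_7: "em_fun 7 s x = (1 - s) * em_kernel x s"
proof -
  have "em_coeff 7 s = (1 - s) * (s * (s + 1) * (s + 2) * (s + 3) * (s + 4) * (s + 5))"
    by (simp add: em_coeff_def numeral_eq_Suc) (simp add: algebra_simps)
  hence "em_fun 7 s x = (1 - s) * (s * (s + 1) * (s + 2) * (s + 3) * (s + 4) * (s + 5)) * of_real x powr (1 - s - 7)"
    by (simp add: em_fun_def)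
  moreover have "1 - s - 7 = - s - 6" by simp
  ultimately show ?thesis by (simp only: em_kernel_def mult.assoc)
qed

text \<open>Mean value inequality in s on a segment of the critical line. Lipschitz bounds pass to
  the infinite remainder by summation, so the series is not differentiated term by term.\<close>

lemma em_kernel_Lipschitz:
  fixes s s' :: complex
  assumes s: "Re s = 1/2" "0 \<le> Im s" "Im s \<le> 34 / 5" and s': "Re s' = 1/2" "0 \<le> Im s'" "Im s' \<le> 34 / 5" and x: "x \<ge> 2"
  shows "norm (em_kernel x s - em_kernel x s') \<le> 146000 * x powr (- (11/2)) * norm (s - s')"
proof -
  define S where "S = {s. Re s \<le> 1/2} \<inter> {s. Re s \<ge> 1/2} \<inter> {s. Im s \<ge> 0} \<inter> {s. Im s \<le> 34 / 5}"
  define P where "P s = s * (s + 1) * (s + 2) * (s + 3) * (s + 4) * (s + 5)" for s :: complex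
  define P' where "P' s = (s + 1) * (s + 2) * (s + 3) * (s + 4) * (s + 5) + s * (s + 2) * (s + 3) * (s + 4) * (s + 5)
     + s * (s + 1) * (s + 3) * (s + 4) * (s + 5) + s * (s + 1) * (s + 2) * (s + 4) * (s + 5)
     + s * (s + 1) * (s + 2) * (s + 3) * (s + 5) + s * (s + 1) * (s + 2) * (s + 3) * (s + 4)" for s :: complex
  have der: "(em_kernel x has_field_derivative (P' z - of_real (ln x) * P z) * of_real x powr (- z - 6)) (at z within S)" for z
  proof -
    have "(P has_field_derivative P' z) (at z within S)"
      unfolding P_def by (auto intro!: derivative_eq_intros) (simp add: P'_def algebra_simps)
    moreover have "((\<lambda>z. of_real x powr (- z - 6)) has_field_derivative of_real x powr (- z - 6) * (- of_real (ln x))) (at z within S)"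
    proof -
      have "((\<lambda>z. of_real x powr (- z - 6)) has_field_derivative Ln (of_real x) * of_real x powr (- z - 6) * (- 1)) (at z within S)"
        by (rule DERIV_chain2[where f = "\<lambda>w. of_real x powr w" and g = "\<lambda>z. - z - 6", OF has_field_derivative_powr_right])
           (use x in \<open>auto intro!: derivative_eq_intros\<close>)
      thus ?thesis using x by (simp add: Ln_of_real mult.commute)
    qed
    ultimately have "((\<lambda>z. P z * of_real x powr (- z - 6)) has_field_derivative
       P' z * of_real x powr (- z - 6) + of_real x powr (- z - 6) * (- of_real (ln x)) * P z) (at z within S)"
      by (rule DERIV_mult)
    moreover have "em_kernel x = (\<lambda>z. P z * of_real x powr (- z - 6))" by (simp add: fun_eq_iff em_kernel_def P_def)
    ultimately show ?thesis by (simp add: algebra_simps)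
  qed
  have bd: "norm ((P' z - of_real (ln x) * P z) * of_real x powr (- z - 6)) \<le> 146000 * x powr (- (11/2))" if "z \<in> S" for z
  proof -
    have z: "Re z = 1/2" "0 \<le> Im z" "Im z \<le> 34 / 5" using that by (auto simp: S_def)
    note N = crit_strip_norms[OF z]
    have nP: "norm (P z) \<le> 6.82 * 6.97 * 7.25 * 7.65 * 8.16 * 8.75"
      unfolding P_def norm_mult using N by (intro mult_mono mult_nonneg_nonneg) auto
    have "norm (P' z) \<le> 6.97 * 7.25 * 7.65 * 8.16 * 8.75 + 6.82 * 7.25 * 7.65 * 8.16 * 8.75 + 6.82 * 6.97 * 7.65 * 8.16 * 8.75
       + 6.82 * 6.97 * 7.25 * 8.16 * 8.75 + 6.82 * 6.97 * 7.25 * 7.65 * 8.75 + 6.82 * 6.97 * 7.25 * 7.65 * 8.16"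
      unfolding P'_def by (rule norm_triangle_mono)+ (unfold norm_mult; use N in \<open>intro mult_mono mult_nonneg_nonneg; simp\<close>)+
    hence nP': "norm (P' z) \<le> 150500" by simp
    have lx: "ln x \<ge> 0" using x by simp
    have "norm (P' z - of_real (ln x) * P z) \<le> norm (P' z) + ln x * norm (P z)"
      using norm_triangle_ineq4[of "P' z" "of_real (ln x) * P z"] lx by (simp add: norm_mult)
    also have "\<dots> \<le> 150500 + (3 / 8 * x) * 188500"
      using nP' nP ln_le_three_eighths[OF x] lx by (intro add_mono mult_mono) auto
    \<comment> \<open>Uses x \<ge> 2 on the constant: 150500/2 + (3/8) 188500 is below
      146000.\<close>
    also have "\<dots> \<le> 146000 * x" using x by simp
    finally have "norm ((P' z - of_real (ln x) * P z) * of_real x powr (- z - 6)) \<le> 146000 * x * x powr (- (13/2))"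
      using x z unfolding norm_mult by (intro mult_mono) (auto simp: norm_powr_real_powr)
    also have "x * x powr (- (13/2)) = x powr (1 + (- (13/2)))" using x by (subst powr_add) auto
    hence "146000 * x * x powr (- (13/2)) = 146000 * x powr (- (11/2))" by simp
    finally show ?thesis .
  qed
  show ?thesis
  proof (rule field_differentiable_bound[where S = S and f' = "\<lambda>z. (P' z - of_real (ln x) * P z) * of_real x powr (- z - 6)"])
    show "convex S" unfolding S_def by (intro convex_Int convex_halfspace_Re_le convex_halfspace_Re_ge convex_halfspace_Im_le convex_halfspace_Im_ge)
  qed (use der bd s s' in \<open>auto simp: S_def\<close>)
qed

text \<open>The Euler--Maclaurin step is linear, so it applies to the difference of the data at s
  and s'. Dividing by 1 - s reduces the seventh derivatives to \<open>em_kernel\<close>; 3.42 rounds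
  up 146000 times 0.7072 / 30240.\<close>

lemma em_term_Lipschitz:
  fixes s s' :: complex
  assumes s: "Re s = 1/2" "0 \<le> Im s" "Im s \<le> 34 / 5" and s': "Re s' = 1/2" "0 \<le> Im s'" "Im s' \<le> 34 / 5" and n: "n \<ge> 2"
  shows "norm (em_term n s / (1 - s) - em_term n s' / (1 - s')) \<le> 3.42 * norm (s - s') * (1 / real n ^ 5)"
proof -
  have s1: "1 - s \<noteq> 0" "1 - s' \<noteq> 0" using s s' by auto
  define F where "F k x = em_fun k s x / (1 - s) - em_fun k s' x / (1 - s')" for k x
  define M where "M = 146000 * (0.7072 / real n ^ 5) * norm (s - s')"
  have "norm (F 0 (real n+1) - F 0 (real n) - (F 1 (real n) + F 1 (real n+1)) / 2 + (F 2 (real n+1) - F 2 (real n)) / 12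
           - (F 4 (real n+1) - F 4 (real n)) / 720) \<le> M / 30240"
  proof (rule Euler_Maclaurin_step)
    fix k :: nat and x assume "k \<le> 6" "x \<in> {real n..real n + 1}"
    hence x: "x > 0" using n by auto
    have "((\<lambda>x. inverse (1 - s) * em_fun k s x - inverse (1 - s') * em_fun k s' x) has_vector_derivative
        (inverse (1 - s) * em_fun (Suc k) s x - inverse (1 - s') * em_fun (Suc k) s' x)) (at x)"
      by (intro has_vector_derivative_diff has_vector_derivative_mult_right em_fun_has_vector_derivative x)
    thus "(F k has_vector_derivative F (Suc k) x) (at x)" unfolding F_def by (simp add: divide_inverse mult.commute)
  next
    fix x assume "x \<in> {real n<..<real n + 1}"
    hence x: "real n < x" by auto
    have "norm (F 7 x) = norm (em_kernel x s - em_kernel x s')" using s1 by (simp add: F_def em_fun_7)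
    also have "\<dots> \<le> 146000 * x powr (- (11/2)) * norm (s - s')" using x n by (intro em_kernel_Lipschitz s s') auto
    also have "x powr (- (11/2)) \<le> real n powr (- (11/2))" using x n by (intro powr_mono2') auto
    also have "real n powr (- (11/2)) = real n powr (- 5) * real n powr (- (1/2))" by (subst powr_add [symmetric]) simp
    also have "real n powr (- 5) = 1 / real n ^ 5" using n by (simp add: powr_minus_divide)
    also have "real n powr (- (1/2)) \<le> 2 powr (- (1/2))" using n by (intro powr_mono2') auto
    also have "2 powr (- (1/2)) \<le> (0.7072 :: real)"
    proof -
      have "sqrt (2::real) \<ge> 1 / 0.7072" by (rule real_le_rsqrt) (simp add: power2_eq_square)
      thus ?thesis by (simp add: powr_minus powr_half_sqrt field_simps)
    qed
    finally show "norm (F 7 x) \<le> M" by (simp add: M_def divide_right_mono mult_right_mono mult_left_mono)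
  qed
  also have "F 0 (real n+1) - F 0 (real n) - (F 1 (real n) + F 1 (real n+1)) / 2 + (F 2 (real n+1) - F 2 (real n)) / 12
           - (F 4 (real n+1) - F 4 (real n)) / 720 = em_term n s / (1 - s) - em_term n s' / (1 - s')"
  proof -
    define u v where "u = inverse (1 - s)" and "v = inverse (1 - s')"
    have "F k x = em_fun k s x * u - em_fun k s' x * v" for k x by (simp add: F_def u_def v_def divide_inverse)
    moreover have "em_term n s / (1 - s) - em_term n s' / (1 - s') = em_term n s * u - em_term n s' * v"
      by (simp add: u_def v_def divide_inverse)
    ultimately show ?thesis by (simp add: em_term_def add.commute) (simp add: algebra_simps add_divide_distrib diff_divide_distrib)
  qed
  also have "M / 30240 \<le> 3.42 * norm (s - s') * (1 / real n ^ 5)"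
  proof -
    have "M / 30240 = (146000 * 0.7072 / 30240) * (norm (s - s') * (1 / real n ^ 5))" by (simp add: M_def)
    also have "\<dots> \<le> 3.42 * (norm (s - s') * (1 / real n ^ 5))" by (rule mult_right_mono) auto
    finally show ?thesis by simp
  qed
  finally show ?thesis .
qed

text \<open>The Euler--Maclaurin approximation of \<open>\<zeta>\<close> with the terms \<open>1\<close> and \<open>2\<^sup>-\<^sup>s\<close> split off.\<close>
definition em_main :: "complex \<Rightarrow> complex" where
  "em_main s = 2 / (s - 1) + 1/2 + s / 24 - s * (s + 1) * (s + 2) / 5760"

definition em_rest :: "complex \<Rightarrow> complex" where
  "em_rest s = zeta s - 1 - 2 powr (- s) * em_main s"

text \<open>Dropping the defect of [1, 2] amounts to starting the Euler--Maclaurin formula at 2,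
  hence the index n + 2.\<close>

lemma em_rest_sums:
  assumes s: "Re s > -1" "s \<noteq> 1"
  shows "(\<lambda>n. em_term (n + 2) s / (1 - s)) sums (- em_rest s)"
proof -
  have "(\<lambda>n. em_term (Suc n) s) sums (\<Sum>n. em_term (Suc n) s)" using s by (intro summable_sums summable_em_term) auto
  hence 1: "(\<lambda>n. em_term (Suc (Suc n)) s) sums ((\<Sum>n. em_term (Suc n) s) - em_term (Suc 0) s)" by (subst sums_Suc_iff) simp
  have c: "em_coeff 0 s = 1" "em_coeff 1 s = 1 - s" "em_coeff 2 s = (1 - s) * (- s)"
       "em_coeff 4 s = (1 - s) * (- s) * (- s - 1) * (- s - 2)"
    by (simp_all add: em_coeff_def numeral_eq_Suc algebra_simps)
  define q where "q = 2 powr (- s)"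
  have q: "2 powr (1 - s) = 2 * q" "2 powr (- s) = q" "2 powr (- 1 - s) = q / 2" "2 powr (- 3 - s) = q / 8"
  proof -
    have a: "2 powr (of_int k - s) = 2 powi k * q" for k
    proof -
      have "2 powr (of_int k - s) = 2 powr (of_int k) * q" unfolding q_def by (subst powr_add [symmetric]) simp
      thus ?thesis by (simp add: powr_of_int power_int_def power_one_over inverse_eq_divide)
    qed
    show "2 powr (1 - s) = 2 * q" "2 powr (- s) = q" "2 powr (- 1 - s) = q / 2" "2 powr (- 3 - s) = q / 8"
      using a[of 1] a[of 0] a[of "-1"] a[of "-3"] by (simp_all add: power_int_minus field_simps)
  qed
  have e: "em_fun 0 s 2 = 2 * q" "em_fun 1 s 2 = (1 - s) * q" "em_fun 2 s 2 = (1 - s) * (- s) * (q / 2)"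
      "em_fun 4 s 2 = (1 - s) * (- s) * (- s - 1) * (- s - 2) * (q / 8)"
      "em_fun 0 s 1 = 1" "em_fun 1 s 1 = (1 - s)" "em_fun 2 s 1 = (1 - s) * (- s)"
      "em_fun 4 s 1 = (1 - s) * (- s) * (- s - 1) * (- s - 2)"
    unfolding em_fun_def c using q by simp_all
  have "em_term (Suc 0) s = 2 * q - 1 - ((1 - s) + (1 - s) * q) / 2 + ((1 - s) * (- s) * (q / 2) - (1 - s) * (- s)) / 12
     - ((1 - s) * (- s) * (- s - 1) * (- s - 2) * (q / 8) - (1 - s) * (- s) * (- s - 1) * (- s - 2)) / 720"
    using e by (simp add: em_term_def)
  moreover have "(\<Sum>n. em_term (Suc n) s) = (s - 1) * zeta s - 1 - (s - 1) * (1/2 + s/12 - s * (s+1) * (s+2) / 720)"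
    using zeta_eq_xi0[OF s] s by (simp add: xi0_def)
  moreover have "(s - 1) * em_rest s =
      (s - 1) * zeta s - (s - 1) - q * (2 + (s - 1) * (1/2 + s / 24 - s * (s + 1) * (s + 2) / 5760))"
  proof -
    have "(s - 1) * em_rest s = (s - 1) * zeta s - (s - 1) - q * ((s - 1) * (2 / (s - 1)) + (s - 1) * (1/2 + s / 24 - s * (s + 1) * (s + 2) / 5760))"
      by (simp only: em_rest_def em_main_def q) (simp add: algebra_simps)
    moreover have "(s - 1) * (2 / (s - 1)) = 2" using s nonzero_mult_div_cancel_left[of "s - 1" 2] by (simp only: times_divide_eq_right) simp
    ultimately show ?thesis by (simp only:)
  qed
  ultimately have "(\<Sum>n. em_term (Suc n) s) - em_term (Suc 0) s = (s - 1) * em_rest s"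
    by (simp only:) (simp add: field_simps)
  with sums_divide[OF 1, of "1 - s"] have "(\<lambda>n. em_term (Suc (Suc n)) s / (1 - s)) sums ((s - 1) * em_rest s / (1 - s))" by simp
  moreover have "(s - 1) * em_rest s / (1 - s) = - em_rest s"
    using s by (simp add: divide_simps) (simp add: algebra_simps)
  ultimately show ?thesis by simp
qed

text \<open>The constant is 3.42 times 3/80.\<close>

lemma norm_em_rest_diff_le:
  fixes s s' :: complex
  assumes s: "Re s = 1/2" "0 \<le> Im s" "Im s \<le> 34 / 5" and s': "Re s' = 1/2" "0 \<le> Im s'" "Im s' \<le> 34 / 5"
  shows "norm (em_rest s - em_rest s') \<le> 0.12825 * norm (s - s')"
proof -
  have "s \<noteq> 1" "s' \<noteq> 1" using s s' by auto
  hence "(\<lambda>n. em_term (n + 2) s / (1 - s) - em_term (n + 2) s' / (1 - s')) sums (- em_rest s - (- em_rest s'))"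
    using s s' by (intro sums_diff em_rest_sums) auto
  hence S: "em_rest s' - em_rest s = (\<Sum>n. em_term (n + 2) s / (1 - s) - em_term (n + 2) s' / (1 - s'))"
    by (simp add: sums_iff)
  note T = suminf_inverse_fifth_powers
  have "norm (\<Sum>n. em_term (n + 2) s / (1 - s) - em_term (n + 2) s' / (1 - s')) \<le> (\<Sum>n. 3.42 * norm (s - s') * (1 / (real n + 2) ^ 5))"
  proof (rule norm_suminf_le)
    show "norm (em_term (n + 2) s / (1 - s) - em_term (n + 2) s' / (1 - s')) \<le> 3.42 * norm (s - s') * (1 / (real n + 2) ^ 5)" for n
      using em_term_Lipschitz[OF s s', of "n + 2"] by (simp add: add.commute)
    show "summable (\<lambda>n. 3.42 * norm (s - s') * (1 / (real n + 2) ^ 5))" by (rule summable_mult[OF T(1)])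
  qed
  also have "\<dots> = 3.42 * norm (s - s') * (\<Sum>n. 1 / (real n + 2) ^ 5)" by (rule suminf_mult[OF T(1)])
  also have "\<dots> \<le> 3.42 * norm (s - s') * (3 / 80)" using T(2) by (rule mult_left_mono) simp
  finally show ?thesis unfolding S [symmetric] norm_minus_commute[of "em_rest s'"] by simp
qed

text \<open>A complex derivative may be computed along any approach; going upwards along the
  critical line keeps the test points inside the segment where the Lipschitz bound holds.\<close>

lemma norm_derivative_le_Lipschitz_on_crit:
  assumes t: "0 \<le> t" "t < b" and f: "(f has_field_derivative D) (at (1/2 + \<i> * of_real t))"
    and L: "\<And>u. t \<le> u \<Longrightarrow> u \<le> b \<Longrightarrow> norm (f (1/2 + \<i> * of_real u) - f (1/2 + \<i> * of_real t)) \<le> B * norm ((1/2 + \<i> * of_real u) - (1/2 + \<i> * of_real t))"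
  shows "norm D \<le> B"
proof -
  define s where "s u = 1/2 + \<i> * complex_of_real u" for u
  have "((\<lambda>z. (f z - f (s t)) / (z - s t)) \<longlongrightarrow> D) (at (s t))"
    using f unfolding s_def has_field_derivative_iff .
  moreover have "filterlim s (at (s t)) (at_right t)"
  proof -
    have "(s \<longlongrightarrow> s t) (at_right t)" unfolding s_def by (intro tendsto_intros)
    moreover have "eventually (\<lambda>u. s u \<noteq> s t) (at_right t)"
      using eventually_at_right_less[of t] by eventually_elim (simp add: s_def)
    ultimately show ?thesis by (simp add: filterlim_at)
  qed
  ultimately have "((\<lambda>u. (f (s u) - f (s t)) / (s u - s t)) \<longlongrightarrow> D) (at_right t)"
    by (rule filterlim_compose)
  thus ?thesis
  proof (rule Lim_norm_ubound[rotated])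
    have "eventually (\<lambda>u. u \<in> {t<..<b}) (at_right t)" using t by (intro eventually_at_right_real)
    thus "\<forall>\<^sub>F u in at_right t. norm ((f (s u) - f (s t)) / (s u - s t)) \<le> B"
    proof eventually_elim
      case (elim u)
      hence "norm (f (s u) - f (s t)) \<le> B * norm (s u - s t)" unfolding s_def by (intro L) auto
      moreover have "norm (s u - s t) > 0" using elim by (simp add: s_def)
      ultimately show ?case by (simp add: norm_divide pos_divide_le_eq)
    qed
  qed simp
qed

text \<open>
  \<open>\<theta>'\<close> vanishes for a single \<open>t > 0\<close>, near \<open>6.29\<close>, so a numerical bound on a short interval suffices. There \<open>\<zeta>'\<close> is
  \<open>2\<^sup>-\<^sup>s (em_main' - ln 2 em_main)\<close> up to the Lipschitz constant of the remainder, and since only the modulus of \<open>2\<^sup>-\<^sup>s\<close>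
  matters, the bound reduces to rational functions of \<open>t\<close>.
\<close>
lemma deriv_zeta_crit_nonzero_aux:
  assumes t: "t = 0 \<or> 5 \<le> t \<and> t < 34 / 5"
  shows "deriv zeta (1/2 + \<i> * of_real t) \<noteq> 0"
proof
  define s where "s = 1/2 + \<i> * complex_of_real t"
  assume "deriv zeta (1/2 + \<i> * of_real t) = 0"
  hence zero: "deriv zeta s = 0" by (simp add: s_def)
  have s1: "s \<noteq> 1" by (auto simp: s_def complex_eq_iff)
  have re: "Re s = 1/2" "Im s = t" by (simp_all add: s_def)
  \<comment> \<open>2^(-s) W is the derivative of 2^(-s) \<open>em_main\<close>. At a zero of
    \<zeta>' the derivative of the remainder is - 2^(-s) W, so |W| \<le> 0.12825 sqrt 2 < 0.182; the
    contradiction is that Re W lies below -0.182.\<close>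
  define W where "W = (- 2 / (s - 1)\<^sup>2 + 1 / 24 - (3 * s\<^sup>2 + 6 * s + 2) / 5760) - of_real (ln 2) * em_main s"
  have "(em_main has_field_derivative (- 2 / (s - 1)\<^sup>2 + 1 / 24 - (3 * s\<^sup>2 + 6 * s + 2) / 5760)) (at s)"
  proof -
    have "(em_main has_field_derivative (- 2 / (s - 1)\<^sup>2 + 1 / 24 - (s * (s + 1) + s * (s + 2) + (s + 1) * (s + 2)) / 5760)) (at s)"
    proof -
      have "((\<lambda>s. 2 / (s - 1)) has_field_derivative - 2 / (s - 1)\<^sup>2) (at s)"
        using s1 by (auto intro!: derivative_eq_intros simp: power2_eq_square)
      moreover have "((\<lambda>s. 1/2 + s / 24 - s * (s + 1) * (s + 2) / 5760) has_field_derivative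
         1 / 24 - (s * (s + 1) + s * (s + 2) + (s + 1) * (s + 2)) / 5760) (at s)"
        by (auto intro!: derivative_eq_intros simp: field_simps)
      ultimately have "((\<lambda>s. 2 / (s - 1) + (1/2 + s / 24 - s * (s + 1) * (s + 2) / 5760)) has_field_derivative
         - 2 / (s - 1)\<^sup>2 + (1 / 24 - (s * (s + 1) + s * (s + 2) + (s + 1) * (s + 2)) / 5760)) (at s)"
        by (rule DERIV_add)
      thus ?thesis by (simp add: em_main_def[abs_def] algebra_simps)
    qed
    moreover have "s * (s + 1) + s * (s + 2) + (s + 1) * (s + 2) = 3 * s\<^sup>2 + 6 * s + 2" by (simp add: algebra_simps power2_eq_square)
    ultimately show ?thesis by simp
  qed
  moreover have "((\<lambda>s. 2 powr (- s)) has_field_derivative - of_real (ln 2) * 2 powr (- s)) (at s)"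
  proof -
    have "((\<lambda>z. 2 powr (- z)) has_field_derivative Ln 2 * 2 powr (- s) * (- 1)) (at s)"
      by (rule DERIV_chain2[where f = "\<lambda>w. 2 powr w" and g = "\<lambda>z. - z", OF has_field_derivative_powr_right])
         (auto intro!: derivative_eq_intros)
    moreover have "Ln 2 = complex_of_real (ln 2)" using Ln_of_real[of 2] by simp
    ultimately show ?thesis by simp
  qed
  ultimately have "(em_rest has_field_derivative (deriv zeta s - 0 - 2 powr (- s) * W)) (at s)"
    unfolding em_rest_def[abs_def] W_def using s1
    by (intro DERIV_cong[OF DERIV_diff[OF DERIV_diff[OF zeta_field_derivative DERIV_const] DERIV_mult]])
       (auto simp: algebra_simps)
  hence der: "(em_rest has_field_derivative (deriv zeta s - 0 - 2 powr (- s) * W)) (at (1/2 + \<i> * of_real t))"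
    by (simp only: s_def)
  have "norm (deriv zeta s - 0 - 2 powr (- s) * W) \<le> 0.12825"
  proof (rule norm_derivative_le_Lipschitz_on_crit[OF _ _ der, where b = "34 / 5", folded s_def])
    show "norm (em_rest (1/2 + \<i> * of_real u) - em_rest s) \<le> 0.12825 * norm ((1/2 + \<i> * of_real u) - s)"
      if "t \<le> u" "u \<le> 34 / 5" for u
      by (rule norm_em_rest_diff_le) (use t that in \<open>auto simp: s_def\<close>)
  qed (use t in auto)
  hence "norm (2 powr (- s)) * norm W \<le> 0.12825" using zero by (simp add: norm_mult)
  moreover have "norm (2 powr (- s)) = 1 / sqrt 2"
    using norm_powr_real_powr[of 2 "- s"] re by (simp add: powr_minus powr_half_sqrt field_simps)
  ultimately have "norm W \<le> 0.12825 * sqrt 2" by (simp add: field_simps)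
  also have "\<dots> \<le> 0.12825 * 1.415" by (intro mult_left_mono real_le_lsqrt) (auto simp: power2_eq_square)
  finally have "norm W \<le> 0.182" by simp
  hence W: "- 0.182 \<le> Re W" using abs_Re_le_cmod[of W] by linarith
  define D where "D = 1 / 4 + t\<^sup>2"
  have D: "D > 0" by (simp add: D_def add_pos_nonneg)
  define v where "v = 1 / (s - 1)"
  have v: "Re v = - 1 / (2 * D)" "Im v = - t / D"
    using D by (simp_all add: v_def re Re_divide Im_divide D_def power2_eq_square field_simps)
  have "Re W = - 2 * (1 / 4 - t\<^sup>2) / D\<^sup>2 + 1 / 24 - (3 * (1 / 4 - t\<^sup>2) + 5) / 5760
      - ln 2 * (- 1 / D + 1/2 + 1 / 48 - (15 / 8 - 9 / 2 * t\<^sup>2) / 5760)"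
  proof -
    have w: "W = (- 2 * (v * v) + 1 / 24 - (3 * (s * s) + 6 * s + 2) / 5760) - of_real (ln 2) * (2 * v + 1/2 + s / 24 - s * (s + 1) * (s + 2) / 5760)"
      by (simp add: W_def em_main_def v_def power2_eq_square)
    have vv: "Re (v * v) = (1 / 4 - t\<^sup>2) / D\<^sup>2"
      using D by (simp add: v power2_eq_square field_simps)
    show ?thesis unfolding w using vv D by (simp add: re v field_simps power2_eq_square)
  qed
  also have "ln 2 * (- 1 / D + 1/2 + 1 / 48 - (15 / 8 - 9 / 2 * t\<^sup>2) / 5760) =
    - ln 2 / D + ln 2 * (25 / 48 - 15 / 46080) + ln 2 * t\<^sup>2 / 1280" by (simp add: field_simps)
  finally have ReW: "Re W = - 2 * (1 / 4 - t\<^sup>2) / D\<^sup>2 + 1 / 24 - (3 * (1 / 4 - t\<^sup>2) + 5) / 5760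
     + ln 2 / D - ln 2 * (25 / 48 - 15 / 46080) - ln 2 * t\<^sup>2 / 1280" by simp
  from t show False
  proof
    assume "t = 0"
    \<comment> \<open>At t = 0 the term -2 / (s - 1)^2 = -8 dominates. This case is needed for the
      normalisation at 0 and for the base point 1/2.\<close>
    thus False using W ReW ln2_le_25_over_36 ln2_ge_two_thirds by (simp add: D_def power2_eq_square)
  next
    assume t5: "5 \<le> t \<and> t < 34 / 5"
    hence "5\<^sup>2 \<le> t\<^sup>2" by (intro power_mono) auto
    hence D25: "D \<ge> 25.25" by (simp add: D_def)
    have "- 2 * (1 / 4 - t\<^sup>2) / D\<^sup>2 \<le> 2 * D / D\<^sup>2" by (rule divide_right_mono) (auto simp: D_def)
    also have "\<dots> = 2 / D" using D by (simp add: power2_eq_square)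
    finally have "Re W \<le> 2 / D + 1 / 24 - (3 * (1 / 4 - t\<^sup>2) + 5) / 5760
     + ln 2 / D - ln 2 * (25 / 48 - 15 / 46080) - ln 2 * t\<^sup>2 / 1280" using ReW by linarith
    moreover have "2 / D \<le> 2 / 25.25" using D25 by (intro divide_left_mono) auto
    moreover have "ln 2 / D \<le> (25/36) / 25.25" using D25 ln2_le_25_over_36 by (intro frac_le) auto
    moreover have "(3 * (1 / 4 - t\<^sup>2) + 5) / 5760 = 23 / 23040 - t\<^sup>2 / 1920" by (simp add: field_simps)
    ultimately have "Re W \<le> 2 / 25.25 + 1 / 24 + t\<^sup>2 / 1920 - 23 / 23040 + (25/36) / 25.25 - ln 2 * (25 / 48 - 15 / 46080) - ln 2 * t\<^sup>2 / 1280"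
      by linarith
    moreover have "(2 / 3 :: real) * (25 / 48 - 15 / 46080) \<le> ln 2 * (25 / 48 - 15 / 46080)"
      using ln2_ge_two_thirds by (intro mult_right_mono) auto
    \<comment> \<open>With ln 2 replaced by 2/3 the two t^2 terms cancel exactly, as (2/3) / 1280 =
      1/1920; only constants remain.\<close>
    moreover have "2 / 3 * t\<^sup>2 \<le> ln 2 * t\<^sup>2" using ln2_ge_two_thirds by (intro mult_right_mono) auto
    ultimately show False using W by simp
  qed
qed

lemma deriv_zeta_crit_0: "deriv zeta (1 / 2) \<noteq> 0"
  using deriv_zeta_crit_nonzero_aux[of 0] by simp

lemma deriv_zeta_crit_nonzero:
  assumes "deriv RS_theta t = 0"
  shows "deriv zeta (1/2 + \<i> * of_real t) \<noteq> 0"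
proof -
  have *: "deriv zeta (1/2 + \<i> * of_real t) \<noteq> 0" if "deriv RS_theta t = 0" "t \<ge> 0" for t
    using that deriv_RS_theta_neg[of t] deriv_RS_theta_pos[of t] by (intro deriv_zeta_crit_nonzero_aux) force
  show ?thesis
  proof (cases "t \<ge> 0")
    case False
    have "1/4 + \<i> * of_real (- t) / 2 = cnj (1/4 + \<i> * of_real t / 2)" by (simp add: complex_eq_iff)
    hence "deriv RS_theta (- t) = deriv RS_theta t"
      unfolding deriv_RS_theta by (simp only: cnj_Digamma [symmetric]) (subst cnj_Digamma [symmetric]; simp add: complex_eq_iff)
    hence "deriv zeta (1/2 + \<i> * of_real (- t)) \<noteq> 0" using False assms by (intro *) auto
    moreover have "1/2 + \<i> * of_real (- t) = cnj (1/2 + \<i> * of_real t)" by (simp add: complex_eq_iff)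
    moreover have "1/2 + \<i> * of_real t \<noteq> 1" by (auto simp: complex_eq_iff)
    ultimately show ?thesis using cnj_deriv_zeta[of "1/2 + \<i> * of_real t"] by (metis complex_cnj_zero)
  qed (use * assms in auto)
qed

section \<open>The derivative of kappa\<close>

text \<open>The reflection formula forces \<theta>' \<zeta> = 0, and the numerical exclusion leaves
  \<zeta> = 0. This justifies the value 0 of the quotient in the definition of \<kappa>.\<close>

lemma deriv_zeta_crit_zero:
  assumes "deriv zeta (crit t) = 0"
  shows "zeta (crit t) = 0"
proof -
  have "gam (crit t) * (2 * of_real (deriv RS_theta t) * zeta (crit t)) = 0"
    using critical_line_reflection[of t] assms by simp
  moreover have "gam (crit t) \<noteq> 0" by (rule gam_nonzero) simp
  moreover have "deriv RS_theta t \<noteq> 0" using deriv_zeta_crit_nonzero assms by blast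
  ultimately show ?thesis by simp
qed

text \<open>At a zero of order n, f = g (z - c)^n gives f / f' = (z - c) g / (n g + (z - c) g'), and
  the denominator is n g(c) at c. The extension has the value 0 at c, as does division by 0.\<close>

lemma logderiv_reciprocal_holomorphic:
  fixes f :: "complex \<Rightarrow> complex"
  assumes S: "open S" "connected S" "c \<in> S" and f: "f holomorphic_on S" "\<exists>w\<in>S. f w \<noteq> 0"
    and zero: "deriv f c = 0 \<Longrightarrow> f c = 0"
  shows "\<exists>r>0. \<exists>Q. Q holomorphic_on ball c r \<and> (\<forall>z\<in>ball c r. f z / deriv f z = Q z)"
proof (cases "deriv f c = 0")
  case False
  have d: "deriv f holomorphic_on S" using f S by (intro holomorphic_deriv)
  hence "continuous_on S (deriv f)" by (rule holomorphic_on_imp_continuous_on)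
  hence "open (S \<inter> deriv f -` (- {0}))" using S by (intro continuous_open_preimage) auto
  moreover have "c \<in> S \<inter> deriv f -` (- {0})" using False S by simp
  ultimately obtain r where r: "r > 0" "ball c r \<subseteq> S \<inter> deriv f -` (- {0})" by (rule openE)
  hence sub: "ball c r \<subseteq> S" by auto
  have "(\<lambda>z. f z / deriv f z) holomorphic_on ball c r"
    using r by (intro holomorphic_on_divide holomorphic_on_subset[OF f(1) sub] holomorphic_on_subset[OF d sub]) auto
  with r(1) show ?thesis by blast
next
  case True
  define n g where "n = nat (zorder f c)" and "g = zor_poly f c"
  obtain r where r: "r > 0" "cball c r \<subseteq> S" "g holomorphic_on cball c r"
      "\<And>w. w \<in> cball c r \<Longrightarrow> f w = g w * (w - c) ^ n \<and> g w \<noteq> 0" and n: "n > 0"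
    using zorder_exist_zero[OF f(1) S f(2)] zero[OF True] unfolding n_def g_def by auto
  have g: "g holomorphic_on ball c r" by (rule holomorphic_on_subset[OF r(3)]) auto
  hence g': "deriv g holomorphic_on ball c r" by (intro holomorphic_deriv) auto
  define h where "h z = of_nat n * g z + (z - c) * deriv g z" for z
  have h: "h holomorphic_on ball c r" unfolding h_def by (intro holomorphic_intros g g')
  have "continuous_on (ball c r) h" using h by (rule holomorphic_on_imp_continuous_on)
  hence op: "open (ball c r \<inter> h -` (- {0}))" by (intro continuous_open_preimage) auto
  have "c \<in> ball c r \<inter> h -` (- {0})" using r(1) r(4)[of c] n by (simp add: h_def)
  with op obtain e where e: "e > 0" "ball c e \<subseteq> ball c r \<inter> h -` (- {0})" by (rule openE)
  hence sub: "ball c e \<subseteq> ball c r" by auto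
  have "f z / deriv f z = (z - c) * g z / h z" if z: "z \<in> ball c e" for z
  proof (cases "z = c")
    case False
    have zr: "z \<in> ball c r" using z sub by auto
    have gz: "(g has_field_derivative deriv g z) (at z)" using g zr by (intro holomorphic_derivI[of g "ball c r"]) auto
    obtain m where m: "n = Suc m" using n by (cases n) auto
    have "((\<lambda>w. g w * (w - c) ^ n) has_field_derivative (z - c) ^ m * h z) (at z)"
      by (rule derivative_eq_intros gz refl | simp)+ (simp add: m h_def algebra_simps)
    hence "(f has_field_derivative (z - c) ^ m * h z) (at z)"
      by (rule has_field_derivative_transform_within_open[OF _ open_ball zr]) (use r(4) in auto)
    hence "deriv f z = (z - c) ^ m * h z" by (rule DERIV_imp_deriv)
    thus ?thesis using r(4)[of z] zr False by (simp add: m)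
  qed (use zero[OF True] in simp)
  moreover have "(\<lambda>z. (z - c) * g z / h z) holomorphic_on ball c e"
    using e by (intro holomorphic_intros holomorphic_on_subset[OF g sub] holomorphic_on_subset[OF h sub]) auto
  ultimately show ?thesis using e(1) by blast
qed

lemma zeta_not_identically_zero: "\<exists>w\<in>- {1}. zeta w \<noteq> 0"
proof -
  obtain K where K: "K \<ge> (3::real)" "\<And>s. Re s \<ge> K \<Longrightarrow> zeta s \<noteq> 0" using zeta_right_half_plane by blast
  show ?thesis using K(1) by (intro bexI[of _ "of_real K"] K(2)) (auto simp: complex_eq_iff)
qed

lemma locally_holomorphic_ext_kappa_phase: "locally_holomorphic_ext kappa_phase id"
  unfolding locally_holomorphic_ext_def
proof
  fix x0 :: real
  have "crit x0 \<in> - {1}" by (auto simp: complex_eq_iff)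
  moreover have "open (- {1 :: complex})" "connected (- {1 :: complex})"
    by (auto intro: connected_punctured_universe)
  ultimately obtain r Q where r: "r > 0" "Q holomorphic_on ball (crit x0) r"
     and Q: "\<And>z. z \<in> ball (crit x0) r \<Longrightarrow> zeta z / deriv zeta z = Q z"
    using logderiv_reciprocal_holomorphic[of "- {1}" "crit x0" zeta] holomorphic_zeta zeta_not_identically_zero deriv_zeta_crit_zero
    by blast
  define R where "R = min r (1/2)"
  \<comment> \<open>The real part of Digamma is replaced by the mean of its values at 1/4 + i z / 2
    and 1/4 - i z / 2, which is holomorphic in z.\<close>
  define F where "F z = 1 + 2 * ((Digamma (1/4 + \<i> * z / 2) + Digamma (1/4 - \<i> * z / 2)) / 4 - of_real (ln pi) / 2) * Q (1/2 + \<i> * z)" for z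
  have im: "\<bar>Im z\<bar> < 1/2" if "z \<in> ball (of_real x0) R" for z
    using that abs_Im_le_cmod[of "of_real x0 - z"] by (auto simp: R_def dist_norm)
  have np: "w \<notin> \<int>\<^sub>\<le>\<^sub>0" if "Re w > 0" for w :: complex using that by (auto elim!: nonpos_Ints_cases)
  have crit: "1/2 + \<i> * z \<in> ball (crit x0) r" if "z \<in> ball (of_real x0) R" for z
  proof -
    have "crit x0 - (1/2 + \<i> * z) = \<i> * (of_real x0 - z)" by (simp add: algebra_simps)
    hence "dist (crit x0) (1/2 + \<i> * z) = dist (of_real x0) z" by (simp add: dist_norm norm_mult)
    thus ?thesis using that by (simp add: R_def)
  qed
  have "(\<lambda>z. Digamma (1/4 + \<i> * z / 2)) holomorphic_on ball (of_real x0) R"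
  proof (rule holomorphic_on_compose_gen[of "\<lambda>z. 1/4 + \<i> * z / 2" _ Digamma "{w. Re w > 0}", unfolded o_def])
    show "Digamma holomorphic_on {w. Re w > 0}" by (intro holomorphic_intros) (use np in auto)
  qed (use im in \<open>force intro!: holomorphic_intros\<close>)+
  moreover have "(\<lambda>z. Digamma (1/4 - \<i> * z / 2)) holomorphic_on ball (of_real x0) R"
  proof (rule holomorphic_on_compose_gen[of "\<lambda>z. 1/4 - \<i> * z / 2" _ Digamma "{w. Re w > 0}", unfolded o_def])
    show "Digamma holomorphic_on {w. Re w > 0}" by (intro holomorphic_intros) (use np in auto)
  qed (use im in \<open>force intro!: holomorphic_intros\<close>)+
  moreover have "(\<lambda>z. Q (1/2 + \<i> * z)) holomorphic_on ball (of_real x0) R"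
    by (rule holomorphic_on_compose_gen[of "\<lambda>z. 1/2 + \<i> * z" _ Q "ball (crit x0) r", unfolded o_def])
       (use r crit in \<open>auto intro!: holomorphic_intros\<close>)
  ultimately have "F holomorphic_on ball (of_real x0) R" unfolding F_def by (intro holomorphic_intros) auto
  moreover have "kappa_phase x = F (of_real x)" if x: "\<bar>x - x0\<bar> < R" for x
  proof -
    have xb: "of_real x \<in> ball (complex_of_real x0) R" using x by (simp add: dist_of_real dist_real_def abs_minus_commute)
    have nz: "1/4 + \<i> * complex_of_real x / 2 \<noteq> 0" by (auto simp: complex_eq_iff)
    have "1/4 - \<i> * complex_of_real x / 2 = cnj (1/4 + \<i> * of_real x / 2)" by (simp add: complex_eq_iff)
    hence "Digamma (1/4 - \<i> * complex_of_real x / 2) = cnj (Digamma (1/4 + \<i> * of_real x / 2))"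
      using cnj_Digamma[OF nz] by simp
    hence "(Digamma (1/4 + \<i> * of_real x / 2) + Digamma (1/4 - \<i> * of_real x / 2)) / 4 - of_real (ln pi) / 2 = complex_of_real (deriv RS_theta x)"
      by (simp add: deriv_RS_theta complex_add_cnj)
    moreover have "zeta (crit x) / deriv zeta (crit x) = Q (crit x)" by (rule Q) (rule crit[OF xb])
    ultimately show ?thesis by (simp only: F_def kappa_phase_def)
  qed
  moreover have "R > 0" using r by (simp add: R_def)
  ultimately show "\<exists>r>0. \<exists>F. F holomorphic_on ball (complex_of_real x0) r \<and> (\<forall>x. \<bar>x - x0\<bar> < r \<longrightarrow> id (kappa_phase x) = F (of_real x))"
    by (intro exI[of _ R] conjI exI[of _ F]) auto
qed

text \<open>At 1/2 all values are real, so minus the quotient of conjugates is -1, matching the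
  prescribed value -1/2 of \<kappa>.\<close>

lemma kappa_phase_0: "kappa_phase 0 = -1"
proof -
  have nz: "deriv zeta (crit 0) \<noteq> 0" using deriv_zeta_crit_0 by simp
  have g: "gam (crit 0) \<noteq> 0" by (rule gam_nonzero) simp
  have "cnj (gam (crit 0) * deriv zeta (crit 0)) = gam (crit 0) * deriv zeta (crit 0)"
    using cnj_deriv_zeta[of "crit 0"] by (simp add: cnj_gam)
  thus ?thesis using kappa_phase_eq[OF nz] nz g by simp
qed

lemma kappa_lift:
  "locally_holomorphic_ext kappa complex_of_real" "exp (2 * of_real pi * \<i> * of_real (kappa t)) = kappa_phase t"
proof -
  obtain k where k: "locally_holomorphic_ext k complex_of_real" "k 0 = - (1/2)"
     "\<And>t. exp (2 * of_real pi * \<i> * of_real (k t)) = kappa_phase t"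
    by (rule unimodular_lift[OF locally_holomorphic_ext_kappa_phase norm_kappa_phase kappa_phase_0]) blast
  have "kappa = k"
    unfolding kappa_def
  proof (rule the_equality)
    show "real_analytic k \<and> k 0 = - (1/2) \<and> (\<forall>t. exp (2 * of_real pi * \<i> * of_real (k t)) =
          1 + 2 * of_real (deriv RS_theta t) * (zeta (1/2 + \<i> * of_real t) / deriv zeta (1/2 + \<i> * of_real t)))"
      using real_analyticI[OF k(1)] k(2) k(3)[unfolded kappa_phase_def] by blast
  next
    fix k' assume k': "real_analytic k' \<and> k' 0 = - (1/2) \<and> (\<forall>t. exp (2 * of_real pi * \<i> * of_real (k' t)) =
          1 + 2 * of_real (deriv RS_theta t) * (zeta (1/2 + \<i> * of_real t) / deriv zeta (1/2 + \<i> * of_real t)))"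
    show "k' = k"
    proof (rule real_phase_unique[where c = "2 * pi"])
      fix t
      have "exp (2 * of_real pi * \<i> * of_real (k' t)) = exp (2 * of_real pi * \<i> * of_real (k t))"
        using k' unfolding k(3) kappa_phase_def by blast
      thus "exp (\<i> * of_real (2 * pi * k' t)) = exp (\<i> * of_real (2 * pi * k t))" by (simp add: mult_ac)
    qed (use k' k real_analyticI[OF k(1)] in \<open>auto intro: real_analytic_imp_continuous\<close>)
  qed
  thus "locally_holomorphic_ext kappa complex_of_real" "exp (2 * of_real pi * \<i> * of_real (kappa t)) = kappa_phase t"
    using k by auto
qed

lemma has_vector_derivative_compose_crit:
  assumes "(H has_field_derivative D) (at (crit t))"
  shows "((\<lambda>t. H (crit t)) has_vector_derivative \<i> * D) (at t)"
proof -
  have "(crit has_vector_derivative \<i>) (at t)" by (auto intro!: derivative_eq_intros)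
  from field_vector_diff_chain_at[OF this assms] show ?thesis by (simp add: o_def)
qed

text \<open>The relation E H = - cnj H is differentiated along the line, with H = gam \<zeta>' and
  \<mu> its logarithmic derivative. Cancelling i E H leaves 2 pi \<kappa>' = - (\<mu> + cnj
  \<mu>).\<close>

lemma deriv_kappa:
  assumes nz: "deriv zeta (crit t) \<noteq> 0"
  shows "pi * deriv kappa t = - deriv RS_theta t - Re (deriv (deriv zeta) (crit t) / deriv zeta (crit t))"
proof -
  define H where "H s = gam s * deriv zeta s" for s
  define \<mu> where "\<mu> = gam_logderiv (crit t) + deriv (deriv zeta) (crit t) / deriv zeta (crit t)"
  define E where "E u = exp (2 * of_real pi * \<i> * of_real (kappa u))" for u :: real
  have g0: "gam (crit u) \<noteq> 0" for u by (rule gam_nonzero) simp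
  have dz: "deriv zeta holomorphic_on - {1}" using holomorphic_zeta by (intro holomorphic_deriv) auto
  have EH: "E u * H (crit u) = - cnj (H (crit u))" if "deriv zeta (crit u) \<noteq> 0" for u
  proof -
    have "E u = - cnj (H (crit u)) / H (crit u)" unfolding E_def kappa_lift(2) H_def by (rule kappa_phase_eq[OF that])
    moreover have "H (crit u) \<noteq> 0" using g0 that by (simp add: H_def)
    ultimately show ?thesis by simp
  qed
  have crit1: "crit u \<in> - {1}" for u by (auto simp: complex_eq_iff)
  have "(deriv zeta has_field_derivative deriv (deriv zeta) (crit t)) (at (crit t))"
    by (rule holomorphic_derivI[OF dz _ crit1]) auto
  moreover have "(gam has_field_derivative gam (crit t) * gam_logderiv (crit t)) (at (crit t))"
    by (rule gam_field_derivative) simp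
  ultimately have "(H has_field_derivative H (crit t) * \<mu>) (at (crit t))"
    unfolding H_def[abs_def] using nz by (intro DERIV_cong[OF DERIV_mult]) (auto simp: \<mu>_def field_simps)
  hence H': "((\<lambda>u. H (crit u)) has_vector_derivative \<i> * (H (crit t) * \<mu>)) (at t)"
    by (rule has_vector_derivative_compose_crit)
  have E': "(E has_vector_derivative 2 * of_real pi * \<i> * of_real (deriv kappa t) * E t) (at t)"
  proof -
    have "(kappa has_real_derivative deriv kappa t) (at t)" by (rule locally_holomorphic_ext_deriv[OF kappa_lift(1)])
    hence "((\<lambda>u. complex_of_real (kappa u)) has_vector_derivative of_real (deriv kappa t)) (at t)"
      by (rule has_vector_derivative_of_real)
    moreover have "((\<lambda>z. exp (2 * of_real pi * \<i> * z)) has_field_derivative E t * (2 * of_real pi * \<i>)) (at (of_real (kappa t)))"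
      by (auto intro!: derivative_eq_intros simp: E_def)
    ultimately have "((\<lambda>z. exp (2 * of_real pi * \<i> * z)) \<circ> (\<lambda>u. complex_of_real (kappa u)) has_vector_derivative
        of_real (deriv kappa t) * (E t * (2 * of_real pi * \<i>))) (at t)"
      by (rule field_vector_diff_chain_at)
    thus ?thesis by (simp add: o_def E_def[abs_def] mult_ac)
  qed
  have "continuous_on UNIV (\<lambda>u. deriv zeta (crit u))"
    by (rule continuous_on_compose2[OF holomorphic_on_imp_continuous_on[OF dz]]) (use crit1 in \<open>auto intro!: continuous_intros\<close>)
  hence op: "open ((\<lambda>u. deriv zeta (crit u)) -` (- {0}))"
    by (metis continuous_on_open_vimage open_UNIV Int_UNIV_right open_Compl closed_singleton)
  \<comment> \<open>The product relation is available only where \<zeta>' is nonzero; that set is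
    open, which suffices for a derivative at t.\<close>
  have A: "((\<lambda>u. E u * H (crit u)) has_vector_derivative - cnj (\<i> * (H (crit t) * \<mu>))) (at t)"
  proof (rule has_vector_derivative_transform_within_open[OF _ op])
    show "((\<lambda>u. - cnj (H (crit u))) has_vector_derivative - cnj (\<i> * (H (crit t) * \<mu>))) (at t)"
      using H' by (intro has_vector_derivative_minus has_vector_derivative_cnj)
    show "- cnj (H (crit u)) = E u * H (crit u)" if "u \<in> (\<lambda>u. deriv zeta (crit u)) -` (- {0})" for u
      using EH[of u] that by simp
  qed (use nz in auto)
  have B: "((\<lambda>u. E u * H (crit u)) has_vector_derivative
       (E t * (\<i> * (H (crit t) * \<mu>)) + 2 * of_real pi * \<i> * of_real (deriv kappa t) * E t * H (crit t))) (at t)"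
    using has_vector_derivative_mult[OF E' H'] .
  from vector_derivative_unique_at[OF B A]
  have "E t * (\<i> * (H (crit t) * \<mu>)) + 2 * of_real pi * \<i> * of_real (deriv kappa t) * E t * H (crit t) = - cnj (\<i> * (H (crit t) * \<mu>))"
    by (simp only:)
  also have "\<dots> = \<i> * cnj (H (crit t)) * cnj \<mu>" by simp
  also have "cnj (H (crit t)) = - (E t * H (crit t))"
    using EH[OF nz] by simp
  finally have eq: "E t * (\<i> * (H (crit t) * \<mu>)) + 2 * of_real pi * \<i> * of_real (deriv kappa t) * E t * H (crit t) = \<i> * - (E t * H (crit t)) * cnj \<mu>" .
  have "(\<i> * E t * H (crit t)) * (\<mu> + 2 * of_real pi * of_real (deriv kappa t) + cnj \<mu>) =
     (E t * (\<i> * (H (crit t) * \<mu>)) + 2 * of_real pi * \<i> * of_real (deriv kappa t) * E t * H (crit t)) - \<i> * - (E t * H (crit t)) * cnj \<mu>"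
    by (simp add: algebra_simps)
  also have "\<dots> = 0" unfolding eq by simp
  finally have "(\<i> * E t * H (crit t)) * (\<mu> + 2 * of_real pi * of_real (deriv kappa t) + cnj \<mu>) = 0" .
  hence "\<mu> + 2 * of_real pi * of_real (deriv kappa t) + cnj \<mu> = 0"
    using g0[of t] nz by (simp add: E_def H_def)
  hence "Re (\<mu> + 2 * of_real pi * of_real (deriv kappa t) + cnj \<mu>) = 0" by simp
  hence "pi * deriv kappa t = - Re \<mu>" by simp
  moreover have "Re \<mu> = deriv RS_theta t + Re (deriv (deriv zeta) (crit t) / deriv zeta (crit t))"
    unfolding \<mu>_def plus_complex.sel Re_gam_logderiv ..
  ultimately show ?thesis by simp
qed

section \<open>The sum over the zeros\<close>

lemma zeta_deriv_entire_eq_0_iff: "zeta_deriv_entire \<rho> = 0 \<longleftrightarrow> \<rho> \<noteq> 1 \<and> deriv zeta \<rho> = 0"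
  by (cases "\<rho> = 1") (auto simp: zeta_deriv_entire_1 zeta_deriv_entire_eq)

lemma zorder_zeta_deriv_entire:
  assumes "\<rho> \<noteq> 1"
  shows "zorder zeta_deriv_entire \<rho> = zorder (deriv zeta) \<rho>" "zorder (deriv zeta) \<rho> \<ge> 0"
proof -
  define n g where "n = zorder zeta_deriv_entire \<rho>" and "g = zor_poly zeta_deriv_entire \<rho>"
  have "\<exists>w\<in>UNIV. zeta_deriv_entire w \<noteq> 0" using zeta_deriv_entire_1 by (intro bexI[of _ 1]) auto
  from zorder_exist_zero[OF holomorphic_zeta_deriv_entire open_UNIV connected_UNIV UNIV_I this, of \<rho>, folded n_def g_def]
  have n: "n \<ge> 0" and ex: "\<exists>r>0. cball \<rho> r \<subseteq> UNIV \<and> g holomorphic_on cball \<rho> r \<and>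
      (\<forall>w\<in>cball \<rho> r. zeta_deriv_entire w = g w * (w - \<rho>) ^ nat n \<and> g w \<noteq> 0)"
    by (simp_all split: if_splits)
  then obtain r where r: "r > 0" "g holomorphic_on cball \<rho> r"
      "\<And>w. w \<in> cball \<rho> r \<Longrightarrow> zeta_deriv_entire w = g w * (w - \<rho>) ^ nat n \<and> g w \<noteq> 0"
    by blast
  have "zorder (deriv zeta) \<rho> = n"
  proof (rule zorder_eqI[where S = "ball \<rho> r \<inter> - {1}" and g = "\<lambda>w. g w / (w - 1)\<^sup>2"])
    show "(\<lambda>w. g w / (w - 1)\<^sup>2) holomorphic_on ball \<rho> r \<inter> - {1}"
      by (intro holomorphic_intros holomorphic_on_subset[OF r(2)]) auto
    fix w assume "w \<in> ball \<rho> r \<inter> - {1}"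
    hence w: "w \<in> cball \<rho> r" "w \<noteq> 1" by auto
    hence "(w - 1)\<^sup>2 * deriv zeta w = g w * (w - \<rho>) ^ nat n" using r(3)[OF w(1)] zeta_deriv_entire_eq[OF w(2)] by simp
    thus "deriv zeta w = g w / (w - 1)\<^sup>2 * (w - \<rho>) powi n"
      using w n by (simp add: power_int_def field_simps)
  qed (use assms r in auto)
  thus "zorder zeta_deriv_entire \<rho> = zorder (deriv zeta) \<rho>" "zorder (deriv zeta) \<rho> \<ge> 0" using n by (simp_all add: n_def)
qed

lemma zorder_deriv_zeta_simple:
  assumes "\<rho> \<noteq> 1" "deriv zeta \<rho> = 0" "deriv (deriv zeta) \<rho> \<noteq> 0"
  shows "zorder (deriv zeta) \<rho> = 1"
proof -
  define f n g where "f = deriv zeta" and "n = nat (zorder (deriv zeta) \<rho>)" and "g = zor_poly (deriv zeta) \<rho>"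
  have hol: "f holomorphic_on - {1}" unfolding f_def using holomorphic_zeta by (intro holomorphic_deriv) auto
  obtain K where K: "K \<ge> (3::real)" "\<And>s. Re s \<ge> K \<Longrightarrow> deriv zeta s \<noteq> 0" using zeta_right_half_plane by blast
  have "\<exists>w\<in>- {1}. f w \<noteq> 0" unfolding f_def using K(1)
    by (intro bexI[of _ "of_real K"] K(2)) (auto simp: complex_eq_iff)
  moreover have "open (- {1 :: complex})" "connected (- {1 :: complex})" "\<rho> \<in> - {1}"
    using assms by (auto intro: connected_punctured_universe)
  ultimately have Z: "(if f \<rho> = 0 then zorder f \<rho> > 0 else zorder f \<rho> = 0) \<and> (\<exists>r>0. cball \<rho> r \<subseteq> - {1} \<and> g holomorphic_on cball \<rho> r \<and>
      (\<forall>w\<in>cball \<rho> r. f w = g w * (w - \<rho>) ^ n \<and> g w \<noteq> 0))"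
    using zorder_exist_zero[OF hol, of \<rho>] unfolding n_def g_def f_def by blast
  have n: "n > 0" using conjunct1[OF Z] assms(2) by (simp add: n_def f_def)
  from conjunct2[OF Z] obtain r where r: "r > 0" "g holomorphic_on cball \<rho> r"
      "\<And>w. w \<in> cball \<rho> r \<Longrightarrow> f w = g w * (w - \<rho>) ^ n"
    by blast
  have "n = 1"
  proof (rule ccontr)
    assume "n \<noteq> 1"
    hence n2: "n - 1 > 0" using n by simp
    have "g holomorphic_on ball \<rho> r" by (rule holomorphic_on_subset[OF r(2)]) auto
    hence gz: "(g has_field_derivative deriv g \<rho>) (at \<rho>)" using r(1) by (intro holomorphic_derivI[of g "ball \<rho> r"]) auto
    have "((\<lambda>w. g w * (w - \<rho>) ^ n) has_field_derivative 0) (at \<rho>)"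
      by (rule derivative_eq_intros gz refl | simp)+ (use n n2 in \<open>simp add: power_0_left\<close>)
    hence "(f has_field_derivative 0) (at \<rho>)"
      by (rule has_field_derivative_transform_within_open[OF _ open_ball, of _ _ _ \<rho> r]) (use r in auto)
    hence "deriv f \<rho> = 0" by (rule DERIV_imp_deriv)
    thus False using assms by (simp add: f_def)
  qed
  thus ?thesis unfolding n_def by linarith
qed

section \<open>Poisson terms of real zeros and poles\<close>

definition decaying :: "(real \<Rightarrow> real) \<Rightarrow> bool" where
  "decaying f \<longleftrightarrow> continuous_on UNIV f \<and> (\<exists>B. \<forall>t. \<bar>f t\<bar> \<le> B) \<and> (\<exists>K. \<forall>t>0. \<bar>f t\<bar> \<le> K / t)"

lemma decaying_add:
  assumes "decaying f" "decaying g"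
  shows "decaying (\<lambda>t. f t + g t)"
proof -
  obtain B K B' K' where *: "\<And>t. \<bar>f t\<bar> \<le> B" "\<And>t. t > 0 \<Longrightarrow> \<bar>f t\<bar> \<le> K / t" "\<And>t. \<bar>g t\<bar> \<le> B'" "\<And>t. t > 0 \<Longrightarrow> \<bar>g t\<bar> \<le> K' / t"
    using assms unfolding decaying_def by metis
  have "\<bar>f t + g t\<bar> \<le> B + B'" for t using *(1,3)[of t] by linarith
  moreover have "\<bar>f t + g t\<bar> \<le> (K + K') / t" if "t > 0" for t using *(2,4)[of t] that unfolding add_divide_distrib by linarith
  ultimately show ?thesis using assms unfolding decaying_def by (blast intro: continuous_on_add)
qed

lemma decaying_cmult:
  assumes "decaying f"
  shows "decaying (\<lambda>t. c * f t)"
proof -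
  obtain B K where *: "\<And>t. \<bar>f t\<bar> \<le> B" "\<And>t. t > 0 \<Longrightarrow> \<bar>f t\<bar> \<le> K / t"
    using assms unfolding decaying_def by metis
  have "\<bar>c * f t\<bar> \<le> \<bar>c\<bar> * B" for t using *(1)[of t] by (simp add: abs_mult mult_left_mono)
  moreover have "\<bar>c * f t\<bar> \<le> (\<bar>c\<bar> * K) / t" if "t > 0" for t
    using mult_left_mono[OF *(2)[OF that], of "\<bar>c\<bar>"] by (simp add: abs_mult)
  moreover have "continuous_on UNIV (\<lambda>t. c * f t)" using assms unfolding decaying_def by (intro continuous_intros) auto
  ultimately show ?thesis unfolding decaying_def by blast
qed

lemma decaying_sum:
  assumes "\<And>i. i \<in> I \<Longrightarrow> decaying (f i)"
  shows "decaying (\<lambda>t. \<Sum>i\<in>I. f i t)"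
proof -
  have z: "decaying (\<lambda>t. 0)" unfolding decaying_def by (auto intro!: exI[of _ 0])
  show ?thesis
  proof (cases "finite I")
    case True
    thus ?thesis using assms by (induction I rule: finite_induct) (auto intro: decaying_add z)
  qed (use z in simp)
qed

text \<open>\<open>poisson c t\<close> is the real part of \<open>1 / (1/2 + i t - a)\<close> for real \<open>a = 1/2 - c\<close>.\<close>
definition poisson :: "real \<Rightarrow> real \<Rightarrow> real" where "poisson c t = c / (c\<^sup>2 + t\<^sup>2)"

lemma Re_inverse_crit: "Re (1 / (crit t - \<rho>)) = (1/2 - Re \<rho>) / ((1/2 - Re \<rho>)\<^sup>2 + (t - Im \<rho>)\<^sup>2)"
  by (simp add: Re_divide)

text \<open>The decay comes from 2 |c| t \<le> c^2 + t^2.\<close>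

lemma decaying_poisson:
  assumes "c \<noteq> 0"
  shows "decaying (poisson c)"
proof -
  have pos: "c\<^sup>2 + t\<^sup>2 > 0" for t using assms by (simp add: add_pos_nonneg)
  have "continuous_on UNIV (poisson c)" unfolding poisson_def[abs_def]
    using pos by (intro continuous_intros ballI) (metis less_irrefl)
  moreover have "\<bar>poisson c t\<bar> \<le> 1 / \<bar>c\<bar>" for t
  proof -
    have "\<bar>poisson c t\<bar> = \<bar>c\<bar> / (c\<^sup>2 + t\<^sup>2)" using pos[of t] by (simp add: poisson_def abs_divide)
    also have "\<dots> \<le> \<bar>c\<bar> / c\<^sup>2" using assms by (intro divide_left_mono mult_pos_pos pos) auto
    also have "\<dots> = 1 / \<bar>c\<bar>" using assms by (simp add: power2_eq_square abs_if field_simps)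
    finally show ?thesis .
  qed
  moreover have "\<bar>poisson c t\<bar> \<le> (1/2) / t" if "t > 0" for t
  proof -
    have "0 \<le> (\<bar>c\<bar> - t)\<^sup>2" by simp
    hence "\<bar>c\<bar> * (2 * t) \<le> c\<^sup>2 + t\<^sup>2" by (simp add: power2_diff)
    hence "\<bar>c\<bar> / (c\<^sup>2 + t\<^sup>2) \<le> 1 / (2 * t)" using pos[of t] that by (simp add: divide_simps mult.commute)
    thus ?thesis using pos[of t] by (simp add: poisson_def abs_divide)
  qed
  ultimately show ?thesis unfolding decaying_def by blast
qed

text \<open>The difference has numerator (y - x)(x y - t^2), and |x y - t^2| \<le> y^2 + t^2 cancels
  one factor of the denominator.\<close>

lemma poisson_diff_le:
  assumes "0 < x" "x \<le> y" "y \<le> x + 2"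
  shows "\<bar>poisson x t - poisson y t\<bar> \<le> 2 / (x\<^sup>2 + t\<^sup>2)"
proof -
  have pos: "x\<^sup>2 + t\<^sup>2 > 0" "y\<^sup>2 + t\<^sup>2 > 0" using assms by (auto intro: add_pos_nonneg)
  have "poisson x t - poisson y t = (y - x) * (x * y - t\<^sup>2) / ((x\<^sup>2 + t\<^sup>2) * (y\<^sup>2 + t\<^sup>2))"
  proof -
    have "poisson x t - poisson y t = (x * (y\<^sup>2 + t\<^sup>2) - y * (x\<^sup>2 + t\<^sup>2)) / ((x\<^sup>2 + t\<^sup>2) * (y\<^sup>2 + t\<^sup>2))"
      unfolding poisson_def using pos by (intro diff_frac_eq) auto
    moreover have "x * (y\<^sup>2 + t\<^sup>2) - y * (x\<^sup>2 + t\<^sup>2) = (y - x) * (x * y - t\<^sup>2)"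
      by (simp add: algebra_simps power2_eq_square)
    ultimately show ?thesis by simp
  qed
  hence "\<bar>poisson x t - poisson y t\<bar> = ((y - x) * \<bar>x * y - t\<^sup>2\<bar>) / ((x\<^sup>2 + t\<^sup>2) * (y\<^sup>2 + t\<^sup>2))"
    using pos assms by (simp add: abs_mult abs_divide)
  also have "\<dots> \<le> (2 * (y\<^sup>2 + t\<^sup>2)) / ((x\<^sup>2 + t\<^sup>2) * (y\<^sup>2 + t\<^sup>2))"
  proof (intro divide_right_mono mult_mono)
    have "x * y \<le> y * y" using assms by (intro mult_right_mono) auto
    moreover have "x * y \<ge> 0" "t\<^sup>2 \<ge> 0" "y\<^sup>2 \<ge> 0" using assms by auto
    ultimately show "\<bar>x * y - t\<^sup>2\<bar> \<le> y\<^sup>2 + t\<^sup>2" unfolding abs_le_iff power2_eq_square[of y] by linarith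
  qed (use pos assms in auto)
  also have "\<dots> = 2 / (x\<^sup>2 + t\<^sup>2)" by (rule mult_divide_mult_cancel_right) (use pos in auto)
  finally show ?thesis .
qed

text \<open>Here \<open>x\<close> comes from the poles of \<open>\<Gamma>(s/2)\<close> and \<open>y\<close> from the interlacing real zeros of \<open>\<zeta>'\<close>.\<close>
lemma decaying_poisson_series:
  assumes xy: "\<And>n. real (Suc n) \<le> x n" "\<And>n. x n \<le> y n" "\<And>n. y n \<le> x n + 2"
  shows "summable (\<lambda>n. poisson (x n) t - poisson (y n) t)" "decaying (\<lambda>t. \<Sum>n. poisson (x n) t - poisson (y n) t)"
proof -
  define q where "q n t = poisson (x n) t - poisson (y n) t" for n t
  have x0: "x n > 0" for n using xy(1)[of n] by simp
  hence y0: "y n > 0" for n using xy(2)[of n] by (meson less_le_trans)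
  have q: "\<bar>q n t\<bar> \<le> 2 * (1 / ((real (Suc n))\<^sup>2 + t\<^sup>2))" for n t
  proof -
    have "\<bar>q n t\<bar> \<le> 2 / ((x n)\<^sup>2 + t\<^sup>2)" unfolding q_def using xy x0 by (intro poisson_diff_le) auto
    also have "(real (Suc n))\<^sup>2 \<le> (x n)\<^sup>2" using xy(1) by (intro power_mono) auto
    hence "2 / ((x n)\<^sup>2 + t\<^sup>2) \<le> 2 / ((real (Suc n))\<^sup>2 + t\<^sup>2)" by (intro divide_left_mono mult_pos_pos add_pos_nonneg) auto
    finally show ?thesis by simp
  qed
  have q': "\<bar>q n t\<bar> \<le> 2 * (1 / (real (Suc n))\<^sup>2)" for n t
  proof -
    have "1 / ((real (Suc n))\<^sup>2 + t\<^sup>2) \<le> 1 / (real (Suc n))\<^sup>2" by (intro divide_left_mono mult_pos_pos add_pos_nonneg) auto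
    thus ?thesis using q[of n t] by linarith
  qed
  have "summable (\<lambda>n. 1 / (real (Suc n))\<^sup>2)" using inverse_squares_sums by (simp add: sums_iff)
  hence M: "summable (\<lambda>n. 2 * (1 / (real (Suc n))\<^sup>2))" by (rule summable_mult)
  have sq: "summable (\<lambda>n. q n t)" for t by (rule summable_comparison_test'[OF M]) (use q' in simp)
  thus "summable (\<lambda>n. poisson (x n) t - poisson (y n) t)" by (simp add: q_def)
  have cq: "continuous_on UNIV (q n)" for n
    unfolding q_def[abs_def] using decaying_poisson[of "x n"] decaying_poisson[of "y n"] x0[of n] y0[of n]
    by (intro continuous_on_diff) (auto simp: decaying_def)
  have "uniform_limit UNIV (\<lambda>N t. \<Sum>n<N. q n t) (\<lambda>t. \<Sum>n. q n t) sequentially"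
    using q' by (intro Weierstrass_m_test[OF _ M]) auto
  hence "continuous_on UNIV (\<lambda>t. \<Sum>n. q n t)"
    by (rule uniform_limit_theorem[rotated]) (auto intro!: always_eventually continuous_on_sum cq)
  moreover have "\<bar>\<Sum>n. q n t\<bar> \<le> (\<Sum>n. 2 * (1 / (real (Suc n))\<^sup>2))" for t
    using norm_suminf_le[OF _ M, of "\<lambda>n. q n t"] q' by simp
  \<comment> \<open>Summing 1 / (n^2 + t^2) over n costs one power of t; this is the source of the
    rate 1/t.\<close>
  moreover have "\<bar>\<Sum>n. q n t\<bar> \<le> pi / t" if t: "t > 0" for t
  proof -
    note S = suminf_inverse_sum_squares[OF t]
    have "\<bar>\<Sum>n. q n t\<bar> \<le> (\<Sum>n. 2 * (1 / ((real (Suc n))\<^sup>2 + t\<^sup>2)))"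
      using norm_suminf_le[OF _ summable_mult[OF S(1), of 2], of "\<lambda>n. q n t"] q by simp
    also have "\<dots> = 2 * (\<Sum>n. 1 / ((real (Suc n))\<^sup>2 + t\<^sup>2))" by (rule suminf_mult[OF S(1)])
    also have "\<dots> \<le> 2 * (pi / (2 * t))" using S(2) by (rule mult_left_mono) simp
    finally show ?thesis by simp
  qed
  ultimately show "decaying (\<lambda>t. \<Sum>n. poisson (x n) t - poisson (y n) t)"
    unfolding decaying_def q_def[symmetric] by blast
qed

section \<open>Convergence and continuity of the sum over the nonreal zeros\<close>

lemma nonreal_zeros_bounded_Re: "\<exists>B. \<forall>\<rho>\<in>nonreal_zeta_deriv_zeros. \<bar>Re \<rho>\<bar> \<le> B"
proof -
  obtain K where K: "K \<ge> (3::real)" "\<And>s. Re s \<ge> K \<Longrightarrow> deriv zeta s \<noteq> 0" using zeta_right_half_plane by blast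
  obtain K' where K': "K' \<ge> (2::real)" "\<And>s. Re s \<le> - K' \<Longrightarrow> deriv zeta s = 0 \<Longrightarrow> Im s = 0" using no_nonreal_zeros_left by blast
  have "\<bar>Re \<rho>\<bar> \<le> K + K'" if "deriv zeta \<rho> = 0" "Im \<rho> \<noteq> 0" for \<rho>
  proof -
    have "Re \<rho> < K" using K(2)[of \<rho>] that by force
    moreover have "Re \<rho> > - K'" using K'(2)[of \<rho>] that by force
    ultimately show ?thesis using K(1) K'(1) by linarith
  qed
  thus ?thesis unfolding nonreal_zeta_deriv_zeros_def by blast
qed

text \<open>The zeros lie in a strip, so numerators are bounded. Denominators are at least a
  multiple of 1 + |\<rho> - 1|^2: far zeros by the triangle inequality, the finitely many near ones
  because they are off the critical line. Zeros on the line contribute 0.\<close>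

lemma zero_term_uniform_bound:
  obtains M where "M summable_on nonreal_zeta_deriv_zeros"
    "\<And>t \<rho>. \<rho> \<in> nonreal_zeta_deriv_zeros \<Longrightarrow> \<bar>t\<bar> \<le> T \<Longrightarrow> \<bar>zero_term t \<rho>\<bar> \<le> M \<rho>"
proof -
  let ?Z = nonreal_zeta_deriv_zeros
  obtain C where "entire_order_three_halves zeta_deriv_entire 1 C" using zeta_deriv_entire_order by blast
  then interpret entire_order_three_halves zeta_deriv_entire 1 C .
  obtain B where B: "\<And>\<rho>. \<rho> \<in> ?Z \<Longrightarrow> \<bar>Re \<rho>\<bar> \<le> B" using nonreal_zeros_bounded_Re by blast
  have Z1: "\<rho> \<noteq> 1" "zeta_deriv_entire \<rho> = 0" if "\<rho> \<in> ?Z" for \<rho>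
    using that by (auto simp: nonreal_zeta_deriv_zeros_def zeta_deriv_entire_eq_0_iff)
  define T' where "T' = max T 1"
  \<comment> \<open>\<open>crit t\<close> lies within T' + 1 of 1, so beyond radius R the distance
    from \<rho> to \<open>crit t\<close> is at least half of |\<rho> - 1|.\<close>
  define R where "R = 2 * (T' + 1)"
  define X where "X = {\<rho> \<in> zeros_upto R. Re \<rho> \<noteq> 1/2}"
  define w where "w \<rho> = 1 + (norm (\<rho> - 1))\<^sup>2" for \<rho> :: complex
  have w: "w \<rho> \<ge> 1" for \<rho> by (simp add: w_def)
  \<comment> \<open>The entry 1/8 serves the far zeros; the other entries bound the near ones from
    below independently of t.\<close>
  define c where "c = Min (insert (1/8) ((\<lambda>\<rho>. (1/2 - Re \<rho>)\<^sup>2 / w \<rho>) ` X))"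
  have finX: "finite X" unfolding X_def using finite_zeros_upto by simp
  have c0: "c > 0" unfolding c_def
  proof (subst Min_gr_iff)
    have "0 < (1/2 - Re \<rho>)\<^sup>2 / w \<rho>" if "\<rho> \<in> X" for \<rho>
      using that w[of \<rho>] by (intro divide_pos_pos) (auto simp: X_def)
    thus "\<forall>a\<in>insert (1/8) ((\<lambda>\<rho>. (1/2 - Re \<rho>)\<^sup>2 / w \<rho>) ` X). 0 < a" by auto
  qed (use finX in auto)
  have c8: "c \<le> 1/8" unfolding c_def using finX by (intro Min_le) auto
  have cX: "c \<le> (1/2 - Re \<rho>)\<^sup>2 / w \<rho>" if "\<rho> \<in> X" for \<rho> unfolding c_def using finX that by (intro Min_le) auto
  have key: "c * w \<rho> \<le> (1/2 - Re \<rho>)\<^sup>2 + (t - Im \<rho>)\<^sup>2" if \<rho>: "\<rho> \<in> ?Z" "Re \<rho> \<noteq> 1/2" and t: "\<bar>t\<bar> \<le> T" for \<rho> t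
  proof (cases "norm (\<rho> - 1) \<le> R")
    case True
    hence "\<rho> \<in> X" using Z1[OF \<rho>(1)] \<rho>(2) by (simp add: X_def zeros_upto_def dist_norm norm_minus_commute)
    hence "c * w \<rho> \<le> (1/2 - Re \<rho>)\<^sup>2" using cX[of \<rho>] w[of \<rho>] by (simp add: pos_le_divide_eq)
    thus ?thesis by (smt (verit) zero_le_power2)
  next
    case False
    have "norm (crit t - 1) \<le> 1/2 + \<bar>t\<bar>"
    proof -
      have "crit t - 1 = of_real (-1/2) + \<i> * of_real t" by simp
      thus ?thesis using norm_triangle_ineq[of "of_real (-1/2)" "\<i> * complex_of_real t"] by (simp add: norm_mult)
    qed
    hence "norm (crit t - 1) \<le> T' + 1" using t by (simp add: T'_def)
    hence "norm (\<rho> - crit t) \<ge> norm (\<rho> - 1) / 2"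
      using norm_triangle_ineq[of "\<rho> - crit t" "crit t - 1"] False by (simp add: R_def)
    hence "(norm (\<rho> - 1) / 2)\<^sup>2 \<le> (norm (\<rho> - crit t))\<^sup>2" by (intro power_mono) auto
    also have "(norm (\<rho> - crit t))\<^sup>2 = (1/2 - Re \<rho>)\<^sup>2 + (t - Im \<rho>)\<^sup>2"
      by (simp add: cmod_power2 power2_commute)
    finally have 1: "(norm (\<rho> - 1))\<^sup>2 / 4 \<le> (1/2 - Re \<rho>)\<^sup>2 + (t - Im \<rho>)\<^sup>2" by (simp add: power_divide)
    have "norm (\<rho> - 1) \<ge> 1" using False by (simp add: R_def T'_def)
    hence "(norm (\<rho> - 1))\<^sup>2 \<ge> 1" by simp
    hence "(1/8) * w \<rho> \<le> (norm (\<rho> - 1))\<^sup>2 / 4" by (simp add: w_def)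
    moreover have "c * w \<rho> \<le> (1/8) * w \<rho>" using c8 w[of \<rho>] by (intro mult_right_mono) auto
    ultimately show ?thesis using 1 by linarith
  qed
  define M where "M \<rho> = (B + 1/2) / c * (real (mult \<rho>) / w \<rho>)" for \<rho>
  show thesis
  proof (rule that)
    have "(\<lambda>\<rho>. real (mult \<rho>) / w \<rho>) summable_on ?Z"
      using summable_mult unfolding w_def by (rule summable_on_subset_banach) (use Z1 in auto)
    thus "M summable_on ?Z" unfolding M_def by (rule summable_on_cmult_right)
    fix t \<rho> assume \<rho>: "\<rho> \<in> ?Z" and t: "\<bar>t\<bar> \<le> T"
    have m: "real_of_int (zorder (deriv zeta) \<rho>) = real (mult \<rho>)"
      using zorder_zeta_deriv_entire[OF Z1(1)[OF \<rho>]] by simp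
    have B0: "B \<ge> 0" using B[OF \<rho>] by linarith
    show "\<bar>zero_term t \<rho>\<bar> \<le> M \<rho>"
    proof (cases "Re \<rho> = 1/2")
      case False
      have p: "0 < c * w \<rho>" using c0 w[of \<rho>] by simp
      have "\<bar>(Re \<rho> - 1/2) / ((1/2 - Re \<rho>)\<^sup>2 + (t - Im \<rho>)\<^sup>2)\<bar> = \<bar>Re \<rho> - 1/2\<bar> / ((1/2 - Re \<rho>)\<^sup>2 + (t - Im \<rho>)\<^sup>2)"
        by (simp add: abs_divide)
      also have "\<dots> \<le> (B + 1/2) / (c * w \<rho>)"
        using B[OF \<rho>] B0 key[OF \<rho> False t] p by (intro frac_le) auto
      finally have "\<bar>zero_term t \<rho>\<bar> \<le> real (mult \<rho>) * ((B + 1/2) / (c * w \<rho>))"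
        unfolding zero_term_def m abs_mult by (intro mult_mono) auto
      thus ?thesis by (simp add: M_def mult.commute)
    next
      case True
      have "0 \<le> M \<rho>" unfolding M_def using B0 c0 w[of \<rho>] by (intro mult_nonneg_nonneg divide_nonneg_nonneg) auto
      thus ?thesis unfolding zero_term_def True by simp
    qed
  qed
qed

lemma summable_zero_term: "zero_term t summable_on nonreal_zeta_deriv_zeros"
proof -
  obtain M where M: "M summable_on nonreal_zeta_deriv_zeros"
    "\<And>t' \<rho>. \<rho> \<in> nonreal_zeta_deriv_zeros \<Longrightarrow> \<bar>t'\<bar> \<le> \<bar>t\<bar> \<Longrightarrow> \<bar>zero_term t' \<rho>\<bar> \<le> M \<rho>"
    using zero_term_uniform_bound[of "\<bar>t\<bar>"] by blast
  have "(\<lambda>\<rho>. norm (zero_term t \<rho>)) summable_on nonreal_zeta_deriv_zeros"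
    by (rule summable_on_comparison_test[OF M(1)]) (use M(2)[of _ t] in auto)
  thus ?thesis by (rule abs_summable_summable)
qed

text \<open>Uniform convergence on bounded intervals. Continuity is what carries the final identity
  across the zeros of \<zeta>' on the critical line.\<close>

lemma continuous_zero_sum:
  "continuous_on UNIV (\<lambda>t. \<Sum>\<^sub>\<infinity>\<rho>\<in>nonreal_zeta_deriv_zeros. zero_term t \<rho>)"
proof -
  let ?Z = nonreal_zeta_deriv_zeros
  have "continuous_on {-T<..<T} (\<lambda>t. \<Sum>\<^sub>\<infinity>\<rho>\<in>?Z. zero_term t \<rho>)" for T :: real
  proof -
    obtain M where M: "M summable_on ?Z" "\<And>t \<rho>. \<rho> \<in> ?Z \<Longrightarrow> \<bar>t\<bar> \<le> T \<Longrightarrow> \<bar>zero_term t \<rho>\<bar> \<le> M \<rho>"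
      using zero_term_uniform_bound[of T] by blast
    have "uniform_limit {-T<..<T} (\<lambda>X t. \<Sum>\<rho>\<in>X. zero_term t \<rho>) (\<lambda>t. \<Sum>\<^sub>\<infinity>\<rho>\<in>?Z. zero_term t \<rho>) (finite_subsets_at_top ?Z)"
      by (rule Weierstrass_m_test_general[OF _ M(1)]) (use M(2) in auto)
    moreover have c: "continuous_on A (\<lambda>t. zero_term t \<rho>)" for \<rho> A
    proof (cases "Re \<rho> = 1/2")
      case False
      hence "(1/2 - Re \<rho>)\<^sup>2 + (t - Im \<rho>)\<^sup>2 \<noteq> 0" for t by (metis add_nonneg_eq_0_iff right_minus_eq zero_eq_power2 zero_le_power2)
      thus ?thesis unfolding zero_term_def by (intro continuous_intros) auto
    next
      case True
      show ?thesis unfolding zero_term_def True by simp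
    qed
    ultimately show ?thesis
      by (intro uniform_limit_theorem[where F = "finite_subsets_at_top ?Z"]) (auto intro!: always_eventually continuous_on_sum c)
  qed
  hence "isCont (\<lambda>t. \<Sum>\<^sub>\<infinity>\<rho>\<in>?Z. zero_term t \<rho>) t" for t
    by (rule continuous_on_interior[of "{- (\<bar>t\<bar> + 1)<..<\<bar>t\<bar> + 1}"]) (auto simp: interior_open)
  thus ?thesis by (simp add: continuous_at_imp_continuous_on)
qed

section \<open>Real zeros and the assembly of the formula\<close>

lemma real_zeros_enumeration:
  obtains N :: nat and R0 :: "complex set" and a :: "nat \<Rightarrow> real" where
    "finite R0" "{\<rho>. zeta_deriv_entire \<rho> = 0 \<and> Im \<rho> = 0} = R0 \<union> range (\<lambda>n. of_real (a n))"
    "R0 \<inter> range (\<lambda>n. of_real (a n)) = {}" "inj a" "N \<ge> 1"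
    "\<And>n. - 2 * real (n + N) - 2 < a n" "\<And>n. a n < - 2 * real (n + N)" "\<And>n. zorder (deriv zeta) (of_real (a n)) = 1"
proof -
  obtain C where "entire_order_three_halves zeta_deriv_entire 1 C" using zeta_deriv_entire_order by blast
  then interpret entire_order_three_halves zeta_deriv_entire 1 C .
  obtain K where K: "K \<ge> (3::real)" "\<And>s. Re s \<ge> K \<Longrightarrow> deriv zeta s \<noteq> 0" using zeta_right_half_plane by blast
  obtain N where N: "N \<ge> 1" "\<And>n. n \<ge> N \<Longrightarrow> deriv zeta (of_real (- 2 * real n)) \<noteq> 0"
    "\<And>n. n \<ge> N \<Longrightarrow> \<exists>a. - 2 * real n - 2 < a \<and> a < - 2 * real n \<and> deriv zeta (of_real a) = 0 \<and> deriv (deriv zeta) (of_real a) \<noteq> 0 \<and>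
        (\<forall>b. - 2 * real n - 2 < b \<and> b < - 2 * real n \<and> deriv zeta (of_real b) = 0 \<longrightarrow> b = a)"
    using real_zeros_left by blast
  have "\<exists>a. \<forall>n. - 2 * real (n + N) - 2 < a n \<and> a n < - 2 * real (n + N) \<and> deriv zeta (of_real (a n)) = 0 \<and> deriv (deriv zeta) (of_real (a n)) \<noteq> 0 \<and>
        (\<forall>b. - 2 * real (n + N) - 2 < b \<and> b < - 2 * real (n + N) \<and> deriv zeta (of_real b) = 0 \<longrightarrow> b = a n)"
    by (intro choice allI N(3)) simp
  then obtain a where a: "\<And>n. - 2 * real (n + N) - 2 < a n" "\<And>n. a n < - 2 * real (n + N)" "\<And>n. deriv zeta (of_real (a n)) = 0"
      "\<And>n. deriv (deriv zeta) (of_real (a n)) \<noteq> 0"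
      "\<And>n b. - 2 * real (n + N) - 2 < b \<Longrightarrow> b < - 2 * real (n + N) \<Longrightarrow> deriv zeta (of_real b) = 0 \<Longrightarrow> b = a n"
    by blast
  have neg: "a n < 0" for n using a(2)[of n] by linarith
  have a1: "complex_of_real (a n) \<noteq> 1" for n
    using neg[of n] of_real_eq_iff[of "a n" 1, where 'a = complex] by fastforce
  define R0 where "R0 = {\<rho>. zeta_deriv_entire \<rho> = 0 \<and> Im \<rho> = 0 \<and> Re \<rho> \<ge> - 2 * real N}"
  show thesis
  proof (rule that)
    have "R0 \<subseteq> zeros_upto (K + 2 * real N + 1)"
    proof
      fix \<rho> assume \<rho>: "\<rho> \<in> R0"
      hence "deriv zeta \<rho> = 0" by (simp add: R0_def zeta_deriv_entire_eq_0_iff)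
      hence "Re \<rho> < K" using K(2)[of \<rho>] by force
      hence "\<bar>1 - Re \<rho>\<bar> \<le> K + 2 * real N + 1" using \<rho> K(1) by (auto simp: R0_def)
      moreover have "dist 1 \<rho> = \<bar>1 - Re \<rho>\<bar>" using \<rho> by (simp add: R0_def dist_norm cmod_eq_Re)
      ultimately show "\<rho> \<in> zeros_upto (K + 2 * real N + 1)" using \<rho> by (simp add: zeros_upto_def R0_def)
    qed
    thus "finite R0" using finite_zeros_upto by (rule finite_subset)
    show "{\<rho>. zeta_deriv_entire \<rho> = 0 \<and> Im \<rho> = 0} = R0 \<union> range (\<lambda>n. of_real (a n))"
    proof (intro set_eqI iffI)
      fix \<rho> assume "\<rho> \<in> {\<rho>. zeta_deriv_entire \<rho> = 0 \<and> Im \<rho> = 0}"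
      hence \<rho>: "zeta_deriv_entire \<rho> = 0" "Im \<rho> = 0" "\<rho> = of_real (Re \<rho>)" by (auto simp: complex_eq_iff)
      show "\<rho> \<in> R0 \<union> range (\<lambda>n. of_real (a n))"
      proof (cases "Re \<rho> \<ge> - 2 * real N")
        case False
        \<comment> \<open>With this n, - Re \<rho> / 2 lies in (n, n + 1]. The endpoint n + 1 is
          excluded afterwards, since \<zeta>' does not vanish at -2(n + 1).\<close>
        define n where "n = nat (\<lceil>- Re \<rho> / 2\<rceil> - 1)"
        have "real N < - Re \<rho> / 2" using False by simp
        hence "int N < \<lceil>- Re \<rho> / 2\<rceil>" by (simp add: less_ceiling_iff)
        hence nN: "n \<ge> N" and c: "real_of_int \<lceil>- Re \<rho> / 2\<rceil> = real n + 1" by (auto simp: n_def)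
        have "- Re \<rho> / 2 \<le> real n + 1" using le_of_int_ceiling[of "- Re \<rho> / 2"] unfolding c .
        hence r1: "- 2 * real n - 2 \<le> Re \<rho>" by simp
        have "real n < - Re \<rho> / 2" using ceiling_correct[of "- Re \<rho> / 2"] unfolding c by simp
        hence r2: "Re \<rho> < - 2 * real n" by simp
        have z: "deriv zeta (of_real (Re \<rho>)) = 0" using \<rho> zeta_deriv_entire_eq_0_iff by metis
        have "Re \<rho> \<noteq> - 2 * real n - 2"
        proof
          assume "Re \<rho> = - 2 * real n - 2"
          hence "Re \<rho> = - 2 * real (Suc n)" by simp
          thus False using N(2)[of "Suc n"] nN z by simp
        qed
        hence "Re \<rho> = a (n - N)" using r1 r2 nN z by (intro a(5)) auto
        thus ?thesis using \<rho>(3) by auto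
      qed (use \<rho> in \<open>simp add: R0_def\<close>)
    next
      fix \<rho> assume "\<rho> \<in> R0 \<union> range (\<lambda>n. of_real (a n))"
      thus "\<rho> \<in> {\<rho>. zeta_deriv_entire \<rho> = 0 \<and> Im \<rho> = 0}"
        using a(3) a1 by (auto simp: R0_def zeta_deriv_entire_eq_0_iff)
    qed
    have "\<not> - 2 * real N \<le> a n" for n using a(2)[of n] by simp
    thus "R0 \<inter> range (\<lambda>n. of_real (a n)) = {}" by (auto simp: R0_def)
    show "inj a"
    proof (rule injI)
      fix m n assume "a m = a n"
      hence "- 2 * real (m + N) - 2 < - 2 * real (n + N)" "- 2 * real (n + N) - 2 < - 2 * real (m + N)"
        using a(1,2)[of m] a(1,2)[of n] by linarith+
      thus "m = n" by auto
    qed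
    show "zorder (deriv zeta) (of_real (a n)) = 1" for n by (rule zorder_deriv_zeta_simple[OF a1 a(3,4)])
  qed (use N(1) a(1,2) in auto)
qed

lemma logderiv_zeta_deriv_entire:
  assumes s: "s \<noteq> 1" "deriv zeta s \<noteq> 0"
  shows "deriv (deriv zeta) s / deriv zeta s = deriv zeta_deriv_entire s / zeta_deriv_entire s - 2 / (s - 1)"
proof -
  have "deriv zeta holomorphic_on - {1}" using holomorphic_zeta by (intro holomorphic_deriv) auto
  hence d: "(deriv zeta has_field_derivative deriv (deriv zeta) s) (at s)"
    by (rule holomorphic_derivI[of _ "- {1}"]) (use s in auto)
  have "((\<lambda>s. (s - 1)\<^sup>2 * deriv zeta s) has_field_derivative 2 * (s - 1) * deriv zeta s + (s - 1)\<^sup>2 * deriv (deriv zeta) s) (at s)"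
    by (rule derivative_eq_intros d refl | simp)+
  hence "(zeta_deriv_entire has_field_derivative 2 * (s - 1) * deriv zeta s + (s - 1)\<^sup>2 * deriv (deriv zeta) s) (at s)"
    by (rule has_field_derivative_transform_within_open[where S = "- {1}"]) (use s zeta_deriv_entire_eq in auto)
  hence "deriv zeta_deriv_entire s = 2 * (s - 1) * deriv zeta s + (s - 1)\<^sup>2 * deriv (deriv zeta) s"
    by (rule DERIV_imp_deriv)
  moreover have "d' / d = (2 * r * d + r\<^sup>2 * d') / (r\<^sup>2 * d) - 2 / r" if "r \<noteq> 0" "d \<noteq> 0" for r d d' :: complex
    using that by (simp add: field_simps power2_eq_square)
  from this[of "s - 1"] s
  have "deriv (deriv zeta) s / deriv zeta s = (2 * (s - 1) * deriv zeta s + (s - 1)\<^sup>2 * deriv (deriv zeta) s) / ((s - 1)\<^sup>2 * deriv zeta s) - 2 / (s - 1)"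
    by (meson right_minus_eq)
  ultimately show ?thesis unfolding zeta_deriv_entire_eq[OF s(1)] by (simp only:)
qed

text \<open>The pole -2k of Gamma (s/2) is at distance 2k + 1/2 from the critical line. Subtracting
  the value at t = 0 cancels the regularising terms of the Digamma series.\<close>

lemma RS_theta_deriv_series:
  "(\<lambda>k. poisson (2 * real k + 1/2) 0 - poisson (2 * real k + 1/2) t) sums (deriv RS_theta t - deriv RS_theta 0)"
proof -
  have nz: "1/4 + \<i> * of_real t / 2 \<noteq> 0" for t by (auto simp: complex_eq_iff)
  have "(\<lambda>k. inverse (of_nat (Suc k)) - inverse (1/4 + \<i> * of_real t / 2 + of_nat k)
         - (inverse (of_nat (Suc k)) - inverse (1/4 + \<i> * of_real 0 / 2 + of_nat k))) sums
      (Digamma (1/4 + \<i> * of_real t / 2) + euler_mascheroni - (Digamma (1/4 + \<i> * of_real 0 / 2) + euler_mascheroni))"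
    by (intro sums_diff Digamma_sums nz)
  hence "(\<lambda>k. Re (inverse (of_nat (Suc k)) - inverse (1/4 + \<i> * of_real t / 2 + of_nat k)
         - (inverse (of_nat (Suc k)) - inverse (1/4 + \<i> * of_real 0 / 2 + of_nat k))) / 2) sums
      (Re (Digamma (1/4 + \<i> * of_real t / 2) + euler_mascheroni - (Digamma (1/4 + \<i> * of_real 0 / 2) + euler_mascheroni)) / 2)"
    by (intro sums_divide sums_Re)
  moreover have P: "Re (inverse (1/4 + \<i> * of_real u / 2 + of_nat k)) / 2 = poisson (2 * real k + 1/2) u" for u k
  proof -
    have "poisson (2 * real k + 1/2) u = (2 * (1/4 + real k)) / (4 * ((1/4 + real k)\<^sup>2 + (u / 2)\<^sup>2))"
      unfolding poisson_def by (rule arg_cong2[where f = "(/)"]) (simp_all add: power2_eq_square algebra_simps)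
    also have "2 * x / (4 * d) = x / d / 2" for x d :: real by simp
    hence "(2 * (1/4 + real k)) / (4 * ((1/4 + real k)\<^sup>2 + (u / 2)\<^sup>2)) = (1/4 + real k) / ((1/4 + real k)\<^sup>2 + (u / 2)\<^sup>2) / 2" .
    finally show ?thesis by simp
  qed
  have "Re (inverse (of_nat (Suc k)) - inverse (1/4 + \<i> * of_real t / 2 + of_nat k)
         - (inverse (of_nat (Suc k)) - inverse (1/4 + \<i> * of_real 0 / 2 + of_nat k))) / 2 =
      poisson (2 * real k + 1/2) 0 - poisson (2 * real k + 1/2) t" for k
    unfolding minus_complex.sel diff_divide_distrib P by simp
  ultimately show ?thesis by (simp add: deriv_RS_theta diff_divide_distrib del: inverse_complex.sel)
qed

text \<open>Every contribution is taken relative to t = 0, which makes the series over poles and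
  over real zeros converge separately before they are combined.\<close>

lemma kappa_deriv_formula:
  obtains A f where "decaying f"
    "\<And>t. deriv zeta (crit t) \<noteq> 0 \<Longrightarrow>
       pi * deriv kappa t = A + f t + (\<Sum>\<^sub>\<infinity>\<rho>\<in>nonreal_zeta_deriv_zeros. zero_term t \<rho>)"
proof -
  obtain C where "entire_order_three_halves zeta_deriv_entire 1 C" using zeta_deriv_entire_order by blast
  then interpret entire_order_three_halves zeta_deriv_entire 1 C .
  obtain N R0 a where R0: "finite R0" "{\<rho>. zeta_deriv_entire \<rho> = 0 \<and> Im \<rho> = 0} = R0 \<union> range (\<lambda>n. of_real (a n))"
    "R0 \<inter> range (\<lambda>n. of_real (a n)) = {}" "inj a" "N \<ge> 1"
    and a: "\<And>n. - 2 * real (n + N) - 2 < a n" "\<And>n. a n < - 2 * real (n + N)" "\<And>n. zorder (deriv zeta) (of_real (a n)) = 1"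
    by (rule real_zeros_enumeration) blast
  let ?NR = nonreal_zeta_deriv_zeros and ?A = "range (\<lambda>n. complex_of_real (a n))"
  let ?F = "\<lambda>s. deriv zeta_deriv_entire s / zeta_deriv_entire s"
  \<comment> \<open>u belongs to the pole -2k of Gamma (s/2), v to the n-th enumerated real
    zero.\<close>
  define u v where "u k t = poisson (2 * real k + 1/2) t" and "v n t = poisson (1/2 - a n) t" for k n t
  define w where "w \<rho> t = real (mult \<rho>) * poisson (1/2 - Re \<rho>) t" for \<rho> t
  \<comment> \<open>Poles and zeros are paired with a shift by N, where the interlacing starts; only
    the paired differences converge without subtracting values at 0.\<close>
  define D where "D t = (\<Sum>n. u (n + N) t - v n t)" for t
  \<comment> \<open>The paired series, the N unpaired poles, the finitely many exceptional real
    zeros and the double pole of \<zeta>' at 1.\<close>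
  define f where "f t = D t + ((\<Sum>k<N. u k t) + ((-1) * (\<Sum>\<rho>\<in>R0. w \<rho> t) + 2 * poisson (-1/2) t))" for t
  define S where "S t = (\<Sum>\<^sub>\<infinity>\<rho>\<in>?NR. zero_term t \<rho>)" for t
  \<comment> \<open>All values at t = 0 left over from the comparison.\<close>
  define A where "A = - deriv RS_theta 0 - Re (?F (1/2)) - S 0 - D 0 - (\<Sum>k<N. u k 0) + (\<Sum>\<rho>\<in>R0. w \<rho> 0)"
  have Z: "{\<rho>. zeta_deriv_entire \<rho> = 0} = ?NR \<union> (R0 \<union> ?A)"
    unfolding R0(2) [symmetric] by (auto simp: nonreal_zeta_deriv_zeros_def zeta_deriv_entire_eq_0_iff)
  have Z1: "\<rho> \<noteq> 1" if "\<rho> \<in> ?NR \<union> (R0 \<union> ?A)" for \<rho>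
    using that unfolding Z [symmetric] by (auto simp: zeta_deriv_entire_eq_0_iff)
  have real: "Im \<rho> = 0" if "\<rho> \<in> R0 \<union> ?A" for \<rho> using that unfolding R0(2) [symmetric] by auto
  have half: "zeta_deriv_entire (1/2) \<noteq> 0"
    using deriv_zeta_crit_0 by (simp add: zeta_deriv_entire_eq_0_iff)
  have summ_uv: "summable (\<lambda>n. u (n + N) t - v n t)" and dec_D: "decaying D" for t
  proof -
    have "real N \<ge> 1" using R0(5) by simp
    hence 1: "real (Suc n) \<le> 2 * real (n + N) + 1/2" for n by simp
    have 2: "2 * real (n + N) + 1/2 \<le> 1/2 - a n" "1/2 - a n \<le> 2 * real (n + N) + 1/2 + 2" for n
      using a(1,2)[of n] by linarith+
    show "summable (\<lambda>n. u (n + N) t - v n t)" "decaying D"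
      unfolding u_def v_def D_def[abs_def]
      using decaying_poisson_series[of "\<lambda>n. 2 * real (n + N) + 1/2" "\<lambda>n. 1/2 - a n", OF 1 2] by simp_all
  qed
  have "decaying f"
    unfolding f_def[abs_def] w_def u_def
  proof (intro decaying_add decaying_cmult decaying_sum decaying_poisson dec_D)
    fix \<rho> assume \<rho>: "\<rho> \<in> R0"
    show "1/2 - Re \<rho> \<noteq> 0"
    proof
      assume "1/2 - Re \<rho> = 0"
      hence "\<rho> = 1/2" using real[of \<rho>] \<rho> by (simp add: complex_eq_iff)
      thus False using half Z \<rho> by blast
    qed
  qed auto
  moreover have "pi * deriv kappa t = A + f t + S t" if t: "deriv zeta (crit t) \<noteq> 0" for t
  proof -
    have crit1: "crit t \<noteq> 1" by (auto simp: complex_eq_iff)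
    have nz: "zeta_deriv_entire (crit t) \<noteq> 0" using t by (simp add: zeta_deriv_entire_eq_0_iff)
    define h where "h \<rho> = Re (of_nat (mult \<rho>) * (1 / (crit t - \<rho>) - 1 / (1/2 - \<rho>)))" for \<rho>
    have h_all: "(h has_sum Re (?F (crit t) - ?F (1/2))) (?NR \<union> (R0 \<union> ?A))"
      unfolding Z [symmetric] h_def using has_sum_Re[OF has_sum_logderiv_diff[OF nz half]] .
    have h_eq: "h \<rho> = real (mult \<rho>) * ((1/2 - Re \<rho>) / ((1/2 - Re \<rho>)\<^sup>2 + (t - Im \<rho>)\<^sup>2))
        - real (mult \<rho>) * ((1/2 - Re \<rho>) / ((1/2 - Re \<rho>)\<^sup>2 + (0 - Im \<rho>)\<^sup>2))" for \<rho>
    proof -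
      have "h \<rho> = real (mult \<rho>) * (Re (1 / (crit t - \<rho>)) - Re (1 / (crit 0 - \<rho>)))" by (simp add: h_def)
      thus ?thesis unfolding Re_inverse_crit by (simp add: right_diff_distrib)
    qed
    have h_NR: "(h has_sum (- S t + S 0)) ?NR"
    proof -
      have "h \<rho> = - zero_term t \<rho> + zero_term 0 \<rho>" if "\<rho> \<in> ?NR" for \<rho>
      proof -
        have m: "real_of_int (zorder (deriv zeta) \<rho>) = real (mult \<rho>)"
          using zorder_zeta_deriv_entire[OF Z1[of \<rho>]] that by simp
        have neg: "(1/2 - Re \<rho>) / x = - ((Re \<rho> - 1/2) / x)" for x by (simp add: minus_divide_left)
        show ?thesis unfolding h_eq zero_term_def m neg by simp
      qed
      moreover have "((\<lambda>\<rho>. - zero_term t \<rho> + zero_term 0 \<rho>) has_sum (- S t + S 0)) ?NR"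
        unfolding S_def by (intro has_sum_add has_sum_uminusI has_sum_infsum summable_zero_term)
      ultimately show ?thesis by (simp cong: has_sum_cong)
    qed
    have h_R0: "(h has_sum (\<Sum>\<rho>\<in>R0. w \<rho> t - w \<rho> 0)) R0"
    proof -
      have "h \<rho> = w \<rho> t - w \<rho> 0" if "\<rho> \<in> R0" for \<rho>
        using real[of \<rho>] that by (simp add: h_eq w_def poisson_def)
      thus ?thesis using has_sum_finite[OF R0(1), of h] by simp
    qed
    have "h summable_on ?NR \<union> (R0 \<union> ?A)" using h_all by (rule has_sum_imp_summable)
    hence "h summable_on ?A" by (rule summable_on_subset_banach) blast
    hence h_A: "(h has_sum infsum h ?A) ?A" by (rule has_sum_infsum)
    define H where "H = infsum h ?A"
    note h_A = h_A [folded H_def]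
    have v_sums: "(\<lambda>n. v n t - v n 0) sums H"
    proof -
      have "inj (\<lambda>n. complex_of_real (a n))" using R0(4) by (auto simp: inj_on_def)
      hence "((h \<circ> (\<lambda>n. complex_of_real (a n))) has_sum H) UNIV" using h_A has_sum_reindex by blast
      moreover have "h (of_real (a n)) = v n t - v n 0" for n
      proof -
        have "of_real (a n) \<in> ?NR \<union> (R0 \<union> ?A)" by auto
        hence "mult (of_real (a n)) = 1" using zorder_zeta_deriv_entire(1)[OF Z1] a(3)[of n] by simp
        thus ?thesis by (simp add: h_eq v_def poisson_def)
      qed
      ultimately show ?thesis by (auto dest!: has_sum_imp_sums simp: o_def)
    qed
    have "?NR \<inter> (R0 \<union> ?A) = {}" using real by (auto simp: nonreal_zeta_deriv_zeros_def)
    hence "(h has_sum ((- S t + S 0) + ((\<Sum>\<rho>\<in>R0. w \<rho> t - w \<rho> 0) + H))) (?NR \<union> (R0 \<union> ?A))"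
      using h_NR h_R0 h_A R0(3) by (intro has_sum_Un_disjoint)
    with h_all have ReF: "Re (?F (crit t)) = Re (?F (1/2)) + (- S t + S 0) + (\<Sum>\<rho>\<in>R0. w \<rho> t) - (\<Sum>\<rho>\<in>R0. w \<rho> 0) + H"
      using has_sum_unique by (fastforce simp: sum_subtractf)
    have "(\<lambda>k. u k t - u k 0) sums (- (deriv RS_theta t - deriv RS_theta 0))"
      using sums_minus[OF RS_theta_deriv_series[of t]] by (simp add: u_def)
    hence "(\<lambda>n. u (n + N) t - u (n + N) 0) sums (- (deriv RS_theta t - deriv RS_theta 0) - (\<Sum>k<N. u k t - u k 0))"
      by (rule sums_split_initial_segment)
    hence "(\<lambda>n. (u (n + N) t - u (n + N) 0) - (v n t - v n 0)) sums
        (- (deriv RS_theta t - deriv RS_theta 0) - (\<Sum>k<N. u k t - u k 0) - H)" using v_sums by (rule sums_diff)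
    moreover have "(\<lambda>n. (u (n + N) t - v n t) - (u (n + N) 0 - v n 0)) sums (D t - D 0)"
      unfolding D_def by (intro sums_diff summable_sums summ_uv)
    hence "(\<lambda>n. (u (n + N) t - u (n + N) 0) - (v n t - v n 0)) sums (D t - D 0)" by (simp add: algebra_simps)
    ultimately have Deq: "D t - D 0 = - (deriv RS_theta t - deriv RS_theta 0) - (\<Sum>k<N. u k t - u k 0) - H"
      by (rule sums_unique2[symmetric])
    \<comment> \<open>The point 1 is 1/2 - c with c = -1/2.\<close>
    have pole: "Re (2 / (crit t - 1)) = 2 * poisson (-1/2) t"
    proof -
      have "Re (2 * z) = 2 * Re z" for z by simp
      from this[of "1 / (crit t - 1)"] show ?thesis
        unfolding Re_inverse_crit poisson_def times_divide_eq_right by simp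
    qed
    have "pi * deriv kappa t = - deriv RS_theta t - (Re (?F (crit t)) - 2 * poisson (-1/2) t)"
      unfolding deriv_kappa[OF t] logderiv_zeta_deriv_entire[OF crit1 t] minus_complex.sel pole ..
    thus ?thesis using Deq ReF unfolding A_def f_def sum_subtractf by linarith
  qed
  ultimately show thesis unfolding S_def by (rule that)
qed

text \<open>Both sides are continuous and agree wherever \<zeta>' is nonzero on the critical line;
  the exceptional t are isolated, so a limit gives the identity there too.\<close>

theorem proposition30:
  "\<exists>(A :: real) (f :: real \<Rightarrow> real).
     continuous_on UNIV f \<and> bounded (range f) \<and> f \<in> O[at_top](\<lambda>t. 1 / t) \<and>
     (\<forall>t. zero_term t summable_on nonreal_zeta_deriv_zeros \<and>
          pi * deriv kappa t = A + f t + (\<Sum>\<^sub>\<infinity>\<rho>\<in>nonreal_zeta_deriv_zeros. zero_term t \<rho>))"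
proof -
  obtain A f where f: "decaying f" and eq: "\<And>t. deriv zeta (crit t) \<noteq> 0 \<Longrightarrow>
       pi * deriv kappa t = A + f t + (\<Sum>\<^sub>\<infinity>\<rho>\<in>nonreal_zeta_deriv_zeros. zero_term t \<rho>)"
    by (rule kappa_deriv_formula) blast
  have cont: "continuous_on UNIV f" and "\<exists>B. \<forall>t. \<bar>f t\<bar> \<le> B" and "\<exists>K. \<forall>t>0. \<bar>f t\<bar> \<le> K / t"
    using f unfolding decaying_def by simp_all
  then obtain B K where B: "\<And>t. \<bar>f t\<bar> \<le> B" and K: "\<And>t. t > 0 \<Longrightarrow> \<bar>f t\<bar> \<le> K / t" by metis
  define G where "G t = pi * deriv kappa t - (A + f t + (\<Sum>\<^sub>\<infinity>\<rho>\<in>nonreal_zeta_deriv_zeros. zero_term t \<rho>))" for t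
  have "continuous_on UNIV (deriv kappa)"
    using locally_holomorphic_ext_deriv(2)[OF kappa_lift(1)] by (simp add: continuous_at_imp_continuous_on)
  hence contG: "continuous_on UNIV G" unfolding G_def by (intro continuous_intros cont continuous_zero_sum)
  have "G t0 = 0" for t0
  proof -
    obtain C where "entire_order_three_halves zeta_deriv_entire 1 C" using zeta_deriv_entire_order by blast
    then interpret entire_order_three_halves zeta_deriv_entire 1 C .
    \<comment> \<open>Only finitely many exceptional points lie within distance 1 of t0, because
      their images are zeros of an entire function in a disc.\<close>
    define X where "X = {t. \<bar>t - t0\<bar> \<le> 1 \<and> deriv zeta (crit t) = 0}"
    have "crit ` X \<subseteq> zeros_upto (\<bar>t0\<bar> + 2)"
    proof (clarsimp simp: X_def zeros_upto_def)
      have crit1: "crit t \<noteq> 1" for t by (auto simp: complex_eq_iff)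
      fix t assume t: "\<bar>t - t0\<bar> \<le> 1" "deriv zeta (crit t) = 0"
      have "dist 1 (crit t) \<le> norm (1/2 :: complex) + norm (\<i> * complex_of_real t)"
        unfolding dist_norm using norm_triangle_ineq4[of "1/2" "\<i> * complex_of_real t"] by (simp add: diff_diff_eq [symmetric])
      also have "\<dots> \<le> \<bar>t0\<bar> + 2" using t(1) by (simp add: norm_mult)
      finally show "dist 1 (crit t) \<le> \<bar>t0\<bar> + 2 \<and> zeta_deriv_entire (crit t) = 0"
        using t(2) crit1 by (simp add: zeta_deriv_entire_eq_0_iff)
    qed
    hence "finite (crit ` X)" using finite_zeros_upto by (rule finite_subset)
    hence "finite X" by (rule finite_imageD) (auto simp: inj_on_def)
    hence op: "open (- (X - {t0}))" by (intro open_Compl finite_imp_closed) auto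
    have "eventually (\<lambda>t. t \<in> - (X - {t0})) (at t0)" using eventually_at_in_open'[OF op] by auto
    moreover have "eventually (\<lambda>t. t \<in> {t0 - 1<..<t0 + 1}) (at t0)"
      by (rule eventually_at_in_open') auto
    moreover have "eventually (\<lambda>t. t \<noteq> t0) (at t0)" by (simp add: eventually_at_filter)
    ultimately have "eventually (\<lambda>t. G t = 0) (at t0)"
    proof eventually_elim
      case (elim t)
      hence "deriv zeta (crit t) \<noteq> 0" by (auto simp: X_def)
      thus ?case using eq[of t] by (simp add: G_def)
    qed
    hence "(G \<longlongrightarrow> 0) (at t0)" by (rule tendsto_eventually)
    moreover have "(G \<longlongrightarrow> G t0) (at t0)" using contG by (simp add: continuous_on_eq_continuous_at isCont_def)
    ultimately show ?thesis using tendsto_unique[of "at t0" G] by simp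
  qed
  hence eq': "pi * deriv kappa t = A + f t + (\<Sum>\<^sub>\<infinity>\<rho>\<in>nonreal_zeta_deriv_zeros. zero_term t \<rho>)" for t
    using G_def[of t] by simp
  have "bounded (range f)" using B by (intro boundedI[of _ B]) auto
  moreover have "f \<in> O[at_top](\<lambda>t. 1 / t)"
  proof (rule bigoI[where c = K])
    show "\<forall>\<^sub>F t in at_top. norm (f t) \<le> K * norm (1 / t)"
      using eventually_gt_at_top[of 0] by eventually_elim (use K in auto)
  qed
  ultimately show ?thesis using cont summable_zero_term eq' by blast
qed

end
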